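(* Let $\mathbf{k}$ be a commutative ring with unit. For any reduced simplicial set $X$ there is a chain homotopy equivalence of dg $\mathbf{k}$-modules, natural in $X$, $$C_*(X)\otimes_\iota i^*_{ad}\widehat{\mathbf{\Omega}}(C_*(X))\;\leftrightarrows\;\widehat{\mathrm{coCH}}_*(C_*(X)),$$ where $\iota:C_*(X)\to\mathbf{\Omega}(C_*(X))$ is the universal twisting cochain, $i:\mathbf{\Omega}(C_*(X))\hookrightarrow\widehat{\mathbf{\Omega}}(C_*(X))$ is the canonical inclusion, and $i^*_{ad}\widehat{\mathbf{\Omega}}(C_*(X))$ is $\widehat{\mathbf{\Omega}}(C_*(X))$ with the adjoint left action of $\mathbf{\Omega}(C_*(X))$ via $i$.
   Context: **Chains.** For a reduced simplicial set $X$ (one vertex), $C=C_*(X)$ is the connected dg coalgebra of normalized simplicial chains over $\mathbf{k}$ with the usual boundary $d_C=\partial$ (degenerate simplices are $0$) and Alexander–Whitney coproduct $\Delta(\sigma)=\sum_{i=0}^n\sigma(0,\dots,i)\otimes\sigma(i,\dots,n)$, written $\Delta c=\sum c'\otimes c''$. Let $\overline C=\bigoplus_{n\ge1}C_n$. **Cobar construction.** $\mathbf{\Omega}(C)=T(s^{-1}\overline C)$ is the tensor algebra, with monomials $\{c_1|\cdots|c_p\}$ of degree $\sum(|c_i|-1)$, concatenation product, and derivation differential $D\{c\}=-\{d_Cc\}-\sum(-1)^{|c'|}\{c'|c''\}$ (sum over terms with $c',c''\in\overline C$; $\{c\}:=0$ for $c\in C_0$). The universal twisting cochain is $\iota(c)=\{c\}$.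 **Coproduct.** For a simplex $\sigma$ of dimension $n\ge1$ put $I_\sigma=1-\{\sigma\}$ if $n=1$ and $I_\sigma=(-1)^n\{\sigma\}$ if $n\ge2$ (where $\{\sigma\}=0$ if $\sigma$ is degenerate). Let $N$ be the dg coalgebra with basis $[0],[1]$ (degree $0$), $[0,1]$ (degree $1$), $\partial[0,1]=[1]-[0]$, $\nabla[j]=[j]\otimes[j]$ for $j=0,1$, $\nabla[0,1]=[0]\otimes[0,1]+[0,1]\otimes[1]$. For a word $w=w_1\otimes\cdots\otimes w_{n-1}\in N^{\otimes(n-1)}$ in basis elements let $V=\{0,n\}\cup\{i:w_i\ne[0]\}$, let $0=i_0<i_1<\cdots<i_r=n$ be $0$, $n$ and all $i$ with $w_i=[1]$, and let $I_\sigma(w)=I_{\tau_1}\cdots I_{\tau_r}$ with $\tau_j$ the face of $\sigma$ on the vertices $V\cap[i_{j-1},i_j]$. The coproduct $\nabla$ on $\mathbf{\Omega}(C)$ is the algebra map determined by $\nabla I_\sigma=(I_\sigma(-)\otimes I_\sigma(-))\bigl(\nabla([0,1]^{\otimes(n-1)})\bigr)$, where $N^{\otimes(n-1)}$ has the tensor product coalgebra structure with Koszul signs; the counit is the algebra map with $\varepsilon(I_\sigma)=1$ if $n=1$ and $0$ if $n\ge2$. This makes $\mathbf{\Omega}(C)$ a dg bialgebra. **Extended cobar construction.** $\widehat{\mathbf{\Omega}}(C)$ is the dg algebra obtained from $\mathbf{\Omega}(C)$ by formally (strictly) inverting all set-like elements, i.e. all $f$ with $\nabla f=f\otimes f$,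 $\varepsilon(f)=1$; $\nabla$ and $\varepsilon$ extend uniquely to algebra maps, and the resulting dg bialgebra $\widehat{\mathbf{\Omega}}(C)$ has the property of being a dg Hopf algebra, i.e. it has a (unique) antipode $s$, which is a map of dg $\mathbf{k}$-modules. **Adjoint action.** For $a\in\mathbf{\Omega}(C)$ with $\nabla a=\sum a'\otimes a''$ and $b\in\widehat{\mathbf{\Omega}}(C)$: $a\cdot b=\sum(-1)^{|a'|(|a''|+|b|)}i(a'')\,b\,s(i(a'))$. This defines the left dg $\mathbf{\Omega}(C)$-module $i^*_{ad}\widehat{\mathbf{\Omega}}(C)$. **Twisted tensor product.** For a dg coalgebra $C$, dg algebra $A$, left dg $A$-module $M$ with action $\mu_M$, and twisting cochain $\tau:C\to A$ (degree $-1$, $d_A\tau+\tau d_C+\mu_A(\tau\otimes\tau)\Delta=0$), $C\otimes_\tau M$ is $C\otimes M$ with differential $d_C\otimes\mathrm{id}+\mathrm{id}\otimes d_M+(\mathrm{id}\otimes\mu_M)(\mathrm{id}\otimes\tau\otimes\mathrm{id})(\Delta\otimes\mathrm{id})$ (Koszul signs). **Extended coHochschild complex.** $\widehat{\mathrm{coCH}}_*(C)=C\otimes\widehat{\mathbf{\Omega}}(C)$ with $$\partial(c\otimes a)=d_Cc\otimes a+(-1)^{|c|}c\otimes Da+\sum(-1)^{|c'|}c'\otimes\{c''\}a-\sum(-1)^{(|c'|+1)(|c''|+|a|)}c''\otimes a\{c'\}.$$ *)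

theory Defs
  imports
    Complex_Main
    "HOL-Library.Poly_Mapping"
    "HOL-Algebra.Module"
begin

section \<open>Complexes of modules\<close>

definition scalar_ring :: "'k::comm_ring_1 ring" where
  "scalar_ring = \<lparr>carrier = UNIV, monoid.mult = (*), one = 1, zero = 0, add = (+)\<rparr>"

text \<open>A dg module over the ring \<open>'k\<close> is a family of modules (in the sense of HOL-Algebra)
  indexed by the integers, with a square-zero linear boundary of degree -1.\<close>

record ('k, 'm) dg_module =
  component :: "int \<Rightarrow> ('k, 'm) module"
  boundary :: "int \<Rightarrow> 'm \<Rightarrow> 'm"

definition linear_map ::
  "('k::comm_ring_1, 'm) module \<Rightarrow> ('k, 'n) module \<Rightarrow> ('m \<Rightarrow> 'n) \<Rightarrow> bool" where
  "linear_map M N f \<longleftrightarrow>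
     f ` carrier M \<subseteq> carrier N \<and>
     (\<forall>x\<in>carrier M. \<forall>y\<in>carrier M. f (x \<oplus>\<^bsub>M\<^esub> y) = f x \<oplus>\<^bsub>N\<^esub> f y) \<and>
     (\<forall>c. \<forall>x\<in>carrier M. f (c \<odot>\<^bsub>M\<^esub> x) = c \<odot>\<^bsub>N\<^esub> f x)"

definition is_dg_module :: "('k::comm_ring_1, 'm) dg_module \<Rightarrow> bool" where
  "is_dg_module M \<longleftrightarrow>
     (\<forall>n. Module.module (scalar_ring :: 'k ring) (component M n)) \<and>
     (\<forall>n. linear_map (component M n) (component M (n - 1)) (boundary M n)) \<and>
     (\<forall>n. \<forall>x\<in>carrier (component M n).
        boundary M (n - 1) (boundary M n x) = \<zero>\<^bsub>component M (n - 2)\<^esub>)"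

definition chain_map ::
  "('k::comm_ring_1, 'm) dg_module \<Rightarrow> ('k, 'n) dg_module \<Rightarrow> (int \<Rightarrow> 'm \<Rightarrow> 'n) \<Rightarrow> bool" where
  "chain_map M N f \<longleftrightarrow>
     (\<forall>n. linear_map (component M n) (component N n) (f n)) \<and>
     (\<forall>n. \<forall>x\<in>carrier (component M n). boundary N n (f n x) = f (n - 1) (boundary M n x))"

definition chain_homotopic ::
  "('k::comm_ring_1, 'm) dg_module \<Rightarrow> ('k, 'n) dg_module \<Rightarrow>
   (int \<Rightarrow> 'm \<Rightarrow> 'n) \<Rightarrow> (int \<Rightarrow> 'm \<Rightarrow> 'n) \<Rightarrow> bool" where
  "chain_homotopic M N f g \<longleftrightarrow>
     (\<exists>h. (\<forall>n. linear_map (component M n) (component N (n + 1)) (h n)) \<and>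
        (\<forall>n. \<forall>x\<in>carrier (component M n).
           f n x = g n x \<oplus>\<^bsub>component N n\<^esub>
             (boundary N (n + 1) (h n x) \<oplus>\<^bsub>component N n\<^esub> h (n - 1) (boundary M n x))))"

definition chain_homotopy_equivalence ::
  "('k::comm_ring_1, 'm) dg_module \<Rightarrow> ('k, 'n) dg_module \<Rightarrow>
   (int \<Rightarrow> 'm \<Rightarrow> 'n) \<Rightarrow> (int \<Rightarrow> 'n \<Rightarrow> 'm) \<Rightarrow> bool" where
  "chain_homotopy_equivalence M N f g \<longleftrightarrow>
     is_dg_module M \<and> is_dg_module N \<and> chain_map M N f \<and> chain_map N M g \<and>
     chain_homotopic M M (\<lambda>n x. g n (f n x)) (\<lambda>n x. x) \<and>
     chain_homotopic N N (\<lambda>n x. f n (g n x)) (\<lambda>n x. x)"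


section \<open>Free modules, their quotients, and free algebras\<close>

text \<open>\<open>'b \<Rightarrow>\<^sub>0 'k\<close> is the free \<open>'k\<close>-module on the type \<open>'b\<close>.\<close>

definition scale :: "'k::comm_ring_1 \<Rightarrow> ('b \<Rightarrow>\<^sub>0 'k) \<Rightarrow> ('b \<Rightarrow>\<^sub>0 'k)" where
  "scale c p = Poly_Mapping.map ((*) c) p"

lemma lookup_scale: "Poly_Mapping.lookup (scale c p) b = c * Poly_Mapping.lookup p b"
  by (simp add: scale_def Poly_Mapping.map.rep_eq when_def)

interpretation free_module: Modules.module "scale :: 'k::comm_ring_1 \<Rightarrow> ('b \<Rightarrow>\<^sub>0 'k) \<Rightarrow> ('b \<Rightarrow>\<^sub>0 'k)"
  by unfold_locales
    (auto intro!: poly_mapping_eqI simp: lookup_scale lookup_add algebra_simps)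

abbreviation bas :: "'b \<Rightarrow> ('b \<Rightarrow>\<^sub>0 'k::comm_ring_1)" where
  "bas b \<equiv> Poly_Mapping.single b 1"

definition lin :: "('a \<Rightarrow> ('b \<Rightarrow>\<^sub>0 'k)) \<Rightarrow> ('a \<Rightarrow>\<^sub>0 'k::comm_ring_1) \<Rightarrow> ('b \<Rightarrow>\<^sub>0 'k)" where
  "lin f p = (\<Sum>a\<in>Poly_Mapping.keys p. scale (Poly_Mapping.lookup p a) (f a))"

definition tens :: "('a \<Rightarrow>\<^sub>0 'k::comm_ring_1) \<Rightarrow> ('b \<Rightarrow>\<^sub>0 'k) \<Rightarrow> ('a \<times> 'b \<Rightarrow>\<^sub>0 'k)" where
  "tens p q = lin (\<lambda>a. lin (\<lambda>b. bas (a, b)) q) p"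

definition supported :: "'b set \<Rightarrow> ('b \<Rightarrow>\<^sub>0 'k::comm_ring_1) set" where
  "supported B = {p. Poly_Mapping.keys p \<subseteq> B}"

definition coset_of :: "('b \<Rightarrow>\<^sub>0 'k::comm_ring_1) set \<Rightarrow> ('b \<Rightarrow>\<^sub>0 'k) \<Rightarrow> ('b \<Rightarrow>\<^sub>0 'k) set" where
  "coset_of R x = {y. y - x \<in> R}"

text \<open>The image of the submodule \<open>F\<close> in the quotient by the submodule \<open>R\<close>. The ring fields of the
  HOL-Algebra record play no role for modules.\<close>

definition quot_module ::
  "('b \<Rightarrow>\<^sub>0 'k::comm_ring_1) set \<Rightarrow> ('b \<Rightarrow>\<^sub>0 'k) set \<Rightarrow> ('k, ('b \<Rightarrow>\<^sub>0 'k) set) module" where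
  "quot_module F R =
     \<lparr>carrier = coset_of R ` F,
      monoid.mult = undefined,
      monoid.one = undefined,
      ring.zero = coset_of R 0,
      ring.add = (\<lambda>S T. \<Union>x\<in>S. \<Union>y\<in>T. coset_of R (x + y)),
      module.smult = (\<lambda>c S. \<Union>x\<in>S. coset_of R (scale c x))\<rparr>"

text \<open>The map on cosets induced by a map \<open>g\<close> of representatives; \<open>R'\<close> are the target relations.\<close>

definition quot_map ::
  "('c \<Rightarrow>\<^sub>0 'k::comm_ring_1) set \<Rightarrow> (('b \<Rightarrow>\<^sub>0 'k) \<Rightarrow> ('c \<Rightarrow>\<^sub>0 'k)) \<Rightarrow>
   ('b \<Rightarrow>\<^sub>0 'k) set \<Rightarrow> ('c \<Rightarrow>\<^sub>0 'k) set" where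
  "quot_map R' g S = (\<Union>x\<in>S. coset_of R' (g x))"

text \<open>Words form the free monoid, written additively, so that the convolution product of
  \<^theory>\<open>HOL-Library.Poly_Mapping\<close> makes \<open>'g word \<Rightarrow>\<^sub>0 'k\<close> the free associative algebra
  (the tensor algebra of the free module) on \<open>'g\<close>.\<close>

datatype 'g word = Word (letters: "'g list")

instantiation word :: (type) monoid_add
begin
definition "0 = Word []"
definition "u + v = Word (letters u @ letters v)"
instance by standard (simp_all add: zero_word_def plus_word_def)
end

text \<open>In what follows \<open>dg\<close> is the degree of letters.\<close>

definition wdeg :: "('g \<Rightarrow> nat) \<Rightarrow> 'g word \<Rightarrow> nat" where
  "wdeg dg w = sum_list (map dg (letters w))"

definition words :: "'g set \<Rightarrow> 'g word set" where
  "words B = {w. set (letters w) \<subseteq> B}"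

definition alg_ext :: "('g \<Rightarrow> ('h word \<Rightarrow>\<^sub>0 'k)) \<Rightarrow> ('g word \<Rightarrow>\<^sub>0 'k::comm_ring_1) \<Rightarrow> ('h word \<Rightarrow>\<^sub>0 'k)" where
  "alg_ext h = lin (\<lambda>w. prod_list (map h (letters w)))"

definition scalar_ext :: "('g \<Rightarrow> 'k) \<Rightarrow> ('g word \<Rightarrow>\<^sub>0 'k::comm_ring_1) \<Rightarrow> 'k" where
  "scalar_ext h p = (\<Sum>w\<in>Poly_Mapping.keys p. Poly_Mapping.lookup p w * prod_list (map h (letters w)))"

primrec der_list ::
  "('g \<Rightarrow> nat) \<Rightarrow> ('g \<Rightarrow> ('g word \<Rightarrow>\<^sub>0 'k::comm_ring_1)) \<Rightarrow> 'g list \<Rightarrow> ('g word \<Rightarrow>\<^sub>0 'k)" where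
  "der_list dg \<delta> [] = 0"
| "der_list dg \<delta> (g # gs) =
     \<delta> g * bas (Word gs) + scale ((-1) ^ dg g) (bas (Word [g]) * der_list dg \<delta> gs)"

definition der_ext ::
  "('g \<Rightarrow> nat) \<Rightarrow> ('g \<Rightarrow> ('g word \<Rightarrow>\<^sub>0 'k::comm_ring_1)) \<Rightarrow> ('g word \<Rightarrow>\<^sub>0 'k) \<Rightarrow> ('g word \<Rightarrow>\<^sub>0 'k)" where
  "der_ext dg \<delta> = lin (\<lambda>w. der_list dg \<delta> (letters w))"

text \<open>Product on the tensor square: \<open>(a \<otimes> b)(c \<otimes> d) = (-1)^(|b||c|) ac \<otimes> bd\<close>.\<close>

definition kmult ::
  "('g \<Rightarrow> nat) \<Rightarrow> ('g word \<times> 'g word \<Rightarrow>\<^sub>0 'k::comm_ring_1) \<Rightarrow> ('g word \<times> 'g word \<Rightarrow>\<^sub>0 'k) \<Rightarrow>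
   ('g word \<times> 'g word \<Rightarrow>\<^sub>0 'k)" where
  "kmult dg p q =
     lin (\<lambda>(a, b). lin (\<lambda>(c, d). scale ((-1) ^ (wdeg dg b * wdeg dg c)) (bas (a + c, b + d))) q) p"

definition tens_alg_ext ::
  "('g \<Rightarrow> nat) \<Rightarrow> ('g \<Rightarrow> ('g word \<times> 'g word \<Rightarrow>\<^sub>0 'k::comm_ring_1)) \<Rightarrow> ('g word \<Rightarrow>\<^sub>0 'k) \<Rightarrow>
   ('g word \<times> 'g word \<Rightarrow>\<^sub>0 'k)" where
  "tens_alg_ext dg h = lin (\<lambda>w. foldr (\<lambda>g. kmult dg (h g)) (letters w) (bas (0, 0)))"


section \<open>Simplicial sets\<close>

text \<open>A monotone map from \<open>{0..m}\<close> to \<open>{0..n}\<close> is the list of its values; for an n-simplex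
  \<open>\<sigma>\<close>, \<open>act X n [i0,...,im] \<sigma>\<close> is the m-simplex usually written \<open>\<sigma>(i0,...,im)\<close>.\<close>

record 'x sset =
  simplices :: "nat \<Rightarrow> 'x set"
  act :: "nat \<Rightarrow> nat list \<Rightarrow> 'x \<Rightarrow> 'x"

definition mono_lists :: "nat \<Rightarrow> nat \<Rightarrow> nat list set" where
  "mono_lists m n = {xs. length xs = Suc m \<and> sorted xs \<and> set xs \<subseteq> {..n}}"

definition simplicial_set :: "'x sset \<Rightarrow> bool" where
  "simplicial_set X \<longleftrightarrow>
     (\<forall>n m. \<forall>xs\<in>mono_lists m n. \<forall>\<sigma>\<in>simplices X n. act X n xs \<sigma> \<in> simplices X m) \<and>
     (\<forall>n. \<forall>\<sigma>\<in>simplices X n. act X n [0..<Suc n] \<sigma> = \<sigma>) \<and>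
     (\<forall>n m l. \<forall>xs\<in>mono_lists m n. \<forall>ys\<in>mono_lists l m. \<forall>\<sigma>\<in>simplices X n.
        act X m ys (act X n xs \<sigma>) = act X n (map (nth xs) ys) \<sigma>)"

definition reduced :: "'x sset \<Rightarrow> bool" where
  "reduced X \<longleftrightarrow> simplicial_set X \<and> (\<exists>v. simplices X 0 = {v})"

definition simplicial_map :: "'x sset \<Rightarrow> 'y sset \<Rightarrow> (nat \<Rightarrow> 'x \<Rightarrow> 'y) \<Rightarrow> bool" where
  "simplicial_map X Y f \<longleftrightarrow>
     (\<forall>n. f n ` simplices X n \<subseteq> simplices Y n) \<and>
     (\<forall>n m. \<forall>xs\<in>mono_lists m n. \<forall>\<sigma>\<in>simplices X n. f m (act X n xs \<sigma>) = act Y n xs (f n \<sigma>))"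

text \<open>Simplices are tagged with their dimension.\<close>

type_synonym 'x simplex = "nat \<times> 'x"

definition face :: "'x sset \<Rightarrow> 'x simplex \<Rightarrow> nat list \<Rightarrow> 'x simplex" where
  "face X s xs = (length xs - 1, act X (fst s) xs (snd s))"

definition nondegenerate :: "'x sset \<Rightarrow> 'x simplex set" where
  "nondegenerate X = {(n, \<sigma>). \<sigma> \<in> simplices X n \<and>
     \<not> (\<exists>m<n. \<exists>xs\<in>mono_lists n m. \<exists>\<tau>\<in>simplices X m. \<sigma> = act X m xs \<tau>)}"


section \<open>Normalized chains\<close>

text \<open>The normalized chains of \<open>X\<close> are the free module on \<open>nondegenerate X\<close>.\<close>

definition chain :: "'x sset \<Rightarrow> 'x simplex \<Rightarrow> ('x simplex \<Rightarrow>\<^sub>0 'k::comm_ring_1)" where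
  "chain X s = (if s \<in> nondegenerate X then bas s else 0)"

definition bd :: "'x sset \<Rightarrow> ('x simplex \<Rightarrow>\<^sub>0 'k::comm_ring_1) \<Rightarrow> ('x simplex \<Rightarrow>\<^sub>0 'k)" where
  "bd X = lin (\<lambda>s. if fst s = 0 then 0
     else (\<Sum>i\<le>fst s. scale ((-1) ^ i) (chain X (face X s (remove1 i [0..<Suc (fst s)])))))"

definition aw ::
  "'x sset \<Rightarrow> ('x simplex \<Rightarrow>\<^sub>0 'k::comm_ring_1) \<Rightarrow> ('x simplex \<times> 'x simplex \<Rightarrow>\<^sub>0 'k)" where
  "aw X = lin (\<lambda>s. \<Sum>i\<le>fst s.
     tens (chain X (face X s [0..<Suc i])) (chain X (face X s [i..<Suc (fst s)])))"

definition chain_push ::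
  "'y sset \<Rightarrow> (nat \<Rightarrow> 'x \<Rightarrow> 'y) \<Rightarrow> ('x simplex \<Rightarrow>\<^sub>0 'k::comm_ring_1) \<Rightarrow> ('y simplex \<Rightarrow>\<^sub>0 'k)" where
  "chain_push Y f = lin (\<lambda>(n, \<sigma>). chain Y (n, f n \<sigma>))"


section \<open>The cobar construction of the chains\<close>

type_synonym ('x, 'k) omega = "'x simplex word \<Rightarrow>\<^sub>0 'k"

text \<open>The letter \<open>s\<close> stands for \<open>{s}\<close>; only simplices of positive dimension occur.\<close>

definition omega_deg :: "'x simplex \<Rightarrow> nat" where
  "omega_deg s = fst s - 1"

definition omega_letters :: "'x sset \<Rightarrow> 'x simplex set" where
  "omega_letters X = {s \<in> nondegenerate X. fst s \<ge> 1}"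

text \<open>\<open>cobar_gen c = {c}\<close>; this is the universal twisting cochain.\<close>

definition cobar_gen :: "('x simplex \<Rightarrow>\<^sub>0 'k::comm_ring_1) \<Rightarrow> ('x, 'k) omega" where
  "cobar_gen = lin (\<lambda>s. if fst s = 0 then 0 else bas (Word [s]))"

definition omega_diff :: "'x sset \<Rightarrow> ('x, 'k::comm_ring_1) omega \<Rightarrow> ('x, 'k) omega" where
  "omega_diff X = der_ext omega_deg (\<lambda>s.
     - cobar_gen (bd X (bas s))
     - lin (\<lambda>(a, b). scale ((-1) ^ fst a) (cobar_gen (bas a) * cobar_gen (bas b))) (aw X (bas s)))"

text \<open>Basis \<open>[0]\<close>, \<open>[1]\<close>, \<open>[0,1]\<close> of the coalgebra of the interval, its coproduct, and the coproduct of
  its tensor powers (the sign moves the right factor of the first letter past the left word).\<close>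

datatype interval = I0 | I1 | I01

definition interval_deg :: "interval \<Rightarrow> nat" where
  "interval_deg a = (if a = I01 then 1 else 0)"

primrec interval_coprod :: "interval \<Rightarrow> (interval \<times> interval \<Rightarrow>\<^sub>0 'k::comm_ring_1)" where
  "interval_coprod I0 = bas (I0, I0)"
| "interval_coprod I1 = bas (I1, I1)"
| "interval_coprod I01 = bas (I0, I01) + bas (I01, I1)"

primrec cube_coprod :: "interval list \<Rightarrow> (interval list \<times> interval list \<Rightarrow>\<^sub>0 'k::comm_ring_1)" where
  "cube_coprod [] = bas ([], [])"
| "cube_coprod (a # w) =
     lin (\<lambda>(a', a''). lin (\<lambda>(u, v).
        scale ((-1) ^ (interval_deg a'' * sum_list (map interval_deg u))) (bas (a' # u, a'' # v)))
       (cube_coprod w)) (interval_coprod a)"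

definition I_simplex :: "'x sset \<Rightarrow> 'x simplex \<Rightarrow> ('x, 'k::comm_ring_1) omega" where
  "I_simplex X s = (if fst s = 1 then 1 - cobar_gen (chain X s)
     else scale ((-1) ^ fst s) (cobar_gen (chain X s)))"

text \<open>\<open>w ! (i - 1)\<close> is the i-th letter \<open>w\<^sub>i\<close>, \<open>0 < i < n\<close>.\<close>

definition I_word :: "'x sset \<Rightarrow> 'x simplex \<Rightarrow> interval list \<Rightarrow> ('x, 'k::comm_ring_1) omega" where
  "I_word X s w =
     (let n = fst s;
          V = {0, n} \<union> {i. 0 < i \<and> i < n \<and> w ! (i - 1) \<noteq> I0};
          cs = sorted_list_of_set ({0, n} \<union> {i. 0 < i \<and> i < n \<and> w ! (i - 1) = I1})
      in prod_list (map (\<lambda>(a, b). I_simplex X (face X s (sorted_list_of_set (V \<inter> {a..b}))))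
           (zip cs (tl cs))))"

definition coprod_I ::
  "'x sset \<Rightarrow> 'x simplex \<Rightarrow> ('x simplex word \<times> 'x simplex word \<Rightarrow>\<^sub>0 'k::comm_ring_1)" where
  "coprod_I X s =
     lin (\<lambda>(u, v). tens (I_word X s u) (I_word X s v)) (cube_coprod (replicate (fst s - 1) I01))"

text \<open>On generators, \<open>{s} = 1 - I_s\<close> in dimension 1 and \<open>{s} = (-1)^n I_s\<close> in dimension
  \<open>n \<ge> 2\<close>.\<close>

definition omega_coprod ::
  "'x sset \<Rightarrow> ('x, 'k::comm_ring_1) omega \<Rightarrow> ('x simplex word \<times> 'x simplex word \<Rightarrow>\<^sub>0 'k)" where
  "omega_coprod X = tens_alg_ext omega_deg (\<lambda>s.
     if fst s = 1 then tens 1 1 - coprod_I X s else scale ((-1) ^ fst s) (coprod_I X s))"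

text \<open>\<open>\<epsilon>(I_s) = 1\<close> in dimension 1 and \<open>\<epsilon>(I_s) = 0\<close> in dimension \<open>\<ge> 2\<close> both mean that
  \<open>\<epsilon>{s} = 0\<close>.\<close>

definition omega_counit :: "('x, 'k::comm_ring_1) omega \<Rightarrow> 'k" where
  "omega_counit = scalar_ext (\<lambda>s. 0)"

text \<open>As usual in a graded coalgebra, set-like elements are homogeneous, hence of degree 0.\<close>

definition set_like :: "'x sset \<Rightarrow> ('x, 'k::comm_ring_1) omega \<Rightarrow> bool" where
  "set_like X f \<longleftrightarrow>
     f \<in> supported {w \<in> words (omega_letters X). wdeg omega_deg w = 0} \<and>
     omega_coprod X f = tens f f \<and> omega_counit f = 1"

definition omega_push ::
  "'y sset \<Rightarrow> (nat \<Rightarrow> 'x \<Rightarrow> 'y) \<Rightarrow> ('x, 'k::comm_ring_1) omega \<Rightarrow> ('y, 'k) omega" where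
  "omega_push Y f = alg_ext (\<lambda>s. cobar_gen (chain_push Y f (bas s)))"


section \<open>The extended cobar construction\<close>

text \<open>The extended cobar construction is the quotient of the free algebra on \<open>xomega_letters X\<close>,
  where \<open>Inv f\<close> is a formal inverse of the set-like element \<open>f\<close>, by the two-sided ideal
  \<open>xomega_ideal X\<close>. The structure maps below are given on representatives.\<close>

datatype ('s, 'f) loc_letter = Cell 's | Inv 'f

type_synonym ('x, 'k) xletter = "('x simplex, ('x, 'k) omega) loc_letter"

type_synonym ('x, 'k) xomega = "('x, 'k) xletter word \<Rightarrow>\<^sub>0 'k"

primrec xomega_deg :: "('x, 'k::comm_ring_1) xletter \<Rightarrow> nat" where
  "xomega_deg (Cell s) = omega_deg s"
| "xomega_deg (Inv f) = 0"

definition xomega_letters :: "'x sset \<Rightarrow> ('x, 'k::comm_ring_1) xletter set" where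
  "xomega_letters X = Cell ` omega_letters X \<union> Inv ` {f. set_like X f}"

definition xomega_incl :: "('x, 'k::comm_ring_1) omega \<Rightarrow> ('x, 'k) xomega" where
  "xomega_incl = alg_ext (\<lambda>s. bas (Word [Cell s]))"

definition xomega_ideal :: "'x sset \<Rightarrow> ('x, 'k::comm_ring_1) xomega set" where
  "xomega_ideal X = free_module.span
     {bas u * r * bas v | u r v.
        u \<in> words (xomega_letters X) \<and> v \<in> words (xomega_letters X) \<and>
        (\<exists>f. set_like X f \<and>
           (r = xomega_incl f * bas (Word [Inv f]) - 1 \<or>
            r = bas (Word [Inv f]) * xomega_incl f - 1))}"

text \<open>The inverse of an element \<open>f\<close> of degree 0 is a cycle, since \<open>Df\<close> has degree -1.\<close>

definition xomega_diff :: "'x sset \<Rightarrow> ('x, 'k::comm_ring_1) xomega \<Rightarrow> ('x, 'k) xomega" where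
  "xomega_diff X = der_ext xomega_deg (\<lambda>l. case l of
     Cell s \<Rightarrow> xomega_incl (omega_diff X (bas (Word [s]))) | Inv f \<Rightarrow> 0)"

definition xomega_coprod ::
  "'x sset \<Rightarrow> ('x, 'k::comm_ring_1) xomega \<Rightarrow> (('x, 'k) xletter word \<times> ('x, 'k) xletter word \<Rightarrow>\<^sub>0 'k)" where
  "xomega_coprod X = tens_alg_ext xomega_deg (\<lambda>l. case l of
     Cell s \<Rightarrow> lin (\<lambda>(u, v). tens (xomega_incl (bas u)) (xomega_incl (bas v)))
       (omega_coprod X (bas (Word [s])))
   | Inv f \<Rightarrow> bas (Word [Inv f], Word [Inv f]))"

definition xomega_counit :: "('x, 'k::comm_ring_1) xomega \<Rightarrow> 'k" where
  "xomega_counit = scalar_ext (\<lambda>l. case l of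
     Cell s \<Rightarrow> omega_counit (bas (Word [s])) | Inv f \<Rightarrow> 1)"

text \<open>A linear degree 0 map of representatives that descends to an antipode of the quotient, i.e.
  \<open>\<mu>(s \<otimes> id)\<nabla> = \<eta>\<epsilon> = \<mu>(id \<otimes> s)\<nabla>\<close> modulo the ideal. The induced map on the quotient is
  unique, so that the choice made in \<open>antipode\<close> concerns only representatives.\<close>

definition is_antipode :: "'x sset \<Rightarrow> (('x, 'k::comm_ring_1) xomega \<Rightarrow> ('x, 'k) xomega) \<Rightarrow> bool" where
  "is_antipode X s \<longleftrightarrow>
     Modules.module_hom scale scale s \<and>
     (\<forall>w\<in>words (xomega_letters X).
        s (bas w) \<in> supported {v \<in> words (xomega_letters X). wdeg xomega_deg v = wdeg xomega_deg w}) \<and>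
     s ` xomega_ideal X \<subseteq> xomega_ideal X \<and>
     (\<forall>a\<in>supported (words (xomega_letters X)).
        lin (\<lambda>(u, v). s (bas u) * bas v) (xomega_coprod X a) - scale (xomega_counit a) 1
          \<in> xomega_ideal X \<and>
        lin (\<lambda>(u, v). bas u * s (bas v)) (xomega_coprod X a) - scale (xomega_counit a) 1
          \<in> xomega_ideal X)"

definition antipode :: "'x sset \<Rightarrow> ('x, 'k::comm_ring_1) xomega \<Rightarrow> ('x, 'k) xomega" where
  "antipode X = (SOME s. is_antipode X s)"

definition adjoint_action ::
  "'x sset \<Rightarrow> ('x, 'k::comm_ring_1) omega \<Rightarrow> ('x, 'k) xomega \<Rightarrow> ('x, 'k) xomega" where
  "adjoint_action X a b =
     lin (\<lambda>(a', a''). lin (\<lambda>w.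
        scale ((-1) ^ (wdeg omega_deg a' * (wdeg omega_deg a'' + wdeg xomega_deg w)))
          (xomega_incl (bas a'') * bas w * antipode X (xomega_incl (bas a')))) b)
       (omega_coprod X a)"

definition xomega_push ::
  "'y sset \<Rightarrow> (nat \<Rightarrow> 'x \<Rightarrow> 'y) \<Rightarrow> ('x, 'k::comm_ring_1) xomega \<Rightarrow> ('y, 'k) xomega" where
  "xomega_push Y f = alg_ext (\<lambda>l. case l of
     Cell s \<Rightarrow> xomega_incl (omega_push Y f (bas (Word [s])))
   | Inv g \<Rightarrow> bas (Word [Inv (omega_push Y f g)]))"


section \<open>The two complexes\<close>

text \<open>Differential of the twisted tensor product \<open>C \<otimes>\<^sub>\<tau> M\<close>, for a coalgebra \<open>C\<close> with basis graded by
  \<open>cdeg\<close>, differential \<open>dC\<close>, coproduct \<open>\<Delta>\<close>, and a module \<open>M\<close> with differential \<open>dM\<close>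
  and action \<open>\<mu>\<close>.\<close>

definition twisted_diff ::
  "('c \<Rightarrow> nat) \<Rightarrow> (('c \<Rightarrow>\<^sub>0 'k) \<Rightarrow> ('c \<Rightarrow>\<^sub>0 'k)) \<Rightarrow> (('c \<Rightarrow>\<^sub>0 'k) \<Rightarrow> ('c \<times> 'c \<Rightarrow>\<^sub>0 'k)) \<Rightarrow>
   (('m \<Rightarrow>\<^sub>0 'k) \<Rightarrow> ('m \<Rightarrow>\<^sub>0 'k)) \<Rightarrow> ('a \<Rightarrow> ('m \<Rightarrow>\<^sub>0 'k) \<Rightarrow> ('m \<Rightarrow>\<^sub>0 'k)) \<Rightarrow>
   (('c \<Rightarrow>\<^sub>0 'k) \<Rightarrow> 'a) \<Rightarrow> ('c \<times> 'm \<Rightarrow>\<^sub>0 'k::comm_ring_1) \<Rightarrow> ('c \<times> 'm \<Rightarrow>\<^sub>0 'k)" where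
  "twisted_diff cdeg dC \<Delta> dM \<mu> \<tau> = lin (\<lambda>(c, m).
     tens (dC (bas c)) (bas m)
     + scale ((-1) ^ cdeg c) (tens (bas c) (dM (bas m)))
     + lin (\<lambda>(c', c''). scale ((-1) ^ cdeg c') (tens (bas c') (\<mu> (\<tau> (bas c'')) (bas m))))
         (\<Delta> (bas c)))"

definition cohochschild_diff ::
  "'x sset \<Rightarrow> ('x simplex \<times> ('x, 'k::comm_ring_1) xletter word \<Rightarrow>\<^sub>0 'k) \<Rightarrow>
   ('x simplex \<times> ('x, 'k) xletter word \<Rightarrow>\<^sub>0 'k)" where
  "cohochschild_diff X = lin (\<lambda>(c, a).
     tens (bd X (bas c)) (bas a)
     + scale ((-1) ^ fst c) (tens (bas c) (xomega_diff X (bas a)))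
     + lin (\<lambda>(c', c''). scale ((-1) ^ fst c')
           (tens (bas c') (xomega_incl (cobar_gen (bas c'')) * bas a))) (aw X (bas c))
     - lin (\<lambda>(c', c''). scale ((-1) ^ ((fst c' + 1) * (fst c'' + wdeg xomega_deg a)))
           (tens (bas c'') (bas a * xomega_incl (cobar_gen (bas c'))))) (aw X (bas c)))"

text \<open>The tensor product of the chains (a free module) with the quotient algebra is the quotient of the
  tensor product of free modules by \<open>tensor_rel X\<close>.\<close>

definition tensor_reps ::
  "'x sset \<Rightarrow> int \<Rightarrow> ('x simplex \<times> ('x, 'k::comm_ring_1) xletter word \<Rightarrow>\<^sub>0 'k) set" where
  "tensor_reps X n = supported {(c, w). c \<in> nondegenerate X \<and> w \<in> words (xomega_letters X) \<and>
     int (fst c + wdeg xomega_deg w) = n}"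

definition tensor_rel ::
  "'x sset \<Rightarrow> ('x simplex \<times> ('x, 'k::comm_ring_1) xletter word \<Rightarrow>\<^sub>0 'k) set" where
  "tensor_rel X = free_module.span
     {tens (bas c) r | c r. c \<in> nondegenerate X \<and> r \<in> xomega_ideal X}"

type_synonym ('x, 'k) tensor_class = "('x simplex \<times> ('x, 'k) xletter word \<Rightarrow>\<^sub>0 'k) set"

definition tensor_complex ::
  "'x sset \<Rightarrow> (('x simplex \<times> ('x, 'k::comm_ring_1) xletter word \<Rightarrow>\<^sub>0 'k) \<Rightarrow>
     ('x simplex \<times> ('x, 'k) xletter word \<Rightarrow>\<^sub>0 'k)) \<Rightarrow> ('k, ('x, 'k) tensor_class) dg_module" where
  "tensor_complex X d =
     \<lparr>component = (\<lambda>n. quot_module (tensor_reps X n) (tensor_rel X)),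
      boundary = (\<lambda>n. quot_map (tensor_rel X) d)\<rparr>"

definition adjoint_twisted_complex ::
  "'x sset \<Rightarrow> ('k::comm_ring_1, ('x, 'k) tensor_class) dg_module" where
  "adjoint_twisted_complex X = tensor_complex X
     (twisted_diff fst (bd X) (aw X) (xomega_diff X) (adjoint_action X) cobar_gen)"

definition extended_coHochschild ::
  "'x sset \<Rightarrow> ('k::comm_ring_1, ('x, 'k) tensor_class) dg_module" where
  "extended_coHochschild X = tensor_complex X (cohochschild_diff X)"

text \<open>Both complexes are functorial in \<open>X\<close> through the following map.\<close>

definition tensor_push ::
  "'y sset \<Rightarrow> (nat \<Rightarrow> 'x \<Rightarrow> 'y) \<Rightarrow> ('x, 'k::comm_ring_1) tensor_class \<Rightarrow> ('y, 'k) tensor_class" where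
  "tensor_push Y f = quot_map (tensor_rel Y)
     (lin (\<lambda>(c, w). tens (chain_push Y f (bas c)) (xomega_push Y f (bas w))))"

end

theory Submission
  imports Defs
begin

text \<open>Both complexes describe the same object. Let \<open>d\<close> be the universal derivation of the cobar
  construction. Its noncommutative differentials are freely generated as a bimodule by the \<open>d{c}\<close>,
  so that with coefficients in \<open>m\<close> they are spanned by the classes \<open>d{c} \<otimes> m\<close>, and the coHochschild
  complex is the cone of \<open>du \<otimes> m \<mapsto> u m - m u\<close>. The twisted tensor product is the analogous cone
  for the adjoint action, with Fox derivatives in the place of differentials. The two presentations are
  exchanged by the isomorphism \<open>c \<otimes> m \<mapsto> \<Sum> \<plusminus> d{c}'' \<otimes> m s({c}')\<close>, whose inverse is
  \<open>c \<otimes> m \<mapsto> \<Sum> \<plusminus> \<partial>{c}'' \<otimes> m {c}'\<close> with \<open>\<partial>\<close> the Fox derivative; this is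
  the antipode axiom and coassociativity. Hence the chain homotopy equivalence is even a natural
  isomorphism of complexes, and all homotopies vanish.

  The bialgebra axioms for the cobar construction come from the coalgebra of a cube: \<open>I_\<sigma>\<close> is a
  compatible family of maps from cubes that kills degenerate simplices. The antipode is found by solving
  \<open>\<Sum> x' s(x'') = \<epsilon>(x)\<close> for \<open>x = I_\<sigma>\<close> by recursion on the dimension, which only
  requires the inverse of the set-like element given by the edge of \<open>\<sigma>\<close> from the first to the last
  vertex.\<close>

section \<open>Linear algebra of free modules\<close>

text \<open>The antipode in the adjoint action is given only by a choice, and its properties hold
  only modulo the ideal. Identities are therefore proved as congruences between representatives, and
  the chosen antipode is replaced by the constructed one: on the cobar construction both agree
  modulo the ideal, because convolution inverses are unique. The same uniqueness makes the antipode
  compatible with the differential and with simplicial maps, so its recursive formula is never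
  differentiated or pushed forward. The coHochschild differential uses products only, the adjoint
  one also the coproduct and the antipode. Hence only \<open>to_coH\<close> is shown directly to be
  a natural chain map; that the adjoint differential respects the relations and squares to zero, and
  that the inverse is a natural chain map, are consequences. The definitions describe coproduct and
  differential on nondegenerate generators, but their faces may be degenerate. So the cube formulas
  have to be verified for degenerate simplices as well.\<close>

definition klin :: "(('a \<Rightarrow>\<^sub>0 'k::comm_ring_1) \<Rightarrow> ('b \<Rightarrow>\<^sub>0 'k)) \<Rightarrow> bool" where
  "klin f \<longleftrightarrow> (\<forall>p q. f (p + q) = f p + f q) \<and> (\<forall>c p. f (scale c p) = scale c (f p))"

lemma klinI: "(\<And>p q. f (p + q) = f p + f q) \<Longrightarrow> (\<And>c p. f (scale c p) = scale c (f p)) \<Longrightarrow> klin f"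
  by (simp add: klin_def)

lemma klin_add: "klin f \<Longrightarrow> f (p + q) = f p + f q"
  by (simp add: klin_def)

lemma klin_scale: "klin f \<Longrightarrow> f (scale c p) = scale c (f p)"
  by (simp add: klin_def)

lemma klin_module_hom: "klin f \<Longrightarrow> Modules.module_hom scale scale f"
  by (auto simp: klin_def module_hom_def module_hom_axioms_def free_module.module_axioms)

lemma scale_simps [simp]:
  "scale c 0 = (0 :: 'b \<Rightarrow>\<^sub>0 'k::comm_ring_1)" "scale 0 p = 0" "scale 1 p = p"
  "scale c (scale d p) = scale (c * d) p" "scale (- c) p = - scale c p" "scale c (- p) = - scale c p"
  for p :: "'b \<Rightarrow>\<^sub>0 'k::comm_ring_1"
  by (auto intro!: poly_mapping_eqI simp: lookup_scale algebra_simps)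

lemma scale_add: "scale c (p + q) = scale c p + scale c q"
  by (auto intro!: poly_mapping_eqI simp: lookup_scale lookup_add algebra_simps)

lemma scale_diff: "scale c (p - q) = scale c p - scale c q"
  by (auto intro!: poly_mapping_eqI simp: lookup_scale lookup_minus algebra_simps)

lemma scale_add_left: "scale (c + d) p = scale c p + scale d p"
  by (auto intro!: poly_mapping_eqI simp: lookup_scale lookup_add algebra_simps)

lemma scale_sum: "scale c (sum f A) = (\<Sum>a\<in>A. scale c (f a))"
  by (induction A rule: infinite_finite_induct) (auto simp: scale_add)

lemma scale_sum_left: "scale (sum f A) p = (\<Sum>a\<in>A. scale (f a) p)"
  by (induction A rule: infinite_finite_induct) (auto simp: scale_add_left)

lemma keys_scale: "Poly_Mapping.keys (scale c p) \<subseteq> Poly_Mapping.keys p"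
  by (auto simp: in_keys_iff lookup_scale)

lemma klin_0: "klin f \<Longrightarrow> f 0 = 0"
  using klin_scale[of f 0 0] by simp

lemma klin_uminus: "klin f \<Longrightarrow> f (- p) = - f p"
  using klin_scale[of f "-1" p] by simp

lemma klin_diff: "klin f \<Longrightarrow> f (p - q) = f p - f q"
  using klin_add[of f p "- q"] by (simp add: klin_uminus)

lemma klin_sum: "klin f \<Longrightarrow> f (sum g A) = (\<Sum>a\<in>A. f (g a))"
  by (induction A rule: infinite_finite_induct) (auto simp: klin_0 klin_add)

lemma lin_superset:
  assumes "finite S" "Poly_Mapping.keys p \<subseteq> S"
  shows "lin f p = (\<Sum>a\<in>S. scale (Poly_Mapping.lookup p a) (f a))"
  unfolding lin_def
  by (rule sum.mono_neutral_left) (use assms in \<open>auto simp: in_keys_iff\<close>)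

lemma klin_lin [simp]: "klin (lin f)"
proof (rule klinI)
  fix p q :: "'a \<Rightarrow>\<^sub>0 'b"
  let ?S = "Poly_Mapping.keys p \<union> Poly_Mapping.keys q"
  show "lin f (p + q) = lin f p + lin f q"
    using keys_add[of p q]
    by (simp add: lin_superset[of ?S] lookup_add scale_add_left sum.distrib)
next
  fix c :: 'b and p :: "'a \<Rightarrow>\<^sub>0 'b"
  show "lin f (scale c p) = scale c (lin f p)"
    using keys_scale[of c p]
    by (simp add: lin_superset[of "Poly_Mapping.keys p"] lookup_scale scale_sum)
qed

lemma lin_bas [simp]: "lin f (bas b) = (f b :: 'c \<Rightarrow>\<^sub>0 'k::comm_ring_1)"
  by (simp add: lin_superset[of "{b}"])

lemma lin_one [simp]: "lin f 1 = (f 0 :: 'c \<Rightarrow>\<^sub>0 'k::comm_ring_1)"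
  using lin_bas[of f 0] by simp

lemma lin_simps [simp]:
  "lin f 0 = 0" "lin f (p + q) = lin f p + lin f q" "lin f (p - q) = lin f p - lin f q"
  "lin f (- p) = - lin f p" "lin f (scale c p) = scale c (lin f p)"
  by (simp_all add: klin_0 klin_add klin_diff klin_uminus klin_scale)

lemma lin_sum: "lin f (sum g A) = (\<Sum>a\<in>A. lin f (g a))"
  by (simp add: klin_sum)

lemma lin_cong: "p = q \<Longrightarrow> (\<And>a. a \<in> Poly_Mapping.keys q \<Longrightarrow> f a = g a) \<Longrightarrow> lin f p = lin g q"
  by (simp add: lin_def)

lemma lin_bas_id [simp]: "lin bas p = p"
proof (rule poly_mapping_eqI)
  fix b
  show "Poly_Mapping.lookup (lin bas p) b = Poly_Mapping.lookup p b"
    by (simp add: lin_def lookup_sum lookup_scale lookup_single when_def if_distrib[of "(*) _"] in_keys_iff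
        cong: if_cong)
qed

lemma klin_compose_lin: "klin f \<Longrightarrow> f (lin g p) = lin (\<lambda>a. f (g a)) p"
  by (simp add: lin_def klin_sum klin_scale)

lemma lin_lin: "lin f (lin g p) = lin (\<lambda>a. lin f (g a)) p"
  by (simp add: klin_compose_lin)

lemma klin_eq_lin: "klin f \<Longrightarrow> f p = lin (\<lambda>b. f (bas b)) p"
  using klin_compose_lin[of f bas p] by simp

text \<open>Most identities below are reduced to basis elements by this rule. Only basis elements
  that occur in p matter, so that facts about words in a given alphabet suffice.\<close>

lemma klin_eqI:
  assumes "klin f" "klin g" "\<And>b. b \<in> Poly_Mapping.keys p \<Longrightarrow> f (bas b) = g (bas b)"
  shows "f p = g p"
  using assms by (subst (1 2) klin_eq_lin) (auto intro: lin_cong)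

lemma lin_swap: "lin (\<lambda>a. lin (\<lambda>b. f a b) q) p = lin (\<lambda>b. lin (\<lambda>a. f a b) p) q"
  unfolding lin_def scale_sum by (subst sum.swap) (simp add: mult.commute)

lemma lin_add_fun: "lin (\<lambda>a. f a + g a) p = lin f p + lin g p"
  by (simp add: lin_def scale_add sum.distrib)

lemma lin_diff_fun: "lin (\<lambda>a. f a - g a) p = lin f p - lin g p"
  by (simp add: lin_def scale_diff sum_subtractf)

lemma lin_uminus_fun: "lin (\<lambda>a. - f a) p = - lin f p"
  by (simp add: lin_def sum_negf)

lemma lin_scale_fun: "lin (\<lambda>a. scale c (f a)) p = scale c (lin f p)"
  by (simp add: lin_def scale_sum mult.commute)

lemma scale_lin: "scale c (lin f p) = lin (\<lambda>a. scale c (f a)) p"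
  by (simp add: lin_scale_fun)

lemma lin_0_fun [simp]: "lin (\<lambda>a. 0) p = 0"
  by (simp add: lin_def)

lemma scale_mult_left: "scale c p * q = scale c (p * q)" for p :: "'b::monoid_add \<Rightarrow>\<^sub>0 'k::comm_ring_1"
  unfolding scale_def mult_map_scale_conv_mult by (simp add: mult.assoc)

lemma bas_mult: "bas u * bas v = (bas (u + v) :: 'b::monoid_add \<Rightarrow>\<^sub>0 'k::comm_ring_1)"
  by (simp add: mult_single)

lemma single_eq_scale: "Poly_Mapping.single b c = scale c (bas b)"
  by (auto intro!: poly_mapping_eqI simp: lookup_scale lookup_single when_def)

text \<open>\<open>Poly_Mapping.single 0 c\<close> is the scalar c inside the algebra. Since
  coefficients commute, multiplying by it on the right is scaling, and associativity then moves
  scalars out of the right factor as well.\<close>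

lemma scale_commute_mult: "p * Poly_Mapping.single 0 c = scale c p"
  for p :: "'b::monoid_add \<Rightarrow>\<^sub>0 'k::comm_ring_1"
proof -
  have "klin (\<lambda>p. p * Poly_Mapping.single 0 c)"
    by (rule klinI) (simp_all add: distrib_right scale_mult_left)
  moreover have "klin (scale c :: ('b \<Rightarrow>\<^sub>0 'k) \<Rightarrow> _)"
    by (rule klinI) (simp_all add: scale_add mult.commute)
  ultimately show ?thesis
  proof (rule klin_eqI)
    fix b :: 'b
    show "bas b * Poly_Mapping.single 0 c = scale c (bas b)"
      by (simp only: mult_single single_eq_scale[of b c] add_0_right mult_1_left)
  qed
qed

lemma scale_mult_right: "p * scale c q = scale c (p * q)" for p :: "'b::monoid_add \<Rightarrow>\<^sub>0 'k::comm_ring_1"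
  by (metis mult.assoc scale_commute_mult)

lemma klin_intros:
  "klin (\<lambda>p. p)" "klin (\<lambda>p. 0)"
  "klin f \<Longrightarrow> klin (\<lambda>p. lin h (f p))"
  "(\<And>a. klin (F a)) \<Longrightarrow> klin (\<lambda>p. lin (\<lambda>a. F a p) q)"
  "klin f \<Longrightarrow> klin g \<Longrightarrow> klin (\<lambda>p. f p + g p)"
  "klin f \<Longrightarrow> klin g \<Longrightarrow> klin (\<lambda>p. f p - g p)"
  "klin f \<Longrightarrow> klin (\<lambda>p. - f p)"
  "klin f \<Longrightarrow> klin (\<lambda>p. scale c (f p))"
  by (auto intro!: klinI simp: klin_add klin_scale scale_add lin_add_fun lin_scale_fun mult.commute
      algebra_simps scale_diff)

lemma klin_mult_left: "klin f \<Longrightarrow> klin (\<lambda>p. f p * q)"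
  for q :: "'b::monoid_add \<Rightarrow>\<^sub>0 'k::comm_ring_1"
  by (auto intro!: klinI simp: klin_add klin_scale distrib_right scale_mult_left)

lemma klin_mult_right: "klin f \<Longrightarrow> klin (\<lambda>p. q * f p)"
  for q :: "'b::monoid_add \<Rightarrow>\<^sub>0 'k::comm_ring_1"
  by (auto intro!: klinI simp: klin_add klin_scale distrib_left scale_mult_right)

lemma lin_mult_left: "lin f p * q = lin (\<lambda>a. f a * q) p"
  for q :: "'b::monoid_add \<Rightarrow>\<^sub>0 'k::comm_ring_1"
  by (rule klin_compose_lin[OF klin_mult_left[OF klin_intros(1)]])

lemma lin_mult_right: "q * lin f p = lin (\<lambda>a. q * f a) p"
  for q :: "'b::monoid_add \<Rightarrow>\<^sub>0 'k::comm_ring_1"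
  by (rule klin_compose_lin[OF klin_mult_right[OF klin_intros(1)]])

lemma lin_mult_lin: "lin f p * lin g q = lin (\<lambda>a. lin (\<lambda>b. f a * g b) q) p"
  for g :: "'c \<Rightarrow> ('b::monoid_add \<Rightarrow>\<^sub>0 'k::comm_ring_1)"
  using lin_mult_left[of f p "lin g q"] by (simp add: lin_mult_right)

lemma mult_eq_lin: "p * q = lin (\<lambda>u. lin (\<lambda>v. bas (u + v)) q) p"
  for p :: "'b::monoid_add \<Rightarrow>\<^sub>0 'k::comm_ring_1"
proof -
  have "lin (\<lambda>v. bas (u + v)) q = bas u * q" for u
    using lin_mult_right[of "bas u" bas q] by (simp add: bas_mult)
  then show ?thesis
    using lin_mult_left[of bas p q] by simp
qed

lemma tens_bas [simp]: "tens (bas a) (bas b) = bas (a, b)"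
  by (simp add: tens_def)

lemma lin_tens: "lin f (tens p q) = lin (\<lambda>a. lin (\<lambda>b. f (a, b)) q) p"
  by (simp add: tens_def lin_lin)

lemma klin_tens_left: "klin f \<Longrightarrow> klin (\<lambda>p. tens (f p) q)"
  unfolding tens_def by (intro klin_intros)

lemma klin_tens_right: "klin f \<Longrightarrow> klin (\<lambda>p. tens q (f p))"
  unfolding tens_def by (intro klin_intros)

lemmas klins = klin_intros klin_mult_left klin_mult_right klin_tens_left klin_tens_right

lemma lin_tens_left: "tens (lin f p) q = lin (\<lambda>a. tens (f a) q) p"
  by (rule klin_compose_lin[OF klin_tens_left[OF klin_intros(1)]])

lemma lin_tens_right: "tens q (lin f p) = lin (\<lambda>a. tens q (f a)) p"
  by (rule klin_compose_lin[OF klin_tens_right[OF klin_intros(1)]])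

lemma tens_simps [simp]:
  "tens 0 q = 0" "tens p 0 = 0" "tens (p + p') q = tens p q + tens p' q"
  "tens p (q + q') = tens p q + tens p q'" "tens (p - p') q = tens p q - tens p' q"
  "tens p (q - q') = tens p q - tens p q'" "tens (scale c p) q = scale c (tens p q)"
  "tens p (scale c q) = scale c (tens p q)" "tens (- p) q = - tens p q" "tens p (- q) = - tens p q"
  by (simp_all add: klin_0[OF klin_tens_left[OF klin_intros(1)]] klin_0[OF klin_tens_right[OF klin_intros(1)]]
      klin_add[OF klin_tens_left[OF klin_intros(1)]] klin_add[OF klin_tens_right[OF klin_intros(1)]]
      klin_diff[OF klin_tens_left[OF klin_intros(1)]] klin_diff[OF klin_tens_right[OF klin_intros(1)]]
      klin_uminus[OF klin_tens_left[OF klin_intros(1)]] klin_uminus[OF klin_tens_right[OF klin_intros(1)]]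
      klin_scale[OF klin_tens_left[OF klin_intros(1)]] klin_scale[OF klin_tens_right[OF klin_intros(1)]])

lemma supported_iff: "p \<in> supported B \<longleftrightarrow> (\<forall>b. b \<in> Poly_Mapping.keys p \<longrightarrow> b \<in> B)"
  by (auto simp: supported_def)

lemma supportedD: "p \<in> supported B \<Longrightarrow> b \<in> Poly_Mapping.keys p \<Longrightarrow> b \<in> B"
  by (auto simp: supported_def)

lemma supported_0 [simp]: "0 \<in> supported B"
  by (simp add: supported_def)

lemma supported_bas [simp]: "b \<in> B \<Longrightarrow> bas b \<in> supported B"
  by (simp add: supported_def)

lemma supported_add: "p \<in> supported B \<Longrightarrow> q \<in> supported B \<Longrightarrow> p + q \<in> supported B"
  using keys_add[of p q] by (auto simp: supported_def)

lemma supported_scale: "p \<in> supported B \<Longrightarrow> scale c p \<in> supported B"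
  using keys_scale[of c p] by (auto simp: supported_def)

lemma supported_uminus: "p \<in> supported B \<Longrightarrow> - p \<in> supported B"
  by (simp add: supported_def keys_minus)

lemma supported_diff: "p \<in> supported B \<Longrightarrow> q \<in> supported B \<Longrightarrow> p - q \<in> supported B"
  using supported_add[of p B "- q"] by (simp add: supported_uminus)

lemma supported_sum: "(\<And>a. a \<in> A \<Longrightarrow> f a \<in> supported B) \<Longrightarrow> sum f A \<in> supported B"
  by (induction A rule: infinite_finite_induct) (auto intro: supported_add)

lemma supported_lin: "(\<And>a. a \<in> Poly_Mapping.keys p \<Longrightarrow> f a \<in> supported B) \<Longrightarrow> lin f p \<in> supported B"
  unfolding lin_def by (intro supported_sum supported_scale)

lemma supported_mono: "p \<in> supported B \<Longrightarrow> B \<subseteq> B' \<Longrightarrow> p \<in> supported B'"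
  by (auto simp: supported_def)

lemma supported_tens: "p \<in> supported A \<Longrightarrow> q \<in> supported B \<Longrightarrow> tens p q \<in> supported (A \<times> B)"
  unfolding tens_def by (intro supported_lin supported_bas) (auto simp: supported_iff)

lemma supported_mult:
  assumes "p \<in> supported A" "q \<in> supported B" "\<And>u v. u \<in> A \<Longrightarrow> v \<in> B \<Longrightarrow> u + v \<in> C"
  shows "p * q \<in> supported C"
  unfolding mult_eq_lin using assms by (intro supported_lin supported_bas) (auto simp: supported_iff)

section \<open>Congruence modulo a span\<close>

definition eqv :: "('b \<Rightarrow>\<^sub>0 'k::comm_ring_1) set \<Rightarrow> ('b \<Rightarrow>\<^sub>0 'k) \<Rightarrow> ('b \<Rightarrow>\<^sub>0 'k) \<Rightarrow> bool" where
  "eqv R x y \<longleftrightarrow> x - y \<in> free_module.span R"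

lemma eqv_refl [simp]: "eqv R x x"
  by (simp add: eqv_def free_module.span_zero)

lemma eqv_sym: "eqv R x y \<Longrightarrow> eqv R y x"
  unfolding eqv_def by (metis free_module.span_neg minus_diff_eq)

lemma eqv_trans [trans]: "eqv R x y \<Longrightarrow> eqv R y z \<Longrightarrow> eqv R x z"
  unfolding eqv_def using free_module.span_add[of "x - y" R "y - z"] by simp

lemma eqv_add: "eqv R x y \<Longrightarrow> eqv R x' y' \<Longrightarrow> eqv R (x + x') (y + y')"
  unfolding eqv_def using free_module.span_add[of "x - y" R "x' - y'"] by (simp add: algebra_simps)

lemma eqv_diff: "eqv R x y \<Longrightarrow> eqv R x' y' \<Longrightarrow> eqv R (x - x') (y - y')"
  unfolding eqv_def using free_module.span_diff[of "x - y" R "x' - y'"] by (simp add: algebra_simps)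

lemma eqv_scale: "eqv R x y \<Longrightarrow> eqv R (scale c x) (scale c y)"
  unfolding eqv_def using free_module.span_scale[of "x - y" R c] by (simp add: scale_diff)

lemma eqv_sum: "(\<And>a. a \<in> A \<Longrightarrow> eqv R (f a) (g a)) \<Longrightarrow> eqv R (sum f A) (sum g A)"
  by (induction A rule: infinite_finite_induct) (auto intro: eqv_add)

lemma eqv_lin: "(\<And>a. a \<in> Poly_Mapping.keys p \<Longrightarrow> eqv R (f a) (g a)) \<Longrightarrow> eqv R (lin f p) (lin g p)"
  unfolding lin_def by (intro eqv_sum eqv_scale)

lemma eqv_0: "eqv R x 0 \<longleftrightarrow> x \<in> free_module.span R"
  by (simp add: eqv_def)

lemma klin_span:
  assumes "klin f" "\<And>x. x \<in> R \<Longrightarrow> f x \<in> free_module.span R'" "x \<in> free_module.span R"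
  shows "f x \<in> free_module.span R'"
  using assms(3)
proof (induction rule: free_module.span_induct_alt)
  case base
  then show ?case by (simp add: klin_0[OF assms(1)] free_module.span_zero)
next
  case (step c x y)
  then show ?case
    by (simp add: klin_add[OF assms(1)] klin_scale[OF assms(1)] assms(2) free_module.span_add free_module.span_scale)
qed

text \<open>Congruences are indexed by generators and not by submodules, so that invariance under a
  linear map becomes a check on generators.\<close>

lemma klin_eqv:
  assumes "klin f" "\<And>x. x \<in> R \<Longrightarrow> f x \<in> free_module.span R'" "eqv R x y"
  shows "eqv R' (f x) (f y)"
  using klin_span[OF assms(1,2) assms(3)[unfolded eqv_def]] by (simp add: eqv_def klin_diff[OF assms(1)])

section \<open>Graded tensor algebras\<close>

text \<open>The sign bookkeeping rests on this: exponents have to agree only in parity, and parities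
  of sums and products are left to automation.\<close>

lemma sgn_eqI: "(even a \<longleftrightarrow> even b) \<Longrightarrow> (- 1 :: 'k::comm_ring_1) ^ a = (- 1) ^ b"
  by (simp add: minus_one_power_iff)

lemma wdeg_simps [simp]:
  "wdeg dg 0 = 0" "wdeg dg (u + v) = wdeg dg u + wdeg dg v" "wdeg dg (Word []) = 0"
  "wdeg dg (Word (g # gs)) = dg g + wdeg dg (Word gs)"
  by (simp_all add: wdeg_def zero_word_def plus_word_def)

lemma letters_simps [simp]: "letters 0 = []" "letters (u + v) = letters u @ letters v"
  by (simp_all add: zero_word_def plus_word_def)

lemma Word_Cons: "Word (g # gs) = Word [g] + Word gs"
  by (simp add: plus_word_def)

lemma Word_Nil: "Word [] = 0"
  by (simp add: zero_word_def)

lemma words_simps [simp]: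
  "0 \<in> words B" "u + v \<in> words B \<longleftrightarrow> u \<in> words B \<and> v \<in> words B"
  "Word [] \<in> words B" "Word (g # gs) \<in> words B \<longleftrightarrow> g \<in> B \<and> Word gs \<in> words B"
  by (auto simp: words_def zero_word_def plus_word_def)

lemma words_UNIV [simp]: "words UNIV = UNIV"
  by (simp add: words_def)

lemma word_induct [consumes 1, case_names zero Cons]:
  assumes "w \<in> words B" "P 0" "\<And>g w. g \<in> B \<Longrightarrow> w \<in> words B \<Longrightarrow> P w \<Longrightarrow> P (Word [g] + w)"
  shows "P w"
proof (cases w)
  case (Word gs)
  have "set gs \<subseteq> B" using assms(1) Word by (simp add: words_def)
  then have "P (Word gs)"
  proof (induction gs)
    case Nil
    then show ?case using assms(2) by (simp add: zero_word_def)
  next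
    case (Cons g gs)
    then show ?case using assms(3)[of g "Word gs"] by (simp add: Word_Cons[of g gs] words_def)
  qed
  then show ?thesis by (simp add: Word)
qed

text \<open>The sign of moving an element of degree k past a word, extended linearly. It allows
  Koszul signs to be written for inhomogeneous elements.\<close>

definition twist :: "('g \<Rightarrow> nat) \<Rightarrow> nat \<Rightarrow> ('g word \<Rightarrow>\<^sub>0 'k::comm_ring_1) \<Rightarrow> ('g word \<Rightarrow>\<^sub>0 'k)" where
  "twist dg k = lin (\<lambda>w. scale ((-1) ^ (k * wdeg dg w)) (bas w))"

lemma klin_twist: "klin (twist dg k)"
  by (simp add: twist_def)

lemma twist_bas [simp]: "twist dg k (bas w) = scale ((-1) ^ (k * wdeg dg w)) (bas w)"
  by (simp add: twist_def)

text \<open>Parity is all that is asked of the degrees, so n + 1 may stand for n - 1 after a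
  differential and no truncated subtraction arises.\<close>

lemma twist_homog:
  assumes "\<And>w. w \<in> Poly_Mapping.keys p \<Longrightarrow> even (wdeg dg w) = even n"
  shows "twist dg k p = scale ((-1) ^ (k * n)) (p :: 'g word \<Rightarrow>\<^sub>0 'k::comm_ring_1)"
proof (rule klin_eqI[OF klin_twist klin_intros(8)[OF klin_intros(1)]])
  fix w assume "w \<in> Poly_Mapping.keys p"
  then show "twist dg k (bas w) = scale ((-1) ^ (k * n)) (bas w)"
    using assms by (auto intro!: arg_cong2[where f = scale] sgn_eqI)
qed

lemma twist_simps [simp]:
  "twist dg k 0 = 0" "twist dg k (p + q) = twist dg k p + twist dg k q"
  "twist dg k (p - q) = twist dg k p - twist dg k q" "twist dg k (- p) = - twist dg k p"
  "twist dg k (scale c p) = scale c (twist dg k p)" "twist dg k 1 = 1"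
  using twist_bas[of dg k 0] by (simp_all add: twist_def)

lemma mult_eqI:
  assumes "klin F" "klin G" "klin H" "\<And>u v. u \<in> Poly_Mapping.keys p \<Longrightarrow> v \<in> Poly_Mapping.keys q \<Longrightarrow>
      F (bas (u + v)) = G (bas u) * H (bas v)"
  shows "F (p * q) = G p * (H q :: 'b::monoid_add \<Rightarrow>\<^sub>0 'k::comm_ring_1)"
proof -
  have "F (p * q) = lin (\<lambda>u. lin (\<lambda>v. F (bas (u + v))) q) p"
    by (simp add: mult_eq_lin klin_compose_lin[OF assms(1)])
  also have "\<dots> = lin (\<lambda>u. lin (\<lambda>v. G (bas u) * H (bas v)) q) p"
    by (intro lin_cong refl assms(4))
  also have "\<dots> = G p * H q"
    by (simp add: klin_eq_lin[OF assms(2), of p] klin_eq_lin[OF assms(3), of q] lin_mult_lin)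
  finally show ?thesis .
qed

lemma twist_mult: "twist dg k (p * q) = twist dg k p * twist dg k q"
  by (rule mult_eqI[where F = "twist dg k" and G = "twist dg k" and H = "twist dg k"])
    (simp_all add: klin_twist scale_mult_left scale_mult_right bas_mult
      power_add[symmetric] distrib_left add.commute)

lemma twist_twist: "twist dg j (twist dg k p) = twist dg (j + k) p"
  by (rule klin_eqI[where p = p])
    (simp_all add: twist_def klins lin_lin power_add[symmetric] distrib_right add.commute)

section \<open>Algebra maps, augmentations and derivations on free algebras\<close>

lemma alg_ext_bas_Cons [simp]: "alg_ext h (bas (Word (g # gs))) = h g * alg_ext h (bas (Word gs))"
  by (simp add: alg_ext_def)

lemma alg_ext_0_1 [simp]: "alg_ext h (bas (Word [])) = 1" "alg_ext h 1 = 1"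
  by (simp_all add: alg_ext_def zero_word_def)

lemma klin_alg_ext: "klin (alg_ext h)"
  by (simp add: alg_ext_def)

lemma alg_ext_bas_add: "alg_ext h (bas (u + v)) = alg_ext h (bas u) * alg_ext h (bas v)"
  by (simp add: alg_ext_def plus_word_def)

lemma alg_ext_mult: "alg_ext h (p * q) = alg_ext h p * alg_ext h q"
  by (rule mult_eqI[where F = "alg_ext h" and G = "alg_ext h" and H = "alg_ext h"])
    (simp_all add: klin_alg_ext alg_ext_bas_add)

lemmas alg_ext_simps [simp] = klin_0[OF klin_alg_ext] klin_add[OF klin_alg_ext] klin_diff[OF klin_alg_ext]
  klin_uminus[OF klin_alg_ext] klin_scale[OF klin_alg_ext] klin_sum[OF klin_alg_ext]

text \<open>Scalars are embedded in a free algebra, because the calculus of \<open>lin\<close>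
  covers maps into free modules.\<close>

definition scalar :: "'k::comm_ring_1 \<Rightarrow> ('g word \<Rightarrow>\<^sub>0 'k)" where
  "scalar c = scale c 1"

lemma scalar_ext_eq_lin:
  "scalar (scalar_ext h p) = (lin (\<lambda>w. scale (prod_list (map h (letters w))) 1) p :: 'h word \<Rightarrow>\<^sub>0 'k::comm_ring_1)"
  by (simp add: scalar_def scalar_ext_def lin_def scale_sum_left)

lemma scalar_inj: "scalar c = (scalar d :: 'h word \<Rightarrow>\<^sub>0 'k::comm_ring_1) \<longleftrightarrow> c = d"
  by (metis lookup_scale lookup_one_zero mult.right_neutral scalar_def)

lemma scalar_ext_add: "scalar_ext h (p + q) = scalar_ext h p + (scalar_ext h q :: 'k::comm_ring_1)"
proof -
  have "(scalar (scalar_ext h (p + q)) :: 'h word \<Rightarrow>\<^sub>0 'k) = scalar (scalar_ext h p + scalar_ext h q)"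
    by (simp add: scalar_ext_eq_lin scalar_def[of "_ + _"] scale_add_left)
      (simp add: scalar_def[symmetric] scalar_ext_eq_lin)
  then show ?thesis by (simp only: scalar_inj)
qed

lemma scalar_ext_scale: "scalar_ext h (scale c p) = c * (scalar_ext h p :: 'k::comm_ring_1)"
proof -
  have "(scalar (scalar_ext h (scale c p)) :: 'h word \<Rightarrow>\<^sub>0 'k) = scale c (scalar (scalar_ext h p))"
    by (simp add: scalar_ext_eq_lin)
  also have "\<dots> = scalar (c * scalar_ext h p)" by (simp add: scalar_def)
  finally show ?thesis by (simp only: scalar_inj)
qed

lemma scalar_ext_bas [simp]: "scalar_ext h (bas w) = prod_list (map h (letters w))"
  by (simp add: scalar_ext_def)

lemma scalar_ext_1 [simp]: "scalar_ext h 1 = 1"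
  using scalar_ext_bas[of h 0] by (simp del: scalar_ext_bas)

lemma scalar_ext_0 [simp]: "scalar_ext h 0 = 0"
  by (simp add: scalar_ext_def)

lemma scalar_ext_uminus: "scalar_ext h (- p) = - scalar_ext h p"
  using scalar_ext_scale[of h "-1" p] by simp

lemma scalar_ext_diff: "scalar_ext h (p - q) = scalar_ext h p - scalar_ext h q"
  using scalar_ext_add[of h p "- q"] by (simp add: scalar_ext_uminus)

lemma scalar_ext_sum: "scalar_ext h (sum g A) = (\<Sum>a\<in>A. scalar_ext h (g a))"
  by (induction A rule: infinite_finite_induct) (auto simp: scalar_ext_add)

lemma scalar_ext_lin: "scalar_ext h (lin f p) = (\<Sum>a\<in>Poly_Mapping.keys p. Poly_Mapping.lookup p a * scalar_ext h (f a))"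
  unfolding lin_def scalar_ext_sum scalar_ext_scale ..

lemma scalar_ext_mult: "scalar_ext h (p * q) = scalar_ext h p * scalar_ext h q"
proof -
  have "scalar_ext h (p * q) = (\<Sum>u\<in>Poly_Mapping.keys p. Poly_Mapping.lookup p u *
      (\<Sum>v\<in>Poly_Mapping.keys q. Poly_Mapping.lookup q v * (prod_list (map h (letters u)) * prod_list (map h (letters v)))))"
    by (simp add: mult_eq_lin[of p q] scalar_ext_lin plus_word_def)
  also have "\<dots> = scalar_ext h p * scalar_ext h q"
    unfolding scalar_ext_def sum_product by (simp add: sum_distrib_left mult_ac)
  finally show ?thesis .
qed

lemma der_list_append:
  "der_list dg \<delta> (xs @ ys) = der_list dg \<delta> xs * bas (Word ys) +
     scale ((-1) ^ wdeg dg (Word xs)) (bas (Word xs) * der_list dg \<delta> ys)"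
proof (induction xs)
  case Nil
  then show ?case by (simp add: Word_Nil)
next
  case (Cons x xs)
  have append: "bas (Word (xs @ ys)) = (bas (Word xs) * bas (Word ys) :: 'a word \<Rightarrow>\<^sub>0 'b)"
    by (simp add: bas_mult plus_word_def)
  show ?case using Cons
    by (simp add: Word_Cons[of x xs] Word_Cons[of x "xs @ ys"] bas_mult[symmetric] distrib_left distrib_right
        mult.assoc scale_mult_left scale_mult_right scale_add power_add append)
qed

lemma klin_der_ext: "klin (der_ext dg \<delta>)"
  by (simp add: der_ext_def)

lemmas der_ext_simps [simp] = klin_0[OF klin_der_ext] klin_add[OF klin_der_ext] klin_diff[OF klin_der_ext]
  klin_uminus[OF klin_der_ext] klin_scale[OF klin_der_ext]

lemma der_ext_1 [simp]: "der_ext dg \<delta> 1 = 0"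
  by (simp add: der_ext_def zero_word_def)

lemma der_ext_letter [simp]: "der_ext dg \<delta> (bas (Word [g])) = \<delta> g"
  by (simp add: der_ext_def Word_Nil)

lemma der_ext_bas_add:
  "der_ext dg \<delta> (bas (u + v)) = der_ext dg \<delta> (bas u) * bas v + twist dg 1 (bas u) * der_ext dg \<delta> (bas v)"
  by (simp add: der_ext_def plus_word_def der_list_append scale_mult_left)

lemma der_ext_mult: "der_ext dg \<delta> (p * q) = der_ext dg \<delta> p * q + twist dg 1 p * der_ext dg \<delta> q"
proof -
  have "der_ext dg \<delta> (p * q) = lin (\<lambda>u. lin (\<lambda>v. der_ext dg \<delta> (bas u) * bas v +
      twist dg 1 (bas u) * der_ext dg \<delta> (bas v)) q) p"
    by (simp add: mult_eq_lin klin_compose_lin[OF klin_der_ext] der_ext_bas_add)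
  also have "\<dots> = lin (\<lambda>u. der_ext dg \<delta> (bas u)) p * lin bas q +
      lin (\<lambda>u. twist dg 1 (bas u)) p * lin (\<lambda>v. der_ext dg \<delta> (bas v)) q"
    by (simp only: lin_add_fun lin_mult_lin)
  finally show ?thesis
    by (simp only: klin_eq_lin[OF klin_der_ext, symmetric] klin_eq_lin[OF klin_twist, symmetric] lin_bas_id)
qed

text \<open>Degree -1 is expressed by adding 1 to the degree of the value: for a word of degree 0
  the supporting set is empty and the value is 0.\<close>

lemma supported_der_ext:
  assumes "\<And>g. g \<in> B \<Longrightarrow> \<delta> g \<in> supported {v \<in> words B. wdeg dg v + 1 = dg g}" "w \<in> words B"
  shows "der_ext dg \<delta> (bas w) \<in> supported {v \<in> words B. wdeg dg v + 1 = wdeg dg w}"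
  using assms(2)
proof (induction rule: word_induct)
  case zero
  then show ?case by simp
next
  case (Cons g w)
  show ?case unfolding der_ext_bas_add twist_bas scale_mult_left der_ext_letter
    by (intro supported_add supported_scale
        supported_mult[of _ "{v \<in> words B. wdeg dg v + 1 = dg g}" _ "{w}"]
        supported_mult[of _ "{Word [g]}" _ "{v \<in> words B. wdeg dg v + 1 = wdeg dg w}"])
      (use Cons assms(1)[of g] in auto)
qed

lemma twist_der_ext:
  assumes "\<And>g. g \<in> B \<Longrightarrow> \<delta> g \<in> supported {v \<in> words B. wdeg dg v + 1 = dg g}" "p \<in> supported (words B)"
  shows "twist dg k (der_ext dg \<delta> p) = scale ((-1) ^ k) (der_ext dg \<delta> (twist dg k p))"
proof (rule klin_eqI[where f = "\<lambda>p. twist dg k (der_ext dg \<delta> p)"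
      and g = "\<lambda>p. scale ((-1) ^ k) (der_ext dg \<delta> (twist dg k p))"])
  show "klin (\<lambda>p. twist dg k (der_ext dg \<delta> p))" "klin (\<lambda>p. scale ((-1) ^ k) (der_ext dg \<delta> (twist dg k p)))"
    by (auto simp: der_ext_def twist_def intro!: klins)
next
  fix w assume "w \<in> Poly_Mapping.keys p"
  then have "w \<in> words B" using assms(2) by (auto simp: supported_iff)
  have "even (wdeg dg v) = even (wdeg dg w + 1)" if "v \<in> Poly_Mapping.keys (der_ext dg \<delta> (bas w))" for v
  proof -
    have "wdeg dg w = wdeg dg v + 1"
      using supportedD[OF supported_der_ext[of B \<delta> dg w, OF assms(1) \<open>w \<in> words B\<close>] that] by simp
    then show ?thesis by simp
  qed
  then have "twist dg k (der_ext dg \<delta> (bas w)) = scale ((-1) ^ (k * (wdeg dg w + 1))) (der_ext dg \<delta> (bas w))"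
    by (rule twist_homog)
  then show "twist dg k (der_ext dg \<delta> (bas w)) = scale ((-1) ^ k) (der_ext dg \<delta> (twist dg k (bas w)))"
    by (simp add: power_add[symmetric])
qed

text \<open>The square of an odd derivation is a derivation, since the mixed terms cancel by the
  sign in \<open>twist_der_ext\<close>. So it vanishes once it vanishes on letters.\<close>

lemma der_ext_der_ext:
  assumes "\<And>g. g \<in> B \<Longrightarrow> \<delta> g \<in> supported {v \<in> words B. wdeg dg v + 1 = dg g}"
    "\<And>g. g \<in> B \<Longrightarrow> der_ext dg \<delta> (\<delta> g) = 0" "w \<in> words B"
  shows "der_ext dg \<delta> (der_ext dg \<delta> (bas w)) = 0"
  using assms(3)
proof (induction rule: word_induct)
  case zero
  then show ?case by simp
next
  case (Cons g w)
  have g: "bas (Word [g]) \<in> supported (words B)"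
    using Cons by simp
  have "twist dg 1 (\<delta> g) = - der_ext dg \<delta> (twist dg 1 (bas (Word [g])))"
    using twist_der_ext[OF assms(1) g, of 1] by simp
  with Cons assms(2) show ?case
    by (simp add: der_ext_bas_add der_ext_mult scale_mult_left del: twist_bas)
qed

subsection \<open>Tensor squares and cubes\<close>

lemma kmult_alt: "kmult dg p q = lin (\<lambda>x. lin (\<lambda>y. scale ((-1) ^ (wdeg dg (snd x) * wdeg dg (fst y)))
    (bas (fst x + fst y, snd x + snd y))) q) p"
  by (simp add: kmult_def split_def)

lemma klin_kmult: "klin f \<Longrightarrow> klin (\<lambda>p. kmult dg (f p) q)" "klin f \<Longrightarrow> klin (\<lambda>p. kmult dg q (f p))"
  unfolding kmult_alt by (intro klins; assumption)+

lemma kmult_simps [simp]: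
  "kmult dg 0 q = 0" "kmult dg p 0 = 0" "kmult dg (p + p') q = kmult dg p q + kmult dg p' q"
  "kmult dg p (q + q') = kmult dg p q + kmult dg p q'" "kmult dg (p - p') q = kmult dg p q - kmult dg p' q"
  "kmult dg p (q - q') = kmult dg p q - kmult dg p q'" "kmult dg (scale c p) q = scale c (kmult dg p q)"
  "kmult dg p (scale c q) = scale c (kmult dg p q)"
  "kmult dg (- p) q = - kmult dg p q" "kmult dg p (- q) = - kmult dg p q"
  by (simp_all add: klin_0[OF klin_kmult(1)[OF klin_intros(1)]] klin_0[OF klin_kmult(2)[OF klin_intros(1)]]
      klin_add[OF klin_kmult(1)[OF klin_intros(1)]] klin_add[OF klin_kmult(2)[OF klin_intros(1)]]
      klin_diff[OF klin_kmult(1)[OF klin_intros(1)]] klin_diff[OF klin_kmult(2)[OF klin_intros(1)]]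
      klin_uminus[OF klin_kmult(1)[OF klin_intros(1)]] klin_uminus[OF klin_kmult(2)[OF klin_intros(1)]]
      klin_scale[OF klin_kmult(1)[OF klin_intros(1)]] klin_scale[OF klin_kmult(2)[OF klin_intros(1)]])

lemma kmult_lin_left: "kmult dg (lin f p) q = lin (\<lambda>a. kmult dg (f a) q) p"
  by (rule klin_compose_lin[OF klin_kmult(1)[OF klin_intros(1)]])

lemma kmult_lin_right: "kmult dg q (lin f p) = lin (\<lambda>a. kmult dg q (f a)) p"
  by (rule klin_compose_lin[OF klin_kmult(2)[OF klin_intros(1)]])

lemma lin_kmult: "lin F (kmult dg p q) = lin (\<lambda>x. lin (\<lambda>y. scale ((-1) ^ (wdeg dg (snd x) * wdeg dg (fst y)))
    (F (fst x + fst y, snd x + snd y))) q) p"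
  by (simp add: kmult_alt lin_lin)

lemma kmult_bas: "kmult dg (bas x) (bas y) = scale ((-1) ^ (wdeg dg (snd x) * wdeg dg (fst y)))
    (bas (fst x + fst y, snd x + snd y))"
  by (simp add: kmult_alt)

lemma kmult_unit: "kmult dg (bas (0, 0)) q = q" "kmult dg p (bas (0, 0)) = p"
  by (simp_all add: kmult_alt)

lemma kmult_assoc: "kmult dg (kmult dg p q) r = kmult dg p (kmult dg q r)"
proof -
  have "kmult dg (kmult dg p q) r = lin (\<lambda>x. lin (\<lambda>y. lin (\<lambda>z. kmult dg (kmult dg (bas x) (bas y)) (bas z)) r) q) p"
    by (simp add: kmult_alt[of dg "kmult dg p q"] lin_kmult kmult_bas scale_lin)
  also have "\<dots> = lin (\<lambda>x. lin (\<lambda>y. lin (\<lambda>z. kmult dg (bas x) (kmult dg (bas y) (bas z))) r) q) p"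
    by (simp add: kmult_bas power_add[symmetric] algebra_simps)
  also have "\<dots> = kmult dg p (kmult dg q r)"
    by (simp add: kmult_alt[of dg p] lin_kmult kmult_bas)
  finally show ?thesis .
qed

text \<open>The only exchange is that of the inner factors p2 and q1, so the sign is governed by the
  parities of these two.\<close>

lemma kmult_tens:
  assumes "\<And>u. u \<in> Poly_Mapping.keys p2 \<Longrightarrow> even (wdeg dg u) = even m"
    "\<And>u. u \<in> Poly_Mapping.keys q1 \<Longrightarrow> even (wdeg dg u) = even n"
  shows "kmult dg (tens p1 p2) (tens q1 q2) = scale ((-1) ^ (m * n)) (tens (p1 * q1) (p2 * q2))"
proof -
  have "kmult dg (tens p1 p2) (tens q1 q2) = lin (\<lambda>a. lin (\<lambda>b. lin (\<lambda>c. lin (\<lambda>d.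
      scale ((-1) ^ (wdeg dg b * wdeg dg c)) (bas (a + c, b + d))) q2) q1) p2) p1"
    by (simp add: kmult_alt lin_tens)
  also have "\<dots> = lin (\<lambda>a. lin (\<lambda>b. lin (\<lambda>c. lin (\<lambda>d.
      scale ((-1) ^ (m * n)) (bas (a + c, b + d))) q2) q1) p2) p1"
    by (intro lin_cong refl arg_cong2[where f = scale] sgn_eqI) (use assms in auto)
  also have "\<dots> = scale ((-1) ^ (m * n)) (lin (\<lambda>a. lin (\<lambda>c. lin (\<lambda>b. lin (\<lambda>d.
      bas (a + c, b + d)) q2) p2) q1) p1)"
    by (subst lin_swap[of _ q1 p2]) (simp add: lin_scale_fun)
  also have "\<dots> = scale ((-1) ^ (m * n)) (tens (p1 * q1) (p2 * q2))"
    by (simp add: tens_def mult_eq_lin lin_lin)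
  finally show ?thesis .
qed

lemma klin_tens_alg_ext: "klin (tens_alg_ext dg h)"
  by (simp add: tens_alg_ext_def)

lemmas tens_alg_ext_simps [simp] = klin_0[OF klin_tens_alg_ext] klin_add[OF klin_tens_alg_ext]
  klin_diff[OF klin_tens_alg_ext] klin_uminus[OF klin_tens_alg_ext] klin_scale[OF klin_tens_alg_ext]

lemma tens_alg_ext_1 [simp]: "tens_alg_ext dg h 1 = bas (0, 0)"
  by (simp add: tens_alg_ext_def)

lemma tens_alg_ext_letter [simp]: "tens_alg_ext dg h (bas (Word [g])) = h g"
  by (simp add: tens_alg_ext_def kmult_unit)

lemma tens_alg_ext_Cons: "tens_alg_ext dg h (bas (Word [g] + w)) = kmult dg (h g) (tens_alg_ext dg h (bas w))"
  by (simp add: tens_alg_ext_def plus_word_def)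

lemma tens_alg_ext_bas_add:
  "tens_alg_ext dg h (bas (u + v)) = kmult dg (tens_alg_ext dg h (bas u)) (tens_alg_ext dg h (bas v))"
proof -
  have "u \<in> words UNIV" by simp
  then show ?thesis
    by (induction rule: word_induct) (simp_all add: kmult_unit tens_alg_ext_Cons add.assoc kmult_assoc)
qed

lemma tens_alg_ext_mult: "tens_alg_ext dg h (p * q) = kmult dg (tens_alg_ext dg h p) (tens_alg_ext dg h q)"
proof -
  have "tens_alg_ext dg h (p * q) = lin (\<lambda>u. lin (\<lambda>v.
      kmult dg (tens_alg_ext dg h (bas u)) (tens_alg_ext dg h (bas v))) q) p"
    by (simp add: mult_eq_lin klin_compose_lin[OF klin_tens_alg_ext] tens_alg_ext_bas_add)
  also have "\<dots> = kmult dg (lin (\<lambda>u. tens_alg_ext dg h (bas u)) p) (lin (\<lambda>v. tens_alg_ext dg h (bas v)) q)"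
    by (subst kmult_lin_left) (simp only: kmult_lin_right)
  finally show ?thesis
    by (simp only: klin_eq_lin[OF klin_tens_alg_ext, symmetric])
qed

definition word_pairs :: "('g \<Rightarrow> nat) \<Rightarrow> 'g set \<Rightarrow> nat \<Rightarrow> ('g word \<times> 'g word) set" where
  "word_pairs dg B n = {x. fst x \<in> words B \<and> snd x \<in> words B \<and> wdeg dg (fst x) + wdeg dg (snd x) = n}"

lemma supported_kmult:
  assumes "p \<in> supported (word_pairs dg B m)" "q \<in> supported (word_pairs dg B n)"
  shows "kmult dg p q \<in> supported (word_pairs dg B (m + n))"
  unfolding kmult_alt using assms
  by (intro supported_lin supported_scale supported_bas) (fastforce simp: supported_iff word_pairs_def)

lemma supported_tens_alg_ext:
  assumes "\<And>g. g \<in> B \<Longrightarrow> h g \<in> supported (word_pairs dg B (dg g))" "w \<in> words B"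
  shows "tens_alg_ext dg h (bas w) \<in> supported (word_pairs dg B (wdeg dg w))"
  using assms(2)
proof (induction rule: word_induct)
  case zero
  then show ?case by (simp add: word_pairs_def)
next
  case (Cons g w)
  then show ?case using supported_kmult[OF assms(1)[OF Cons(1)] Cons(3)]
    by (simp add: tens_alg_ext_Cons)
qed

section \<open>Coassociativity on the free algebra\<close>

definition k3mult :: "('g \<Rightarrow> nat) \<Rightarrow> ('g word \<times> 'g word \<times> 'g word \<Rightarrow>\<^sub>0 'k::comm_ring_1) \<Rightarrow>
    ('g word \<times> 'g word \<times> 'g word \<Rightarrow>\<^sub>0 'k) \<Rightarrow> ('g word \<times> 'g word \<times> 'g word \<Rightarrow>\<^sub>0 'k)" where
  "k3mult dg p q = lin (\<lambda>(a, b, c). lin (\<lambda>(a', b', c').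
     scale ((-1) ^ (wdeg dg b * wdeg dg a' + wdeg dg c * wdeg dg a' + wdeg dg c * wdeg dg b'))
       (bas (a + a', b + b', c + c'))) q) p"

definition coprod_left where
  "coprod_left \<Delta> p = lin (\<lambda>x. lin (\<lambda>y. bas (fst y, snd y, snd x)) (\<Delta> (bas (fst x)))) p"

definition coprod_right where
  "coprod_right \<Delta> p = lin (\<lambda>x. lin (\<lambda>y. bas (fst x, fst y, snd y)) (\<Delta> (bas (snd x)))) p"

text \<open>The sign of moving past \<open>fst y\<close> has to split into the signs of moving past
  its two parts, which requires that the coproduct preserves degrees.\<close>

lemma coprod_left_kmult:
  assumes h: "\<And>g. g \<in> B \<Longrightarrow> h g \<in> supported (word_pairs dg B (dg g))" and q: "q \<in> supported (word_pairs dg B n)"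
  shows "coprod_left (tens_alg_ext dg h) (kmult dg p q) =
    k3mult dg (coprod_left (tens_alg_ext dg h) p) (coprod_left (tens_alg_ext dg h) q)"
proof -
  let ?\<Delta> = "tens_alg_ext dg h"
  have "coprod_left ?\<Delta> (kmult dg p q) = lin (\<lambda>x. lin (\<lambda>y. lin (\<lambda>x'. lin (\<lambda>y'.
      scale ((-1) ^ (wdeg dg (snd x) * wdeg dg (fst y) + wdeg dg (snd x') * wdeg dg (fst y')))
        (bas (fst x' + fst y', snd x' + snd y', snd x + snd y))) (?\<Delta> (bas (fst y)))) (?\<Delta> (bas (fst x)))) q) p"
    by (simp add: coprod_left_def lin_kmult tens_alg_ext_bas_add scale_lin power_add)
  also have "\<dots> = lin (\<lambda>x. lin (\<lambda>y. lin (\<lambda>x'. lin (\<lambda>y'.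
      scale ((-1) ^ (wdeg dg (snd x') * wdeg dg (fst y') + wdeg dg (snd x) * wdeg dg (fst y') + wdeg dg (snd x) * wdeg dg (snd y')))
        (bas (fst x' + fst y', snd x' + snd y', snd x + snd y))) (?\<Delta> (bas (fst y)))) (?\<Delta> (bas (fst x)))) q) p"
  proof (intro lin_cong refl)
    fix x y x' y'
    assume "y \<in> Poly_Mapping.keys q" and y': "y' \<in> Poly_Mapping.keys (?\<Delta> (bas (fst y)))"
    then have "fst y \<in> words B" using supportedD[OF q] by (auto simp: word_pairs_def)
    from supportedD[OF supported_tens_alg_ext[OF h this] y']
    have "wdeg dg (fst y) = wdeg dg (fst y') + wdeg dg (snd y')"
      by (auto simp: word_pairs_def)
    then show "scale ((-1) ^ (wdeg dg (snd x) * wdeg dg (fst y) + wdeg dg (snd x') * wdeg dg (fst y')))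
        (bas (fst x' + fst y', snd x' + snd y', snd x + snd y)) =
      scale ((-1) ^ (wdeg dg (snd x') * wdeg dg (fst y') + wdeg dg (snd x) * wdeg dg (fst y') + wdeg dg (snd x) * wdeg dg (snd y')))
        (bas (fst x' + fst y', snd x' + snd y', snd x + snd y))"
      by (simp add: algebra_simps)
  qed
  also have "\<dots> = k3mult dg (coprod_left ?\<Delta> p) (coprod_left ?\<Delta> q)"
    unfolding k3mult_def coprod_left_def lin_lin
    by (rule lin_cong[OF refl], subst lin_swap) (simp add: lin_lin split_def)
  finally show ?thesis .
qed

lemma coprod_right_kmult:
  assumes h: "\<And>g. g \<in> B \<Longrightarrow> h g \<in> supported (word_pairs dg B (dg g))" and p: "p \<in> supported (word_pairs dg B n)"
  shows "coprod_right (tens_alg_ext dg h) (kmult dg p q) =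
    k3mult dg (coprod_right (tens_alg_ext dg h) p) (coprod_right (tens_alg_ext dg h) q)"
proof -
  let ?\<Delta> = "tens_alg_ext dg h"
  have "coprod_right ?\<Delta> (kmult dg p q) = lin (\<lambda>x. lin (\<lambda>y. lin (\<lambda>x'. lin (\<lambda>y'.
      scale ((-1) ^ (wdeg dg (snd x) * wdeg dg (fst y) + wdeg dg (snd x') * wdeg dg (fst y')))
        (bas (fst x + fst y, fst x' + fst y', snd x' + snd y'))) (?\<Delta> (bas (snd y)))) (?\<Delta> (bas (snd x)))) q) p"
    by (simp add: coprod_right_def lin_kmult tens_alg_ext_bas_add scale_lin power_add)
  also have "\<dots> = lin (\<lambda>x. lin (\<lambda>y. lin (\<lambda>x'. lin (\<lambda>y'.
      scale ((-1) ^ (wdeg dg (fst x') * wdeg dg (fst y) + wdeg dg (snd x') * wdeg dg (fst y) + wdeg dg (snd x') * wdeg dg (fst y')))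
        (bas (fst x + fst y, fst x' + fst y', snd x' + snd y'))) (?\<Delta> (bas (snd y)))) (?\<Delta> (bas (snd x)))) q) p"
  proof (intro lin_cong refl)
    fix x y x' y'
    assume "x \<in> Poly_Mapping.keys p" and x': "x' \<in> Poly_Mapping.keys (?\<Delta> (bas (snd x)))"
    then have "snd x \<in> words B" using supportedD[OF p] by (auto simp: word_pairs_def)
    from supportedD[OF supported_tens_alg_ext[OF h this] x']
    have "wdeg dg (snd x) = wdeg dg (fst x') + wdeg dg (snd x')"
      by (auto simp: word_pairs_def)
    then show "scale ((-1) ^ (wdeg dg (snd x) * wdeg dg (fst y) + wdeg dg (snd x') * wdeg dg (fst y')))
        (bas (fst x + fst y, fst x' + fst y', snd x' + snd y')) =
      scale ((-1) ^ (wdeg dg (fst x') * wdeg dg (fst y) + wdeg dg (snd x') * wdeg dg (fst y) + wdeg dg (snd x') * wdeg dg (fst y')))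
        (bas (fst x + fst y, fst x' + fst y', snd x' + snd y'))"
      by (simp add: algebra_simps)
  qed
  also have "\<dots> = k3mult dg (coprod_right ?\<Delta> p) (coprod_right ?\<Delta> q)"
    unfolding k3mult_def coprod_right_def lin_lin
    by (rule lin_cong[OF refl], subst lin_swap[where p = q]) (simp add: lin_lin split_def)
  finally show ?thesis .
qed

text \<open>Both iterated coproducts are multiplicative for \<open>k3mult\<close>, so agreement on
  letters is enough.\<close>

lemma coassoc_ext:
  assumes h: "\<And>g. g \<in> B \<Longrightarrow> h g \<in> supported (word_pairs dg B (dg g))"
    and co: "\<And>g. g \<in> B \<Longrightarrow> coprod_left (tens_alg_ext dg h) (h g) = coprod_right (tens_alg_ext dg h) (h g)"
    and w: "w \<in> words B"
  shows "coprod_left (tens_alg_ext dg h) (tens_alg_ext dg h (bas w)) =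
    coprod_right (tens_alg_ext dg h) (tens_alg_ext dg h (bas w))"
  using w
proof (induction rule: word_induct)
  case zero
  then show ?case by (simp add: coprod_left_def coprod_right_def)
next
  case (Cons g w)
  show ?case
    by (simp add: tens_alg_ext_Cons coprod_left_kmult[OF h supported_tens_alg_ext[OF h Cons(2)]]
        coprod_right_kmult[OF h h[OF Cons(1)]] co[OF Cons(1)] Cons(3))
qed

lemma lin_coprod_left:
  "lin (\<lambda>(u, v, w). T u v w) (coprod_left \<Delta> p) =
    lin (\<lambda>x. lin (\<lambda>y. T (fst y) (snd y) (snd x)) (\<Delta> (bas (fst x)))) p"
  by (simp add: coprod_left_def lin_lin split_def)

lemma lin_coprod_right:
  "lin (\<lambda>(u, v, w). T u v w) (coprod_right \<Delta> p) =
    lin (\<lambda>x. lin (\<lambda>y. T (fst x) (fst y) (snd y)) (\<Delta> (bas (snd x)))) p"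
  by (simp add: coprod_right_def lin_lin split_def)

section \<open>The differential of the tensor square\<close>

definition tens_der :: "('g \<Rightarrow> nat) \<Rightarrow> (('g word \<Rightarrow>\<^sub>0 'k::comm_ring_1) \<Rightarrow> ('g word \<Rightarrow>\<^sub>0 'k)) \<Rightarrow>
    ('g word \<times> 'g word \<Rightarrow>\<^sub>0 'k) \<Rightarrow> ('g word \<times> 'g word \<Rightarrow>\<^sub>0 'k)" where
  "tens_der dg D = lin (\<lambda>x. tens (D (bas (fst x))) (bas (snd x)) +
     scale ((-1) ^ wdeg dg (fst x)) (tens (bas (fst x)) (D (bas (snd x)))))"

lemma klin_tens_der: "klin (tens_der dg D)"
  by (simp add: tens_der_def)

lemmas tens_der_simps [simp] = klin_0[OF klin_tens_der] klin_add[OF klin_tens_der]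
  klin_diff[OF klin_tens_der] klin_uminus[OF klin_tens_der] klin_scale[OF klin_tens_der]

lemma klin_comp: "klin F \<Longrightarrow> klin f \<Longrightarrow> klin (\<lambda>p. F (f p))"
  by (auto intro!: klinI simp: klin_add klin_scale)

lemma klin_eqI2:
  assumes "\<And>q. klin (\<lambda>p. F p q)" "\<And>q. klin (\<lambda>p. G p q)" "\<And>p. klin (F p)" "\<And>p. klin (G p)"
    and "\<And>x y. x \<in> Poly_Mapping.keys p \<Longrightarrow> y \<in> Poly_Mapping.keys q \<Longrightarrow> F (bas x) (bas y) = G (bas x) (bas y)"
  shows "F p q = G p q"
proof (rule klin_eqI[where f = "\<lambda>p. F p q" and g = "\<lambda>p. G p q"])
  fix x assume x: "x \<in> Poly_Mapping.keys p"
  show "F (bas x) q = G (bas x) q"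
  proof (rule klin_eqI[where f = "F (bas x)" and g = "G (bas x)", OF assms(3,4)])
    fix y assume "y \<in> Poly_Mapping.keys q"
    with x show "F (bas x) (bas y) = G (bas x) (bas y)" by (rule assms(5))
  qed
qed (fact assms(1), fact assms(2))

lemma even_der_keys:
  assumes "\<And>g. g \<in> B \<Longrightarrow> \<delta> g \<in> supported {v \<in> words B. wdeg dg v + 1 = dg g}"
    "w \<in> words B" "v \<in> Poly_Mapping.keys (der_ext dg \<delta> (bas w))"
  shows "even (wdeg dg v) = even (wdeg dg w + 1)"
proof -
  have "wdeg dg w = wdeg dg v + 1"
    using supportedD[OF supported_der_ext[of B \<delta> dg w, OF assms(1,2)] assms(3)] by simp
  then show ?thesis by simp
qed

text \<open>The sign of the second summand is the total degree of p, whence the homogeneous supports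
  in \<open>word_pairs\<close>.\<close>

lemma tens_der_kmult:
  assumes d: "\<And>g. g \<in> B \<Longrightarrow> \<delta> g \<in> supported {v \<in> words B. wdeg dg v + 1 = dg g}"
    and p: "p \<in> supported (word_pairs dg B m)" and q: "q \<in> supported (word_pairs dg B n)"
  shows "tens_der dg (der_ext dg \<delta>) (kmult dg p q) =
    kmult dg (tens_der dg (der_ext dg \<delta>) p) q +
    scale ((-1) ^ m) (kmult dg p (tens_der dg (der_ext dg \<delta>) q))"
proof (rule klin_eqI2[where F = "\<lambda>p q. tens_der dg (der_ext dg \<delta>) (kmult dg p q)" and
      G = "\<lambda>p q. kmult dg (tens_der dg (der_ext dg \<delta>) p) q +
        scale ((-1) ^ m) (kmult dg p (tens_der dg (der_ext dg \<delta>) q))" and p = p and q = q])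
  fix x y assume x: "x \<in> Poly_Mapping.keys p" and y: "y \<in> Poly_Mapping.keys q"
  obtain x1 x2 y1 y2 where xy: "x = (x1, x2)" "y = (y1, y2)" by (cases x; cases y)
  have xB: "x1 \<in> words B" "x2 \<in> words B" "m = wdeg dg x1 + wdeg dg x2"
    and yB: "y1 \<in> words B" "y2 \<in> words B"
    using supportedD[OF p x] supportedD[OF q y] by (auto simp: word_pairs_def xy)
  let ?D = "\<lambda>u. der_ext dg \<delta> (bas u)"
  let ?s = "\<lambda>a. scale ((-1) ^ a)"
  \<comment> \<open>One product for each of the four tensor factors that the derivation can hit. In
    \<open>k2\<close> and \<open>k3\<close> it hits an inner factor, whose degree changes
    parity.\<close>
  have k1: "kmult dg (tens (?D x1) (bas x2)) (tens (bas y1) (bas y2)) =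
      ?s (wdeg dg x2 * wdeg dg y1) (tens (?D x1 * bas y1) (bas (x2 + y2)))"
    by (subst kmult_tens[where m = "wdeg dg x2" and n = "wdeg dg y1"]) (auto simp: bas_mult)
  have k2: "kmult dg (tens (bas x1) (?D x2)) (tens (bas y1) (bas y2)) =
      ?s ((wdeg dg x2 + 1) * wdeg dg y1) (tens (bas (x1 + y1)) (?D x2 * bas y2))"
    by (subst kmult_tens[where m = "wdeg dg x2 + 1" and n = "wdeg dg y1"])
      (use even_der_keys[of B \<delta> dg, OF d xB(2)] in \<open>auto simp: bas_mult\<close>)
  have k3: "kmult dg (tens (bas x1) (bas x2)) (tens (?D y1) (bas y2)) =
      ?s (wdeg dg x2 * (wdeg dg y1 + 1)) (tens (bas x1 * ?D y1) (bas (x2 + y2)))"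
    by (subst kmult_tens[where m = "wdeg dg x2" and n = "wdeg dg y1 + 1"])
      (use even_der_keys[of B \<delta> dg, OF d yB(1)] in \<open>auto simp: bas_mult\<close>)
  have k4: "kmult dg (tens (bas x1) (bas x2)) (tens (bas y1) (?D y2)) =
      ?s (wdeg dg x2 * wdeg dg y1) (tens (bas (x1 + y1)) (bas x2 * ?D y2))"
    by (subst kmult_tens[where m = "wdeg dg x2" and n = "wdeg dg y1"]) (auto simp: bas_mult)
  show "tens_der dg (der_ext dg \<delta>) (kmult dg (bas x) (bas y)) =
    kmult dg (tens_der dg (der_ext dg \<delta>) (bas x)) (bas y) +
    ?s m (kmult dg (bas x) (tens_der dg (der_ext dg \<delta>) (bas y)))"
  proof -
    let ?a = "wdeg dg x1" and ?b = "wdeg dg x2" and ?c = "wdeg dg y1"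
    have "tens_der dg (der_ext dg \<delta>) (kmult dg (bas x) (bas y)) =
        ?s (?b * ?c) (tens (?D x1 * bas y1) (bas (x2 + y2))) +
        ?s (?b * ?c + ?a) (tens (bas x1 * ?D y1) (bas (x2 + y2))) +
        ?s (?b * ?c + (?a + ?c)) (tens (bas (x1 + y1)) (?D x2 * bas y2)) +
        ?s (?b * ?c + (?a + ?c) + ?b) (tens (bas (x1 + y1)) (bas x2 * ?D y2))"
      by (simp add: xy kmult_bas tens_der_def der_ext_bas_add scale_add scale_mult_left power_add mult.assoc)
    also have "?s (?b * ?c + ?a) (tens (bas x1 * ?D y1) (bas (x2 + y2))) =
        ?s (?a + ?b + ?b * (?c + 1)) (tens (bas x1 * ?D y1) (bas (x2 + y2)))"
      by (intro arg_cong2[where f = scale] sgn_eqI) auto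
    also have "?s (?b * ?c + (?a + ?c)) (tens (bas (x1 + y1)) (?D x2 * bas y2)) =
        ?s (?a + (?b + 1) * ?c) (tens (bas (x1 + y1)) (?D x2 * bas y2))"
      by (intro arg_cong2[where f = scale] sgn_eqI) auto
    also have "?s (?b * ?c + (?a + ?c) + ?b) (tens (bas (x1 + y1)) (bas x2 * ?D y2)) =
        ?s (?a + ?b + ?c + ?b * ?c) (tens (bas (x1 + y1)) (bas x2 * ?D y2))"
      by (intro arg_cong2[where f = scale] sgn_eqI) auto
    finally show ?thesis
      using k1 k2 k3 k4 by (simp add: xy xB(3) tens_der_def scale_add power_add mult.assoc)
  qed
qed (auto intro!: klins klin_comp[OF klin_tens_der] klin_kmult)

text \<open>Both composites satisfy the same Leibniz rule over the same algebra map, so letters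
  suffice.\<close>

lemma coder_ext:
  assumes h: "\<And>g. g \<in> B \<Longrightarrow> h g \<in> supported (word_pairs dg B (dg g))"
    and d: "\<And>g. g \<in> B \<Longrightarrow> \<delta> g \<in> supported {v \<in> words B. wdeg dg v + 1 = dg g}"
    and c: "\<And>g. g \<in> B \<Longrightarrow> tens_alg_ext dg h (\<delta> g) = tens_der dg (der_ext dg \<delta>) (h g)"
    and w: "w \<in> words B"
  shows "tens_alg_ext dg h (der_ext dg \<delta> (bas w)) = tens_der dg (der_ext dg \<delta>) (tens_alg_ext dg h (bas w))"
  using w
proof (induction rule: word_induct)
  case zero
  then show ?case by (simp add: tens_der_def)
next
  case (Cons g w)
  then show ?case
    by (simp add: der_ext_bas_add tens_alg_ext_mult tens_alg_ext_Cons scale_mult_left c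
        tens_der_kmult[OF d h supported_tens_alg_ext[OF h]])
qed

lemma tens_lin_lin: "tens (lin f p) (lin g q) = lin (\<lambda>a. lin (\<lambda>b. tens (f a) (g b)) q) p"
  using lin_tens_left[of f p "lin g q"] by (simp add: lin_tens_right)

section \<open>Algebra maps compatible with coproducts or differentials\<close>

definition pair_map :: "(('g word \<Rightarrow>\<^sub>0 'k::comm_ring_1) \<Rightarrow> ('h word \<Rightarrow>\<^sub>0 'k)) \<Rightarrow>
    ('g word \<times> 'g word \<Rightarrow>\<^sub>0 'k) \<Rightarrow> ('h word \<times> 'h word \<Rightarrow>\<^sub>0 'k)" where
  "pair_map \<phi> = lin (\<lambda>x. tens (\<phi> (bas (fst x))) (\<phi> (bas (snd x))))"

lemma klin_pair_map: "klin (pair_map \<phi>)"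
  by (simp add: pair_map_def)

lemmas pair_map_simps [simp] = klin_0[OF klin_pair_map] klin_add[OF klin_pair_map]
  klin_diff[OF klin_pair_map] klin_uminus[OF klin_pair_map] klin_scale[OF klin_pair_map]

lemma lin_pair_map:
  assumes "klin \<phi>"
  shows "lin (\<lambda>x. tens (\<phi> (f x)) (\<phi> (g x))) p = pair_map \<phi> (lin (\<lambda>x. tens (f x) (g x)) p)"
proof -
  have "tens (\<phi> a) (\<phi> b) = pair_map \<phi> (tens a b)" for a b
    by (simp add: pair_map_def lin_tens klin_eq_lin[OF assms, of a] klin_eq_lin[OF assms, of b] tens_lin_lin)
  then show ?thesis by (simp add: klin_compose_lin[OF klin_pair_map])
qed

lemma pair_map_tens: "klin \<phi> \<Longrightarrow> pair_map \<phi> (tens a b) = tens (\<phi> a) (\<phi> b)"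
  using lin_pair_map[of \<phi> "\<lambda>_. a" "\<lambda>_. b" "bas ()"] by simp

lemma supported_alg_ext:
  assumes "\<And>g. g \<in> B \<Longrightarrow> f g \<in> supported {v \<in> words B'. wdeg dg' v = dg g}" "w \<in> words B"
  shows "alg_ext f (bas w) \<in> supported {v \<in> words B'. wdeg dg' v = wdeg dg w}"
  using assms(2)
proof (induction rule: word_induct)
  case zero
  then show ?case by (simp add: supported_iff)
next
  case (Cons g w)
  show ?case unfolding alg_ext_bas_add
    by (rule supported_mult[OF _ Cons(3)])
      (use assms(1)[OF Cons(1)] in \<open>auto simp: alg_ext_def\<close>)
qed

lemma pair_map_kmult:
  assumes f: "\<And>g. g \<in> B \<Longrightarrow> f g \<in> supported {v \<in> words B'. wdeg dg' v = dg g}"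
    and p: "p \<in> supported (word_pairs dg B m)" and q: "q \<in> supported (word_pairs dg B n)"
  shows "pair_map (alg_ext f) (kmult dg p q) = kmult dg' (pair_map (alg_ext f) p) (pair_map (alg_ext f) q)"
proof (rule klin_eqI2[where F = "\<lambda>p q. pair_map (alg_ext f) (kmult dg p q)" and
      G = "\<lambda>p q. kmult dg' (pair_map (alg_ext f) p) (pair_map (alg_ext f) q)" and p = p and q = q])
  fix x y assume x: "x \<in> Poly_Mapping.keys p" and y: "y \<in> Poly_Mapping.keys q"
  then have "snd x \<in> words B" "fst y \<in> words B"
    using supportedD[OF p x] supportedD[OF q y] by (auto simp: word_pairs_def)
  then have e: "u \<in> Poly_Mapping.keys (alg_ext f (bas (snd x))) \<Longrightarrow> wdeg dg' u = wdeg dg (snd x)"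
    "u \<in> Poly_Mapping.keys (alg_ext f (bas (fst y))) \<Longrightarrow> wdeg dg' u = wdeg dg (fst y)" for u
    using supportedD[OF supported_alg_ext[of B f B' dg' dg, OF f]] by auto
  have "kmult dg' (pair_map (alg_ext f) (bas x)) (pair_map (alg_ext f) (bas y)) =
     scale ((- 1) ^ (wdeg dg (snd x) * wdeg dg (fst y)))
      (tens (alg_ext f (bas (fst x)) * alg_ext f (bas (fst y))) (alg_ext f (bas (snd x)) * alg_ext f (bas (snd y))))"
    unfolding pair_map_def lin_bas
    by (intro kmult_tens) (simp_all add: e)
  then show "pair_map (alg_ext f) (kmult dg (bas x) (bas y)) =
      kmult dg' (pair_map (alg_ext f) (bas x)) (pair_map (alg_ext f) (bas y))"
    by (simp add: kmult_bas pair_map_def alg_ext_bas_add)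
qed (auto intro!: klins klin_comp[OF klin_pair_map] klin_kmult klin_pair_map)

lemma coprod_morphism:
  assumes f: "\<And>g. g \<in> B \<Longrightarrow> f g \<in> supported {v \<in> words B'. wdeg dg' v = dg g}"
    and h: "\<And>g. g \<in> B \<Longrightarrow> h g \<in> supported (word_pairs dg B (dg g))"
    and c: "\<And>g. g \<in> B \<Longrightarrow> tens_alg_ext dg' h' (f g) = pair_map (alg_ext f) (h g)"
    and w: "w \<in> words B"
  shows "tens_alg_ext dg' h' (alg_ext f (bas w)) = pair_map (alg_ext f) (tens_alg_ext dg h (bas w))"
  using w
proof (induction rule: word_induct)
  case zero
  then show ?case by (simp add: pair_map_def tens_def)
next
  case (Cons g w)
  have "alg_ext f (bas (Word [g])) = f g" by (simp add: alg_ext_def)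
  then show ?case using Cons
    by (simp add: alg_ext_bas_add tens_alg_ext_mult tens_alg_ext_Cons c
        pair_map_kmult[of B f B' dg' dg, OF f h supported_tens_alg_ext[of B h, OF h]])
qed

lemma der_morphism:
  assumes f: "\<And>g. g \<in> B \<Longrightarrow> f g \<in> supported {v \<in> words B'. wdeg dg' v = dg g}"
    and c: "\<And>g. g \<in> B \<Longrightarrow> der_ext dg' \<delta>' (f g) = alg_ext f (\<delta> g)"
    and w: "w \<in> words B"
  shows "der_ext dg' \<delta>' (alg_ext f (bas w)) = alg_ext f (der_ext dg \<delta> (bas w))"
  using w
proof (induction rule: word_induct)
  case zero
  then show ?case by simp
next
  case (Cons g w)
  have fg: "alg_ext f (bas (Word [g])) = f g" by (simp add: alg_ext_def)
  have "twist dg' 1 (f g) = scale ((-1) ^ dg g) (f g)"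
    using twist_homog[of "f g" dg' "dg g" 1] supportedD[OF f[OF Cons(1)]] by auto
  then show ?case using Cons
    by (simp add: alg_ext_bas_add der_ext_mult der_ext_bas_add scale_mult_left fg c alg_ext_mult)
qed

section \<open>Counits\<close>

lemma counit_degree:
  assumes "\<And>g. g \<in> B \<Longrightarrow> e g \<noteq> 0 \<Longrightarrow> dg g = 0" "w \<in> words B" "scalar_ext e (bas w) \<noteq> (0 :: 'k::comm_ring_1)"
  shows "wdeg dg w = 0"
  using assms(2,3)
  by (induction rule: word_induct) (use assms(1) in \<open>auto dest: mult_not_zero\<close>)

text \<open>The augmentation vanishes in positive degrees by \<open>counit_degree\<close>. Thus in
  every term the coefficient is 0 or the Koszul sign is trivial, and both counit identities become
  multiplicative.\<close>

lemma counit_ext: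
  fixes e :: "'g \<Rightarrow> 'k::comm_ring_1"
  assumes h: "\<And>g. g \<in> B \<Longrightarrow> h g \<in> supported (word_pairs dg B (dg g))"
    and e: "\<And>g. g \<in> B \<Longrightarrow> e g \<noteq> 0 \<Longrightarrow> dg g = 0"
    and l: "\<And>g. g \<in> B \<Longrightarrow> lin (\<lambda>x. scale (scalar_ext e (bas (fst x))) (bas (snd x))) (h g) = bas (Word [g])"
    and r: "\<And>g. g \<in> B \<Longrightarrow> lin (\<lambda>x. scale (scalar_ext e (bas (snd x))) (bas (fst x))) (h g) = bas (Word [g])"
    and w: "w \<in> words B"
  shows "lin (\<lambda>x. scale (scalar_ext e (bas (fst x))) (bas (snd x))) (tens_alg_ext dg h (bas w)) = bas w"
    and "lin (\<lambda>x. scale (scalar_ext e (bas (snd x))) (bas (fst x))) (tens_alg_ext dg h (bas w)) = bas w"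
proof -
  have "lin (\<lambda>x. scale (scalar_ext e (bas (fst x))) (bas (snd x))) (tens_alg_ext dg h (bas w)) = bas w \<and>
    lin (\<lambda>x. scale (scalar_ext e (bas (snd x))) (bas (fst x))) (tens_alg_ext dg h (bas w)) = bas w"
    using w
  proof (induction rule: word_induct)
    case zero
    then show ?case by simp
  next
    case (Cons g w)
    let ?E = "\<lambda>u. scalar_ext e (bas u)"
    have hg: "snd x \<in> words B" if "x \<in> Poly_Mapping.keys (h g)" for x
      using supportedD[OF h[OF Cons(1)] that] by (auto simp: word_pairs_def)
    have wB: "fst y \<in> words B" if "y \<in> Poly_Mapping.keys (tens_alg_ext dg h (bas w))" for y
      using supportedD[OF supported_tens_alg_ext[of B h dg, OF h Cons(2)] that] by (auto simp: word_pairs_def)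
    have "lin (\<lambda>x. scale (?E (fst x)) (bas (snd x))) (tens_alg_ext dg h (bas (Word [g] + w))) =
       lin (\<lambda>x. lin (\<lambda>y. scale ((- 1) ^ (wdeg dg (snd x) * wdeg dg (fst y)))
          (scale (?E (fst x) * ?E (fst y)) (bas (snd x + snd y)))) (tens_alg_ext dg h (bas w))) (h g)"
      by (simp add: tens_alg_ext_Cons lin_kmult mult.assoc)
    also have "\<dots> = lin (\<lambda>x. lin (\<lambda>y. scale (?E (fst x)) (bas (snd x)) * scale (?E (fst y)) (bas (snd y)))
         (tens_alg_ext dg h (bas w))) (h g)"
    proof (intro lin_cong refl)
      fix x y assume "y \<in> Poly_Mapping.keys (tens_alg_ext dg h (bas w))"
      then have "?E (fst y) \<noteq> 0 \<Longrightarrow> wdeg dg (fst y) = 0"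
        using counit_degree[of B e dg "fst y"] e wB[of y] by metis
      then have "?E (fst y) = 0 \<or> wdeg dg (fst y) = 0" by argo
      then show "scale ((- 1) ^ (wdeg dg (snd x) * wdeg dg (fst y)))
          (scale (?E (fst x) * ?E (fst y)) (bas (snd x + snd y))) =
          scale (?E (fst x)) (bas (snd x)) * scale (?E (fst y)) (bas (snd y))"
        by (auto simp: scale_mult_left scale_mult_right bas_mult mult_ac)
    qed
    also have "\<dots> = bas (Word [g] + w)"
      using Cons l by (simp only: lin_mult_lin[symmetric]) (simp add: bas_mult)
    finally have 1: "lin (\<lambda>x. scale (?E (fst x)) (bas (snd x))) (tens_alg_ext dg h (bas (Word [g] + w))) =
      bas (Word [g] + w)" .
    have "lin (\<lambda>x. scale (?E (snd x)) (bas (fst x))) (tens_alg_ext dg h (bas (Word [g] + w))) =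
       lin (\<lambda>x. lin (\<lambda>y. scale ((- 1) ^ (wdeg dg (snd x) * wdeg dg (fst y)))
          (scale (?E (snd x) * ?E (snd y)) (bas (fst x + fst y)))) (tens_alg_ext dg h (bas w))) (h g)"
      by (simp add: tens_alg_ext_Cons lin_kmult mult.assoc)
    also have "\<dots> = lin (\<lambda>x. lin (\<lambda>y. scale (?E (snd x)) (bas (fst x)) * scale (?E (snd y)) (bas (fst y)))
         (tens_alg_ext dg h (bas w))) (h g)"
    proof (intro lin_cong refl)
      fix x y assume "x \<in> Poly_Mapping.keys (h g)"
      then have "?E (snd x) \<noteq> 0 \<Longrightarrow> wdeg dg (snd x) = 0"
        using counit_degree[of B e dg "snd x"] e hg[of x] by metis
      then have "?E (snd x) = 0 \<or> wdeg dg (snd x) = 0" by argo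
      then show "scale ((- 1) ^ (wdeg dg (snd x) * wdeg dg (fst y)))
          (scale (?E (snd x) * ?E (snd y)) (bas (fst x + fst y))) =
          scale (?E (snd x)) (bas (fst x)) * scale (?E (snd y)) (bas (fst y))"
        by (auto simp: scale_mult_left scale_mult_right bas_mult mult_ac)
    qed
    also have "\<dots> = bas (Word [g] + w)"
      using Cons r by (simp only: lin_mult_lin[symmetric]) (simp add: bas_mult)
    finally show ?case using 1 by simp
  qed
  then show "lin (\<lambda>x. scale (scalar_ext e (bas (fst x))) (bas (snd x))) (tens_alg_ext dg h (bas w)) = bas w"
    "lin (\<lambda>x. scale (scalar_ext e (bas (snd x))) (bas (fst x))) (tens_alg_ext dg h (bas w)) = bas w"
    by auto
qed

section \<open>The cubes\<close>

text \<open>The tensor powers of the interval coalgebra are the parts of fixed word length in the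
  free algebra on three letters, so the results on free algebras treat all cubes at once.
  \<open>cube_coprod_eq\<close> makes the link with \<open>cube_coprod\<close>.\<close>

abbreviation cube_word_coprod :: "(interval word \<Rightarrow>\<^sub>0 'k::comm_ring_1) \<Rightarrow> (interval word \<times> interval word \<Rightarrow>\<^sub>0 'k)" where
  "cube_word_coprod \<equiv> tens_alg_ext interval_deg
     (\<lambda>a. lin (\<lambda>x. bas (Word [fst x], Word [snd x])) (interval_coprod a))"

definition cube_bd :: "(interval word \<Rightarrow>\<^sub>0 'k::comm_ring_1) \<Rightarrow> (interval word \<Rightarrow>\<^sub>0 'k)" where
  "cube_bd = der_ext interval_deg (\<lambda>a. if a = I01 then bas (Word [I1]) - bas (Word [I0]) else 0)"

abbreviation interval_counit :: "interval \<Rightarrow> 'k::comm_ring_1" where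
  "interval_counit a \<equiv> (if a = I01 then 0 else 1)"

lemma cube_coprod_eq:
  "cube_coprod w = lin (\<lambda>x. bas (letters (fst x), letters (snd x))) (cube_word_coprod (bas (Word w)))"
proof (induction w)
  case Nil
  then show ?case by (simp add: Word_Nil)
next
  case (Cons a w)
  then show ?case
    by (simp add: Word_Cons[of a w] tens_alg_ext_Cons lin_kmult lin_lin scale_lin split_def wdeg_def)
qed

lemma interval_word_pairs:
  "lin (\<lambda>x. bas (Word [fst x], Word [snd x])) (interval_coprod a) \<in>
    supported (word_pairs interval_deg UNIV (interval_deg a))"
  by (cases a) (auto intro!: supported_add simp: word_pairs_def interval_deg_def)

lemma interval_bd_supported:
  "(if a = I01 then bas (Word [I1]) - bas (Word [I0]) else 0) \<in>
    supported {v \<in> words UNIV. wdeg interval_deg v + 1 = interval_deg a}"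
  by (auto intro!: supported_diff simp: interval_deg_def)

lemma cube_coassoc: "coprod_left cube_word_coprod (cube_word_coprod (bas w)) =
    coprod_right cube_word_coprod (cube_word_coprod (bas w))"
proof (rule coassoc_ext[where B = UNIV])
  fix a
  show "coprod_left cube_word_coprod (lin (\<lambda>x. bas (Word [fst x], Word [snd x])) (interval_coprod a)) =
    coprod_right cube_word_coprod (lin (\<lambda>x. bas (Word [fst x], Word [snd x])) (interval_coprod a))"
    by (cases a) (simp_all add: coprod_left_def coprod_right_def)
qed (rule interval_word_pairs | simp)+

lemma cube_bd_bd: "cube_bd (cube_bd (bas w)) = 0"
  unfolding cube_bd_def
  by (rule der_ext_der_ext[where B = UNIV, OF interval_bd_supported]) auto

lemma cube_coder: "cube_word_coprod (cube_bd (bas w)) =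
    tens_der interval_deg cube_bd (cube_word_coprod (bas w))"
  unfolding cube_bd_def
proof (rule coder_ext[where B = UNIV])
  fix a
  show "cube_word_coprod (if a = I01 then bas (Word [I1]) - bas (Word [I0]) else 0) =
      tens_der interval_deg (der_ext interval_deg (\<lambda>a. if a = I01 then bas (Word [I1]) - bas (Word [I0]) else 0))
        (lin (\<lambda>x. bas (Word [fst x], Word [snd x])) (interval_coprod a))"
    by (cases a) (simp_all add: tens_der_def interval_deg_def)
qed (rule interval_word_pairs interval_bd_supported | simp)+

lemma cube_counit:
  "lin (\<lambda>x. scale (scalar_ext interval_counit (bas (fst x))) (bas (snd x))) (cube_word_coprod (bas w)) = bas w"
  "lin (\<lambda>x. scale (scalar_ext interval_counit (bas (snd x))) (bas (fst x))) (cube_word_coprod (bas w)) = bas w"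
proof -
  have *: "lin (\<lambda>x. scale (scalar_ext interval_counit (bas (fst x))) (bas (snd x)))
        (lin (\<lambda>x. bas (Word [fst x], Word [snd x])) (interval_coprod a)) = bas (Word [a])"
      "lin (\<lambda>x. scale (scalar_ext interval_counit (bas (snd x))) (bas (fst x)))
        (lin (\<lambda>x. bas (Word [fst x], Word [snd x])) (interval_coprod a)) = bas (Word [a])" for a
    by (cases a; simp)+
  note c = counit_ext[where B = UNIV and w = w and e = interval_counit, OF interval_word_pairs _ *]
  show "lin (\<lambda>x. scale (scalar_ext interval_counit (bas (fst x))) (bas (snd x))) (cube_word_coprod (bas w)) = bas w"
    "lin (\<lambda>x. scale (scalar_ext interval_counit (bas (snd x))) (bas (fst x))) (cube_word_coprod (bas w)) = bas w"
    by (rule c; simp add: interval_deg_def split: if_splits)+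
qed

text \<open>\<open>kw G acc xs w\<close> reads the word \<open>w\<close> along the vertices \<open>xs\<close> (one more than there are letters);
  \<open>acc\<close> collects the vertices of the current factor since the last cut.\<close>

primrec kw :: "(nat list \<Rightarrow> 'a::monoid_mult) \<Rightarrow> nat list \<Rightarrow> nat list \<Rightarrow> interval list \<Rightarrow> 'a" where
  "kw G acc xs [] = G (acc @ xs)"
| "kw G acc xs (c # w) = (case c of
     I0 \<Rightarrow> kw G acc (tl xs) w
   | I1 \<Rightarrow> G (acc @ [hd xs]) * kw G [hd xs] (tl xs) w
   | I01 \<Rightarrow> kw G (acc @ [hd xs]) (tl xs) w)"

lemma kw_drop: "length u = length xs \<Longrightarrow> kw G acc (xs @ x # ys) (u @ I0 # v) = kw G acc (xs @ ys) (u @ v)"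
proof (induction u arbitrary: acc xs)
  case (Cons c u)
  then show ?case by (cases xs) (auto split: interval.split)
qed simp

lemma kw_cut: "length u = length xs \<Longrightarrow>
    kw G acc (xs @ x # ys) (u @ I1 # v) = kw G acc (xs @ [x]) u * kw G [x] ys v"
proof (induction u arbitrary: acc xs)
  case (Cons c u)
  then show ?case by (cases xs) (auto split: interval.split simp: mult.assoc)
qed simp

lemma kw_top: "length xs = Suc n \<Longrightarrow> kw G acc xs (replicate n I01) = G (acc @ xs)"
proof (induction n arbitrary: acc xs)
  case (Suc n)
  then show ?case by (cases xs) auto
qed simp

lemma kw_map: "length xs = Suc (length w) \<Longrightarrow>
    kw G (map f acc) (map f xs) w = kw (\<lambda>ys. G (map f ys)) acc xs w"
proof (induction w arbitrary: acc xs)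
  case (Cons c w)
  then obtain x xs' where xs: "xs = x # xs'" by (cases xs) auto
  show ?case using Cons.IH[of xs' acc] Cons.IH[of xs' "acc @ [x]"] Cons.IH[of xs' "[x]"] Cons.prems
    by (auto simp: xs split: interval.split)
qed simp

lemma kw_comp: "(\<And>a b. \<phi> (a * b) = \<phi> a * \<phi> b) \<Longrightarrow> \<phi> (kw G acc xs w) = kw (\<lambda>ys. \<phi> (G ys)) acc xs w"
  by (induction w arbitrary: acc xs) (auto split: interval.split)

text \<open>Each factor of a word has at least two vertices, so only the values of G on sorted lists
  of length at least 2 matter. This permits changing G on lists that are not faces.\<close>

lemma kw_cong:
  assumes "\<And>ys. 2 \<le> length ys \<Longrightarrow> sorted ys \<Longrightarrow> set ys \<subseteq> A \<Longrightarrow> G ys = H ys"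
  shows "acc \<noteq> [] \<Longrightarrow> sorted (acc @ xs) \<Longrightarrow> set (acc @ xs) \<subseteq> A \<Longrightarrow> length xs = Suc (length w) \<Longrightarrow>
    kw G acc xs w = kw H acc xs w"
proof (induction w arbitrary: acc xs)
  case Nil
  then have "2 \<le> length (acc @ xs)" by (cases acc) auto
  then show ?case using Nil by (simp add: assms)
next
  case (Cons c w)
  then obtain x xs' where xs: "xs = x # xs'" by (cases xs) auto
  have "2 \<le> length (acc @ [x])" using Cons.prems by (cases acc) auto
  moreover have "sorted (acc @ [x])" using Cons.prems by (auto simp: xs sorted_append)
  ultimately show ?case
    using Cons.IH[of acc xs'] Cons.IH[of "acc @ [x]" xs'] Cons.IH[of "[x]" xs'] Cons.prems
    by (auto simp: xs sorted_append assms split: interval.split)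
qed

text \<open>The first and the last vertex carry no letter, so a word of length n is read along n + 2
  vertices; the first vertex starts the accumulator.\<close>

definition kword :: "(nat list \<Rightarrow> 'a::monoid_mult) \<Rightarrow> nat list \<Rightarrow> interval word \<Rightarrow> 'a" where
  "kword G xs w = kw G [hd xs] (tl xs) (letters w)"

lemma kword_drop:
  "length as = Suc (length u) \<Longrightarrow> kword G (as @ x # bs) (Word (u @ I0 # v)) = kword G (as @ bs) (Word (u @ v))"
  by (cases as) (auto simp: kword_def kw_drop)

lemma kword_cut:
  "length as = Suc (length u) \<Longrightarrow>
    kword G (as @ x # bs) (Word (u @ I1 # v)) = kword G (as @ [x]) (Word u) * kword G (x # bs) (Word v)"
  by (cases as) (auto simp: kword_def kw_cut)

lemma kword_top: "length xs = n + 2 \<Longrightarrow> kword G xs (Word (replicate n I01)) = G xs"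
  by (cases xs) (auto simp: kword_def kw_top)

text \<open>Facts about top cubes over all vertex lists spread to all faces: a word with a letter
  \<open>I0\<close> is a word over fewer vertices, a word with a letter \<open>I1\<close> is a
  product of two shorter words, and what remains are the words that consist of \<open>I01\<close>
  only.\<close>

lemma kword_induct [consumes 2, case_names top drop cut]:
  assumes "length xs = length w + 2" "sorted xs \<and> set xs \<subseteq> A"
    and top: "\<And>xs n. length xs = n + 2 \<Longrightarrow> sorted xs \<and> set xs \<subseteq> A \<Longrightarrow> P xs (replicate n I01)"
    and drop: "\<And>as x bs u v. length as = Suc (length u) \<Longrightarrow> length bs = Suc (length v) \<Longrightarrow>
      sorted (as @ x # bs) \<and> set (as @ x # bs) \<subseteq> A \<Longrightarrow> P (as @ bs) (u @ v) \<Longrightarrow> P (as @ x # bs) (u @ I0 # v)"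
    and cut: "\<And>as x bs u v. length as = Suc (length u) \<Longrightarrow> length bs = Suc (length v) \<Longrightarrow>
      sorted (as @ x # bs) \<and> set (as @ x # bs) \<subseteq> A \<Longrightarrow> P (as @ [x]) u \<Longrightarrow> P (x # bs) v \<Longrightarrow>
      P (as @ x # bs) (u @ I1 # v)"
  shows "P xs w"
  using assms(1,2)
proof (induction "length w" arbitrary: xs w rule: less_induct)
  case less
  have split: "\<exists>as x bs. xs = as @ x # bs \<and> length as = Suc (length u) \<and> length bs = Suc (length v)"
    if "w = u @ c # v" for u c v
    using that less.prems(1)
    by (intro exI[of _ "take (Suc (length u)) xs"] exI[of _ "xs ! Suc (length u)"]
        exI[of _ "drop (Suc (Suc (length u))) xs"]) (simp add: id_take_nth_drop[symmetric])
  consider (0) "I0 \<in> set w" | (1) "I1 \<in> set w" | (top) "set w \<subseteq> {I01}"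
    by (metis interval.exhaust insertCI subsetI)
  then show ?case
  proof cases
    case 0
    then obtain u v where w: "w = u @ I0 # v" by (meson split_list)
    from split[OF this] obtain as x bs where xs: "xs = as @ x # bs" "length as = Suc (length u)" "length bs = Suc (length v)"
      by blast
    have "P (as @ bs) (u @ v)"
      by (rule less.hyps) (use xs w less.prems in \<open>auto simp: sorted_append\<close>)
    with drop xs w less.prems show ?thesis by auto
  next
    case 1
    then obtain u v where w: "w = u @ I1 # v" by (meson split_list)
    from split[OF this] obtain as x bs where xs: "xs = as @ x # bs" "length as = Suc (length u)" "length bs = Suc (length v)"
      by blast
    have "P (as @ [x]) u" "P (x # bs) v"
      by (rule less.hyps; use xs w less.prems in \<open>auto simp: sorted_append\<close>)+
    with cut xs w less.prems show ?thesis by auto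
  next
    case top
    then have "w = replicate (length w) I01"
      by (metis replicate_eqI singletonD subsetD)
    with assms(3)[of xs "length w"] less.prems show ?thesis by simp
  qed
qed

text \<open>\<open>tri w u v\<close> means that \<open>u \<otimes> v\<close> occurs in the coproduct of the cube \<open>w\<close>.\<close>

inductive tri :: "interval list \<Rightarrow> interval list \<Rightarrow> interval list \<Rightarrow> bool" where
  tri_Nil: "tri [] [] []"
| tri_I0: "tri w u v \<Longrightarrow> tri (I0 # w) (I0 # u) (I0 # v)"
| tri_I1: "tri w u v \<Longrightarrow> tri (I1 # w) (I1 # u) (I1 # v)"
| tri_left: "tri w u v \<Longrightarrow> tri (I01 # w) (I0 # u) (I01 # v)"
| tri_right: "tri w u v \<Longrightarrow> tri (I01 # w) (I01 # u) (I1 # v)"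

lemma tri_length: "tri w u v \<Longrightarrow> length u = length w \<and> length v = length w"
  by (induction rule: tri.induct) auto

lemma cube_coprod_supported:
  "cube_word_coprod (bas (Word w)) \<in> supported {x. tri w (letters (fst x)) (letters (snd x))}"
proof (induction w)
  case Nil
  then show ?case by (simp add: Word_Nil tri_Nil)
next
  case (Cons a w)
  have "lin (\<lambda>x. bas (Word [fst x], Word [snd x])) (interval_coprod a) \<in>
      supported {(Word [b], Word [c]) | b c. \<forall>u v. tri w u v \<longrightarrow> tri (a # w) (b # u) (c # v)}"
    by (cases a) (auto intro!: supported_add supported_bas intro: tri.intros simp del: supported_bas)
  with Cons show ?case
    unfolding Word_Cons[of a w] tens_alg_ext_Cons kmult_alt
    by (intro supported_lin supported_scale supported_bas) (fastforce dest!: supportedD)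
qed

lemma cube_coprod_tri:
  "x \<in> Poly_Mapping.keys (cube_word_coprod (bas (Word w))) \<Longrightarrow> tri w (letters (fst x)) (letters (snd x))"
  using supportedD[OF cube_coprod_supported] by blast

lemma cube_bd_length:
  "v \<in> Poly_Mapping.keys (cube_bd (bas (Word w))) \<Longrightarrow> length (letters v) = length w"
proof -
  have "cube_bd (bas (Word w)) \<in> supported {v. length (letters v) = length w}"
  proof (induction w)
    case Nil
    then show ?case by (simp add: cube_bd_def Word_Nil)
  next
    case (Cons a w)
    show ?case unfolding Word_Cons[of a w] cube_bd_def der_ext_bas_add twist_bas scale_mult_left
      by (intro supported_add supported_scale supported_mult[of _ "{v. length (letters v) = 1}" _ "{v. length (letters v) = length w}"])
        (use Cons in \<open>auto simp: cube_bd_def intro!: supported_diff\<close>)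
  qed
  then show "v \<in> Poly_Mapping.keys (cube_bd (bas (Word w))) \<Longrightarrow> length (letters v) = length w"
    by (auto dest: supportedD)
qed

section \<open>From top cubes to all faces\<close>

definition kpair :: "(nat list \<Rightarrow> ('g word \<Rightarrow>\<^sub>0 'k::comm_ring_1)) \<Rightarrow> nat list \<Rightarrow>
    (interval word \<times> interval word \<Rightarrow>\<^sub>0 'k) \<Rightarrow> ('g word \<times> 'g word \<Rightarrow>\<^sub>0 'k)" where
  "kpair G xs = lin (\<lambda>x. tens (kword G xs (fst x)) (kword G xs (snd x)))"

lemma kword_supported:
  assumes G: "\<And>ys. sorted ys \<and> set ys \<subseteq> A \<Longrightarrow> 2 \<le> length ys \<Longrightarrow>
      G ys \<in> supported {v \<in> words B. wdeg dg v = length ys - 2}"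
    and "length xs = length w + 2" "sorted xs \<and> set xs \<subseteq> A"
  shows "kword G xs (Word w) \<in> supported {v \<in> words B. wdeg dg v = wdeg interval_deg (Word w)}"
  using assms(2,3)
proof (induction xs w rule: kword_induct)
  case (top xs n)
  have "wdeg interval_deg (Word (replicate n I01)) = n"
    by (simp add: wdeg_def interval_deg_def sum_list_replicate)
  then show ?case using G[of xs] top by (simp add: kword_top)
next
  case (drop as x bs u v)
  then show ?case by (simp add: kword_drop wdeg_def interval_deg_def)
next
  case (cut as x bs u v)
  have w: "Word (u @ I1 # v) = Word u + Word [I1] + Word v" by (simp add: plus_word_def)
  show ?case
    unfolding kword_cut[OF cut(1)] by (rule supported_mult[OF cut(4,5)]) (auto simp: w interval_deg_def)
qed

text \<open>\<open>I0\<close> and \<open>I1\<close> are set-like, so in the coproduct of a word they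
  keep their position in both factors. Both factors are therefore dropped or cut at the same vertex,
  and a common cut becomes a product for \<open>kmult\<close>.\<close>

lemma tens_alg_ext_kword:
  assumes G: "\<And>ys. sorted ys \<and> set ys \<subseteq> A \<Longrightarrow> 2 \<le> length ys \<Longrightarrow>
      G ys \<in> supported {v \<in> words B. wdeg dg v = length ys - 2}"
    and GC: "\<And>ys. sorted ys \<and> set ys \<subseteq> A \<Longrightarrow> 2 \<le> length ys \<Longrightarrow>
      tens_alg_ext dg h (G ys) = kpair G ys (cube_word_coprod (bas (Word (replicate (length ys - 2) I01))))"
    and "length xs = length w + 2" "sorted xs \<and> set xs \<subseteq> A"
  shows "tens_alg_ext dg h (kword G xs (Word w)) = kpair G xs (cube_word_coprod (bas (Word w)))"
  using assms(3,4)
proof (induction xs w rule: kword_induct)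
  case (top xs n)
  then show ?case using GC[of xs] by (simp add: kword_top)
next
  case (drop as x bs u v)
  have w: "Word (u @ I0 # v) = Word u + (Word [I0] + Word v)" by (simp add: plus_word_def)
  have uv: "Word (u @ v) = Word u + Word v" by (simp add: plus_word_def)
  have "kpair G (as @ bs) (cube_word_coprod (bas (Word (u @ v)))) =
      kpair G (as @ x # bs) (cube_word_coprod (bas (Word (u @ I0 # v))))"
  proof -
    have "kpair G (as @ bs) (cube_word_coprod (bas (Word (u @ v)))) =
      lin (\<lambda>y. lin (\<lambda>z. scale ((- 1) ^ (wdeg interval_deg (snd y) * wdeg interval_deg (fst z)))
        (tens (kword G (as @ bs) (fst y + fst z)) (kword G (as @ bs) (snd y + snd z))))
        (cube_word_coprod (bas (Word v)))) (cube_word_coprod (bas (Word u)))"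
      by (simp add: kpair_def uv tens_alg_ext_bas_add lin_kmult)
    also have "\<dots> = lin (\<lambda>y. lin (\<lambda>z. scale ((- 1) ^ (wdeg interval_deg (snd y) * wdeg interval_deg (fst z)))
        (tens (kword G (as @ x # bs) (fst y + (Word [I0] + fst z))) (kword G (as @ x # bs) (snd y + (Word [I0] + snd z)))))
        (cube_word_coprod (bas (Word v)))) (cube_word_coprod (bas (Word u)))"
    proof (intro lin_cong refl)
      fix y z assume y: "y \<in> Poly_Mapping.keys (cube_word_coprod (bas (Word u)))"
      have l: "length (letters (fst y)) = length u" "length (letters (snd y)) = length u"
        using tri_length[OF cube_coprod_tri[OF y]] by auto
      show "scale ((- 1) ^ (wdeg interval_deg (snd y) * wdeg interval_deg (fst z)))
        (tens (kword G (as @ bs) (fst y + fst z)) (kword G (as @ bs) (snd y + snd z))) =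
        scale ((- 1) ^ (wdeg interval_deg (snd y) * wdeg interval_deg (fst z)))
        (tens (kword G (as @ x # bs) (fst y + (Word [I0] + fst z))) (kword G (as @ x # bs) (snd y + (Word [I0] + snd z))))"
        using l drop(1) kword_drop[of as "letters (fst y)" G x bs "letters (fst z)"]
          kword_drop[of as "letters (snd y)" G x bs "letters (snd z)"] by (simp add: plus_word_def)
    qed
    also have "\<dots> = kpair G (as @ x # bs) (cube_word_coprod (bas (Word (u @ I0 # v))))"
      by (simp add: kpair_def w tens_alg_ext_bas_add lin_kmult interval_deg_def)
    finally show ?thesis .
  qed
  then show ?case using drop by (simp add: kword_drop)
next
  case (cut as x bs u v)
  have w: "Word (u @ I1 # v) = Word u + (Word [I1] + Word v)" by (simp add: plus_word_def)
  have "kpair G (as @ x # bs) (cube_word_coprod (bas (Word (u @ I1 # v)))) =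
      kmult dg (kpair G (as @ [x]) (cube_word_coprod (bas (Word u)))) (kpair G (x # bs) (cube_word_coprod (bas (Word v))))"
  proof -
    have "kpair G (as @ x # bs) (cube_word_coprod (bas (Word (u @ I1 # v)))) =
      lin (\<lambda>y. lin (\<lambda>z. scale ((- 1) ^ (wdeg interval_deg (snd y) * wdeg interval_deg (fst z)))
        (tens (kword G (as @ x # bs) (fst y + (Word [I1] + fst z))) (kword G (as @ x # bs) (snd y + (Word [I1] + snd z)))))
        (cube_word_coprod (bas (Word v)))) (cube_word_coprod (bas (Word u)))"
      by (simp add: kpair_def w tens_alg_ext_bas_add lin_kmult interval_deg_def)
    also have "\<dots> = lin (\<lambda>y. lin (\<lambda>z. kmult dg
        (tens (kword G (as @ [x]) (fst y)) (kword G (as @ [x]) (snd y)))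
        (tens (kword G (x # bs) (fst z)) (kword G (x # bs) (snd z))))
        (cube_word_coprod (bas (Word v)))) (cube_word_coprod (bas (Word u)))"
    proof (intro lin_cong refl)
      fix y z assume y: "y \<in> Poly_Mapping.keys (cube_word_coprod (bas (Word u)))"
        and z: "z \<in> Poly_Mapping.keys (cube_word_coprod (bas (Word v)))"
      obtain a1 a2 b1 b2 where yz: "y = (Word a1, Word a2)" "z = (Word b1, Word b2)"
        by (cases y; cases z; metis word.exhaust)
      have l: "length a1 = length u" "length a2 = length u" "length b1 = length v"
        using tri_length[OF cube_coprod_tri[OF y]] tri_length[OF cube_coprod_tri[OF z]] by (auto simp: yz)
      with cut(1) have e: "kword G (as @ x # bs) (Word a1 + (Word [I1] + Word b1)) =
          kword G (as @ [x]) (Word a1) * kword G (x # bs) (Word b1)"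
        "kword G (as @ x # bs) (Word a2 + (Word [I1] + Word b2)) =
          kword G (as @ [x]) (Word a2) * kword G (x # bs) (Word b2)"
        using kword_cut[of as a1 G x bs b1] kword_cut[of as a2 G x bs b2] by (auto simp: plus_word_def)
      have k: "kword G (as @ [x]) (Word a2) \<in> supported {v \<in> words B. wdeg dg v = wdeg interval_deg (Word a2)}"
        "kword G (x # bs) (Word b1) \<in> supported {v \<in> words B. wdeg dg v = wdeg interval_deg (Word b1)}"
        by (rule kword_supported[of A, OF G]; use l cut(1-3) in \<open>auto simp: sorted_append\<close>)+
      have "kmult dg (tens (kword G (as @ [x]) (Word a1)) (kword G (as @ [x]) (Word a2)))
          (tens (kword G (x # bs) (Word b1)) (kword G (x # bs) (Word b2))) =
        scale ((- 1) ^ (wdeg interval_deg (Word a2) * wdeg interval_deg (Word b1)))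
          (tens (kword G (as @ [x]) (Word a1) * kword G (x # bs) (Word b1))
            (kword G (as @ [x]) (Word a2) * kword G (x # bs) (Word b2)))"
        by (rule kmult_tens) (use supportedD[OF k(1)] supportedD[OF k(2)] in auto)
      then show "scale ((- 1) ^ (wdeg interval_deg (snd y) * wdeg interval_deg (fst z)))
          (tens (kword G (as @ x # bs) (fst y + (Word [I1] + fst z))) (kword G (as @ x # bs) (snd y + (Word [I1] + snd z)))) =
        kmult dg (tens (kword G (as @ [x]) (fst y)) (kword G (as @ [x]) (snd y)))
          (tens (kword G (x # bs) (fst z)) (kword G (x # bs) (snd z)))"
        by (simp add: yz e)
    qed
    also have "\<dots> = kmult dg (kpair G (as @ [x]) (cube_word_coprod (bas (Word u)))) (kpair G (x # bs) (cube_word_coprod (bas (Word v))))"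
      unfolding kpair_def by (subst kmult_lin_left) (simp only: kmult_lin_right)
    finally show ?thesis .
  qed
  then show ?case using cut by (simp add: kword_cut tens_alg_ext_mult)
qed

text \<open>The boundary of \<open>I0\<close> and \<open>I1\<close> is 0, so these letters stay in
  place in the boundary of a word. A dropped vertex changes nothing, and at a cut the boundary of
  the word becomes the Leibniz rule.\<close>

lemma der_ext_kword:
  assumes G: "\<And>ys. sorted ys \<and> set ys \<subseteq> A \<Longrightarrow> 2 \<le> length ys \<Longrightarrow>
      G ys \<in> supported {v \<in> words B. wdeg dg v = length ys - 2}"
    and GD: "\<And>ys. sorted ys \<and> set ys \<subseteq> A \<Longrightarrow> 2 \<le> length ys \<Longrightarrow>
      der_ext dg \<delta> (G ys) = lin (kword G ys) (cube_bd (bas (Word (replicate (length ys - 2) I01))))"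
    and "length xs = length w + 2" "sorted xs \<and> set xs \<subseteq> A"
  shows "der_ext dg \<delta> (kword G xs (Word w)) = lin (kword G xs) (cube_bd (bas (Word w)))"
  using assms(3,4)
proof (induction xs w rule: kword_induct)
  case (top xs n)
  then show ?case using GD[of xs] by (simp add: kword_top)
next
  case (drop as x bs u v)
  have w: "Word (u @ I0 # v) = Word u + (Word [I0] + Word v)" by (simp add: plus_word_def)
  have uv: "Word (u @ v) = Word u + Word v" by (simp add: plus_word_def)
  have 1: "kword G (as @ x # bs) (a + (Word [I0] + b)) = kword G (as @ bs) (a + b)"
    if "length (letters a) = length u" for a b
    using that kword_drop[of as "letters a" G x bs "letters b"] drop(1) by (simp add: plus_word_def)
  have "lin (kword G (as @ x # bs)) (cube_bd (bas (Word u)) * bas (Word [I0] + Word v)) =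
      lin (kword G (as @ bs)) (cube_bd (bas (Word u)) * bas (Word v))"
    by (auto simp: mult_eq_lin lin_lin 1 cube_bd_length intro!: lin_cong)
  moreover have "lin (kword G (as @ x # bs)) (bas (Word u) * (bas (Word [I0]) * p)) =
      lin (kword G (as @ bs)) (bas (Word u) * p)" for p
    by (auto simp: mult_eq_lin lin_lin 1 intro!: lin_cong)
  ultimately have "lin (kword G (as @ bs)) (cube_bd (bas (Word (u @ v)))) =
      lin (kword G (as @ x # bs)) (cube_bd (bas (Word (u @ I0 # v))))"
    by (simp add: w uv cube_bd_def der_ext_bas_add scale_mult_left interval_deg_def)
  then show ?case using drop by (simp add: kword_drop)
next
  case (cut as x bs u v)
  have w: "Word (u @ I1 # v) = Word u + (Word [I1] + Word v)" by (simp add: plus_word_def)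
  have 1: "kword G (as @ x # bs) (a + (Word [I1] + b)) = kword G (as @ [x]) a * kword G (x # bs) b"
    if "length (letters a) = length u" for a b
    using that kword_cut[of as "letters a" G x bs "letters b"] cut(1) by (simp add: plus_word_def)
  have "lin (kword G (as @ x # bs)) (cube_bd (bas (Word u)) * bas (Word [I1] + Word v)) =
      lin (kword G (as @ [x])) (cube_bd (bas (Word u))) * kword G (x # bs) (Word v)"
    by (auto simp: mult_eq_lin[of "cube_bd _"] lin_lin lin_mult_left 1 cube_bd_length intro!: lin_cong)
  moreover have "lin (kword G (as @ x # bs)) (bas (Word u) * (bas (Word [I1]) * p)) =
      kword G (as @ [x]) (Word u) * lin (kword G (x # bs)) p" for p
    by (auto simp: mult_eq_lin[of "bas _"] lin_lin lin_mult_right 1 intro!: lin_cong)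
  moreover have "twist dg 1 (kword G (as @ [x]) (Word u)) =
      scale ((-1) ^ wdeg interval_deg (Word u)) (kword G (as @ [x]) (Word u))"
  proof -
    have k: "kword G (as @ [x]) (Word u) \<in> supported {v \<in> words B. wdeg dg v = wdeg interval_deg (Word u)}"
      by (rule kword_supported[of A, OF G]; use cut(1-3) in \<open>auto simp: sorted_append\<close>)
    have "twist dg 1 (kword G (as @ [x]) (Word u)) =
        scale ((-1) ^ (1 * wdeg interval_deg (Word u))) (kword G (as @ [x]) (Word u))"
      by (rule twist_homog) (use supportedD[OF k] in auto)
    then show ?thesis by simp
  qed
  ultimately show ?case using cut
    by (simp add: kword_cut der_ext_mult)
      (simp add: w cube_bd_def der_ext_bas_add scale_mult_left interval_deg_def)
qed

lemma scalar_ext_kword: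
  assumes G: "\<And>ys. sorted ys \<and> set ys \<subseteq> A \<Longrightarrow> 2 \<le> length ys \<Longrightarrow>
      scalar_ext e (G ys) = (if length ys = 2 then 1 else 0 :: 'k::comm_ring_1)"
    and "length xs = length w + 2" "sorted xs \<and> set xs \<subseteq> A"
  shows "scalar_ext e (kword G xs (Word w)) = scalar_ext interval_counit (bas (Word w))"
  using assms(2,3)
proof (induction xs w rule: kword_induct)
  case (top xs n)
  then show ?case using G[of xs] by (simp add: kword_top power_0_left)
qed (simp_all add: kword_drop kword_cut scalar_ext_mult)

text \<open>Both copies of z lie in the accumulator, hence in one factor. Since a further vertex
  follows, this factor is not the edge [z, z], the one degenerate face that G need not kill.\<close>

lemma kw_repeated:
  assumes G: "\<And>ps z qs. length (ps @ z # z # qs) \<ge> 3 \<Longrightarrow> G (ps @ z # z # qs) = (0 :: 'a::ring_1)"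
  shows "length acc + length xs + length w \<ge> 3 \<Longrightarrow> acc = ps @ z # z # qs \<Longrightarrow> length xs = Suc (length w) \<Longrightarrow>
    kw G acc xs w = 0"
proof (induction w arbitrary: acc xs qs)
  case Nil
  then show ?case using G[of ps z "qs @ xs"] by (cases xs) auto
next
  case (Cons c w)
  then obtain x xs' where xs: "xs = x # xs'" by (cases xs) auto
  then show ?case using Cons.IH[of acc xs' qs] Cons.IH[of "acc @ [x]" xs' "qs @ [x]"] Cons.prems G[of ps z "qs @ [x]"]
    by (auto split: interval.split)
qed

text \<open>The terms of the coproduct of a cube are pairs of complementary faces, one of which contains both copies
  of a repeated vertex.\<close>

lemma kw_repeated_pair:
  assumes G: "\<And>ps z qs. length (ps @ z # z # qs) \<ge> 3 \<Longrightarrow> G (ps @ z # z # qs) = (0 :: 'a::ring_1)"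
  shows "tri (replicate n I01) u v \<Longrightarrow> a \<noteq> [] \<Longrightarrow> b \<noteq> [] \<Longrightarrow> length (ps @ z # z # qs) = Suc n \<Longrightarrow>
    kw G a (ps @ z # z # qs) u = 0 \<or> kw G b (ps @ z # z # qs) v = 0"
proof (induction ps arbitrary: a b n u v)
  case Nil
  have kr: "kw G (ps @ z # z # qs) xs w = 0" if "length xs = Suc (length w)" for ps qs xs w
    by (rule kw_repeated[of G _ _ _ ps z qs, OF G]) (use that in auto)
  obtain m where m: "n = Suc m" "length qs = m" using Nil by auto
  obtain c d u' v' where uv: "u = c # u'" "v = d # v'" and cd: "c = I0 \<and> d = I01 \<or> c = I01 \<and> d = I1"
    and t: "tri (replicate m I01) u' v'"
    using Nil(1) by (auto simp: m elim: tri.cases)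
  have Gab: "G (a @ z # z # qs) = 0" "G (b @ z # z # qs) = 0" for qs
    using G[of a z qs] G[of b z qs] Nil(2,3) by (cases a; cases b; simp)+
  show ?case
  proof (cases m)
    case 0
    then have "u' = []" "v' = []" "qs = []" using tri_length[OF t] m by auto
    then show ?thesis using cd Gab[of "[]"] by (auto simp: uv)
  next
    case (Suc k)
    obtain c' d' u'' v'' where uv': "u' = c' # u''" "v' = d' # v''" and cd': "c' = I0 \<and> d' = I01 \<or> c' = I01 \<and> d' = I1"
      and t': "tri (replicate k I01) u'' v''"
      using t by (auto simp: Suc elim: tri.cases)
    have l: "length qs = Suc (length u'')" "length qs = Suc (length v'')"
      using tri_length[OF t'] m Suc by auto
    \<comment> \<open>Four combinations of letters at the two copies of z. If the left word has
      \<open>I01\<close> at both, the left factor contains both copies. Otherwise the right one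
      does: it keeps both, or ends a face at the second, or starts a face at the first.\<close>
    show ?thesis
      using cd cd' kr[OF l(1), of a "[]"] kr[OF l(2), of b "[]"] kr[OF l(2), of "[]" "[]"] Gab[of "[]"]
      by (auto simp: uv uv')
  qed
next
  case (Cons p ps)
  obtain m where m: "n = Suc m" using Cons by auto
  obtain c d u' v' where uv: "u = c # u'" "v = d # v'" and cd: "c = I0 \<and> d = I01 \<or> c = I01 \<and> d = I1"
    and t: "tri (replicate m I01) u' v'"
    using Cons(2) by (auto simp: m elim: tri.cases)
  show ?case
    using Cons.IH[OF t, of a "b @ [p]"] Cons.IH[OF t, of "a @ [p]" "[p]"] cd Cons.prems
    by (auto simp: uv m)
qed

text \<open>The first vertex carries no letter, so a repetition at the beginning of the list is
  treated apart: there the letter of the second copy decides which factor contains both.\<close>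

lemma kword_repeated_pair:
  assumes G: "\<And>ps z qs. length (ps @ z # z # qs) \<ge> 3 \<Longrightarrow> G (ps @ z # z # qs) = (0 :: 'a::ring_1)"
    and t: "tri (replicate n I01) u v" and l: "length (ps @ z # z # qs) = n + 2" "n \<ge> 1"
  shows "kword G (ps @ z # z # qs) (Word u) = 0 \<or> kword G (ps @ z # z # qs) (Word v) = 0"
proof (cases ps)
  case Nil
  have kr: "kw G (ps @ z # z # qs) xs w = 0" if "length xs = Suc (length w)" for ps qs xs w
    by (rule kw_repeated[of G _ _ _ ps z qs, OF G]) (use that in auto)
  obtain m where m: "n = Suc m" "length qs = Suc m" using l Nil by (cases n) auto
  obtain c d u' v' where uv: "u = c # u'" "v = d # v'" and cd: "c = I0 \<and> d = I01 \<or> c = I01 \<and> d = I1"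
    and t': "tri (replicate m I01) u' v'"
    using t by (auto simp: m elim: tri.cases)
  have l: "length qs = Suc (length u')" "length qs = Suc (length v')"
    using tri_length[OF t'] m by auto
  show ?thesis using cd kr[OF l(1), of "[]" "[]"] kr[OF l(2), of "[]" "[]"] Nil
    by (auto simp: kword_def uv)
next
  case (Cons p ps')
  then show ?thesis
    using kw_repeated_pair[of G n u v "[p]" "[p]" ps' z qs, OF G t] l by (simp add: kword_def)
qed

section \<open>Faces and degeneracies\<close>

definition is_simplex :: "'x sset \<Rightarrow> 'x simplex \<Rightarrow> bool" where
  "is_simplex X s \<longleftrightarrow> snd s \<in> simplices X (fst s)"

definition vertex_list :: "'x simplex \<Rightarrow> nat list \<Rightarrow> bool" where
  "vertex_list s xs \<longleftrightarrow> sorted xs \<and> set xs \<subseteq> {..fst s}"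

lemma vertex_list_upt: "k \<le> fst s \<Longrightarrow> vertex_list s [j..<Suc k]"
  by (auto simp: vertex_list_def simp del: upt_Suc)

lemma fst_face [simp]: "fst (face X s xs) = length xs - 1"
  by (simp add: face_def)

lemma sorted_repeated:
  "sorted xs \<Longrightarrow> \<not> distinct xs \<Longrightarrow> \<exists>ps (z::nat) qs. xs = ps @ z # z # qs"
proof (induction xs)
  case (Cons x xs)
  show ?case
  proof (cases "distinct xs")
    case True
    then have "x \<in> set xs" using Cons by simp
    then obtain y ys where "xs = y # ys" by (cases xs) auto
    with Cons \<open>x \<in> set xs\<close> have "xs = x # ys" by force
    then show ?thesis by (metis append_Nil)
  next
    case False
    then show ?thesis using Cons by (metis append_Cons sorted_simps(2))
  qed
qed simp

locale reduced_sset =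
  fixes X :: "'x sset"
  assumes reduced: "reduced X"
begin

lemma simplicial: "simplicial_set X"
  using reduced by (simp add: reduced_def)

lemma face_is_simplex:
  assumes "is_simplex X s" "vertex_list s xs" "xs \<noteq> []"
  shows "is_simplex X (face X s xs)"
proof -
  have "xs \<in> mono_lists (length xs - 1) (fst s)"
    using assms by (cases xs) (auto simp: mono_lists_def vertex_list_def)
  then show ?thesis
    using simplicial assms by (simp add: is_simplex_def face_def simplicial_set_def)
qed

lemma face_face:
  assumes "is_simplex X s" "vertex_list s xs" "xs \<noteq> []" "vertex_list (face X s xs) ys" "ys \<noteq> []"
  shows "face X (face X s xs) ys = face X s (map ((!) xs) ys)"
proof -
  have "xs \<in> mono_lists (length xs - 1) (fst s)"
    using assms by (cases xs) (auto simp: mono_lists_def vertex_list_def)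
  moreover have "ys \<in> mono_lists (length ys - 1) (length xs - 1)"
    using assms by (cases ys) (auto simp: mono_lists_def vertex_list_def)
  ultimately show ?thesis
    using simplicial assms by (auto simp: is_simplex_def face_def simplicial_set_def)
qed

lemma face_id:
  assumes "is_simplex X s" "n = Suc (fst s)"
  shows "face X s [0..<n] = s"
  using simplicial assms by (auto simp: is_simplex_def face_def simplicial_set_def prod_eq_iff simp del: upt_Suc)

lemma nondegenerate_iff: "s \<in> nondegenerate X \<longleftrightarrow> is_simplex X s \<and>
    \<not> (\<exists>m<fst s. \<exists>xs\<in>mono_lists (fst s) m. \<exists>\<tau>\<in>simplices X m. snd s = act X m xs \<tau>)"
  by (cases s) (auto simp: nondegenerate_def is_simplex_def)

lemma nondegenerate_is_simplex: "s \<in> nondegenerate X \<Longrightarrow> is_simplex X s"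
  by (simp add: nondegenerate_iff)

text \<open>The vertex list factors through the list with one copy of z removed, so the face is a
  degeneracy of a simplex of smaller dimension.\<close>

lemma face_repeated:
  assumes "is_simplex X t" "vertex_list t (ps @ z # z # qs)"
  shows "face X t (ps @ z # z # qs) \<notin> nondegenerate X"
proof
  assume nd: "face X t (ps @ z # z # qs) \<in> nondegenerate X"
  let ?zs = "ps @ z # qs" and ?p = "length ps" and ?n = "length ps + length qs"
  \<comment> \<open>The values of the degeneracy map that takes the value \<open>?p\<close>
    twice.\<close>
  let ?ds = "[0..<Suc ?p] @ [?p..<Suc ?n]"
  have v: "vertex_list t ?zs" using assms by (auto simp: vertex_list_def sorted_append)
  have ds: "?ds \<in> mono_lists (Suc ?n) ?n" by (auto simp: mono_lists_def sorted_append)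
  have map_id: "map ((!) ?zs) [0..<Suc ?p] = ps @ [z]" "map ((!) ?zs) [?p..<Suc ?n] = z # qs"
    by (auto intro!: nth_equalityI simp: nth_append simp del: upt_Suc)
  have "map ((!) ?zs) ?ds = ps @ z # z # qs"
    unfolding map_append map_id by simp
  moreover have "face X (face X t ?zs) ?ds = face X t (map ((!) ?zs) ?ds)"
    using assms(1) v by (intro face_face) (auto simp: vertex_list_def sorted_append)
  ultimately have "snd (face X t (ps @ z # z # qs)) = act X ?n ?ds (snd (face X t ?zs))"
    by (simp add: face_def)
  moreover have "snd (face X t ?zs) \<in> simplices X ?n"
    using face_is_simplex[OF assms(1) v] by (simp add: is_simplex_def)
  ultimately show False
    using nd ds unfolding nondegenerate_iff by (simp del: upt_Suc) blast
qed

text \<open>By the pigeonhole principle the monotone map of a degenerate simplex takes some value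
  twice, and equal values are adjacent in a sorted list.\<close>

lemma degenerateE:
  assumes "is_simplex X s" "s \<notin> nondegenerate X"
  obtains t ps z qs where "is_simplex X t" "vertex_list t (ps @ z # z # qs)" "s = face X t (ps @ z # z # qs)"
proof -
  obtain m xs \<tau> where m: "m < fst s" and xs: "xs \<in> mono_lists (fst s) m" and \<tau>: "\<tau> \<in> simplices X m"
    and s: "snd s = act X m xs \<tau>"
    using assms by (auto simp: nondegenerate_iff)
  have "\<not> distinct xs"
  proof
    assume "distinct xs"
    then have "length xs = card (set xs)" by (simp add: distinct_card)
    also have "\<dots> \<le> card {..m}" using xs by (intro card_mono) (auto simp: mono_lists_def)
    finally show False using xs m by (simp add: mono_lists_def)
  qed
  moreover have "sorted xs" using xs by (simp add: mono_lists_def)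
  ultimately obtain ps z qs where "xs = ps @ z # z # qs"
    using sorted_repeated by blast
  then show ?thesis
    using that[of "(m, \<tau>)" ps z qs] xs \<tau> s
    by (auto simp: is_simplex_def mono_lists_def vertex_list_def face_def prod_eq_iff)
qed

end

abbreviation I_face :: "'x sset \<Rightarrow> 'x simplex \<Rightarrow> nat list \<Rightarrow> ('x, 'k::comm_ring_1) omega" where
  "I_face X s ys \<equiv> I_simplex X (face X s ys)"

abbreviation simplex_gen :: "'x sset \<Rightarrow> 'x simplex \<Rightarrow> ('x, 'k::comm_ring_1) omega" where
  "simplex_gen X s \<equiv> cobar_gen (chain X s)"

lemma cobar_gen_simps [simp]:
  "cobar_gen 0 = 0" "cobar_gen (p + q) = cobar_gen p + cobar_gen q"
  "cobar_gen (p - q) = cobar_gen p - cobar_gen q" "cobar_gen (- p) = - cobar_gen p"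
  "cobar_gen (scale c p) = scale c (cobar_gen p)"
  "cobar_gen (bas s) = (if fst s = 0 then 0 else bas (Word [s]))"
  by (simp_all add: cobar_gen_def)

lemma klin_cobar_gen: "klin cobar_gen"
  by (simp add: cobar_gen_def)

lemma simplex_gen_eq: "simplex_gen X s = (if s \<in> omega_letters X then bas (Word [s]) else 0)"
  by (auto simp: chain_def omega_letters_def)

text \<open>Both cases of \<open>I_simplex\<close> in one formula. The summand 1 of an edge turns a
  product with the first or last edge into an outer face, which is how the outer faces cancel in
  \<open>omega_diff_I_nondegenerate\<close>.\<close>

lemma simplex_gen_I: "fst s \<ge> 1 \<Longrightarrow> simplex_gen X s =
    (if fst s = 1 then 1 else 0) + scale ((-1) ^ fst s) (I_simplex X s)"
  by (auto simp: I_simplex_def power_add[symmetric] scale_diff mult_2[symmetric])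

lemma simplex_gen_0: "fst s = 0 \<Longrightarrow> simplex_gen X s = 0"
  by (simp add: simplex_gen_eq omega_letters_def)

lemma sorted_list_of_set_snoc:
  fixes i :: nat
  assumes "finite S" "\<And>x. x \<in> S \<Longrightarrow> x < i"
  shows "sorted_list_of_set (insert i S) = sorted_list_of_set S @ [i]"
proof -
  have "sorted_list_of_set (set (sorted_list_of_set S @ [i])) = sorted_list_of_set S @ [i]"
    by (rule sorted_list_of_set.idem_if_sorted_distinct) (use assms in \<open>auto simp: sorted_append less_imp_le\<close>)
  moreover have "set (sorted_list_of_set S @ [i]) = insert i S" using assms by auto
  ultimately show ?thesis by (simp only:)
qed

lemma sorted_list_of_set_cons:
  fixes i :: nat
  assumes "finite S" "\<And>x. x \<in> S \<Longrightarrow> i < x"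
  shows "sorted_list_of_set (insert i S) = i # sorted_list_of_set S"
proof -
  have "sorted_list_of_set (set (i # sorted_list_of_set S)) = i # sorted_list_of_set S"
    by (rule sorted_list_of_set.idem_if_sorted_distinct) (use assms in \<open>auto simp: sorted_append less_imp_le\<close>)
  moreover have "set (i # sorted_list_of_set S) = insert i S" using assms by auto
  ultimately show ?thesis by (simp only:)
qed

text \<open>The definition by sets of vertices is read from left to right. The induction runs over
  the position i together with the last cut a: the accumulator is the part of V in [a, i), and
  \<open>L i\<close> lists the cuts that remain.\<close>

lemma I_word_eq_kword:
  assumes n: "n = fst s" "n \<ge> 1" "length w = n - 1"
  shows "I_word X s w = (kword (I_face X s) [0..<Suc n] (Word w) :: ('x, 'k::comm_ring_1) omega)"
proof -
  let ?G = "I_face X s :: nat list \<Rightarrow> ('x, 'k) omega"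
  define V where "V = {0, n} \<union> {i. 0 < i \<and> i < n \<and> w ! (i - 1) \<noteq> I0}"
  define L where "L i = sorted_list_of_set (insert n {j. i \<le> j \<and> j < n \<and> w ! (j - 1) = I1})" for i
  have fin: "finite {j. i \<le> j \<and> j < n \<and> P j}" for i P by simp
  have *: "kw ?G (sorted_list_of_set (V \<inter> {a..<i})) [i..<Suc n] (drop (i - 1) w) =
      prod_list (map (\<lambda>(a, b). ?G (sorted_list_of_set (V \<inter> {a..b}))) (zip (a # L i) (L i)))"
    if "1 \<le> i" "i \<le> n" "a < i" for i a
    using that
  proof (induction "n - i" arbitrary: i a)
    case 0
    then have i: "i = n" by simp
    have "insert n {j. n \<le> j \<and> j < n \<and> w ! (j - 1) = I1} = {n}" by auto
    then have "L n = [n]" unfolding L_def by (simp only:) simp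
    moreover have "V \<inter> {a..n} = insert n (V \<inter> {a..<n})" using 0 by (auto simp: V_def)
    then have "sorted_list_of_set (V \<inter> {a..n}) = sorted_list_of_set (V \<inter> {a..<n}) @ [n]"
      using sorted_list_of_set_snoc[of "V \<inter> {a..<n}" n] by simp
    ultimately show ?case using n by (simp add: i)
  next
    case (Suc k)
    then have i: "i < n" and k: "k = n - Suc i" by auto
    have d: "drop (i - 1) w = w ! (i - 1) # drop i w"
      using Suc.prems i n Cons_nth_drop_Suc[of "i - 1" w] by simp
    have u: "[i..<Suc n] = i # [Suc i..<Suc n]" using i by (simp add: upt_conv_Cons)
    have e: "{a..<Suc i} = insert i {a..<i}" using Suc.prems by auto
    have IH: "kw ?G (sorted_list_of_set (V \<inter> {b..<Suc i})) [Suc i..<Suc n] (drop i w) =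
        prod_list (map (\<lambda>(a, b). ?G (sorted_list_of_set (V \<inter> {a..b}))) (zip (b # L (Suc i)) (L (Suc i))))"
      if "b < Suc i" for b
      using Suc.hyps(1)[of "Suc i" b] k that i by (simp del: upt_Suc)
    show ?case
    proof (cases "w ! (i - 1) = I0")
      case True
      then have "V \<inter> {a..<Suc i} = V \<inter> {a..<i}" using i Suc.prems by (auto simp: V_def e)
      moreover have "{j. i \<le> j \<and> j < n \<and> w ! (j - 1) = I1} = {j. Suc i \<le> j \<and> j < n \<and> w ! (j - 1) = I1}"
        using True by (auto simp: le_eq_less_or_eq)
      then have "L i = L (Suc i)" by (simp only: L_def)
      ultimately show ?thesis using IH[of a] Suc.prems True unfolding d u by (simp del: upt_Suc)
    next
      case False
      then have "V \<inter> {a..<Suc i} = insert i (V \<inter> {a..<i})" using i Suc.prems by (auto simp: V_def e)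
      then have acc: "sorted_list_of_set (V \<inter> {a..<Suc i}) = sorted_list_of_set (V \<inter> {a..<i}) @ [i]"
        using sorted_list_of_set_snoc[of "V \<inter> {a..<i}" i] by simp
      show ?thesis
      proof (cases "w ! (i - 1) = I01")
        case True
        have "{j. i \<le> j \<and> j < n \<and> w ! (j - 1) = I1} = {j. Suc i \<le> j \<and> j < n \<and> w ! (j - 1) = I1}"
          using True by (auto simp: le_eq_less_or_eq)
        then have "L i = L (Suc i)" by (simp only: L_def)
        then show ?thesis using IH[of a] Suc.prems True acc unfolding d u by (simp del: upt_Suc)
      next
        case False': False
        then have 1: "w ! (i - 1) = I1" using False by (cases "w ! (i - 1)") auto
        have "insert n {j. i \<le> j \<and> j < n \<and> w ! (j - 1) = I1} =
            insert i (insert n {j. Suc i \<le> j \<and> j < n \<and> w ! (j - 1) = I1})"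
          using 1 i by (auto simp: le_eq_less_or_eq)
        then have "L i = i # L (Suc i)"
          unfolding L_def by (simp only:) (rule sorted_list_of_set_cons, use i in auto)
        moreover have "V \<inter> {i..<Suc i} = {i}" using False i Suc.prems by (auto simp: V_def)
        moreover have "V \<inter> {a..i} = V \<inter> {a..<Suc i}" by auto
        ultimately have "kw ?G [i] [Suc i..<Suc n] (drop i w) = prod_list
            (map (\<lambda>(a, b). ?G (sorted_list_of_set (V \<inter> {a..b}))) (zip (i # L (Suc i)) (L (Suc i))))"
          and L: "L i = i # L (Suc i)" and V: "V \<inter> {a..i} = V \<inter> {a..<Suc i}"
          using IH[of i] by (simp_all del: upt_Suc)
        then have "kw ?G (sorted_list_of_set (V \<inter> {a..<i})) (i # [Suc i..<Suc n]) (I1 # drop i w) =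
            ?G (sorted_list_of_set (V \<inter> {a..i})) * prod_list
            (map (\<lambda>(a, b). ?G (sorted_list_of_set (V \<inter> {a..b}))) (zip (i # L (Suc i)) (L (Suc i))))"
          by (simp only: kw.simps interval.case list.sel acc)
        then show ?thesis unfolding d u 1 L by (simp only: zip_Cons_Cons list.map prod_list.Cons prod.case)
      qed
    qed
  qed
  have "{0, n} \<union> {i. 0 < i \<and> i < n \<and> w ! (i - 1) = I1} =
      insert 0 (insert n {j. 1 \<le> j \<and> j < n \<and> w ! (j - 1) = I1})" by auto
  then have "sorted_list_of_set ({0, n} \<union> {i. 0 < i \<and> i < n \<and> w ! (i - 1) = I1}) = 0 # L 1"
    unfolding L_def by (simp only:) (rule sorted_list_of_set_cons, use n in auto)
  then have "I_word X s w = prod_list (map (\<lambda>(a, b). ?G (sorted_list_of_set (V \<inter> {a..b}))) (zip (0 # L 1) (L 1)))"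
    by (simp only: I_word_def Let_def n(1)[symmetric] V_def[symmetric] list.sel)
  also have "\<dots> = kw ?G (sorted_list_of_set (V \<inter> {0..<1})) [1..<Suc n] (drop (1 - 1) w)"
    by (rule *[symmetric]) (use n in auto)
  also have "V \<inter> {0..<1} = {0}" by (auto simp: V_def)
  also have "[1..<Suc n] = tl [0..<Suc n]" by (simp add: upt_conv_Cons del: upt_Suc)
  finally show ?thesis by (simp add: kword_def hd_append upt_conv_Cons[of 0] del: upt_Suc)
qed

context reduced_sset
begin

lemma simplex_gen_supported:
  "fst s \<ge> 1 \<Longrightarrow> simplex_gen X s \<in> supported {v \<in> words (omega_letters X). wdeg omega_deg v = fst s - 1}"
  by (auto simp: simplex_gen_eq omega_deg_def)

lemma I_simplex_supported:
  "fst s \<ge> 1 \<Longrightarrow> I_simplex X s \<in> supported {v \<in> words (omega_letters X). wdeg omega_deg v = fst s - 1}"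
  unfolding I_simplex_def
  using simplex_gen_supported[of s]
  by (auto intro!: supported_diff supported_scale simp del: cobar_gen_simps simp: supported_iff[of 1])

lemma I_face_supported:
  "2 \<le> length ys \<Longrightarrow> I_face X s ys \<in> supported {v \<in> words (omega_letters X). wdeg omega_deg v = length ys - 2}"
proof -
  assume "2 \<le> length ys"
  then have "1 \<le> fst (face X s ys)" "fst (face X s ys) - 1 = length ys - 2" by auto
  then show ?thesis using I_simplex_supported[of "face X s ys"] by simp
qed

lemma I_simplex_degenerate:
  "s \<notin> nondegenerate X \<Longrightarrow> I_simplex X s = (if fst s = 1 then 1 else 0)"
  by (simp add: I_simplex_def chain_def)

text \<open>Used to replace a degenerate simplex by a vertex list with a repetition in the simplex
  from which it comes.\<close>

lemma kword_face:
  assumes "is_simplex X s" "vertex_list s ys" "length ys = length w + 2"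
  shows "kword (I_face X (face X s ys)) [0..<length ys] (Word w) = kword (I_face X s) ys (Word w)"
proof -
  have l: "length ys = Suc (Suc (length w))" using assms by simp
  have hd: "hd ys = ys ! 0" using l by (cases ys) auto
  have upt: "[0..<length ys] = 0 # [1..<length ys]" by (simp add: l upt_conv_Cons del: upt_Suc)
  have "tl ys = map ((!) ys) (tl [0..<length ys])" by (metis map_nth map_tl)
  then have tl: "tl ys = map ((!) ys) [1..<length ys]" by (simp only: upt list.sel)
  have "kword (I_face X s) ys (Word w) = kw (I_face X s) (map ((!) ys) [0]) (map ((!) ys) [1..<length ys]) w"
    by (simp only: kword_def hd tl word.sel list.map)
  also have "\<dots> = kw (\<lambda>zs. I_face X s (map ((!) ys) zs)) [0] [1..<length ys] w"
    by (rule kw_map) (simp add: l del: upt_Suc)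
  also have "\<dots> = kw (I_face X (face X s ys)) [0] [1..<length ys] w"
  proof (rule kw_cong[where A = "{..<length ys}"])
    fix zs assume "2 \<le> length zs" "sorted zs" "set zs \<subseteq> {..<length ys}"
    then have "face X (face X s ys) zs = face X s (map ((!) ys) zs)"
      using assms by (intro face_face) (auto simp: vertex_list_def)
    then show "I_face X s (map ((!) ys) zs) = I_face X (face X s ys) zs" by simp
  qed (auto simp: l simp del: upt_Suc)
  finally show ?thesis unfolding kword_def upt list.sel word.sel by (rule sym)
qed

text \<open>Outside of the vertex lists \<open>I_face X s\<close> has junk values; the proof replaces them by 0.\<close>

lemma kword_face_repeated_pair:
  assumes s: "is_simplex X s" "vertex_list s (ps @ z # z # qs)"
    and t: "tri (replicate n I01) u v" and l: "length (ps @ z # z # qs) = n + 2" "n \<ge> 1"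
  shows "kword (I_face X s) (ps @ z # z # qs) (Word u) = (0 :: ('x, 'k::comm_ring_1) omega) \<or>
    kword (I_face X s) (ps @ z # z # qs) (Word v) = (0 :: ('x, 'k) omega)"
proof -
  define G where "G ys = (if vertex_list s ys then I_face X s ys else 0 :: ('x, 'k) omega)" for ys
  have "G (ps @ z # z # qs) = 0" if "length (ps @ z # z # qs) \<ge> 3" for ps z qs
    using face_repeated[OF s(1), of ps z qs] that by (auto simp: G_def I_simplex_degenerate)
  from kword_repeated_pair[of G, OF this t l]
  have "kword G (ps @ z # z # qs) (Word u) = 0 \<or> kword G (ps @ z # z # qs) (Word v) = 0" by blast
  moreover have "kword G (ps @ z # z # qs) (Word w) = kword (I_face X s) (ps @ z # z # qs) (Word w)"
    if "length w = n" for w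
    unfolding kword_def word.sel
    by (rule kw_cong[where A = "{..fst s}"])
      (use s l that in \<open>cases ps; auto simp: G_def vertex_list_def sorted_append\<close>)+
  ultimately show ?thesis using tri_length[OF t] by simp
qed

lemma tens_1_1: "tens 1 1 = bas (0, 0)"
  by (simp add: tens_def)

text \<open>For nondegenerate s this unfolds the definition. The content is the degenerate case,
  where the left side is the coproduct of 1 for an edge and of 0 in higher dimension. In the latter
  case one of any two complementary faces contains both copies of a repeated vertex and
  vanishes.\<close>

lemma omega_coprod_I_simplex:
  assumes s: "is_simplex X s" "fst s \<ge> 1"
  shows "omega_coprod X (I_simplex X s :: ('x, 'k::comm_ring_1) omega) =
    kpair (I_face X s) [0..<Suc (fst s)] (cube_word_coprod (bas (Word (replicate (fst s - 1) I01))))"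
proof (cases "s \<in> nondegenerate X")
  case True
  then have gen: "simplex_gen X s = bas (Word [s])"
    using s by (simp add: chain_def)
  have "(coprod_I X s :: _ \<Rightarrow>\<^sub>0 'k) = kpair (I_face X s) [0..<Suc (fst s)] (cube_word_coprod (bas (Word (replicate (fst s - 1) I01))))"
    unfolding coprod_I_def cube_coprod_eq lin_lin kpair_def
  proof (rule lin_cong[OF refl])
    fix x :: "interval word \<times> interval word"
    assume "x \<in> Poly_Mapping.keys (cube_word_coprod (bas (Word (replicate (fst s - 1) I01))) :: _ \<Rightarrow>\<^sub>0 'k)"
    from tri_length[OF cube_coprod_tri[OF this]]
    have "I_word X s (letters (fst x)) = (kword (I_face X s) [0..<Suc (fst s)] (fst x) :: _ \<Rightarrow>\<^sub>0 'k)"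
      "I_word X s (letters (snd x)) = (kword (I_face X s) [0..<Suc (fst s)] (snd x) :: _ \<Rightarrow>\<^sub>0 'k)"
      using s(2) by (simp_all add: I_word_eq_kword del: upt_Suc)
    then show "lin (\<lambda>(u, v). tens (I_word X s u) (I_word X s v)) (bas (letters (fst x), letters (snd x))) =
        tens (kword (I_face X s) [0..<Suc (fst s)] (fst x)) (kword (I_face X s) [0..<Suc (fst s)] (snd x) :: _ \<Rightarrow>\<^sub>0 'k)"
      by simp
  qed
  then show ?thesis
    using s(2) by (simp add: omega_coprod_def I_simplex_def[of X s] tens_1_1 gen power_add[symmetric] mult_2[symmetric] del: upt_Suc)
next
  case False
  show ?thesis
  proof (cases "fst s = 1")
    case True
    have "[0..<Suc (Suc 0)] = [0, 1]" by (simp add: upt_conv_Cons)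
    then have "kword (I_face X s) [0..<Suc (fst s)] 0 = (I_simplex X s :: ('x, 'k) omega)"
      using face_id[OF s(1), of 2] by (simp add: kword_def True numeral_2_eq_2 del: upt_Suc)
    then show ?thesis
      using False True by (simp add: I_simplex_degenerate omega_coprod_def kpair_def Word_Nil tens_1_1 del: upt_Suc)
  next
    case False2: False
    obtain t ps z qs where t: "is_simplex X t" "vertex_list t (ps @ z # z # qs)" and st: "s = face X t (ps @ z # z # qs)"
      using degenerateE[OF s(1) False] by metis
    let ?zs = "ps @ z # z # qs"
    have l: "length ?zs = Suc (fst s)" by (simp add: st)
    have n1: "1 \<le> fst s - 1" using s(2) False2 by linarith
    have "kpair (I_face X s) [0..<Suc (fst s)] (cube_word_coprod (bas (Word (replicate (fst s - 1) I01)))) =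
        (lin (\<lambda>x. 0) (cube_word_coprod (bas (Word (replicate (fst s - 1) I01)))) :: _ \<Rightarrow>\<^sub>0 'k)"
      unfolding kpair_def
    proof (rule lin_cong[OF refl])
      fix x :: "interval word \<times> interval word"
      assume "x \<in> Poly_Mapping.keys (cube_word_coprod (bas (Word (replicate (fst s - 1) I01))) :: _ \<Rightarrow>\<^sub>0 'k)"
      then have tri: "tri (replicate (fst s - 1) I01) (letters (fst x)) (letters (snd x))"
        by (rule cube_coprod_tri)
      have "kword (I_face X s) [0..<Suc (fst s)] (Word w) = (kword (I_face X t) ?zs (Word w) :: _ \<Rightarrow>\<^sub>0 'k)"
        if "length w = fst s - 1" for w
        using kword_face[OF t, of w] l s(2) that by (simp add: st[symmetric] del: upt_Suc)
      then have "kword (I_face X s) [0..<Suc (fst s)] (fst x) = (0 :: _ \<Rightarrow>\<^sub>0 'k) \<or>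
          kword (I_face X s) [0..<Suc (fst s)] (snd x) = (0 :: _ \<Rightarrow>\<^sub>0 'k)"
        using kword_face_repeated_pair[OF t tri _ n1] l tri_length[OF tri]
        by (cases x; cases "fst x"; cases "snd x") (auto simp del: upt_Suc)
      then show "tens (kword (I_face X s) [0..<Suc (fst s)] (fst x)) (kword (I_face X s) [0..<Suc (fst s)] (snd x) :: _ \<Rightarrow>\<^sub>0 'k) = 0"
        by (auto simp del: upt_Suc)
    qed
    then show ?thesis
      using False False2 by (simp add: I_simplex_degenerate omega_coprod_def del: upt_Suc)
  qed
qed

end

section \<open>The cobar differential as the boundary of a cube\<close>

lemma cube_bd_top:
  "cube_bd (bas (Word (replicate n I01))) = (\<Sum>i<n. scale ((-1) ^ i)
     (bas (Word (replicate i I01 @ I1 # replicate (n - 1 - i) I01)) -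
      bas (Word (replicate i I01 @ I0 # replicate (n - 1 - i) I01))) :: interval word \<Rightarrow>\<^sub>0 'k::comm_ring_1)"
proof (induction n)
  case 0
  then show ?case by (simp add: cube_bd_def Word_Nil)
next
  case (Suc n)
  have 1: "bas (Word [a]) * bas (Word w) = (bas (Word (a # w)) :: interval word \<Rightarrow>\<^sub>0 'k)" for a w
    by (simp add: bas_mult plus_word_def)
  have "cube_bd (bas (Word (replicate (Suc n) I01))) =
      bas (Word (I1 # replicate n I01)) - bas (Word (I0 # replicate n I01)) -
      bas (Word [I01]) * (cube_bd (bas (Word (replicate n I01))) :: interval word \<Rightarrow>\<^sub>0 'k)"
    by (simp add: Word_Cons[of I01 "replicate n I01"] cube_bd_def der_ext_bas_add scale_mult_left interval_deg_def
        left_diff_distrib 1)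
  also have "\<dots> = bas (Word (I1 # replicate n I01)) - bas (Word (I0 # replicate n I01)) +
     (\<Sum>i<n. scale ((-1) ^ Suc i)
     (bas (Word (replicate (Suc i) I01 @ I1 # replicate (n - 1 - i) I01)) -
      bas (Word (replicate (Suc i) I01 @ I0 # replicate (n - 1 - i) I01))))"
    unfolding Suc sum_distrib_left scale_mult_right right_diff_distrib 1 by (simp add: sum_negf)
  finally show ?case by (simp add: sum.lessThan_Suc_shift del: sum.lessThan_Suc)
qed

text \<open>The letter with index i belongs to the vertex with index i + 1, because the first vertex
  carries no letter; hence the offsets in \<open>take\<close> and \<open>drop\<close>.\<close>

lemma lin_kword_cube_bd_top:
  assumes "length ys = n + 2"
  shows "lin (kword G ys) (cube_bd (bas (Word (replicate n I01)))) = (\<Sum>i<n. scale ((-1) ^ i)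
     (G (take (i + 2) ys) * G (drop (i + 1) ys) - G (take (i + 1) ys @ drop (i + 2) ys)))"
  unfolding cube_bd_top lin_sum lin_simps lin_bas
proof (intro sum.cong refl arg_cong2[where f = scale] arg_cong2[where f = minus])
  fix i assume "i \<in> {..<n}"
  then have i: "i < n" by simp
  have ys: "ys = take (i + 1) ys @ ys ! (i + 1) # drop (i + 2) ys"
    using i assms id_take_nth_drop[of "i + 1" ys] by simp
  have t: "take (i + 2) ys = take (i + 1) ys @ [ys ! (i + 1)]" "drop (i + 1) ys = ys ! (i + 1) # drop (i + 2) ys"
    using i assms take_Suc_conv_app_nth[of "i + 1" ys] Cons_nth_drop_Suc[of "i + 1" ys] by simp_all
  have "kword G ys (Word (replicate i I01 @ I1 # replicate (n - 1 - i) I01)) =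
      kword G (take (i + 1) ys @ [ys ! (i + 1)]) (Word (replicate i I01)) *
      kword G (ys ! (i + 1) # drop (i + 2) ys) (Word (replicate (n - 1 - i) I01))"
    by (subst ys, rule kword_cut) (use i assms in simp)
  also have "\<dots> = G (take (i + 2) ys) * G (drop (i + 1) ys)"
    using i assms by (simp only: t[symmetric]) (intro arg_cong2[where f = "(*)"] kword_top, auto)
  finally show "kword G ys (Word (replicate i I01 @ I1 # replicate (n - 1 - i) I01)) =
    G (take (i + 2) ys) * G (drop (i + 1) ys)" .
  have "kword G ys (Word (replicate i I01 @ I0 # replicate (n - 1 - i) I01)) =
      kword G (take (i + 1) ys @ drop (i + 2) ys) (Word (replicate i I01 @ replicate (n - 1 - i) I01))"
    by (subst ys, rule kword_drop) (use i assms in simp)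
  also have "replicate i I01 @ replicate (n - 1 - i) I01 = replicate (n - 1) I01"
    using i by (simp add: replicate_add[symmetric])
  also have "kword G (take (i + 1) ys @ drop (i + 2) ys) (Word (replicate (n - 1) I01)) =
      G (take (i + 1) ys @ drop (i + 2) ys)"
    by (rule kword_top) (use i assms in auto)
  finally show "kword G ys (Word (replicate i I01 @ I0 # replicate (n - 1 - i) I01)) =
    G (take (i + 1) ys @ drop (i + 2) ys)" .
qed

text \<open>A face that contains both copies of z is 0 unless it is [z, z]. Away from the ends, the
  two faces that omit one of the copies are equal and have opposite signs. At either end, the
  product with G [z, z] = 1 cancels the face that omits a copy.\<close>

lemma repeated_bd_sum:
  assumes G: "\<And>ps z qs. length (ps @ z # z # qs) \<ge> 3 \<Longrightarrow> G (ps @ z # z # qs) = (0 :: 'g word \<Rightarrow>\<^sub>0 'k::comm_ring_1)"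
    and G2: "G [z, z] = 1" and l: "length (ps @ z # z # qs) = n + 2" "n \<ge> 1"
  defines "ys \<equiv> ps @ z # z # qs"
  shows "(\<Sum>i<n. scale ((-1) ^ i)
     (G (take (i + 2) ys) * G (drop (i + 1) ys) - G (take (i + 1) ys @ drop (i + 2) ys))) = 0"
proof -
  let ?p = "length ps"
  let ?t = "\<lambda>i. scale ((-1) ^ i) (G (take (i + 2) ys) * G (drop (i + 1) ys) - G (take (i + 1) ys @ drop (i + 2) ys))"
  have n: "n = length ps + length qs" using l by simp
  have before: "?t i = 0" if "i + 1 < ?p" for i
  proof -
    have "G (drop (i + 1) ys) = 0" "G (take (i + 1) ys @ drop (i + 2) ys) = 0"
      using that G[of "drop (i + 1) ps" z qs] G[of "take (i + 1) ps @ drop (i + 2) ps" z qs] by (auto simp: ys_def)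
    then show ?thesis by simp
  qed
  have after: "?t i = 0" if "i > ?p" "i < n" for i
  proof -
    have "take (i + 2) ys = ps @ z # z # take (i - ?p) qs" "take (i + 1) ys = ps @ z # z # take (i - 1 - ?p) qs"
      using that by (auto simp: ys_def take_Cons' Suc_diff_le)
    then have "G (take (i + 2) ys) = 0" "G (take (i + 1) ys @ drop (i + 2) ys) = 0"
      using that l G[of ps z "take (i - ?p) qs"] G[of ps z "take (i - 1 - ?p) qs @ drop (i + 2) ys"] n
      by (auto simp: ys_def)
    then show ?thesis by simp
  qed
  have at1: "G (take (?p + 1) ys) = G (ps @ [z])" "G (drop ?p ys) = G (z # z # qs)"
    "take ?p ys @ drop (?p + 1) ys = ps @ z # qs" by (auto simp: ys_def)
  have at2: "G (take (?p + 2) ys) = G (ps @ [z, z])" "G (drop (?p + 1) ys) = G (z # qs)"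
    "take (?p + 1) ys @ drop (?p + 2) ys = ps @ z # qs" by (auto simp: ys_def)
  show ?thesis
  proof (cases "ps = []")
    case True
    then have "?p < n" using n l by auto
    have "sum ?t {..<n} = sum ?t {?p}"
      by (rule sum.mono_neutral_right) (use \<open>?p < n\<close> after True in auto)
    also have "\<dots> = 0" using True G2 at2 by simp
    finally show ?thesis .
  next
    case False
    then obtain m where m: "?p = Suc m" by (cases ps) auto
    have z: "G (ps @ [z, z]) = 0" using G[of ps z "[]"] False by (cases ps) auto
    show ?thesis
    proof (cases "qs = []")
      case True
      then have "m < n" "?p = n" using n m by auto
      have "sum ?t {..<n} = sum ?t {m}"
        by (rule sum.mono_neutral_right) (use \<open>m < n\<close> \<open>?p = n\<close> before m in \<open>auto simp: less_Suc_eq\<close>)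
      also have "\<dots> = 0" using True G2 at1 by (simp add: m)
      finally show ?thesis .
    next
      case False
      then have "m < n" "Suc m < n" using n m by (cases qs; auto)+
      have z2: "G (z # z # qs) = 0" using G[of "[]" z qs] False by (cases qs) auto
      have "sum ?t {..<n} = sum ?t {m, Suc m}"
      proof (rule sum.mono_neutral_right)
        show "\<forall>i\<in>{..<n} - {m, Suc m}. ?t i = 0"
        proof
          fix i assume "i \<in> {..<n} - {m, Suc m}"
          then have "i < n" "i + 1 < ?p \<or> ?p < i" using m by auto
          then show "?t i = 0" using before after by blast
        qed
      qed (use \<open>m < n\<close> \<open>Suc m < n\<close> in auto)
      also have "\<dots> = 0" using at1 at2 z z2 by (simp add: m)
      finally show ?thesis .
    qed
  qed
qed

context reduced_sset
begin

lemma omega_diff_letter: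
  "omega_diff X (bas (Word [s]) :: ('x, 'k::comm_ring_1) omega) =
    - cobar_gen (bd X (bas s))
    - lin (\<lambda>x. scale ((-1) ^ fst (fst x)) (cobar_gen (bas (fst x)) * cobar_gen (bas (snd x)))) (aw X (bas s))"
  by (simp add: omega_diff_def split_def)

lemma lin_aw: "lin f (aw X (bas s)) = (\<Sum>i\<le>fst s. lin (\<lambda>a. lin (\<lambda>b. f (a, b)) (chain X (face X s [i..<Suc (fst s)])))
    (chain X (face X s [0..<Suc i])))"
  by (simp add: aw_def lin_sum lin_tens del: upt_Suc)

lemma chain_lin: "lin f (chain X s) = (if s \<in> nondegenerate X then f s else 0)"
  by (simp add: chain_def)

lemma omega_diff_letter_gen:
  "omega_diff X (bas (Word [s]) :: ('x, 'k::comm_ring_1) omega) =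
    - (if fst s = 0 then 0 else \<Sum>i\<le>fst s. scale ((-1) ^ i) (simplex_gen X (face X s (remove1 i [0..<Suc (fst s)]))))
    - (\<Sum>i\<le>fst s. scale ((-1) ^ i) (simplex_gen X (face X s [0..<Suc i]) * simplex_gen X (face X s [i..<Suc (fst s)])))"
proof -
  have "lin (\<lambda>x. scale ((-1) ^ fst (fst x)) (cobar_gen (bas (fst x)) * cobar_gen (bas (snd x)))) (aw X (bas s)) =
     (\<Sum>i\<le>fst s. scale ((-1) ^ i) (simplex_gen X (face X s [0..<Suc i]) * simplex_gen X (face X s [i..<Suc (fst s)])) :: ('x, 'k) omega)"
    unfolding lin_aw by (rule sum.cong) (auto simp: chain_lin chain_def simp del: upt_Suc)
  then show ?thesis
    by (simp add: omega_diff_letter bd_def klin_sum[OF klin_cobar_gen] del: upt_Suc)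
qed

lemma omega_diff_I_nondegenerate:
  assumes s: "s \<in> nondegenerate X" "fst s \<ge> 1"
  shows "omega_diff X (I_simplex X s :: ('x, 'k::comm_ring_1) omega) =
    (\<Sum>i<fst s - 1. scale ((-1) ^ i) (I_face X s [0..<i + 2] * I_face X s [i + 1..<Suc (fst s)]
      - I_face X s ([0..<i + 1] @ [i + 2..<Suc (fst s)])))"
proof (cases "fst s = 1")
  case True
  have "simplex_gen X s = (bas (Word [s]) :: ('x, 'k) omega)" using s by (simp add: chain_def)
  moreover have "omega_diff X (bas (Word [s]) :: ('x, 'k) omega) = 0"
    by (simp add: omega_diff_letter_gen True simplex_gen_0 numeral_2_eq_2 del: cobar_gen_simps)
  ultimately show ?thesis
    using True by (simp add: I_simplex_def[of X s] omega_diff_def)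
next
  case False
  \<comment> \<open>Dimension m + 2 gives faces of dimension m + 1, so the summand 1 of
    \<open>simplex_gen_I\<close> occurs for these faces exactly when m = 0.\<close>
  define m where "m = fst s - 2"
  have m: "fst s = m + 2" using False s(2) by (simp add: m_def)
  let ?G = "I_face X s :: _ \<Rightarrow> ('x, 'k) omega"
  let ?s = "\<lambda>i. scale ((-1) ^ i) :: ('x, 'k) omega \<Rightarrow> _"
  have gen: "simplex_gen X s = (bas (Word [s]) :: ('x, 'k) omega)" using s by (simp add: chain_def)
  define d where "d i = ?G (remove1 i [0..<m + 3])" for i
  define f where "f i = ?G [0..<i + 2]" for i
  define b where "b i = ?G [i + 1..<m + 3]" for i
  have rm: "remove1 (i + 1) [0..<m + 3] = [0..<i + 1] @ [i + 2..<m + 3]" if "i < m + 1" for i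
  proof -
    have "[0..<m + 3] = [0..<i + 1] @ (i + 1) # [i + 2..<m + 3]"
      using that upt_add_eq_append[of 0 "i + 1" "m + 2 - i"] upt_conv_Cons[of "i + 1" "m + 3"]
      by (simp add: eval_nat_numeral del: upt_Suc)
    then show ?thesis by (simp add: remove1_append del: upt_Suc)
  qed
  have rm0: "remove1 0 [0..<m + 3] = [1..<m + 3]" by (simp add: upt_conv_Cons del: upt_Suc)
  have rmm: "remove1 (m + 2) [0..<m + 3] = [0..<m + 2]"
    by (simp add: numeral_3_eq_3 remove1_append)
  have gd: "simplex_gen X (face X s (remove1 i [0..<m + 3])) = (if m = 0 then 1 else 0) + ?s (m + 1) (d i)"
    if "i < m + 3" for i
    using that by (subst simplex_gen_I) (auto simp: d_def length_remove1)
  have gf: "simplex_gen X (face X s [0..<i + 2]) = (if i = 0 then 1 else 0) + ?s (i + 1) (f i)" for i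
    by (subst simplex_gen_I) (auto simp: f_def)
  have gb: "simplex_gen X (face X s [i + 1..<m + 3]) = (if i = m then 1 else 0) + ?s (m + 1 - i) (b i)"
    if "i < m + 1" for i
    using that by (subst simplex_gen_I) (auto simp: b_def)
  \<comment> \<open>The units of the m + 3 faces occur only for m = 0, where 1 - 1 + 1 = 1.\<close>
  have D1: "(\<Sum>i\<le>fst s. ?s i (simplex_gen X (face X s (remove1 i [0..<Suc (fst s)])))) =
     (if m = 0 then 1 else 0) + ?s (m + 1) (d 0) + (\<Sum>i<m + 1. ?s (i + m) (d (i + 1))) - d (m + 2)"
  proof -
    have "(\<Sum>i\<le>fst s. ?s i (simplex_gen X (face X s (remove1 i [0..<Suc (fst s)])))) =
       (\<Sum>i<m + 3. ?s i ((if m = 0 then 1 else 0) + ?s (m + 1) (d i)))"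
      unfolding m by (rule sum.cong) (use gd in \<open>auto simp: lessThan_Suc_atMost eval_nat_numeral simp del: upt_Suc\<close>)
    also have "\<dots> = (\<Sum>i<m + 3. ?s i (if m = 0 then 1 else 0)) + (\<Sum>i<m + 3. ?s i (?s (m + 1) (d i)))"
      by (simp only: scale_add sum.distrib)
    also have "(\<Sum>i<m + 3. ?s i (if m = 0 then 1 else 0)) = (if m = 0 then 1 else 0)"
      by (simp add: eval_nat_numeral)
    also have "(\<Sum>i<m + 3. ?s i (?s (m + 1) (d i))) = ?s (m + 1) (d 0) + (\<Sum>i<m + 1. ?s (i + m) (d (i + 1))) - d (m + 2)"
    proof -
      have "(\<Sum>i<m + 3. ?s i (?s (m + 1) (d i))) =
          ?s 0 (?s (m + 1) (d 0)) + (\<Sum>i<m + 1. ?s (Suc i) (?s (m + 1) (d (Suc i)))) + ?s (m + 2) (?s (m + 1) (d (m + 2)))"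
        using sum.lessThan_Suc_shift[of "\<lambda>i. ?s i (?s (m + 1) (d i))" "m + 2"]
          sum.lessThan_Suc[of "\<lambda>i. ?s (Suc i) (?s (m + 1) (d (Suc i)))" "m + 1"]
        by (simp add: eval_nat_numeral)
      moreover have "(- 1 :: 'k) ^ (m + 2) * (- 1) ^ (m + 1) = - 1"
        by (simp add: power_add[symmetric] mult_2[symmetric])
      ultimately show ?thesis by (simp add: power_add)
    qed
    finally show ?thesis by simp
  qed
  \<comment> \<open>The products with i = 0 or i = m involve an edge, whose summand 1 leaves
    \<open>b 0\<close> or \<open>f m\<close>. For m = 0 both factors are edges, and the product of
    the two units gives -1.\<close>
  have D2: "(\<Sum>i\<le>fst s. ?s i (simplex_gen X (face X s [0..<Suc i]) * simplex_gen X (face X s [i..<Suc (fst s)]))) =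
     (if m = 0 then - 1 else 0) + ?s m (b 0) + f m + (\<Sum>i<m + 1. ?s (i + 1 + m) (f i * b i))"
  proof -
    let ?F = "\<lambda>i. ?s i (simplex_gen X (face X s [0..<Suc i]) * simplex_gen X (face X s [i..<Suc (fst s)]))"
    have "?F 0 = 0" "?F (m + 2) = 0" by (simp_all add: simplex_gen_0 m del: cobar_gen_simps upt_Suc)
    then have "(\<Sum>i\<le>fst s. ?F i) = (\<Sum>i<m + 1. ?F (Suc i))"
      unfolding m using sum.lessThan_Suc_shift[of ?F "m + 2"] sum.lessThan_Suc[of "\<lambda>i. ?F (Suc i)" "m + 1"]
      by (simp add: lessThan_Suc_atMost[symmetric] eval_nat_numeral m del: cobar_gen_simps upt_Suc)
    also have "\<dots> = (\<Sum>i<m + 1. (if i = 0 then (if m = 0 then - 1 else 0) else 0) + (if i = 0 then ?s m (b 0) else 0) +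
        (if i = m then f m else 0) + ?s (i + 1 + m) (f i * b i))"
    proof (rule sum.cong[OF refl])
      fix i assume "i \<in> {..<m + 1}"
      then have i: "i < m + 1" by simp
      have F: "?F (Suc i) = ?s (Suc i) (((if i = 0 then 1 else 0) + ?s (i + 1) (f i)) * ((if i = m then 1 else 0) + ?s (m + 1 - i) (b i)))"
        using gf[of i] gb[OF i] by (simp add: m eval_nat_numeral del: upt_Suc cobar_gen_simps)
      have 1: "(- 1 :: 'k) ^ Suc i * (- 1) ^ Suc i = 1" by (simp add: power_add[symmetric] mult_2[symmetric])
      have 2: "(- 1 :: 'k) ^ (m + 1 - i) = (- 1) ^ (i + 1 + m)" using i by (intro sgn_eqI) auto
      have 3: "scale c ((p + scale c x) * (q + scale e y)) = scale c (p * q) + scale (c * e) (p * y) + x * q + scale e (x * y)"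
        if "c * c = 1" for c e :: 'k and p q x y :: "('x, 'k) omega"
      proof -
        have "c * e * c = e" using that by (metis mult.assoc mult.commute mult_1_right)
        with that show ?thesis
          by (simp add: distrib_left distrib_right scale_mult_left scale_mult_right scale_add mult.assoc[symmetric])
      qed
      show "?F (Suc i) = (if i = 0 then (if m = 0 then - 1 else 0) else 0) + (if i = 0 then ?s m (b 0) else 0) +
        (if i = m then f m else 0) + ?s (i + 1 + m) (f i * b i)"
        using 3[OF 1, of "if i = 0 then 1 else 0" "f i" "if i = m then 1 else 0" "(- 1) ^ (i + 1 + m)" "b i"]
        unfolding F 2 by (auto simp: add_ac)
    qed
    also have "\<dots> = (if m = 0 then - 1 else 0) + ?s m (b 0) + f m + (\<Sum>i<m + 1. ?s (i + 1 + m) (f i * b i))"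
      unfolding sum.distrib by (simp add: sum.delta lessThan_iff del: sum.lessThan_Suc)
    finally show ?thesis .
  qed
  \<comment> \<open>These are the two outer faces; they occur in \<open>D1\<close> and
    \<open>D2\<close> with opposite signs.\<close>
  have b0: "b 0 = d 0" and fm: "f m = d (m + 2)" by (simp_all only: b_def d_def f_def rm0 rmm add_0)
  have "omega_diff X (I_simplex X s) = ?s m (omega_diff X (bas (Word [s])))"
    by (simp add: I_simplex_def[of X s] gen m omega_diff_def)
  also have "\<dots> = - ?s m ((if m = 0 then 1 else 0) + ?s (m + 1) (d 0) + (\<Sum>i<m + 1. ?s (i + m) (d (i + 1))) - d (m + 2)
     + ((if m = 0 then - 1 else 0) + ?s m (b 0) + f m + (\<Sum>i<m + 1. ?s (i + 1 + m) (f i * b i))))"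
    unfolding omega_diff_letter_gen D1 D2 by (simp add: m scale_add scale_diff)
  also have "\<dots> = - ?s m ((\<Sum>i<m + 1. ?s (i + m) (d (i + 1))) + (\<Sum>i<m + 1. ?s (i + 1 + m) (f i * b i)))"
    by (simp add: b0 fm)
  also have "\<dots> = (\<Sum>i<m + 1. ?s i (f i * b i - d (i + 1)))"
  proof -
    have "(- 1 :: 'k) ^ m * (- 1) ^ (i + m) = (- 1) ^ i" "(- 1 :: 'k) ^ m * (- 1) ^ (i + 1 + m) = - ((- 1) ^ i)" for i
      by (simp_all add: power_add mult.left_commute power2_eq_square[symmetric] power_mult[symmetric] mult_2[symmetric]
          flip: power_mult_distrib)
    then show ?thesis
      by (simp add: scale_add scale_sum scale_diff sum_subtractf sum_negf del: sum.lessThan_Suc)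
  qed
  also have "\<dots> = (\<Sum>i<fst s - 1. scale ((-1) ^ i) (I_face X s [0..<i + 2] * I_face X s [i + 1..<Suc (fst s)]
      - I_face X s ([0..<i + 1] @ [i + 2..<Suc (fst s)])))"
    using rm by (intro sum.cong) (auto simp: m f_def b_def d_def eval_nat_numeral simp del: upt_Suc)
  finally show ?thesis .
qed

text \<open>For a degenerate simplex of dimension at least 2 the left side is 0, and the faces on
  the right cancel by \<open>repeated_bd_sum\<close>. This uses that degenerate edges have the value
  1.\<close>

lemma omega_diff_I_simplex:
  assumes s: "is_simplex X s" "fst s \<ge> 1"
  shows "omega_diff X (I_simplex X s :: ('x, 'k::comm_ring_1) omega) =
    lin (kword (I_face X s) [0..<Suc (fst s)]) (cube_bd (bas (Word (replicate (fst s - 1) I01))))"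
proof (cases "s \<in> nondegenerate X")
  case True
  have l: "length [0..<Suc (fst s)] = (fst s - 1) + 2" using s by simp
  show ?thesis
    unfolding omega_diff_I_nondegenerate[OF True s(2)] lin_kword_cube_bd_top[OF l]
    by (intro sum.cong refl) (use s(2) in \<open>auto simp: take_upt drop_upt simp del: upt_Suc\<close>)
next
  case False
  show ?thesis
  proof (cases "fst s = 1")
    case True
    then show ?thesis using False by (simp add: I_simplex_degenerate omega_diff_def cube_bd_def Word_Nil)
  next
    case False2: False
    obtain t ps z qs where t: "is_simplex X t" "vertex_list t (ps @ z # z # qs)" and st: "s = face X t (ps @ z # z # qs)"
      using degenerateE[OF s(1) False] by metis
    let ?zs = "ps @ z # z # qs"
    \<comment> \<open>Outside of the vertex lists of t the values are chosen so that the hypotheses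
      of \<open>repeated_bd_sum\<close> hold for all lists.\<close>
    define G where "G ys = (if vertex_list t ys then I_face X t ys else if ys = [z, z] then 1 else 0 :: ('x, 'k) omega)" for ys
    have l: "length ?zs = (fst s - 1) + 2" and n1: "1 \<le> fst s - 1"
    proof -
      have "fst s = length ps + length qs + 1" by (simp add: st)
      then show "length ?zs = (fst s - 1) + 2" by simp
      show "1 \<le> fst s - 1" using s(2) False2 by simp
    qed
    have "lin (kword (I_face X s) [0..<Suc (fst s)]) (cube_bd (bas (Word (replicate (fst s - 1) I01)))) =
        lin (kword G ?zs) (cube_bd (bas (Word (replicate (fst s - 1) I01))))"
    proof (rule lin_cong[OF refl])
      fix v assume "v \<in> Poly_Mapping.keys (cube_bd (bas (Word (replicate (fst s - 1) I01))) :: _ \<Rightarrow>\<^sub>0 'k)"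
      from cube_bd_length[OF this] have lv: "length ?zs = length (letters v) + 2" using l by simp
      have "kword (I_face X s) [0..<Suc (fst s)] v = kword (I_face X t) ?zs v"
        using kword_face[OF t lv] l s(2) by (simp add: st[symmetric] del: upt_Suc)
      also have "\<dots> = kword G ?zs v"
        unfolding kword_def
        by (rule kw_cong[where A = "{..fst t}"])
          (use t lv in \<open>cases ps; auto simp: G_def vertex_list_def sorted_append\<close>)+
      finally show "kword (I_face X s) [0..<Suc (fst s)] v = kword G ?zs v" .
    qed
    also have "\<dots> = 0"
      unfolding lin_kword_cube_bd_top[OF l]
    proof (rule repeated_bd_sum[OF _ _ l n1])
      show "G (ps' @ y # y # qs') = 0" if "length (ps' @ y # y # qs') \<ge> 3" for ps' y qs'
      proof -
        have "ps' @ y # y # qs' \<noteq> [z, z]" using that by (metis One_nat_def Suc_1 length_Cons list.size(3) not_less_eq_eq numeral_3_eq_3 order_refl)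
        then show ?thesis
          using face_repeated[OF t(1), of ps' y qs'] that by (auto simp: G_def I_simplex_degenerate)
      qed
      show "G [z, z] = 1"
        using face_repeated[OF t(1), of "[]" z "[]"] by (auto simp: G_def I_simplex_degenerate)
    qed
    finally show ?thesis
      using False False2 by (simp add: I_simplex_degenerate omega_diff_def)
  qed
qed

end

section \<open>The dg bialgebra structure of the cobar construction\<close>

lemma tri_degree: "tri w u v \<Longrightarrow>
    wdeg interval_deg (Word u) + wdeg interval_deg (Word v) = wdeg interval_deg (Word w)"
  by (induction rule: tri.induct) (auto simp: interval_deg_def)

lemma wdeg_top [simp]: "wdeg interval_deg (Word (replicate n I01)) = n"
  by (simp add: wdeg_def interval_deg_def sum_list_replicate)

lemma lin_tens_coprod_left:
  assumes "klin \<Delta>"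
  shows "coprod_left \<Delta> (tens P Q) = lin (\<lambda>x. lin (\<lambda>b. bas (fst x, snd x, b)) Q) (\<Delta> P)"
  unfolding coprod_left_def lin_tens
  by (subst klin_eq_lin[OF assms, of P]) (simp add: lin_lin, subst lin_swap, simp)

lemma lin_tens_coprod_right:
  assumes "klin \<Delta>"
  shows "coprod_right \<Delta> (tens P Q) = lin (\<lambda>x. lin (\<lambda>a. bas (a, fst x, snd x)) P) (\<Delta> Q)"
  unfolding coprod_right_def lin_tens
  by (subst klin_eq_lin[OF assms, of Q]) (simp add: lin_lin, subst lin_swap, subst lin_swap[of _ _ Q], simp)

definition tens3 where
  "tens3 P Q R = lin (\<lambda>a. lin (\<lambda>b. lin (\<lambda>c. bas (a, b, c)) R) Q) P"

lemma klin_coprod_left: "klin (coprod_left \<Delta>)"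
  by (auto simp: coprod_left_def[abs_def] intro: klin_lin)

lemma klin_coprod_right: "klin (coprod_right \<Delta>)"
  by (auto simp: coprod_right_def[abs_def] intro: klin_lin)

context reduced_sset
begin

abbreviation \<Omega>words :: "'x simplex word set" where
  "\<Omega>words \<equiv> words (omega_letters X)"

abbreviation omega_pairs :: "nat \<Rightarrow> ('x simplex word \<times> 'x simplex word) set" where
  "omega_pairs \<equiv> word_pairs omega_deg (omega_letters X)"

abbreviation top_cube :: "'x simplex \<Rightarrow> interval word" where
  "top_cube s \<equiv> Word (replicate (fst s - 1) I01)"

abbreviation I_cube :: "'x simplex \<Rightarrow> interval word \<Rightarrow> ('x, 'k::comm_ring_1) omega" where
  "I_cube s \<equiv> kword (I_face X s) [0..<Suc (fst s)]"

lemma klin_omega_coprod: "klin (omega_coprod X)"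
  by (simp add: omega_coprod_def klin_tens_alg_ext)

lemma klin_omega_diff: "klin (omega_diff X)"
  by (simp add: omega_diff_def klin_der_ext)

lemmas omega_coprod_simps [simp] = klin_0[OF klin_omega_coprod] klin_add[OF klin_omega_coprod]
  klin_diff[OF klin_omega_coprod] klin_uminus[OF klin_omega_coprod] klin_scale[OF klin_omega_coprod]

lemmas omega_diff_simps [simp] = klin_0[OF klin_omega_diff] klin_add[OF klin_omega_diff]
  klin_diff[OF klin_omega_diff] klin_uminus[OF klin_omega_diff] klin_scale[OF klin_omega_diff]

lemma omega_coprod_1 [simp]: "omega_coprod X 1 = bas (0, 0)"
  by (simp add: omega_coprod_def)

lemma omega_diff_1 [simp]: "omega_diff X 1 = 0"
  by (simp add: omega_diff_def)

text \<open>These are the hypotheses on G in \<open>kword_supported\<close>,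
  \<open>tens_alg_ext_kword\<close>, \<open>der_ext_kword\<close> and
  \<open>scalar_ext_kword\<close>.\<close>

lemma I_face_vertices:
  fixes s :: "'x simplex"
  assumes "is_simplex X s"
  shows "sorted ys \<and> set ys \<subseteq> {..fst s} \<Longrightarrow> 2 \<le> length ys \<Longrightarrow> (I_face X s ys :: ('x, 'k::comm_ring_1) omega) \<in>
      supported {v \<in> \<Omega>words. wdeg omega_deg v = length ys - 2}"
    and "sorted ys \<and> set ys \<subseteq> {..fst s} \<Longrightarrow> 2 \<le> length ys \<Longrightarrow> omega_coprod X (I_face X s ys :: ('x, 'k) omega) =
      kpair (I_face X s) ys (cube_word_coprod (bas (Word (replicate (length ys - 2) I01))))"
    and "sorted ys \<and> set ys \<subseteq> {..fst s} \<Longrightarrow> 2 \<le> length ys \<Longrightarrow> omega_diff X (I_face X s ys :: ('x, 'k) omega) =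
      lin (kword (I_face X s) ys) (cube_bd (bas (Word (replicate (length ys - 2) I01))))"
    and "2 \<le> length ys \<Longrightarrow> omega_counit (I_face X s ys :: ('x, 'k) omega) = (if length ys = 2 then 1 else 0)"
proof -
  show "2 \<le> length ys \<Longrightarrow> (I_face X s ys :: ('x, 'k) omega) \<in> supported {v \<in> \<Omega>words. wdeg omega_deg v = length ys - 2}"
    by (rule I_face_supported)
  show "2 \<le> length ys \<Longrightarrow> omega_counit (I_face X s ys :: ('x, 'k) omega) = (if length ys = 2 then 1 else 0)"
    by (auto simp: I_simplex_def omega_counit_def simplex_gen_eq scalar_ext_diff scalar_ext_scale)
  assume ys: "sorted ys \<and> set ys \<subseteq> {..fst s}" "2 \<le> length ys"
  then have v: "vertex_list s ys" "ys \<noteq> []" by (auto simp: vertex_list_def)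
  have f: "is_simplex X (face X s ys)" "fst (face X s ys) \<ge> 1"
    using face_is_simplex[OF assms v] ys(2) by auto
  have l: "Suc (length ys - 1) = length ys" "length ys - 1 - 1 = length ys - 2" using ys(2) by auto
  have k: "kword (I_face X (face X s ys)) [0..<length ys] w = (kword (I_face X s) ys w :: ('x, 'k) omega)"
    if "length (letters w) = length ys - 2" for w
  proof -
    have "length ys = length (letters w) + 2" using that ys(2) by linarith
    from kword_face[OF assms v(1) this] show ?thesis by simp
  qed
  show "omega_coprod X (I_face X s ys :: ('x, 'k) omega) =
      kpair (I_face X s) ys (cube_word_coprod (bas (Word (replicate (length ys - 2) I01))))"
    unfolding omega_coprod_I_simplex[OF f] fst_face l kpair_def
    by (rule lin_cong[OF refl]) (auto dest!: cube_coprod_tri tri_length simp: k)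
  show "omega_diff X (I_face X s ys :: ('x, 'k) omega) =
      lin (kword (I_face X s) ys) (cube_bd (bas (Word (replicate (length ys - 2) I01))))"
    unfolding omega_diff_I_simplex[OF f] fst_face l
    by (rule lin_cong[OF refl]) (auto dest!: cube_bd_length simp: k)
qed

text \<open>Reading words along s is thus a map of dg coalgebras with counit from the cube to the
  cobar construction, for degenerate s as well. The bialgebra axioms for letters are transported
  along it.\<close>

lemma I_cube_facts:
  fixes s :: "'x simplex"
  assumes s: "is_simplex X s" "fst s \<ge> 1" and w: "length w = fst s - 1"
  shows I_cube_supported: "(I_cube s (Word w) :: ('x, 'k::comm_ring_1) omega) \<in>
      supported {v \<in> \<Omega>words. wdeg omega_deg v = wdeg interval_deg (Word w)}"
    and omega_coprod_I_cube: "omega_coprod X (I_cube s (Word w) :: ('x, 'k) omega) =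
      kpair (I_face X s) [0..<Suc (fst s)] (cube_word_coprod (bas (Word w)))"
    and omega_diff_I_cube: "omega_diff X (I_cube s (Word w) :: ('x, 'k) omega) =
      lin (I_cube s) (cube_bd (bas (Word w)))"
    and omega_counit_I_cube: "omega_counit (I_cube s (Word w) :: ('x, 'k) omega) =
      scalar_ext interval_counit (bas (Word w))"
proof -
  have l: "length [0..<Suc (fst s)] = length w + 2" "sorted [0..<Suc (fst s)] \<and> set [0..<Suc (fst s)] \<subseteq> {..fst s}"
    using s(2) w by (auto simp del: upt_Suc)
  note f = I_face_vertices[OF s(1), where 'k = 'k]
  show "(I_cube s (Word w) :: ('x, 'k) omega) \<in>
      supported {v \<in> \<Omega>words. wdeg omega_deg v = wdeg interval_deg (Word w)}"
    by (rule kword_supported[OF f(1) l])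
  show "omega_coprod X (I_cube s (Word w) :: ('x, 'k) omega) =
      kpair (I_face X s) [0..<Suc (fst s)] (cube_word_coprod (bas (Word w)))"
    unfolding omega_coprod_def
    by (rule tens_alg_ext_kword[OF f(1) f(2)[unfolded omega_coprod_def] l])
  show "omega_diff X (I_cube s (Word w) :: ('x, 'k) omega) = lin (I_cube s) (cube_bd (bas (Word w)))"
    unfolding omega_diff_def
    by (rule der_ext_kword[OF f(1) f(3)[unfolded omega_diff_def] l])
  show "omega_counit (I_cube s (Word w) :: ('x, 'k) omega) = scalar_ext interval_counit (bas (Word w))"
    unfolding omega_counit_def
    by (rule scalar_ext_kword[OF f(4)[unfolded omega_counit_def] l])
qed

lemma I_cube_top: "is_simplex X s \<Longrightarrow> fst s \<ge> 1 \<Longrightarrow> I_cube s (top_cube s) = I_simplex X s"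
  by (subst kword_top) (auto simp: face_id simp del: upt_Suc)

lemma letter_I:
  assumes "s \<in> omega_letters X"
  shows "bas (Word [s]) = (if fst s = 1 then 1 else 0) + scale ((-1) ^ fst s) (I_simplex X s)"
    and "is_simplex X s" "fst s \<ge> 1"
proof -
  show s: "is_simplex X s" "fst s \<ge> 1" using assms by (auto simp: omega_letters_def nondegenerate_is_simplex)
  show "bas (Word [s]) = (if fst s = 1 then 1 else 0) + scale ((-1) ^ fst s) (I_simplex X s)"
    using simplex_gen_I[OF s(2), of X] assms by (simp add: simplex_gen_eq)
qed

lemma kpair_I_supported:
  fixes s :: "'x simplex"
  assumes s: "is_simplex X s" "fst s \<ge> 1" and w: "length w = fst s - 1"
  shows "(kpair (I_face X s) [0..<Suc (fst s)] (cube_word_coprod (bas (Word w))) :: _ \<Rightarrow>\<^sub>0 'k::comm_ring_1) \<in>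
    supported (omega_pairs (wdeg interval_deg (Word w)))"
  unfolding kpair_def
proof (rule supported_lin)
  fix x assume "x \<in> Poly_Mapping.keys (cube_word_coprod (bas (Word w)) :: _ \<Rightarrow>\<^sub>0 'k)"
  from cube_coprod_tri[OF this] have t: "tri w (letters (fst x)) (letters (snd x))" .
  obtain u v where x: "x = (Word u, Word v)" by (cases x; metis word.exhaust)
  have "(I_cube s (Word u) :: ('x, 'k) omega) \<in> supported {a \<in> \<Omega>words. wdeg omega_deg a = wdeg interval_deg (Word u)}"
    "(I_cube s (Word v) :: ('x, 'k) omega) \<in> supported {a \<in> \<Omega>words. wdeg omega_deg a = wdeg interval_deg (Word v)}"
    using tri_length[OF t] w by (intro I_cube_supported s; simp add: x)+
  then show "tens (I_cube s (fst x)) (I_cube s (snd x) :: ('x, 'k) omega) \<in> supported (omega_pairs (wdeg interval_deg (Word w)))"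
    using tri_degree[OF t] by (auto simp: x word_pairs_def intro: supported_mono[OF supported_tens])
qed

lemma omega_coprod_letter_supported:
  assumes "s \<in> omega_letters X"
  shows "omega_coprod X (bas (Word [s]) :: ('x, 'k::comm_ring_1) omega) \<in> supported (omega_pairs (omega_deg s))"
proof -
  note s = letter_I(2,3)[OF assms]
  have "omega_coprod X (I_simplex X s :: ('x, 'k) omega) \<in> supported (omega_pairs (omega_deg s))"
    using kpair_I_supported[OF s, of "replicate (fst s - 1) I01", where 'k = 'k]
    by (simp add: omega_coprod_I_simplex[OF s] omega_deg_def del: upt_Suc)
  then show ?thesis
    unfolding letter_I(1)[OF assms] by (auto intro!: supported_add supported_diff supported_uminus supported_scale simp: word_pairs_def omega_deg_def)
qed

lemma omega_diff_letter_supported: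
  assumes "s \<in> omega_letters X"
  shows "omega_diff X (bas (Word [s]) :: ('x, 'k::comm_ring_1) omega) \<in> supported {v \<in> \<Omega>words. wdeg omega_deg v + 1 = omega_deg s}"
proof -
  note s = letter_I(2,3)[OF assms]
  have "omega_diff X (I_simplex X s :: ('x, 'k) omega) \<in> supported {v \<in> \<Omega>words. wdeg omega_deg v + 1 = omega_deg s}"
    unfolding omega_diff_I_simplex[OF s]
  proof (rule supported_lin)
    fix a assume a: "a \<in> Poly_Mapping.keys (cube_bd (bas (top_cube s)) :: _ \<Rightarrow>\<^sub>0 'k)"
    then have l: "length (letters a) = fst s - 1" by (auto dest: cube_bd_length)
    have "wdeg interval_deg a + 1 = omega_deg s"
      using supportedD[OF supported_der_ext[of UNIV _ interval_deg "top_cube s", OF interval_bd_supported] a[unfolded cube_bd_def]]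
      by (simp add: omega_deg_def)
    then show "(I_cube s a :: ('x, 'k) omega) \<in> supported {v \<in> \<Omega>words. wdeg omega_deg v + 1 = omega_deg s}"
      using I_cube_supported[OF s l, where 'k = 'k] by (auto elim: supported_mono)
  qed
  then show ?thesis
    unfolding letter_I(1)[OF assms] by (auto intro!: supported_scale supported_uminus)
qed

text \<open>Together with \<open>omega_diff_letter_def\<close> it restates facts about letters for
  the generator functions inside \<open>omega_coprod\<close> and \<open>omega_diff\<close>, the form
  in which the extension lemmas take them.\<close>

lemma omega_coprod_letter: "omega_coprod X (bas (Word [s])) =
    (if fst s = 1 then tens 1 1 - coprod_I X s else scale ((-1) ^ fst s) (coprod_I X s))"
  by (simp add: omega_coprod_def)

lemma omega_diff_letter_def: "omega_diff X (bas (Word [s])) =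
    - cobar_gen (bd X (bas s)) - lin (\<lambda>(a, b). scale ((-1) ^ fst a) (cobar_gen (bas a) * cobar_gen (bas b))) (aw X (bas s))"
  by (simp add: omega_diff_def)

lemmas omega_coprod_letter_supported' = omega_coprod_letter_supported[unfolded omega_coprod_letter]
lemmas omega_diff_letter_supported' = omega_diff_letter_supported[unfolded omega_diff_letter_def]

lemma omega_coprod_bas_add: "omega_coprod X (bas (u + v)) = kmult omega_deg (omega_coprod X (bas u)) (omega_coprod X (bas v))"
  unfolding omega_coprod_def by (rule tens_alg_ext_bas_add)

lemma omega_diff_mult: "omega_diff X (p * q) = omega_diff X p * q + twist omega_deg 1 p * omega_diff X q"
  unfolding omega_diff_def by (rule der_ext_mult)

lemma omega_coprod_supported:
  "w \<in> \<Omega>words \<Longrightarrow> omega_coprod X (bas w) \<in> supported (omega_pairs (wdeg omega_deg w))"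
  unfolding omega_coprod_def by (rule supported_tens_alg_ext[OF omega_coprod_letter_supported'])

lemma omega_diff_supported:
  "w \<in> \<Omega>words \<Longrightarrow> omega_diff X (bas w) \<in> supported {v \<in> \<Omega>words. wdeg omega_deg v + 1 = wdeg omega_deg w}"
  unfolding omega_diff_def by (rule supported_der_ext[OF omega_diff_letter_supported'])

text \<open>\<open>I_cube s\<close> is a coalgebra map, so iterated coproducts of its values are
  images of iterated coproducts of the cube.\<close>

lemma lin_kpair_left:
  assumes s: "is_simplex X s" "fst s \<ge> 1"
  shows "coprod_left (omega_coprod X) (kpair (I_face X s) [0..<Suc (fst s)] (cube_word_coprod (bas (top_cube s)))) =
    lin (\<lambda>(u, v, w). tens3 (I_cube s u) (I_cube s v) (I_cube s w :: ('x, 'k::comm_ring_1) omega))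
      (coprod_left cube_word_coprod (cube_word_coprod (bas (top_cube s))))"
  unfolding kpair_def klin_compose_lin[OF klin_coprod_left] lin_coprod_left
proof (rule lin_cong[OF refl])
  fix x assume "x \<in> Poly_Mapping.keys (cube_word_coprod (bas (top_cube s)) :: _ \<Rightarrow>\<^sub>0 'k)"
  from tri_length[OF cube_coprod_tri[OF this]] have l: "length (letters (fst x)) = fst s - 1" by simp
  have "omega_coprod X (I_cube s (fst x) :: ('x, 'k) omega) = kpair (I_face X s) [0..<Suc (fst s)] (cube_word_coprod (bas (fst x)))"
    using omega_coprod_I_cube[OF s l, where 'k = 'k] by simp
  then show "coprod_left (omega_coprod X) (tens (I_cube s (fst x)) (I_cube s (snd x) :: ('x, 'k) omega)) =
      lin (\<lambda>y. tens3 (I_cube s (fst y)) (I_cube s (snd y)) (I_cube s (snd x))) (cube_word_coprod (bas (fst x)))"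
    by (simp add: lin_tens_coprod_left[OF klin_omega_coprod] kpair_def lin_lin lin_tens tens3_def del: upt_Suc)
qed

lemma lin_kpair_right:
  assumes s: "is_simplex X s" "fst s \<ge> 1"
  shows "coprod_right (omega_coprod X) (kpair (I_face X s) [0..<Suc (fst s)] (cube_word_coprod (bas (top_cube s)))) =
    lin (\<lambda>(u, v, w). tens3 (I_cube s u) (I_cube s v) (I_cube s w :: ('x, 'k::comm_ring_1) omega))
      (coprod_right cube_word_coprod (cube_word_coprod (bas (top_cube s))))"
  unfolding kpair_def klin_compose_lin[OF klin_coprod_right] lin_coprod_right
proof (rule lin_cong[OF refl])
  fix x assume "x \<in> Poly_Mapping.keys (cube_word_coprod (bas (top_cube s)) :: _ \<Rightarrow>\<^sub>0 'k)"
  from tri_length[OF cube_coprod_tri[OF this]] have l: "length (letters (snd x)) = fst s - 1" by simp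
  have "omega_coprod X (I_cube s (snd x) :: ('x, 'k) omega) = kpair (I_face X s) [0..<Suc (fst s)] (cube_word_coprod (bas (snd x)))"
    using omega_coprod_I_cube[OF s l, where 'k = 'k] by simp
  moreover have "lin (\<lambda>a. lin (\<lambda>b. lin (\<lambda>c. bas (c, a, b)) P) R) Q = tens3 P Q R"
    for P Q R :: "('x, 'k) omega"
    unfolding tens3_def by (subst lin_swap[where p = R and q = P], subst lin_swap[where p = Q and q = P], rule refl)
  ultimately show "coprod_right (omega_coprod X) (tens (I_cube s (fst x)) (I_cube s (snd x) :: ('x, 'k) omega)) =
      lin (\<lambda>y. tens3 (I_cube s (fst x)) (I_cube s (fst y)) (I_cube s (snd y))) (cube_word_coprod (bas (snd x)))"
    by (simp add: lin_tens_coprod_right[OF klin_omega_coprod] kpair_def lin_lin lin_tens del: upt_Suc)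
qed

lemma omega_coassoc_letter:
  assumes "s \<in> omega_letters X"
  shows "coprod_left (omega_coprod X) (omega_coprod X (bas (Word [s]) :: ('x, 'k::comm_ring_1) omega)) =
    coprod_right (omega_coprod X) (omega_coprod X (bas (Word [s])))"
proof -
  note s = letter_I(2,3)[OF assms]
  have "coprod_left (omega_coprod X) (omega_coprod X (I_simplex X s :: ('x, 'k) omega)) =
      coprod_right (omega_coprod X) (omega_coprod X (I_simplex X s))"
    unfolding omega_coprod_I_simplex[OF s] lin_kpair_left[OF s] lin_kpair_right[OF s] cube_coassoc ..
  moreover have "coprod_left (omega_coprod X) (bas (0, 0)) = coprod_right (omega_coprod X) (bas (0, 0) :: _ \<Rightarrow>\<^sub>0 'k)"
    by (simp add: coprod_left_def coprod_right_def)
  ultimately show ?thesis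
    unfolding letter_I(1)[OF assms]
    by (auto simp: klin_add[OF klin_coprod_left] klin_add[OF klin_coprod_right] klin_diff[OF klin_coprod_left]
        klin_diff[OF klin_coprod_right] klin_scale[OF klin_coprod_left] klin_scale[OF klin_coprod_right]
        klin_0[OF klin_coprod_left] klin_0[OF klin_coprod_right])
qed

lemma omega_coassoc:
  assumes "w \<in> \<Omega>words"
  shows "coprod_left (omega_coprod X) (omega_coprod X (bas w)) = coprod_right (omega_coprod X) (omega_coprod X (bas w))"
  using omega_coassoc_letter unfolding omega_coprod_letter unfolding omega_coprod_def
  by (intro coassoc_ext[OF omega_coprod_letter_supported' _ assms])

text \<open>The form in which coassociativity is used: T is any function of three words, so no
  linearity has to be shown for it.\<close>

lemma omega_coassoc_lin:
  assumes "w \<in> \<Omega>words"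
  shows "lin (\<lambda>x. lin (\<lambda>y. T (fst y) (snd y) (snd x)) (omega_coprod X (bas (fst x)))) (omega_coprod X (bas w)) =
    lin (\<lambda>x. lin (\<lambda>y. T (fst x) (fst y) (snd y)) (omega_coprod X (bas (snd x)))) (omega_coprod X (bas w))"
  using arg_cong[OF omega_coassoc[OF assms], of "lin (\<lambda>(u, v, w). T u v w)"]
  by (simp only: lin_coprod_left lin_coprod_right)

lemma omega_counit_letter:
  assumes "s \<in> omega_letters X"
  shows "lin (\<lambda>x. scale (omega_counit (bas (fst x))) (bas (snd x))) (omega_coprod X (bas (Word [s]) :: ('x, 'k::comm_ring_1) omega)) = bas (Word [s])"
    and "lin (\<lambda>x. scale (omega_counit (bas (snd x))) (bas (fst x))) (omega_coprod X (bas (Word [s]) :: ('x, 'k) omega)) = bas (Word [s])"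
proof -
  note s = letter_I(2,3)[OF assms]
  have L: "lin (\<lambda>x. scale (omega_counit (bas (fst x))) (bas (snd x))) (tens P Q) = scale (omega_counit P) Q"
    and R: "lin (\<lambda>x. scale (omega_counit (bas (snd x))) (bas (fst x))) (tens Q P) = scale (omega_counit P) Q"
    for P Q :: "('x, 'k) omega"
  proof -
    have *: "lin (\<lambda>a. scale (omega_counit (bas a)) Q) P = scale (omega_counit P) Q"
      unfolding lin_def omega_counit_def by (simp add: scale_sum_left scalar_ext_def)
    show "lin (\<lambda>x. scale (omega_counit (bas (fst x))) (bas (snd x))) (tens P Q) = scale (omega_counit P) Q"
      using * by (simp add: lin_tens lin_scale_fun)
    show "lin (\<lambda>x. scale (omega_counit (bas (snd x))) (bas (fst x))) (tens Q P) = scale (omega_counit P) Q"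
      using * by (simp add: lin_tens) (subst lin_swap, simp add: lin_scale_fun)
  qed
  have c1: "lin (\<lambda>x. scale (omega_counit (I_cube s (fst x) :: ('x, 'k) omega)) (I_cube s (snd x))) (cube_word_coprod (bas (top_cube s))) =
      lin (I_cube s) (lin (\<lambda>x. scale (scalar_ext interval_counit (bas (fst x))) (bas (snd x))) (cube_word_coprod (bas (top_cube s))))"
    and c2: "lin (\<lambda>x. scale (omega_counit (I_cube s (snd x) :: ('x, 'k) omega)) (I_cube s (fst x))) (cube_word_coprod (bas (top_cube s))) =
      lin (I_cube s) (lin (\<lambda>x. scale (scalar_ext interval_counit (bas (snd x))) (bas (fst x))) (cube_word_coprod (bas (top_cube s))))"
    unfolding lin_lin lin_simps lin_bas
    using omega_counit_I_cube[OF s, where 'k = 'k]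
    by (auto intro!: lin_cong dest!: cube_coprod_tri tri_length simp del: upt_Suc scalar_ext_bas) (metis word.collapse)+
  have "lin (\<lambda>x. scale (omega_counit (bas (fst x))) (bas (snd x))) (omega_coprod X (I_simplex X s :: ('x, 'k) omega)) = I_simplex X s"
    "lin (\<lambda>x. scale (omega_counit (bas (snd x))) (bas (fst x))) (omega_coprod X (I_simplex X s :: ('x, 'k) omega)) = I_simplex X s"
    unfolding omega_coprod_I_simplex[OF s] kpair_def lin_lin L R c1 c2 cube_counit lin_bas
    by (rule I_cube_top[OF s])+
  moreover have "omega_counit (bas 0 :: ('x, 'k) omega) = 1" by (simp add: omega_counit_def)
  ultimately show "lin (\<lambda>x. scale (omega_counit (bas (fst x))) (bas (snd x))) (omega_coprod X (bas (Word [s]) :: ('x, 'k) omega)) = bas (Word [s])"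
    "lin (\<lambda>x. scale (omega_counit (bas (snd x))) (bas (fst x))) (omega_coprod X (bas (Word [s]) :: ('x, 'k) omega)) = bas (Word [s])"
    unfolding letter_I(1)[OF assms] by auto
qed

lemma omega_counit:
  assumes w: "w \<in> \<Omega>words"
  shows "lin (\<lambda>x. scale (omega_counit (bas (fst x))) (bas (snd x))) (omega_coprod X (bas w)) = (bas w :: ('x, 'k::comm_ring_1) omega)"
    and "lin (\<lambda>x. scale (omega_counit (bas (snd x))) (bas (fst x))) (omega_coprod X (bas w)) = (bas w :: ('x, 'k) omega)"
proof -
  note l = omega_counit_letter[where 'k = 'k, unfolded omega_coprod_letter omega_counit_def]
  show "lin (\<lambda>x. scale (omega_counit (bas (fst x))) (bas (snd x))) (omega_coprod X (bas w)) = (bas w :: ('x, 'k) omega)"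
    "lin (\<lambda>x. scale (omega_counit (bas (snd x))) (bas (fst x))) (omega_coprod X (bas w)) = (bas w :: ('x, 'k) omega)"
    unfolding omega_coprod_def omega_counit_def
    by (rule counit_ext[OF omega_coprod_letter_supported' _ l w]; simp)+
qed

text \<open>\<open>I_cube s\<close> is a chain map that preserves degrees, so its tensor square
  commutes with the differentials.\<close>

lemma omega_diff_kpair:
  assumes s: "is_simplex X s" "fst s \<ge> 1" and p: "\<And>x. x \<in> Poly_Mapping.keys p \<Longrightarrow>
    length (letters (fst x)) = fst s - 1 \<and> length (letters (snd x)) = fst s - 1"
  shows "tens_der omega_deg (omega_diff X) (kpair (I_face X s) [0..<Suc (fst s)] p) =
    (kpair (I_face X s) [0..<Suc (fst s)] (tens_der interval_deg cube_bd p) :: _ \<Rightarrow>\<^sub>0 'k::comm_ring_1)"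
proof -
  have T: "tens_der omega_deg (omega_diff X) (tens P Q) =
     tens (omega_diff X P) Q + scale ((-1) ^ n) (tens P (omega_diff X Q))"
    if "P \<in> supported {v \<in> \<Omega>words. wdeg omega_deg v = n}" for P Q :: "('x, 'k) omega" and n
  proof -
    have "tens_der omega_deg (omega_diff X) (tens P Q) =
      lin (\<lambda>a. lin (\<lambda>b. tens (omega_diff X (bas a)) (bas b) + scale ((-1) ^ n) (tens (bas a) (omega_diff X (bas b)))) Q) P"
      unfolding tens_der_def lin_tens
      by (intro lin_cong refl) (use that in \<open>auto dest: supportedD\<close>)
    also have "\<dots> = tens (lin (\<lambda>a. omega_diff X (bas a)) P) (lin bas Q) +
       scale ((-1) ^ n) (tens (lin bas P) (lin (\<lambda>b. omega_diff X (bas b)) Q))"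
      by (simp only: tens_lin_lin lin_add_fun lin_scale_fun)
    finally show ?thesis by (simp only: klin_eq_lin[OF klin_omega_diff, symmetric] lin_bas_id)
  qed
  have K: "kpair (I_face X s) [0..<Suc (fst s)] (tens P Q) = tens (lin (I_cube s) P) (lin (I_cube s) Q)" for P Q
    by (simp add: kpair_def lin_tens tens_lin_lin del: upt_Suc)
  have kl: "klin (kpair (I_face X s) [0..<Suc (fst s)] :: _ \<Rightarrow> _ \<Rightarrow>\<^sub>0 'k)" by (simp add: kpair_def[abs_def] del: upt_Suc)
  have e: "kpair (I_face X s) [0..<Suc (fst s)] p = lin (\<lambda>x. tens (I_cube s (fst x)) (I_cube s (snd x))) p"
    by (simp only: kpair_def)
  show ?thesis
    unfolding e klin_compose_lin[OF klin_tens_der] tens_der_def[of interval_deg] klin_compose_lin[OF kl]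
  proof (rule lin_cong[OF refl])
    fix x assume "x \<in> Poly_Mapping.keys p"
    from p[OF this] have l: "length (letters (fst x)) = fst s - 1" "length (letters (snd x)) = fst s - 1" by auto
    show "tens_der omega_deg (omega_diff X) (tens (I_cube s (fst x)) (I_cube s (snd x) :: ('x, 'k) omega)) =
       kpair (I_face X s) [0..<Suc (fst s)] (tens (cube_bd (bas (fst x))) (bas (snd x)) +
         scale ((- 1) ^ wdeg interval_deg (fst x)) (tens (bas (fst x)) (cube_bd (bas (snd x)))))"
    proof -
      have "(I_cube s (fst x) :: ('x, 'k) omega) \<in> supported {v \<in> \<Omega>words. wdeg omega_deg v = wdeg interval_deg (fst x)}"
        using I_cube_supported[OF s l(1), where 'k = 'k] by simp
      from T[OF this, of "I_cube s (snd x)"]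
      have "tens_der omega_deg (omega_diff X) (tens (I_cube s (fst x)) (I_cube s (snd x) :: ('x, 'k) omega)) =
        tens (lin (I_cube s) (cube_bd (bas (fst x)))) (I_cube s (snd x)) +
        scale ((- 1) ^ wdeg interval_deg (fst x)) (tens (I_cube s (fst x)) (lin (I_cube s) (cube_bd (bas (snd x)))))"
        using omega_diff_I_cube[OF s l(1), where 'k = 'k] omega_diff_I_cube[OF s l(2), where 'k = 'k]
        by (simp only: word.collapse)
      also have "\<dots> = kpair (I_face X s) [0..<Suc (fst s)] (tens (cube_bd (bas (fst x))) (bas (snd x)) +
         scale ((- 1) ^ wdeg interval_deg (fst x)) (tens (bas (fst x)) (cube_bd (bas (snd x)))))"
        by (simp only: klin_add[OF kl] klin_scale[OF kl] K lin_bas)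
      finally show ?thesis .
    qed
  qed
qed

lemma omega_coder_letter:
  assumes "s \<in> omega_letters X"
  shows "omega_coprod X (omega_diff X (bas (Word [s]) :: ('x, 'k::comm_ring_1) omega)) =
    tens_der omega_deg (omega_diff X) (omega_coprod X (bas (Word [s])))"
proof -
  note s = letter_I(2,3)[OF assms]
  have "omega_coprod X (omega_diff X (I_simplex X s :: ('x, 'k) omega)) =
      lin (\<lambda>a. omega_coprod X (I_cube s a)) (cube_bd (bas (top_cube s)))"
    unfolding omega_diff_I_simplex[OF s] klin_compose_lin[OF klin_omega_coprod] ..
  also have "\<dots> = lin (\<lambda>a. kpair (I_face X s) [0..<Suc (fst s)] (cube_word_coprod (bas a))) (cube_bd (bas (top_cube s)))"
  proof (rule lin_cong[OF refl])
    fix a assume "a \<in> Poly_Mapping.keys (cube_bd (bas (top_cube s)) :: _ \<Rightarrow>\<^sub>0 'k)"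
    then have "length (letters a) = fst s - 1" by (auto dest: cube_bd_length)
    from omega_coprod_I_cube[OF s this, where 'k = 'k]
    show "omega_coprod X (I_cube s a :: ('x, 'k) omega) = kpair (I_face X s) [0..<Suc (fst s)] (cube_word_coprod (bas a))"
      by simp
  qed
  also have "\<dots> = kpair (I_face X s) [0..<Suc (fst s)] (cube_word_coprod (cube_bd (bas (top_cube s))))"
    by (subst klin_eq_lin[OF klin_tens_alg_ext, of _ _ "cube_bd _"]) (simp add: kpair_def lin_lin del: upt_Suc)
  also have "\<dots> = tens_der omega_deg (omega_diff X) (kpair (I_face X s) [0..<Suc (fst s)] (cube_word_coprod (bas (top_cube s))))"
    unfolding cube_coder by (rule omega_diff_kpair[OF s, symmetric]) (auto dest!: cube_coprod_tri tri_length)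
  finally have "omega_coprod X (omega_diff X (I_simplex X s :: ('x, 'k) omega)) =
      tens_der omega_deg (omega_diff X) (omega_coprod X (I_simplex X s))"
    unfolding omega_coprod_I_simplex[OF s] .
  moreover have "tens_der omega_deg (omega_diff X) (bas (0, 0) :: _ \<Rightarrow>\<^sub>0 'k) = 0"
    by (simp add: tens_der_def)
  ultimately show ?thesis unfolding letter_I(1)[OF assms] by auto
qed

lemma omega_coder:
  assumes "w \<in> \<Omega>words"
  shows "omega_coprod X (omega_diff X (bas w)) = tens_der omega_deg (omega_diff X) (omega_coprod X (bas w))"
  using omega_coder_letter unfolding omega_coprod_letter omega_diff_letter_def unfolding omega_coprod_def omega_diff_def
  by (intro coder_ext[OF omega_coprod_letter_supported' omega_diff_letter_supported' _ assms])

text \<open>Inherited from the boundary of the cube, with no computation with the chain boundary and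
  the Alexander-Whitney coproduct.\<close>

lemma omega_diff_diff_letter:
  assumes "s \<in> omega_letters X"
  shows "omega_diff X (omega_diff X (bas (Word [s]) :: ('x, 'k::comm_ring_1) omega)) = 0"
proof -
  note s = letter_I(2,3)[OF assms]
  have "omega_diff X (omega_diff X (I_simplex X s :: ('x, 'k) omega)) =
      lin (\<lambda>a. omega_diff X (I_cube s a)) (cube_bd (bas (top_cube s)))"
    unfolding omega_diff_I_simplex[OF s] klin_compose_lin[OF klin_omega_diff] ..
  also have "\<dots> = lin (\<lambda>a. lin (I_cube s) (cube_bd (bas a))) (cube_bd (bas (top_cube s)))"
  proof (rule lin_cong[OF refl])
    fix a assume "a \<in> Poly_Mapping.keys (cube_bd (bas (top_cube s)) :: _ \<Rightarrow>\<^sub>0 'k)"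
    then have "length (letters a) = fst s - 1" by (auto dest: cube_bd_length)
    from omega_diff_I_cube[OF s this, where 'k = 'k]
    show "omega_diff X (I_cube s a :: ('x, 'k) omega) = lin (I_cube s) (cube_bd (bas a))" by simp
  qed
  also have "\<dots> = lin (I_cube s) (cube_bd (cube_bd (bas (top_cube s))))"
    unfolding lin_lin[symmetric] cube_bd_def by (simp only: klin_eq_lin[OF klin_der_ext, symmetric])
  finally show ?thesis unfolding letter_I(1)[OF assms] by (auto simp: cube_bd_bd)
qed

text \<open>The cube of an edge has dimension 0 and a single, set-like basis element. Degenerate
  edges are included; for them the element is 1.\<close>

lemma set_like_I_simplex:
  assumes "is_simplex X s" "fst s = 1"
  shows "set_like X (I_simplex X s :: ('x, 'k::comm_ring_1) omega)"
proof -
  have s: "fst s \<ge> 1" using assms by simp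
  have "omega_coprod X (I_simplex X s :: ('x, 'k) omega) = tens (I_cube s 0) (I_cube s 0)"
    unfolding omega_coprod_I_simplex[OF assms(1) s] by (simp add: assms(2) kpair_def Word_Nil del: upt_Suc)
  moreover have "I_cube s 0 = (I_simplex X s :: ('x, 'k) omega)"
    using I_cube_top[OF assms(1) s] by (simp add: assms(2) Word_Nil del: upt_Suc)
  moreover have "omega_counit (I_simplex X s :: ('x, 'k) omega) = 1"
    by (simp add: I_simplex_def assms omega_counit_def simplex_gen_eq scalar_ext_diff)
  ultimately show ?thesis
    using I_simplex_supported[OF s] by (simp add: set_like_def assms(2))
qed

end

section \<open>Two-sided ideals and anti-homomorphisms\<close>

definition ideal_gens :: "('g word \<Rightarrow>\<^sub>0 'k::comm_ring_1) set \<Rightarrow> bool" where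
  "ideal_gens R \<longleftrightarrow> (\<forall>x\<in>R. \<forall>u v. bas u * x * bas v \<in> free_module.span R)"

lemma span_lin: "(\<And>a. a \<in> Poly_Mapping.keys p \<Longrightarrow> f a \<in> free_module.span R) \<Longrightarrow> lin f p \<in> free_module.span R"
  unfolding lin_def by (intro free_module.span_sum free_module.span_scale)

lemma ideal_gens_mult:
  assumes "ideal_gens R" "x \<in> free_module.span R"
  shows "a * x * b \<in> free_module.span R"
proof (rule klin_span[where f = "\<lambda>x. a * x * b" and R = R])
  show "klin (\<lambda>x. a * x * b)" by (intro klins)
  fix x assume x: "x \<in> R"
  have "a * x * b = lin (\<lambda>u. bas u * x * b) a"
    by (simp add: lin_mult_left[symmetric])
  also have "\<dots> = lin (\<lambda>u. lin (\<lambda>v. bas u * x * bas v) b) a"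
    by (simp add: lin_mult_right[symmetric])
  finally show "a * x * b \<in> free_module.span R"
    using assms(1) x by (auto simp: ideal_gens_def intro!: span_lin)
qed (rule assms)

lemma eqv_mult:
  assumes "ideal_gens R" "eqv R x x'" "eqv R y y'"
  shows "eqv R (x * y) (x' * y')"
proof -
  have "1 * (x - x') * y + x' * (y - y') * 1 \<in> free_module.span R"
    using assms by (intro free_module.span_add ideal_gens_mult) (auto simp: eqv_def)
  then show ?thesis by (simp add: eqv_def algebra_simps)
qed

lemma eqv_mult3:
  assumes "ideal_gens R" "eqv R y y'"
  shows "eqv R (x * y * z) (x * y' * z)"
  by (intro eqv_mult assms eqv_refl)

text \<open>An antipode reverses products up to the Koszul sign, so it is determined by its values
  on letters.\<close>

primrec anti_list :: "('g \<Rightarrow> nat) \<Rightarrow> ('g \<Rightarrow> ('h word \<Rightarrow>\<^sub>0 'k::comm_ring_1)) \<Rightarrow> 'g list \<Rightarrow> ('h word \<Rightarrow>\<^sub>0 'k)" where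
  "anti_list dg f [] = 1"
| "anti_list dg f (g # gs) = scale ((-1) ^ (dg g * wdeg dg (Word gs))) (anti_list dg f gs * f g)"

definition anti_ext :: "('g \<Rightarrow> nat) \<Rightarrow> ('g \<Rightarrow> ('h word \<Rightarrow>\<^sub>0 'k::comm_ring_1)) \<Rightarrow> ('g word \<Rightarrow>\<^sub>0 'k) \<Rightarrow> ('h word \<Rightarrow>\<^sub>0 'k)" where
  "anti_ext dg f = lin (\<lambda>w. anti_list dg f (letters w))"

lemma klin_anti_ext: "klin (anti_ext dg f)"
  by (simp add: anti_ext_def)

lemmas anti_ext_simps [simp] = klin_0[OF klin_anti_ext] klin_add[OF klin_anti_ext] klin_diff[OF klin_anti_ext]
  klin_uminus[OF klin_anti_ext] klin_scale[OF klin_anti_ext]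

lemma anti_ext_1 [simp]: "anti_ext dg f 1 = 1"
  by (simp add: anti_ext_def)

lemma anti_ext_letter [simp]: "anti_ext dg f (bas (Word [g])) = f g"
  by (simp add: anti_ext_def)

lemma anti_ext_bas_add: "anti_ext dg f (bas (u + v)) =
    scale ((-1) ^ (wdeg dg u * wdeg dg v)) (anti_ext dg f (bas v) * anti_ext dg f (bas u))"
proof -
  have "anti_list dg f (xs @ ys) = scale ((-1) ^ (wdeg dg (Word xs) * wdeg dg (Word ys)))
      (anti_list dg f ys * anti_list dg f xs)" for xs ys
  proof (induction xs)
    case (Cons x xs)
    have "wdeg dg (Word (xs @ ys)) = wdeg dg (Word xs) + wdeg dg (Word ys)" by (simp add: wdeg_def)
    with Cons show ?case
      by (simp add: scale_mult_left scale_mult_right mult.assoc power_add[symmetric] algebra_simps)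
  qed simp
  then show ?thesis
    by (cases u; cases v) (simp add: anti_ext_def plus_word_def)
qed

lemma supported_anti_ext:
  assumes "\<And>g. g \<in> B \<Longrightarrow> f g \<in> supported {v \<in> words B'. wdeg dg' v = dg g}" "w \<in> words B"
  shows "anti_ext dg f (bas w) \<in> supported {v \<in> words B'. wdeg dg' v = wdeg dg w}"
  using assms(2)
proof (induction rule: word_induct)
  case zero
  then show ?case by (simp add: supported_iff)
next
  case (Cons g w)
  show ?case unfolding anti_ext_bas_add anti_ext_letter
    by (intro supported_scale supported_mult[OF Cons(3) assms(1)[OF Cons(1)]]) auto
qed

lemma anti_ext_cong:
  assumes "\<And>g. g \<in> B \<Longrightarrow> f g = f' g" "p \<in> supported (words B)"
  shows "anti_ext dg f p = anti_ext dg f' p"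
proof (rule klin_eqI[OF klin_anti_ext klin_anti_ext])
  fix w assume "w \<in> Poly_Mapping.keys p"
  then have "w \<in> words B" using assms(2) by (rule supportedD[rotated])
  then show "anti_ext dg f (bas w) = anti_ext dg f' (bas w)"
    by (induction rule: word_induct) (simp_all add: anti_ext_bas_add assms(1))
qed

text \<open>In (ab)' S((ab)'') = a' (b' S(b'')) S(a'') the inner bracket is a scalar by induction,
  and what remains is the hypothesis on the letter a.\<close>

lemma antipode_right_ext:
  fixes e :: "'g \<Rightarrow> 'k::comm_ring_1"
  assumes R: "ideal_gens R"
    and h: "\<And>g. g \<in> B \<Longrightarrow> h g \<in> supported (word_pairs dg B (dg g))"
    and e: "\<And>g. g \<in> B \<Longrightarrow> e g \<noteq> 0 \<Longrightarrow> dg g = 0"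
    and l: "\<And>g. g \<in> B \<Longrightarrow> eqv R (lin (\<lambda>x. alg_ext F (bas (fst x)) * anti_ext dg f (bas (snd x))) (h g)) (scale (e g) 1)"
    and w: "w \<in> words B"
  shows "eqv R (lin (\<lambda>x. alg_ext F (bas (fst x)) * anti_ext dg f (bas (snd x))) (tens_alg_ext dg h (bas w)))
    (scale (scalar_ext e (bas w)) 1)"
  using w
proof (induction rule: word_induct)
  case zero
  then show ?case by (simp add: alg_ext_def anti_ext_def)
next
  case (Cons g w)
  let ?i = "\<lambda>u. alg_ext F (bas u)" and ?S = "\<lambda>u. anti_ext dg f (bas u)"
  have "lin (\<lambda>x. ?i (fst x) * ?S (snd x)) (tens_alg_ext dg h (bas (Word [g] + w))) =
     lin (\<lambda>x. lin (\<lambda>y. scale ((-1) ^ (wdeg dg (snd x) * wdeg dg w)) (?i (fst x) * (?i (fst y) * ?S (snd y)) * ?S (snd x)))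
       (tens_alg_ext dg h (bas w))) (h g)"
    unfolding tens_alg_ext_Cons lin_kmult
  proof (intro lin_cong refl)
    fix x y assume "y \<in> Poly_Mapping.keys (tens_alg_ext dg h (bas w))"
    from supportedD[OF supported_tens_alg_ext[of B h dg, OF h Cons(2)] this]
    have d: "wdeg dg w = wdeg dg (fst y) + wdeg dg (snd y)" by (auto simp: word_pairs_def)
    show "scale ((-1) ^ (wdeg dg (snd x) * wdeg dg (fst y))) (?i (fst (fst x + fst y, snd x + snd y)) * ?S (snd (fst x + fst y, snd x + snd y))) =
       scale ((-1) ^ (wdeg dg (snd x) * wdeg dg w)) (?i (fst x) * (?i (fst y) * ?S (snd y)) * ?S (snd x))"
      by (simp add: d alg_ext_bas_add anti_ext_bas_add scale_mult_right mult.assoc power_add[symmetric] distrib_left)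
  qed
  also have "\<dots> = lin (\<lambda>x. scale ((-1) ^ (wdeg dg (snd x) * wdeg dg w))
       (?i (fst x) * lin (\<lambda>y. ?i (fst y) * ?S (snd y)) (tens_alg_ext dg h (bas w)) * ?S (snd x))) (h g)"
    by (simp add: lin_mult_right lin_mult_left scale_lin)
  also have "eqv R \<dots> (lin (\<lambda>x. scale ((-1) ^ (wdeg dg (snd x) * wdeg dg w))
       (?i (fst x) * scale (scalar_ext e (bas w)) 1 * ?S (snd x))) (h g))"
    by (intro eqv_lin eqv_scale eqv_mult3 R Cons(3))
  \<comment> \<open>The counit of w is 0 unless w has degree 0, so the remaining sign is trivial
    whenever it matters.\<close>
  also have "\<dots> = scale (scalar_ext e (bas w)) (lin (\<lambda>x. ?i (fst x) * ?S (snd x)) (h g))"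
    using counit_degree[of B e dg w, OF e Cons(2)]
    by (cases "scalar_ext e (bas w) = 0") (simp_all add: scale_mult_left scale_mult_right scale_lin del: scalar_ext_bas)
  also have "eqv R \<dots> (scale (scalar_ext e (bas w)) (scale (e g) 1))"
    by (intro eqv_scale l Cons)
  also have "\<dots> = scale (scalar_ext e (bas (Word [g] + w))) 1" by (simp add: mult.commute)
  finally show ?case .
qed

text \<open>The mirror image of \<open>antipode_right_ext\<close>: in S(b') (S(a') a'') b'' the
  hypothesis on the letter a is used first and the induction hypothesis on b last.\<close>

lemma antipode_left_ext:
  fixes e :: "'g \<Rightarrow> 'k::comm_ring_1"
  assumes R: "ideal_gens R"
    and h: "\<And>g. g \<in> B \<Longrightarrow> h g \<in> supported (word_pairs dg B (dg g))"
    and e: "\<And>g. g \<in> B \<Longrightarrow> e g \<noteq> 0 \<Longrightarrow> dg g = 0"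
    and l: "\<And>g. g \<in> B \<Longrightarrow> eqv R (lin (\<lambda>x. anti_ext dg f (bas (fst x)) * alg_ext F (bas (snd x))) (h g)) (scale (e g) 1)"
    and w: "w \<in> words B"
  shows "eqv R (lin (\<lambda>x. anti_ext dg f (bas (fst x)) * alg_ext F (bas (snd x))) (tens_alg_ext dg h (bas w)))
    (scale (scalar_ext e (bas w)) 1)"
  using w
proof (induction rule: word_induct)
  case zero
  then show ?case by (simp add: alg_ext_def anti_ext_def)
next
  case (Cons g w)
  let ?i = "\<lambda>u. alg_ext F (bas u)" and ?S = "\<lambda>u. anti_ext dg f (bas u)"
  have "lin (\<lambda>x. ?S (fst x) * ?i (snd x)) (tens_alg_ext dg h (bas (Word [g] + w))) =
     lin (\<lambda>x. lin (\<lambda>y. scale ((-1) ^ (dg g * wdeg dg (fst y))) (?S (fst y) * (?S (fst x) * ?i (snd x)) * ?i (snd y)))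
       (tens_alg_ext dg h (bas w))) (h g)"
    unfolding tens_alg_ext_Cons lin_kmult
  proof (intro lin_cong refl)
    fix x y assume "x \<in> Poly_Mapping.keys (h g)"
    from supportedD[OF h[OF Cons(1)] this]
    have d: "dg g = wdeg dg (fst x) + wdeg dg (snd x)" by (auto simp: word_pairs_def)
    show "scale ((-1) ^ (wdeg dg (snd x) * wdeg dg (fst y))) (?S (fst (fst x + fst y, snd x + snd y)) * ?i (snd (fst x + fst y, snd x + snd y))) =
       scale ((-1) ^ (dg g * wdeg dg (fst y))) (?S (fst y) * (?S (fst x) * ?i (snd x)) * ?i (snd y))"
      by (simp add: d alg_ext_bas_add anti_ext_bas_add scale_mult_left mult.assoc power_add[symmetric] distrib_right add.commute)
  qed
  also have "\<dots> = lin (\<lambda>y. scale ((-1) ^ (dg g * wdeg dg (fst y)))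
       (?S (fst y) * lin (\<lambda>x. ?S (fst x) * ?i (snd x)) (h g) * ?i (snd y))) (tens_alg_ext dg h (bas w))"
    by (subst lin_swap) (simp add: lin_mult_right lin_mult_left scale_lin)
  also have "eqv R \<dots> (lin (\<lambda>y. scale ((-1) ^ (dg g * wdeg dg (fst y)))
       (?S (fst y) * scale (e g) 1 * ?i (snd y))) (tens_alg_ext dg h (bas w)))"
    by (intro eqv_lin eqv_scale eqv_mult3 R l Cons)
  also have "\<dots> = scale (e g) (lin (\<lambda>x. ?S (fst x) * ?i (snd x)) (tens_alg_ext dg h (bas w)))"
    using e[OF Cons(1)]
    by (cases "e g = 0") (simp_all add: scale_mult_left scale_mult_right scale_lin)
  also have "eqv R \<dots> (scale (e g) (scale (scalar_ext e (bas w)) 1))"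
    by (intro eqv_scale Cons)
  also have "\<dots> = scale (scalar_ext e (bas (Word [g] + w))) 1" by simp
  finally show ?case .
qed

section \<open>Convolution\<close>

context reduced_sset
begin

text \<open>No Koszul sign occurs, because the right factor of a convolution always has degree 0
  below. Functions of words are convolved, so that no linearity has to be carried along.\<close>

definition conv :: "('x simplex word \<Rightarrow> ('g word \<Rightarrow>\<^sub>0 'k::comm_ring_1)) \<Rightarrow> ('x simplex word \<Rightarrow> ('g word \<Rightarrow>\<^sub>0 'k)) \<Rightarrow>
    'x simplex word \<Rightarrow> ('g word \<Rightarrow>\<^sub>0 'k)" where
  "conv f g w = lin (\<lambda>x. f (fst x) * g (snd x)) (omega_coprod X (bas w))"

definition conv_unit :: "'x simplex word \<Rightarrow> ('g word \<Rightarrow>\<^sub>0 'k::comm_ring_1)" where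
  "conv_unit w = scale (omega_counit (bas w)) 1"

lemma omega_coprod_words:
  assumes "w \<in> \<Omega>words" "x \<in> Poly_Mapping.keys (omega_coprod X (bas w))"
  shows "fst x \<in> \<Omega>words" "snd x \<in> \<Omega>words" "wdeg omega_deg w = wdeg omega_deg (fst x) + wdeg omega_deg (snd x)"
  using supportedD[OF omega_coprod_supported[OF assms(1)] assms(2)] by (auto simp: word_pairs_def)

lemma conv_assoc:
  assumes "w \<in> \<Omega>words"
  shows "conv (conv f g) h w = conv f (conv g h) w"
  using omega_coassoc_lin[OF assms, of "\<lambda>u v w. f u * g v * h w"]
  by (simp add: conv_def lin_mult_left lin_mult_right mult.assoc)

lemma conv_unit_left:
  assumes "w \<in> \<Omega>words"
  shows "conv conv_unit f w = f w"
proof -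
  have "conv conv_unit f w = lin f (lin (\<lambda>x. scale (omega_counit (bas (fst x))) (bas (snd x))) (omega_coprod X (bas w)))"
    by (simp add: conv_def conv_unit_def lin_lin scale_mult_left)
  then show ?thesis by (simp add: omega_counit(1)[OF assms])
qed

lemma conv_unit_right:
  assumes "w \<in> \<Omega>words"
  shows "conv f conv_unit w = f w"
proof -
  have "conv f conv_unit w = lin f (lin (\<lambda>x. scale (omega_counit (bas (snd x))) (bas (fst x))) (omega_coprod X (bas w)))"
    by (simp add: conv_def conv_unit_def lin_lin scale_mult_right)
  then show ?thesis by (simp add: omega_counit(2)[OF assms])
qed

lemma conv_eqv:
  assumes "ideal_gens R" "\<And>u. u \<in> \<Omega>words \<Longrightarrow> eqv R (f u) (f' u)" "\<And>u. u \<in> \<Omega>words \<Longrightarrow> eqv R (g u) (g' u)"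
    "w \<in> \<Omega>words"
  shows "eqv R (conv f g w) (conv f' g' w)"
  unfolding conv_def
  by (intro eqv_lin eqv_mult assms) (auto dest: omega_coprod_words[OF assms(4)])

text \<open>A right inverse S of i cancels i on the right: f = (f * i) * S. Uniqueness of antipodes,
  their naturality and their compatibility with the differential all come from this.\<close>

lemma conv_cancel:
  assumes R: "ideal_gens R" and inv: "\<And>u. u \<in> \<Omega>words \<Longrightarrow> eqv R (conv i S u) (conv_unit u)"
    and eq: "\<And>u. u \<in> \<Omega>words \<Longrightarrow> eqv R (conv f i u) (conv g i u)" and w: "w \<in> \<Omega>words"
  shows "eqv R (f w) (g w)"
proof -
  have *: "eqv R (conv (conv f i) S w) (f w)" for f
  proof -
    have "eqv R (conv f (conv i S) w) (conv f conv_unit w)"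
      by (rule conv_eqv[OF R]) (simp_all add: inv w)
    then show ?thesis by (simp add: conv_assoc[OF w] conv_unit_right[OF w])
  qed
  have "eqv R (f w) (conv (conv f i) S w)" by (rule eqv_sym[OF *])
  also have "eqv R \<dots> (conv (conv g i) S w)" by (rule conv_eqv[OF R]) (simp_all add: eq w)
  also have "eqv R \<dots> (g w)" by (rule *)
  finally show ?thesis .
qed

text \<open>A right convolution inverse is a left inverse as soon as it is one in degree 0: the
  defect \<open>n = S * i - 1\<close> satisfies \<open>n = - n * n\<close>, which kills it by induction on the degree.\<close>

lemma conv_left_inverse:
  assumes R: "ideal_gens R" and inv: "\<And>u. u \<in> \<Omega>words \<Longrightarrow> eqv R (conv i S u) (conv_unit u)"
    and inv0: "\<And>u. u \<in> \<Omega>words \<Longrightarrow> wdeg omega_deg u = 0 \<Longrightarrow> eqv R (conv S i u) (conv_unit u)"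
    and w: "w \<in> \<Omega>words"
  shows "eqv R (conv S i w) (conv_unit w)"
  using w
proof (induction "wdeg omega_deg w" arbitrary: w rule: less_induct)
  case less
  define N where "N u = conv S i u - conv_unit u" for u
  show ?case
  proof (cases "wdeg omega_deg w = 0")
    case True
    then show ?thesis using inv0 less.prems by blast
  next
    case False
    have N0: "eqv R (N u) 0" if "u \<in> \<Omega>words" "wdeg omega_deg u < wdeg omega_deg w" for u
      using eqv_diff[OF less.hyps[OF that(2,1)] eqv_refl[of R "conv_unit u"]] by (simp add: N_def)
    \<comment> \<open>i * N = (i * S) * i - i, which vanishes because S is a right inverse.\<close>
    have iN: "eqv R (conv i N u) 0" if u: "u \<in> \<Omega>words" for u
    proof -
      have "conv i N u = conv i (conv S i) u - conv i conv_unit u"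
        by (simp add: conv_def N_def right_diff_distrib lin_diff_fun)
      also have "conv i (conv S i) u = conv (conv i S) i u" by (simp add: conv_assoc[OF u])
      also have "eqv R (conv (conv i S) i u - conv i conv_unit u) (conv conv_unit i u - conv i conv_unit u)"
        by (intro eqv_diff eqv_refl conv_eqv[OF R]) (simp_all add: inv u)
      also have "\<dots> = 0" by (simp add: conv_unit_left[OF u] conv_unit_right[OF u])
      finally show ?thesis .
    qed
    have "eqv R (conv S (conv i N) w) (conv S (\<lambda>_. 0) w)"
      by (rule conv_eqv[OF R]) (simp_all add: iN less.prems)
    then have 1: "eqv R (conv S (conv i N) w) 0" by (simp add: conv_def)
    have "conv S (conv i N) w = conv (\<lambda>u. N u + conv_unit u) N w"
      by (simp add: conv_assoc[OF less.prems, symmetric] N_def)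
    also have "\<dots> = conv N N w + conv conv_unit N w"
      by (simp add: conv_def distrib_right lin_add_fun)
    finally have 2: "conv S (conv i N) w = conv N N w + N w" by (simp add: conv_unit_left[OF less.prems])
    have "eqv R (conv N N w) (lin (\<lambda>x. 0) (omega_coprod X (bas w)))"
      unfolding conv_def
    proof (rule eqv_lin)
      fix x assume x: "x \<in> Poly_Mapping.keys (omega_coprod X (bas w) :: _ \<Rightarrow>\<^sub>0 'b)"
      note xw = omega_coprod_words[OF less.prems x]
      show "eqv R (N (fst x) * N (snd x)) 0"
      proof (cases "wdeg omega_deg (fst x) < wdeg omega_deg w")
        case True
        from eqv_mult[OF R N0[OF xw(1) True] eqv_refl] show ?thesis by simp
      next
        case False2: False
        then have "wdeg omega_deg (snd x) < wdeg omega_deg w" using xw(3) False by simp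
        from eqv_mult[OF R eqv_refl N0[OF xw(2) this]] show ?thesis by simp
      qed
    qed
    then have 3: "eqv R (conv N N w) 0" by simp
    have "eqv R (N w) 0"
      using eqv_diff[OF 1 3] by (simp add: 2)
    then show ?thesis using eqv_add[OF _ eqv_refl[of R "conv_unit w"]] by (fastforce simp: N_def)
  qed
qed

end

section \<open>The extended cobar construction\<close>

text \<open>Unlike in \<open>xomega_ideal\<close>, the words \<open>u\<close> and \<open>v\<close> are arbitrary: working modulo
  these relations needs no control of supports.\<close>

definition xomega_rel :: "'x sset \<Rightarrow> ('x, 'k::comm_ring_1) xomega set" where
  "xomega_rel X = {bas u * r * bas v | u r v. \<exists>f. set_like X f \<and>
     (r = xomega_incl f * bas (Word [Inv f]) - 1 \<or> r = bas (Word [Inv f]) * xomega_incl f - 1)}"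

lemma ideal_gens_xomega_rel: "ideal_gens (xomega_rel X)"
  unfolding ideal_gens_def
proof (intro ballI allI)
  fix x :: "('a, 'b) xomega" and u v
  assume "x \<in> xomega_rel X"
  then obtain u' r v' where "x = bas u' * r * bas v'" and r: "\<exists>f. set_like X f \<and>
     (r = xomega_incl f * bas (Word [Inv f]) - 1 \<or> r = bas (Word [Inv f]) * xomega_incl f - 1)"
    unfolding xomega_rel_def by blast
  then have "bas u * x * bas v = bas (u + u') * r * bas (v' + v)"
    by (simp add: bas_mult[symmetric] mult.assoc)
  with r have "bas u * x * bas v \<in> xomega_rel X" unfolding xomega_rel_def by blast
  then show "bas u * x * bas v \<in> free_module.span (xomega_rel X)" by (rule free_module.span_base)
qed

lemma inverse_right: "set_like X f \<Longrightarrow> eqv (xomega_rel X) (xomega_incl f * bas (Word [Inv f])) 1"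
proof -
  assume "set_like X f"
  then have "bas 0 * (xomega_incl f * bas (Word [Inv f]) - 1) * bas 0 \<in> xomega_rel X" unfolding xomega_rel_def by blast
  then show ?thesis by (simp add: eqv_def free_module.span_base)
qed

lemma inverse_left: "set_like X f \<Longrightarrow> eqv (xomega_rel X) (bas (Word [Inv f]) * xomega_incl f) 1"
proof -
  assume "set_like X f"
  then have "bas 0 * (bas (Word [Inv f]) * xomega_incl f - 1) * bas 0 \<in> xomega_rel X" unfolding xomega_rel_def by blast
  then show ?thesis by (simp add: eqv_def free_module.span_base)
qed

abbreviation cell_word :: "'x simplex word \<Rightarrow> ('x, 'k::comm_ring_1) xletter word" where
  "cell_word w \<equiv> Word (map Cell (letters w))"

lemma klin_xomega_incl: "klin xomega_incl"
  by (simp add: xomega_incl_def klin_alg_ext)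

lemmas xomega_incl_simps [simp] = klin_0[OF klin_xomega_incl] klin_add[OF klin_xomega_incl] klin_diff[OF klin_xomega_incl]
  klin_uminus[OF klin_xomega_incl] klin_scale[OF klin_xomega_incl]

lemma xomega_incl_1 [simp]: "xomega_incl 1 = 1"
  by (simp add: xomega_incl_def)

lemma xomega_incl_bas: "xomega_incl (bas w) = bas (cell_word w)"
proof -
  have "w \<in> words UNIV" by simp
  then show ?thesis
    by (induction rule: word_induct)
      (simp_all add: xomega_incl_def Word_Nil alg_ext_bas_add bas_mult plus_word_def alg_ext_def)
qed

lemma xomega_incl_mult: "xomega_incl (p * q) = xomega_incl p * xomega_incl q"
  by (simp add: xomega_incl_def alg_ext_mult)

lemma wdeg_cell_word [simp]: "wdeg xomega_deg (cell_word w) = wdeg omega_deg w"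
  by (simp add: wdeg_def o_def)

lemma cell_word_in: "w \<in> words (omega_letters X) \<Longrightarrow> cell_word w \<in> words (xomega_letters X)"
  by (auto simp: words_def xomega_letters_def)

lemma xomega_incl_supported:
  assumes "p \<in> supported {v \<in> words (omega_letters X). wdeg omega_deg v = n}"
  shows "xomega_incl p \<in> supported {v \<in> words (xomega_letters X). wdeg xomega_deg v = n}"
  unfolding klin_eq_lin[OF klin_xomega_incl, of p]
  by (rule supported_lin) (use assms in \<open>auto dest!: supportedD simp: xomega_incl_bas cell_word_in\<close>)

definition letter_retract :: "'l set \<Rightarrow> ('l word \<Rightarrow>\<^sub>0 'k::comm_ring_1) \<Rightarrow> ('l word \<Rightarrow>\<^sub>0 'k)" where
  "letter_retract B = alg_ext (\<lambda>l. if l \<in> B then bas (Word [l]) else 0)"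

lemma letter_retract_bas:
  "letter_retract B (bas w) = (if w \<in> words B then bas w else 0)"
proof -
  have "w \<in> words UNIV" by simp
  then show ?thesis
    by (induction rule: word_induct) (auto simp: letter_retract_def alg_ext_bas_add bas_mult alg_ext_def)
qed

lemma klin_letter_retract: "klin (letter_retract B)"
  by (simp add: letter_retract_def klin_alg_ext)

lemma letter_retract_id: "p \<in> supported (words B) \<Longrightarrow> letter_retract B p = p"
  by (rule klin_eqI[OF klin_letter_retract klin_intros(1)])
    (auto dest: supportedD simp: letter_retract_bas)

text \<open>Sending the letters that do not occur in \<open>X\<close> to 0 shows that the restriction of \<open>u\<close> and \<open>v\<close>
  in \<open>xomega_ideal\<close> does no harm.\<close>

lemma letter_retract_rel:
  assumes "x \<in> xomega_rel X"
  shows "letter_retract (xomega_letters X) x \<in> xomega_ideal X"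
proof -
  obtain u r v f where x: "x = bas u * r * bas v" and f: "set_like X f"
    and r: "r = xomega_incl f * bas (Word [Inv f]) - 1 \<or> r = bas (Word [Inv f]) * xomega_incl f - 1"
    using assms unfolding xomega_rel_def by blast
  have "xomega_incl f \<in> supported (words (xomega_letters X))"
    using f xomega_incl_supported[of f X 0] by (auto simp: set_like_def elim: supported_mono)
  moreover have "bas (Word [Inv f]) \<in> supported (words (xomega_letters X))"
    using f by (auto simp: xomega_letters_def)
  ultimately have "r \<in> supported (words (xomega_letters X))"
    using r by (auto intro!: supported_diff supported_mult[of _ "words (xomega_letters X)" _ "words (xomega_letters X)"]
        simp: supported_iff[of 1])
  then have e: "letter_retract (xomega_letters X) x =
      letter_retract (xomega_letters X) (bas u) * r * letter_retract (xomega_letters X) (bas v)"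
    by (simp add: x letter_retract_id letter_retract_def alg_ext_mult) (simp add: letter_retract_def[symmetric] letter_retract_id)
  show ?thesis
  proof (cases "u \<in> words (xomega_letters X) \<and> v \<in> words (xomega_letters X)")
    case True
    then show ?thesis unfolding e xomega_ideal_def
      using f r by (auto simp: letter_retract_bas intro!: free_module.span_base)
  next
    case False
    then show ?thesis unfolding e xomega_ideal_def
      by (auto simp: letter_retract_bas free_module.span_zero)
  qed
qed

lemma xomega_ideal_subset: "xomega_ideal X \<subseteq> free_module.span (xomega_rel X)"
  unfolding xomega_ideal_def by (rule free_module.span_mono) (auto simp: xomega_rel_def)

lemma span_xomega_rel_ideal:
  assumes "x \<in> free_module.span (xomega_rel X)" "x \<in> supported (words (xomega_letters X))"
  shows "x \<in> xomega_ideal X"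
proof -
  have "letter_retract (xomega_letters X) x \<in> free_module.span (xomega_ideal X)"
    by (rule klin_span[OF klin_letter_retract _ assms(1)]) (auto intro: free_module.span_base letter_retract_rel)
  then show ?thesis
    using assms(2) by (simp add: letter_retract_id xomega_ideal_def free_module.span_span)
qed

section \<open>The antipode\<close>

text \<open>Choosing [0] \<otimes> [0,1] at every letter gives the first summand. Every other choice
  puts [1] somewhere into the right factor, which is then a product of values on simplices of
  smaller dimension; the recursion for the antipode rests on this.\<close>

lemma cube_coprod_split:
  "\<exists>q. cube_word_coprod (bas (Word (replicate n I01))) =
     (bas (Word (replicate n I0), Word (replicate n I01)) + q :: _ \<Rightarrow>\<^sub>0 'k::comm_ring_1) \<and>
   q \<in> supported {x. tri (replicate n I01) (letters (fst x)) (letters (snd x)) \<and> I1 \<in> set (letters (snd x))}"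
proof (induction n)
  case 0
  then show ?case by (intro exI[of _ 0]) (simp add: Word_Nil)
next
  case (Suc n)
  let ?T = "\<lambda>n x. tri (replicate n I01) (letters (fst x)) (letters (snd x))"
  let ?c = "cube_word_coprod (bas (Word (replicate n I01))) :: _ \<Rightarrow>\<^sub>0 'k"
  from Suc obtain q :: "_ \<Rightarrow>\<^sub>0 'k" where q: "?c = bas (Word (replicate n I0), Word (replicate n I01)) + q"
    and qs: "q \<in> supported {x. ?T n x \<and> I1 \<in> set (letters (snd x))}" by blast
  have deg: "wdeg interval_deg (Word (replicate n I0)) = 0"
    by (simp add: wdeg_def interval_deg_def sum_list_replicate)
  let ?q = "kmult interval_deg (bas (Word [I0], Word [I01])) q + kmult interval_deg (bas (Word [I01], Word [I1])) ?c"
  have "cube_word_coprod (bas (Word (replicate (Suc n) I01))) =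
      kmult interval_deg (bas (Word [I0], Word [I01]) + bas (Word [I01], Word [I1])) ?c"
    by (simp add: Word_Cons[of I01 "replicate n I01"] tens_alg_ext_Cons)
  also have "\<dots> = kmult interval_deg (bas (Word [I0], Word [I01])) (bas (Word (replicate n I0), Word (replicate n I01))) + ?q"
    by (simp add: q)
  also have "kmult interval_deg (bas (Word [I0], Word [I01])) (bas (Word (replicate n I0), Word (replicate n I01))) =
      (bas (Word (replicate (Suc n) I0), Word (replicate (Suc n) I01)) :: _ \<Rightarrow>\<^sub>0 'k)"
    by (simp add: kmult_bas deg plus_word_def)
  finally have "cube_word_coprod (bas (Word (replicate (Suc n) I01))) =
      bas (Word (replicate (Suc n) I0), Word (replicate (Suc n) I01)) + ?q" .
  moreover have "?q \<in> supported {x. ?T (Suc n) x \<and> I1 \<in> set (letters (snd x))}"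
    using supportedD[OF qs] cube_coprod_tri[of _ "replicate n I01", where 'a = 'k]
    by (auto simp: kmult_alt plus_word_def intro!: supported_add supported_lin supported_scale supported_bas
        intro!: tri_left tri_right simp del: supported_bas)
  ultimately show ?case by blast
qed

definition lower_cubes :: "nat \<Rightarrow> (interval word \<times> interval word \<Rightarrow>\<^sub>0 'k::comm_ring_1)" where
  "lower_cubes n = cube_word_coprod (bas (Word (replicate n I01))) - bas (Word (replicate n I0), Word (replicate n I01))"

lemma lower_cubes_supported: "lower_cubes n \<in>
    supported {x. tri (replicate n I01) (letters (fst x)) (letters (snd x)) \<and> I1 \<in> set (letters (snd x))}"
proof -
  obtain q :: "_ \<Rightarrow>\<^sub>0 'a" where q: "cube_word_coprod (bas (Word (replicate n I01))) =
      bas (Word (replicate n I0), Word (replicate n I01)) + q"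
    "q \<in> supported {x. tri (replicate n I01) (letters (fst x)) (letters (snd x)) \<and> I1 \<in> set (letters (snd x))}"
    using cube_coprod_split by blast
  have "lower_cubes n = q" unfolding lower_cubes_def q(1) by (rule add_diff_cancel_left')
  then show ?thesis using q(2) by (simp only:)
qed

text \<open>The recursion solves the antipode equation for the top cube; its term that contains the antipode of
  \<open>s\<close> itself has left factor the edge \<open>[0, fst s]\<close>, and \<open>lower_cubes\<close> are the other terms. The
  additional natural number bounds the recursion depth.\<close>

primrec antipode_fuel :: "'x sset \<Rightarrow> nat \<Rightarrow> 'x simplex \<Rightarrow> ('x, 'k::comm_ring_1) xomega" where
  "antipode_fuel X 0 = (\<lambda>s. 0)"
| "antipode_fuel X (Suc n) = (\<lambda>s. if fst s \<le> n then antipode_fuel X n s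
     else if fst s = 1 then 1 - bas (Word [Inv (I_simplex X s)])
     else - scale ((-1) ^ fst s) (bas (Word [Inv (I_face X s [0, fst s])]) *
       lin (\<lambda>x. xomega_incl (kword (I_face X s) [0..<Suc (fst s)] (fst x)) *
         anti_ext omega_deg (antipode_fuel X n) (kword (I_face X s) [0..<Suc (fst s)] (snd x))) (lower_cubes (fst s - 1))))"

definition antipode_cell :: "'x sset \<Rightarrow> 'x simplex \<Rightarrow> ('x, 'k::comm_ring_1) xomega" where
  "antipode_cell X s = antipode_fuel X (fst s) s"

text \<open>The dimension of s is a sufficient bound on the recursion depth, and any larger bound
  gives the same value.\<close>

lemma antipode_fuel_cell: "fst s \<le> n \<Longrightarrow> antipode_fuel X n s = antipode_cell X s"
proof (induction n)
  case (Suc n)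
  show ?case
  proof (cases "fst s = Suc n")
    case True
    then show ?thesis by (simp only: antipode_cell_def)
  qed (use Suc in auto)
qed (simp add: antipode_cell_def)

lemma antipode_cell_1: "fst s = 1 \<Longrightarrow> antipode_cell X s = 1 - bas (Word [Inv (I_simplex X s)])"
  by (simp add: antipode_cell_def)

context reduced_sset
begin

lemma kword_letters:
  assumes "is_simplex X s" "length xs = length w + 2" "vertex_list s xs"
  shows "(kword (I_face X s) xs (Word w) :: ('x, 'k::comm_ring_1) omega) \<in> supported (words {t \<in> omega_letters X. fst t < length xs})"
  using assms(2) assms(3)[unfolded vertex_list_def]
proof (induction xs w rule: kword_induct)
  case (top xs n)
  then show ?case
    by (auto simp: kword_top I_simplex_def simplex_gen_eq supported_iff[of 1] intro!: supported_diff supported_uminus supported_scale)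
next
  case (drop as x bs u v)
  then show ?case by (auto simp: kword_drop words_def elim!: supported_mono)
next
  case (cut as x bs u v)
  have "words {t \<in> omega_letters X. fst t < length (as @ [x])} \<subseteq> words {t \<in> omega_letters X. fst t < length (as @ x # bs)}"
    "words {t \<in> omega_letters X. fst t < length (x # bs)} \<subseteq> words {t \<in> omega_letters X. fst t < length (as @ x # bs)}"
    using cut by (auto simp: words_def)
  then show ?case
    unfolding kword_cut[OF cut(1)] by (intro supported_mult[OF cut(4,5)]) auto
qed

text \<open>A letter \<open>I1\<close> cuts the word at an inner vertex, so both pieces miss a
  vertex of s and only simplices of smaller dimension occur.\<close>

lemma I_cube_lower:
  fixes s :: "'x simplex"
  assumes s: "is_simplex X s" "fst s \<ge> 1" and w: "length w = fst s - 1" "I1 \<in> set w"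
  shows "(I_cube s (Word w) :: ('x, 'k::comm_ring_1) omega) \<in> supported (words {t \<in> omega_letters X. fst t < fst s})"
proof -
  from w(2) obtain u v where uv: "w = u @ I1 # v" by (meson split_list)
  have l: "Suc (length u) < Suc (fst s)" using w s by (simp add: uv)
  let ?as = "[0..<Suc (length u)]" and ?bs = "[Suc (Suc (length u))..<Suc (fst s)]"
  have xs: "[0..<Suc (fst s)] = ?as @ Suc (length u) # ?bs"
    using l w upt_add_eq_append[of 0 "Suc (length u)" "Suc (fst s) - Suc (length u)"] upt_conv_Cons[of "Suc (length u)" "Suc (fst s)"]
    by (simp del: upt_Suc)
  have lw: "Suc (length u + length v) = fst s - 1" using w by (simp add: uv)
  have A: "(kword (I_face X s) (?as @ [Suc (length u)]) (Word u) :: ('x, 'k) omega) \<in> supported (words {t \<in> omega_letters X. fst t < length (?as @ [Suc (length u)])})"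
    using l by (intro kword_letters s) (auto simp: vertex_list_def sorted_append simp del: upt_Suc)
  have B: "(kword (I_face X s) (Suc (length u) # ?bs) (Word v) :: ('x, 'k) omega) \<in> supported (words {t \<in> omega_letters X. fst t < length (Suc (length u) # ?bs)})"
    using l lw by (intro kword_letters s) (auto simp: vertex_list_def simp del: upt_Suc)
  have K: "kword (I_face X s) (?as @ Suc (length u) # ?bs) (Word (u @ I1 # v)) =
      (kword (I_face X s) (?as @ [Suc (length u)]) (Word u) * kword (I_face X s) (Suc (length u) # ?bs) (Word v) :: ('x, 'k) omega)"
    by (rule kword_cut) (simp del: upt_Suc)
  have sub: "words {t \<in> omega_letters X. fst t < length (?as @ [Suc (length u)])} \<subseteq> words {t \<in> omega_letters X. fst t < fst s}"
    "words {t \<in> omega_letters X. fst t < length (Suc (length u) # ?bs)} \<subseteq> words {t \<in> omega_letters X. fst t < fst s}"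
    using lw by (auto simp: words_def simp del: upt_Suc)
  show ?thesis
    unfolding xs uv K by (rule supported_mult[OF supported_mono[OF A sub(1)] supported_mono[OF B sub(2)]]) simp
qed

lemma I_cube_bottom: "fst s \<ge> 1 \<Longrightarrow> kword G [0..<Suc (fst s)] (Word (replicate (fst s - 1) I0)) = G [0, fst s]"
proof -
  have "kw G acc xs (replicate n I0) = G (acc @ [last xs])" if "length xs = Suc n" for acc xs n
    using that
  proof (induction n arbitrary: xs)
    case 0
    then show ?case by (cases xs) auto
  next
    case (Suc n)
    then show ?case by (cases xs) auto
  qed
  from this[of "[1..<Suc (fst s)]" "fst s - 1" "[0]"]
  show "fst s \<ge> 1 \<Longrightarrow> kword G [0..<Suc (fst s)] (Word (replicate (fst s - 1) I0)) = G [0, fst s]"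
    by (simp add: kword_def upt_conv_Cons[of 0] del: upt_Suc)
qed

abbreviation anti_cell :: "('x, 'k::comm_ring_1) omega \<Rightarrow> ('x, 'k) xomega" where
  "anti_cell \<equiv> anti_ext omega_deg (antipode_cell X)"

text \<open>By \<open>I_cube_lower\<close> the right factors involve only smaller simplices, so the
  bound on the recursion depth disappears from the equation.\<close>

lemma antipode_cell_rec:
  assumes s: "is_simplex X s" "fst s \<ge> 2"
  shows "antipode_cell X s = - scale ((-1) ^ fst s) (bas (Word [Inv (I_face X s [0, fst s])]) *
       lin (\<lambda>x. xomega_incl (I_cube s (fst x)) * anti_cell (I_cube s (snd x))) (lower_cubes (fst s - 1)) :: ('x, 'k::comm_ring_1) xomega)"
proof -
  obtain n where n: "fst s = Suc n" "fst s \<noteq> 1" using s(2) by (cases "fst s") auto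
  have "lin (\<lambda>x. xomega_incl (I_cube s (fst x)) * anti_ext omega_deg (antipode_fuel X n) (I_cube s (snd x))) (lower_cubes (fst s - 1)) =
     (lin (\<lambda>x. xomega_incl (I_cube s (fst x)) * anti_cell (I_cube s (snd x))) (lower_cubes (fst s - 1)) :: ('x, 'k) xomega)"
  proof (intro lin_cong refl arg_cong2[where f = "(*)"])
    fix x assume "x \<in> Poly_Mapping.keys (lower_cubes (fst s - 1) :: _ \<Rightarrow>\<^sub>0 'k)"
    from supportedD[OF lower_cubes_supported this]
    have t: "tri (replicate (fst s - 1) I01) (letters (fst x)) (letters (snd x))" "I1 \<in> set (letters (snd x))" by auto
    have "(I_cube s (snd x) :: ('x, 'k) omega) \<in> supported (words {t \<in> omega_letters X. fst t < fst s})"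
      using I_cube_lower[OF s(1) _ _ t(2), where 'k = 'k] tri_length[OF t(1)] s(2) by simp
    then show "anti_ext omega_deg (antipode_fuel X n) (I_cube s (snd x) :: ('x, 'k) omega) = anti_cell (I_cube s (snd x))"
      by (rule anti_ext_cong[rotated]) (auto simp: antipode_fuel_cell n(1))
  qed
  moreover have "antipode_cell X s = (antipode_fuel X (Suc n) s :: ('x, 'k) xomega)"
    by (simp only: antipode_cell_def n)
  moreover have "\<not> fst s \<le> n" using n by simp
  then have "(antipode_fuel X (Suc n) s :: ('x, 'k) xomega) = - scale ((-1) ^ fst s) (bas (Word [Inv (I_face X s [0, fst s])]) *
       lin (\<lambda>x. xomega_incl (I_cube s (fst x)) *
         anti_ext omega_deg (antipode_fuel X n) (I_cube s (snd x))) (lower_cubes (fst s - 1)))"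
    by (simp only: antipode_fuel.simps n(2) if_False)
  ultimately show ?thesis by (simp only:)
qed

lemma antipode_cell_supported:
  "s \<in> omega_letters X \<Longrightarrow> (antipode_cell X s :: ('x, 'k::comm_ring_1) xomega) \<in>
     supported {v \<in> words (xomega_letters X). wdeg xomega_deg v = omega_deg s}"
proof (induction "fst s" arbitrary: s rule: less_induct)
  case less
  note s = letter_I(2,3)[OF less.prems]
  show ?case
  proof (cases "fst s = 1")
    case True
    then show ?thesis
      using set_like_I_simplex[OF s(1) True, where 'k = 'k]
      by (auto simp: antipode_cell_1 omega_deg_def xomega_letters_def supported_iff[of 1] intro!: supported_diff)
  next
    case False
    then have s2: "fst s \<ge> 2" using s(2) by simp
    have "is_simplex X (face X s [0, fst s])"
      by (rule face_is_simplex[OF s(1)]) (auto simp: vertex_list_def)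
    from set_like_I_simplex[OF this, where 'k = 'k]
    have inv: "(Word [Inv (I_face X s [0, fst s])] :: ('x, 'k) xletter word) \<in> {v \<in> words (xomega_letters X). wdeg xomega_deg v = 0}"
      by (simp add: xomega_letters_def)
    have "lin (\<lambda>x. xomega_incl (I_cube s (fst x)) * anti_cell (I_cube s (snd x))) (lower_cubes (fst s - 1)) \<in>
       supported {v \<in> words (xomega_letters X :: ('x, 'k) xletter set). wdeg xomega_deg v = fst s - 1}"
    proof (rule supported_lin)
      fix x assume "x \<in> Poly_Mapping.keys (lower_cubes (fst s - 1) :: _ \<Rightarrow>\<^sub>0 'k)"
      from supportedD[OF lower_cubes_supported this]
      have t: "tri (replicate (fst s - 1) I01) (letters (fst x)) (letters (snd x))" "I1 \<in> set (letters (snd x))" by auto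
      have l: "length (letters (fst x)) = fst s - 1" "length (letters (snd x)) = fst s - 1"
        using tri_length[OF t(1)] by auto
      have d: "wdeg interval_deg (fst x) + wdeg interval_deg (snd x) = fst s - 1"
        using tri_degree[OF t(1)] by simp
      have 1: "xomega_incl (I_cube s (fst x) :: ('x, 'k) omega) \<in> supported {v \<in> words (xomega_letters X). wdeg xomega_deg v = wdeg interval_deg (fst x)}"
        using xomega_incl_supported[OF I_cube_supported[OF s l(1), where 'k = 'k]] by simp
      have "(I_cube s (snd x) :: ('x, 'k) omega) \<in> supported ({v. wdeg omega_deg v = wdeg interval_deg (snd x)} \<inter> words {t \<in> omega_letters X. fst t < fst s})"
        using I_cube_lower[OF s l(2) t(2), where 'k = 'k] I_cube_supported[OF s l(2), where 'k = 'k]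
        by (auto simp: supported_def)
      then have 2: "anti_cell (I_cube s (snd x) :: ('x, 'k) omega) \<in> supported {v \<in> words (xomega_letters X). wdeg xomega_deg v = wdeg interval_deg (snd x)}"
        unfolding klin_eq_lin[OF klin_anti_ext, of _ _ "I_cube s (snd x)"]
      proof (intro supported_lin)
        fix a assume a: "(I_cube s (snd x) :: ('x, 'k) omega) \<in> supported ({v. wdeg omega_deg v = wdeg interval_deg (snd x)} \<inter> words {t \<in> omega_letters X. fst t < fst s})"
          "a \<in> Poly_Mapping.keys (I_cube s (snd x) :: ('x, 'k) omega)"
        have aw: "a \<in> words {t \<in> omega_letters X. fst t < fst s}" "wdeg omega_deg a = wdeg interval_deg (snd x)"
          using supportedD[OF a] by auto
        show "anti_cell (bas a :: ('x, 'k) omega) \<in> supported {v \<in> words (xomega_letters X). wdeg xomega_deg v = wdeg interval_deg (snd x)}"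
          unfolding aw(2)[symmetric]
          by (rule supported_anti_ext[OF _ aw(1)]) (use less.hyps in auto)
      qed
      show "xomega_incl (I_cube s (fst x)) * anti_cell (I_cube s (snd x) :: ('x, 'k) omega) \<in>
         supported {v \<in> words (xomega_letters X). wdeg xomega_deg v = fst s - 1}"
        by (rule supported_mult[OF 1 2]) (use d in auto)
    qed
    then show ?thesis
      unfolding antipode_cell_rec[OF s(1) s2]
      by (intro supported_uminus supported_scale supported_mult[OF supported_bas[OF inv]]) (auto simp: omega_deg_def)
  qed
qed

abbreviation Jeq :: "('x, 'k::comm_ring_1) xomega \<Rightarrow> ('x, 'k) xomega \<Rightarrow> bool" (infix "\<approx>" 50) where
  "a \<approx> b \<equiv> eqv (xomega_rel X) a b"

lemmas Jideal = ideal_gens_xomega_rel[of X]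

lemma I_simplex_letter:
  assumes "s \<in> omega_letters X"
  shows "I_simplex X s = (if fst s = 1 then 1 - bas (Word [s]) else scale ((-1) ^ fst s) (bas (Word [s])))"
  using assms by (simp add: I_simplex_def simplex_gen_eq)

text \<open>In dimension at least 2 the convolution is I_e S(I_s) + low, where e is the edge from
  the first to the last vertex. The recursion defines S(I_s) as minus the formal inverse of I_e
  times low, so the sum vanishes modulo the relation for I_e.\<close>

lemma antipode_right_letter:
  assumes "s \<in> omega_letters X"
  shows "lin (\<lambda>x. xomega_incl (bas (fst x)) * anti_cell (bas (snd x))) (omega_coprod X (bas (Word [s]))) \<approx> (0 :: ('x, 'k::comm_ring_1) xomega)"
proof -
  note s = letter_I(2,3)[OF assms]
  define CV :: "_ \<Rightarrow> ('x, 'k) xomega" where "CV = lin (\<lambda>x. xomega_incl (bas (fst x)) * anti_cell (bas (snd x)))"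
  have kl: "klin CV" by (simp add: CV_def)
  have T: "CV (tens P Q) = xomega_incl P * anti_cell Q" for P Q
    unfolding CV_def lin_tens
    by (simp add: klin_eq_lin[OF klin_xomega_incl, of P] klin_eq_lin[OF klin_anti_ext, of _ _ Q] lin_mult_lin)
  have inv0: "set_like X (I_face X s [0, fst s] :: ('x, 'k) omega)"
    by (rule set_like_I_simplex[OF face_is_simplex[OF s(1)]]) (auto simp: vertex_list_def)
  have "CV (omega_coprod X (I_simplex X s)) \<approx> (if fst s = 1 then 1 else 0)"
  proof (cases "fst s = 1")
    case True
    have sl: "set_like X (I_simplex X s :: ('x, 'k) omega)" by (rule set_like_I_simplex[OF s(1) True])
    then have "omega_coprod X (I_simplex X s :: ('x, 'k) omega) = tens (I_simplex X s) (I_simplex X s)"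
      by (simp add: set_like_def)
    moreover have "anti_cell (I_simplex X s :: ('x, 'k) omega) = bas (Word [Inv (I_simplex X s)])"
      unfolding I_simplex_letter[OF assms] using True by (simp add: antipode_cell_1 I_simplex_letter[OF assms])
    ultimately show ?thesis using inverse_right[OF sl] True by (simp add: T)
  next
    case False
    define low :: "('x, 'k) xomega" where "low = lin (\<lambda>x. xomega_incl (I_cube s (fst x)) * anti_cell (I_cube s (snd x))) (lower_cubes (fst s - 1))"
    have c: "(cube_word_coprod (bas (top_cube s)) :: _ \<Rightarrow>\<^sub>0 'k) = bas (Word (replicate (fst s - 1) I0), top_cube s) + lower_cubes (fst s - 1)"
      by (simp add: lower_cubes_def)
    have "CV (omega_coprod X (I_simplex X s)) = xomega_incl (I_face X s [0, fst s]) * anti_cell (I_simplex X s) + low"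
      unfolding omega_coprod_I_simplex[OF s] kpair_def klin_compose_lin[OF kl] T c
      using s low_def I_cube_top[OF s, where 'a = 'k] I_cube_bottom[OF s(2), of "I_face X s :: _ \<Rightarrow> ('x, 'k) omega"] by (simp del: upt_Suc)
    also have "anti_cell (I_simplex X s :: ('x, 'k) omega) = - (bas (Word [Inv (I_face X s [0, fst s])]) * low)"
      unfolding I_simplex_letter[OF assms] using False s antipode_cell_rec[OF s(1), where 'k = 'k, folded low_def]
      by (simp add: power_add[symmetric] mult_2[symmetric] del: upt_Suc)
    finally have E: "CV (omega_coprod X (I_simplex X s)) = low - xomega_incl (I_face X s [0, fst s]) * bas (Word [Inv (I_face X s [0, fst s])]) * low"
      by (simp add: mult.assoc)
    have "low - xomega_incl (I_face X s [0, fst s]) * bas (Word [Inv (I_face X s [0, fst s])]) * low \<approx> low - 1 * low"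
      by (intro eqv_diff eqv_refl eqv_mult[OF Jideal] inverse_right inv0)
    then show ?thesis unfolding E using False by simp
  qed
  then have "(if fst s = 1 then 1 else 0) + scale ((-1) ^ fst s) (CV (omega_coprod X (I_simplex X s))) \<approx>
      (if fst s = 1 then 1 else 0) + scale ((-1) ^ fst s) (if fst s = 1 then 1 else 0)"
    by (intro eqv_add eqv_refl eqv_scale)
  moreover have "CV (bas (0, 0)) = 1" using T[of 1 1] by (simp add: tens_1_1)
  ultimately have "CV (omega_coprod X (bas (Word [s]))) \<approx> 0"
    unfolding letter_I(1)[OF assms]
    by (auto simp: klin_add[OF kl] klin_scale[OF kl] klin_0[OF kl] klin_diff[OF kl] split: if_splits)
  then show ?thesis by (simp add: CV_def)
qed

abbreviation Oincl :: "'x simplex word \<Rightarrow> ('x, 'k::comm_ring_1) xomega" where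
  "Oincl w \<equiv> xomega_incl (bas w)"

abbreviation Oanti :: "'x simplex word \<Rightarrow> ('x, 'k::comm_ring_1) xomega" where
  "Oanti w \<equiv> anti_cell (bas w)"

lemma antipode_right:
  assumes "w \<in> \<Omega>words"
  shows "conv Oincl Oanti w \<approx> (conv_unit w :: ('x, 'k::comm_ring_1) xomega)"
  unfolding conv_def conv_unit_def omega_coprod_def xomega_incl_def omega_counit_def
proof (rule antipode_right_ext[OF Jideal omega_coprod_letter_supported' _ _ assms])
  fix s assume s: "s \<in> omega_letters X"
  show "lin (\<lambda>x. alg_ext (\<lambda>s. bas (Word [Cell s])) (bas (fst x)) * anti_cell (bas (snd x)))
      (if fst s = 1 then tens 1 1 - coprod_I X s else scale ((- 1) ^ fst s) (coprod_I X s)) \<approx> (scale 0 1 :: ('x, 'k) xomega)"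
    using antipode_right_letter[OF s, where 'k = 'k]
    unfolding omega_coprod_letter xomega_incl_def by (simp only: scale_simps)
qed auto

text \<open>In degree 0 only edges occur, and their formal inverses are two-sided. The recursion in
  higher dimensions solves only the equation for a right inverse, so this is the start of the
  induction in \<open>conv_left_inverse\<close>.\<close>

lemma antipode_left_degree_0:
  assumes "w \<in> \<Omega>words" "wdeg omega_deg w = 0"
  shows "conv Oanti Oincl w \<approx> (conv_unit w :: ('x, 'k::comm_ring_1) xomega)"
proof -
  let ?B = "{s \<in> omega_letters X. fst s = 1}"
  have "w \<in> words ?B"
    using assms
  proof (induction rule: word_induct)
    case (Cons g w)
    then have "fst g \<ge> 1" "omega_deg g = 0" by (auto simp: omega_letters_def)
    then show ?case using Cons by (simp add: omega_deg_def)
  qed simp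
  have I: "(I_simplex X s :: ('x, 'k) omega) \<in> supported {v \<in> words ?B. wdeg omega_deg v = 0}" if "s \<in> ?B" for s
    using that by (auto simp: I_simplex_letter omega_deg_def supported_iff[of 1] intro!: supported_diff)
  have c: "omega_coprod X (bas (Word [s])) = tens 1 1 - tens (I_simplex X s) (I_simplex X s :: ('x, 'k) omega)" if "s \<in> ?B" for s
  proof -
    have "set_like X (I_simplex X s :: ('x, 'k) omega)" using that by (auto intro: set_like_I_simplex letter_I)
    moreover have "bas (Word [s]) = (1 - I_simplex X s :: ('x, 'k) omega)"
      using that letter_I(1)[of s] by simp
    ultimately show ?thesis by (simp add: set_like_def tens_1_1)
  qed
  show ?thesis
    unfolding conv_def conv_unit_def omega_coprod_def xomega_incl_def omega_counit_def
  proof (rule antipode_left_ext[OF Jideal _ _ _ \<open>w \<in> words ?B\<close>])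
    fix s assume s: "s \<in> ?B"
    show "(if fst s = 1 then tens 1 1 - coprod_I X s else scale ((- 1) ^ fst s) (coprod_I X s) :: _ \<Rightarrow>\<^sub>0 'k) \<in>
         supported (word_pairs omega_deg ?B (omega_deg s))"
      unfolding omega_coprod_letter[symmetric] unfolding c[OF s] unfolding tens_1_1
      using s by (auto intro!: supported_diff supported_mono[OF supported_tens[OF I[OF s] I[OF s]]] simp: word_pairs_def omega_deg_def)
    have "lin (\<lambda>x. anti_cell (bas (fst x)) * xomega_incl (bas (snd x))) (omega_coprod X (bas (Word [s]))) =
       1 - anti_cell (I_simplex X s) * xomega_incl (I_simplex X s :: ('x, 'k) omega)"
      unfolding c[OF s]
      by (simp add: lin_tens tens_1_1)
        (simp add: klin_eq_lin[OF klin_xomega_incl, of "I_simplex X s"] klin_eq_lin[OF klin_anti_ext, of _ _ "I_simplex X s"]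
          lin_mult_lin)
    also have "anti_cell (I_simplex X s :: ('x, 'k) omega) = bas (Word [Inv (I_simplex X s)])"
      using s by (simp add: I_simplex_letter[of s] antipode_cell_1)
    also have "1 - bas (Word [Inv (I_simplex X s)]) * xomega_incl (I_simplex X s :: ('x, 'k) omega) \<approx> 1 - 1"
      using s by (intro eqv_diff eqv_refl inverse_left set_like_I_simplex) (auto intro: letter_I)
    finally show "lin (\<lambda>x. anti_cell (bas (fst x)) * alg_ext (\<lambda>s. bas (Word [Cell s])) (bas (snd x)))
        (if fst s = 1 then tens 1 1 - coprod_I X s else scale ((- 1) ^ fst s) (coprod_I X s)) \<approx> (scale 0 1 :: ('x, 'k) xomega)"
      by (simp add: omega_coprod_letter xomega_incl_def)
  qed simp
qed

lemma antipode_left: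
  assumes "w \<in> \<Omega>words"
  shows "conv Oanti Oincl w \<approx> (conv_unit w :: ('x, 'k::comm_ring_1) xomega)"
  by (rule conv_left_inverse[OF Jideal antipode_right antipode_left_degree_0 assms])

end

section \<open>The differential of the extended cobar construction\<close>

lemma xomega_diff_simps [simp]:
  "xomega_diff X 0 = 0" "xomega_diff X (p + q) = xomega_diff X p + xomega_diff X q"
  "xomega_diff X (p - q) = xomega_diff X p - xomega_diff X q" "xomega_diff X (- p) = - xomega_diff X p"
  "xomega_diff X (scale c p) = scale c (xomega_diff X p)" "xomega_diff X 1 = 0"
  "xomega_diff X (bas (Word [Inv f])) = 0"
  "xomega_diff X (bas (Word [Cell s])) = xomega_incl (omega_diff X (bas (Word [s])))"
  by (simp_all add: xomega_diff_def)

lemma klin_xomega_diff: "klin (xomega_diff X)"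
  by (simp add: xomega_diff_def klin_der_ext)

lemma xomega_diff_mult: "xomega_diff X (p * q) = xomega_diff X p * q + twist xomega_deg 1 p * xomega_diff X q"
  unfolding xomega_diff_def by (rule der_ext_mult)

context reduced_sset
begin

abbreviation Xwords :: "('x, 'k::comm_ring_1) xletter word set" where
  "Xwords \<equiv> words (xomega_letters X)"

lemma xomega_letter_cases:
  assumes "l \<in> xomega_letters X"
  obtains s where "l = Cell s" "s \<in> omega_letters X" | f where "l = Inv f" "set_like X f"
  using assms by (auto simp: xomega_letters_def)

lemma xomega_diff_letter_supported:
  "l \<in> xomega_letters X \<Longrightarrow> (case l of Cell s \<Rightarrow> xomega_incl (omega_diff X (bas (Word [s]))) | Inv f \<Rightarrow> 0) \<in>
    supported {v \<in> (Xwords :: ('x, 'k::comm_ring_1) xletter word set). wdeg xomega_deg v + 1 = xomega_deg l}"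
proof (erule xomega_letter_cases)
  fix s assume l: "l = Cell s" "s \<in> omega_letters X"
  have "xomega_incl (omega_diff X (bas (Word [s]) :: ('x, 'k) omega)) \<in>
      supported {v \<in> Xwords. wdeg xomega_deg v + 1 = omega_deg s}"
  proof (cases "omega_deg s")
    case 0
    then have "omega_diff X (bas (Word [s]) :: ('x, 'k) omega) = 0"
      using omega_diff_letter_supported[OF l(2), where 'k = 'k] by (auto simp: supported_def)
    then show ?thesis by simp
  next
    case (Suc n)
    then show ?thesis
      using xomega_incl_supported[of "omega_diff X (bas (Word [s]) :: ('x, 'k) omega)" X n]
        omega_diff_letter_supported[OF l(2), where 'k = 'k] by simp
  qed
  then show ?thesis by (simp add: l)
qed simp

lemma xomega_diff_supported:
  "w \<in> Xwords \<Longrightarrow> xomega_diff X (bas w) \<in> supported {v \<in> Xwords. wdeg xomega_deg v + 1 = wdeg xomega_deg w}"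
  unfolding xomega_diff_def by (rule supported_der_ext[OF xomega_diff_letter_supported])

lemma twist_xomega_diff:
  "p \<in> supported Xwords \<Longrightarrow> twist xomega_deg k (xomega_diff X p) = scale ((-1) ^ k) (xomega_diff X (twist xomega_deg k p))"
  unfolding xomega_diff_def by (rule twist_der_ext[OF xomega_diff_letter_supported])

lemma xomega_diff_incl_bas:
  assumes "w \<in> \<Omega>words"
  shows "xomega_diff X (xomega_incl (bas w)) = xomega_incl (omega_diff X (bas w))"
  unfolding xomega_diff_def xomega_incl_def omega_diff_def
proof (rule der_morphism[where B = "omega_letters X" and B' = UNIV, OF _ _ assms])
qed (simp_all add: omega_diff_def xomega_incl_def)

lemma xomega_diff_incl:
  assumes "p \<in> supported \<Omega>words"
  shows "xomega_diff X (xomega_incl p) = xomega_incl (omega_diff X p)"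
proof (rule klin_eqI[where f = "\<lambda>p. xomega_diff X (xomega_incl p)" and g = "\<lambda>p. xomega_incl (omega_diff X p)"])
qed (use assms in \<open>auto intro: klin_comp klin_xomega_diff klin_xomega_incl klin_omega_diff xomega_diff_incl_bas dest: supportedD\<close>)

lemma xomega_diff_diff:
  assumes "w \<in> Xwords"
  shows "xomega_diff X (xomega_diff X (bas w)) = (0 :: ('x, 'k::comm_ring_1) xomega)"
  unfolding xomega_diff_def
proof (rule der_ext_der_ext[OF xomega_diff_letter_supported _ assms])
  fix l assume "l \<in> (xomega_letters X :: ('x, 'k) xletter set)"
  then show "der_ext xomega_deg (\<lambda>l. case l of Cell s \<Rightarrow> xomega_incl (omega_diff X (bas (Word [s]))) | Inv f \<Rightarrow> 0)
       (case l of Cell s \<Rightarrow> xomega_incl (omega_diff X (bas (Word [s]))) | Inv f \<Rightarrow> 0) = (0 :: ('x, 'k) xomega)"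
  proof (cases rule: xomega_letter_cases)
    case (1 s)
    have "xomega_diff X (xomega_incl (omega_diff X (bas (Word [s]) :: ('x, 'k) omega))) = 0"
      using omega_diff_letter_supported[OF 1(2), where 'k = 'k] omega_diff_diff_letter[OF 1(2), where 'k = 'k]
      by (subst xomega_diff_incl) (auto elim: supported_mono)
    then show ?thesis by (simp add: 1 xomega_diff_def)
  qed simp
qed

lemma set_like_supported: "set_like X f \<Longrightarrow> f \<in> supported {w \<in> \<Omega>words. wdeg omega_deg w = 0}"
  by (simp add: set_like_def)

lemma xomega_incl_set_like_supported:
  "set_like X f \<Longrightarrow> xomega_incl f \<in> supported {w \<in> Xwords. wdeg xomega_deg w = 0}"
  by (rule xomega_incl_supported[OF set_like_supported])

lemma omega_diff_set_like: "set_like X f \<Longrightarrow> omega_diff X f = 0"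
proof -
  assume f: "set_like X f"
  have "omega_diff X f \<in> supported {}"
    unfolding klin_eq_lin[OF klin_omega_diff, of f]
  proof (rule supported_lin)
    fix w assume "w \<in> Poly_Mapping.keys f"
    from supportedD[OF set_like_supported[OF f] this] have w: "w \<in> \<Omega>words" "wdeg omega_deg w = 0" by auto
    show "omega_diff X (bas w) \<in> supported {}"
      using omega_diff_supported[OF w(1)] w(2) by (auto simp: supported_def)
  qed
  then show ?thesis by (simp add: supported_def)
qed

text \<open>The middle factor r of a relation is a cycle of degree 0, because set-like elements have
  degree 0 and their differential would have degree -1. So the differential and \<open>twist\<close>
  act on the outer words only.\<close>

lemma xomega_rel_cases:
  assumes "x \<in> xomega_rel X"
  obtains u v r where "x = bas u * r * bas v" "r \<in> xomega_rel X" "xomega_diff X r = 0"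
    "\<And>k. twist xomega_deg k r = r"
proof -
  obtain u r v f where x: "x = bas u * r * bas v" and f: "set_like X f"
    and r: "r = xomega_incl f * bas (Word [Inv f]) - 1 \<or> r = bas (Word [Inv f]) * xomega_incl f - 1"
    using assms unfolding xomega_rel_def by blast
  have t: "twist xomega_deg k (xomega_incl f) = xomega_incl f" for k
    using twist_homog[of "xomega_incl f" xomega_deg 0 k] supportedD[OF xomega_incl_set_like_supported[OF f]] by auto
  have "xomega_diff X (xomega_incl f) = 0"
    using xomega_diff_incl[OF supported_mono[OF set_like_supported[OF f]]] omega_diff_set_like[OF f] by auto
  then have "xomega_diff X r = 0" using r by (auto simp: xomega_diff_mult)
  moreover have "twist xomega_deg k r = r" for k using r t[of k] by (auto simp: twist_mult)
  moreover have "bas 0 * r * bas 0 \<in> xomega_rel X" using f r unfolding xomega_rel_def by blast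
  ultimately show ?thesis using that x by simp
qed

lemma xomega_diff_eqv: "p \<approx> q \<Longrightarrow> xomega_diff X p \<approx> xomega_diff X q"
proof (rule klin_eqv[OF klin_xomega_diff])
  fix x assume "x \<in> xomega_rel X"
  then obtain u v r where x: "x = bas u * r * bas v" and r: "r \<in> xomega_rel X" "xomega_diff X r = 0"
    "\<And>k. twist xomega_deg k r = r" by (rule xomega_rel_cases) blast
  have "xomega_diff X x = xomega_diff X (bas u) * r * bas v + twist xomega_deg 1 (bas u) * r * xomega_diff X (bas v)"
    by (simp add: x xomega_diff_mult twist_mult r distrib_right mult.assoc del: twist_bas)
  also have "\<dots> \<in> free_module.span (xomega_rel X)"
    by (intro free_module.span_add ideal_gens_mult[OF Jideal] free_module.span_base r)
  finally show "xomega_diff X x \<in> free_module.span (xomega_rel X)" .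
qed

lemma twist_eqv: "p \<approx> q \<Longrightarrow> twist xomega_deg k p \<approx> twist xomega_deg k q"
proof (rule klin_eqv[OF klin_twist])
  fix x assume "x \<in> xomega_rel X"
  then obtain u v r where x: "x = bas u * r * bas v" and r: "r \<in> xomega_rel X" "xomega_diff X r = 0"
    "\<And>k. twist xomega_deg k r = r" by (rule xomega_rel_cases) blast
  have "twist xomega_deg k x = twist xomega_deg k (bas u) * r * twist xomega_deg k (bas v)"
    by (simp add: x twist_mult r del: twist_bas)
  also have "\<dots> \<in> free_module.span (xomega_rel X)"
    by (intro ideal_gens_mult[OF Jideal] free_module.span_base r)
  finally show "twist xomega_deg k x \<in> free_module.span (xomega_rel X)" .
qed

text \<open>The differential of a letter consists of words of length 1 and 2, hence lies in the
  augmentation ideal, and so does every product that contains it.\<close>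

lemma omega_counit_diff:
  assumes "w \<in> \<Omega>words"
  shows "lin conv_unit (omega_diff X (bas w)) = (0 :: 'g word \<Rightarrow>\<^sub>0 'k::comm_ring_1)"
proof -
  have c0: "conv_unit (u :: 'x simplex word) = (0 :: 'g word \<Rightarrow>\<^sub>0 'k)" if "letters u \<noteq> []" for u
    using that by (cases "letters u") (auto simp: conv_unit_def omega_counit_def)
  have mult0: "lin conv_unit (p * q) = (0 :: 'g word \<Rightarrow>\<^sub>0 'k)" if "lin conv_unit p = (0 :: 'g word \<Rightarrow>\<^sub>0 'k) \<or> lin conv_unit q = (0 :: 'g word \<Rightarrow>\<^sub>0 'k)" for p q
  proof -
    have e: "lin conv_unit p = (scalar (omega_counit p) :: 'g word \<Rightarrow>\<^sub>0 'k)" for p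
      unfolding omega_counit_def scalar_ext_eq_lin conv_unit_def by simp
    have "omega_counit p = 0 \<or> omega_counit q = 0"
      using that unfolding e by (metis scalar_def scalar_inj scale_simps(2))
    then show ?thesis unfolding e by (auto simp: omega_counit_def scalar_ext_mult scalar_def)
  qed
  have l: "lin conv_unit (cobar_gen p) = (0 :: 'g word \<Rightarrow>\<^sub>0 'k)" for p
    by (simp add: cobar_gen_def lin_lin if_distrib[of "lin _"] c0 cong: if_cong)
  have d: "lin conv_unit (omega_diff X (bas (Word [s]))) = (0 :: 'g word \<Rightarrow>\<^sub>0 'k)" for s
    unfolding omega_diff_letter by (simp only: lin_simps l) (simp add: lin_lin mult0 l del: cobar_gen_simps)
  show ?thesis using assms
  proof (induction rule: word_induct)
    case (Cons g w)
    have "omega_diff X (bas (Word [g] + w) :: ('x, 'k) omega) = omega_diff X (bas (Word [g])) * bas w + twist omega_deg 1 (bas (Word [g])) * omega_diff X (bas w)"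
      unfolding omega_diff_def by (rule der_ext_bas_add)
    then show ?case using Cons by (simp add: mult0 d del: twist_bas)
  qed simp
qed

text \<open>Applying the differential D to S * i = \<epsilon>, and evaluating S * i on Dw, where
  \<epsilon> is 0, gives two expansions that vanish modulo the ideal. They share the terms with the
  differential on i, so (D S) * i = (S D) * i, and i cancels on the right.\<close>

lemma omega_antipode_diff:
  assumes "w \<in> \<Omega>words"
  shows "xomega_diff X (Oanti w) \<approx> (anti_cell (omega_diff X (bas w)) :: ('x, 'k::comm_ring_1) xomega)"
proof -
  let ?D = "xomega_diff X :: ('x, 'k) xomega \<Rightarrow> _"
  have anti_supp: "(Oanti u :: ('x, 'k) xomega) \<in> supported {v \<in> Xwords. wdeg xomega_deg v = wdeg omega_deg u}"
    if "u \<in> \<Omega>words" for u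
    by (rule supported_anti_ext[OF antipode_cell_supported that])
  have "conv (\<lambda>u. ?D (Oanti u)) Oincl w \<approx> conv (\<lambda>u. anti_cell (omega_diff X (bas u))) Oincl w" if w: "w \<in> \<Omega>words" for w
  proof -
    have "?D (conv Oanti Oincl w) = lin (\<lambda>x. ?D (Oanti (fst x) * Oincl (snd x))) (omega_coprod X (bas w))"
      unfolding conv_def by (rule klin_compose_lin[OF klin_xomega_diff])
    also have "\<dots> = lin (\<lambda>x. ?D (Oanti (fst x)) * Oincl (snd x) +
       scale ((-1) ^ wdeg omega_deg (fst x)) (Oanti (fst x) * xomega_incl (omega_diff X (bas (snd x))))) (omega_coprod X (bas w))"
    proof (rule lin_cong[OF refl])
      fix x assume "x \<in> Poly_Mapping.keys (omega_coprod X (bas w) :: _ \<Rightarrow>\<^sub>0 'k)"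
      note x = omega_coprod_words[OF w this]
      have "twist xomega_deg 1 (Oanti (fst x) :: ('x, 'k) xomega) = scale ((-1) ^ (1 * wdeg omega_deg (fst x))) (Oanti (fst x))"
        by (rule twist_homog) (use supportedD[OF anti_supp[OF x(1)]] in auto)
      then show "?D (Oanti (fst x) * Oincl (snd x)) = ?D (Oanti (fst x)) * Oincl (snd x) +
         scale ((-1) ^ wdeg omega_deg (fst x)) (Oanti (fst x) * xomega_incl (omega_diff X (bas (snd x))))"
        by (simp add: xomega_diff_mult xomega_diff_incl_bas[OF x(2)] scale_mult_left)
    qed
    finally have 1: "?D (conv Oanti Oincl w) = conv (\<lambda>u. ?D (Oanti u)) Oincl w +
       lin (\<lambda>x. scale ((-1) ^ wdeg omega_deg (fst x)) (Oanti (fst x) * xomega_incl (omega_diff X (bas (snd x))))) (omega_coprod X (bas w))"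
      by (simp add: lin_add_fun conv_def)
    define CV :: "_ \<Rightarrow> ('x, 'k) xomega" where "CV = lin (\<lambda>x. Oanti (fst x) * Oincl (snd x))"
    have kl: "klin CV" by (simp add: CV_def)
    have T: "CV (tens P Q) = anti_cell P * xomega_incl Q" for P Q
      unfolding CV_def lin_tens
      by (simp add: klin_eq_lin[OF klin_xomega_incl, of Q] klin_eq_lin[OF klin_anti_ext, of _ _ P] lin_mult_lin)
    have "CV (omega_coprod X (omega_diff X (bas w))) = CV (tens_der omega_deg (omega_diff X) (omega_coprod X (bas w)))"
      by (simp add: omega_coder[OF w])
    also have "\<dots> = lin (\<lambda>x. anti_cell (omega_diff X (bas (fst x))) * Oincl (snd x) +
       scale ((-1) ^ wdeg omega_deg (fst x)) (Oanti (fst x) * xomega_incl (omega_diff X (bas (snd x))))) (omega_coprod X (bas w))"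
      by (simp add: tens_der_def klin_compose_lin[OF kl] klin_add[OF kl] klin_scale[OF kl] T)
    finally have 2: "CV (omega_coprod X (omega_diff X (bas w))) = conv (\<lambda>u. anti_cell (omega_diff X (bas u))) Oincl w +
       lin (\<lambda>x. scale ((-1) ^ wdeg omega_deg (fst x)) (Oanti (fst x) * xomega_incl (omega_diff X (bas (snd x))))) (omega_coprod X (bas w))"
      by (simp add: lin_add_fun conv_def)
    have "CV (omega_coprod X (omega_diff X (bas w))) = lin (conv Oanti Oincl) (omega_diff X (bas w))"
      by (subst klin_eq_lin[OF klin_omega_coprod, of "omega_diff X (bas w)"])
        (simp add: klin_compose_lin[OF kl], simp add: CV_def conv_def[abs_def])
    also have "\<dots> \<approx> lin conv_unit (omega_diff X (bas w))"
      using supportedD[OF omega_diff_supported[OF w]] by (intro eqv_lin antipode_left) auto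
    also have "lin conv_unit (omega_diff X (bas w)) = (0 :: ('x, 'k) xomega)"
      using omega_counit_diff[OF w] by simp
    finally have 3: "CV (omega_coprod X (omega_diff X (bas w))) \<approx> 0" .
    have "?D (conv Oanti Oincl w) \<approx> ?D (conv_unit w)"
      by (intro xomega_diff_eqv antipode_left w)
    then have 4: "?D (conv Oanti Oincl w) \<approx> 0" by (simp add: conv_unit_def)
    \<comment> \<open>The expansions \<open>1\<close> and \<open>2\<close> have the same second
      summand, the one in which the differential falls on the inclusion.\<close>
    show ?thesis using eqv_diff[OF eqv_trans[OF 4 eqv_sym[OF 3]] eqv_refl] unfolding 1 2
      by (metis (no_types, lifting) add_diff_cancel_right')
  qed
  then show ?thesis
    by (intro conv_cancel[OF Jideal antipode_right _ assms, where f = "\<lambda>u. ?D (Oanti u)"]) auto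
qed

end

section \<open>The antipode of the extended cobar construction\<close>

lemma alg_ext_letter: "alg_ext h (bas (Word [g])) = h g"
  by (simp add: alg_ext_def)

lemma alg_ext_id: "alg_ext (\<lambda>l. bas (Word [l])) p = p"
proof (rule klin_eqI[OF klin_alg_ext klin_intros(1)])
  fix w :: "'a word"
  have "w \<in> words UNIV" by simp
  then show "alg_ext (\<lambda>l. bas (Word [l])) (bas w) = bas w"
    by (induction rule: word_induct) (simp_all add: alg_ext_bas_add bas_mult alg_ext_letter)
qed

context reduced_sset
begin

text \<open>The formal inverse of a set-like f is set-like as well, so an antipode has to send it to
  f.\<close>

definition xanti :: "('x, 'k::comm_ring_1) xomega \<Rightarrow> ('x, 'k) xomega" where
  "xanti = anti_ext xomega_deg (\<lambda>l. case l of Cell s \<Rightarrow> antipode_cell X s | Inv f \<Rightarrow> xomega_incl f)"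

lemma klin_xanti: "klin xanti"
  by (simp add: xanti_def klin_anti_ext)

lemma xanti_incl: "xanti (xomega_incl p) = anti_cell p"
proof (rule klin_eqI[where f = "\<lambda>p. xanti (xomega_incl p)", OF klin_comp[OF klin_xanti klin_xomega_incl] klin_anti_ext])
  fix w :: "'x simplex word"
  have "w \<in> words UNIV" by simp
  then show "xanti (xomega_incl (bas w)) = anti_cell (bas w :: ('x, 'a) omega)"
  proof (induction rule: word_induct)
    case (Cons s w)
    have "cell_word (Word [s] + w) = (Word [Cell s] + cell_word w :: ('x, 'a) xletter word)"
      by (simp add: plus_word_def)
    then show ?case using Cons
      by (simp add: xomega_incl_bas xanti_def anti_ext_bas_add)
  qed (simp add: xanti_def)
qed

lemma xomega_coprod_letter_supported:
  assumes "l \<in> xomega_letters X"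
  shows "(case l of Cell s \<Rightarrow> lin (\<lambda>(u, v). tens (xomega_incl (bas u)) (xomega_incl (bas v))) (omega_coprod X (bas (Word [s])))
     | Inv f \<Rightarrow> bas (Word [Inv f], Word [Inv f])) \<in>
    supported (word_pairs xomega_deg (xomega_letters X :: ('x, 'k::comm_ring_1) xletter set) (xomega_deg l))"
  using assms
proof (cases rule: xomega_letter_cases)
  case (1 s)
  show ?thesis
    unfolding 1 loc_letter.case
    using supportedD[OF omega_coprod_letter_supported[OF 1(2), where 'k = 'k]]
    by (intro supported_lin) (auto simp: xomega_incl_bas word_pairs_def intro!: supported_bas cell_word_in simp del: supported_bas)
next
  case (2 f)
  then show ?thesis using assms by (simp add: word_pairs_def)
qed

lemma xomega_coprod_supported:
  "w \<in> Xwords \<Longrightarrow> xomega_coprod X (bas w) \<in> supported (word_pairs xomega_deg (xomega_letters X) (wdeg xomega_deg w))"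
  unfolding xomega_coprod_def by (rule supported_tens_alg_ext[OF xomega_coprod_letter_supported])

lemma klin_xomega_coprod: "klin (xomega_coprod X)"
  by (simp add: xomega_coprod_def klin_tens_alg_ext)

lemma xomega_coprod_incl:
  assumes "w \<in> \<Omega>words"
  shows "xomega_coprod X (xomega_incl (bas w)) = pair_map xomega_incl (omega_coprod X (bas w) :: _ \<Rightarrow>\<^sub>0 'k::comm_ring_1)"
  unfolding xomega_coprod_def xomega_incl_def omega_coprod_def
proof (rule coprod_morphism[where B = "omega_letters X" and B' = UNIV, OF _ omega_coprod_letter_supported' _ assms])
  fix s assume "s \<in> omega_letters X"
  show "tens_alg_ext xomega_deg (\<lambda>l. case l of
      Cell s \<Rightarrow> lin (\<lambda>(u, v). tens (alg_ext (\<lambda>s. bas (Word [Cell s])) (bas u)) (alg_ext (\<lambda>s. bas (Word [Cell s])) (bas v)))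
        (tens_alg_ext omega_deg (\<lambda>s. if fst s = 1 then tens 1 1 - coprod_I X s else scale ((- 1) ^ fst s) (coprod_I X s)) (bas (Word [s])))
     | Inv f \<Rightarrow> bas (Word [Inv f], Word [Inv f])) (bas (Word [Cell s])) =
    (pair_map (alg_ext (\<lambda>s. bas (Word [Cell s])))
       (if fst s = 1 then tens 1 1 - coprod_I X s else scale ((- 1) ^ fst s) (coprod_I X s)) :: _ \<Rightarrow>\<^sub>0 'k)"
    by (simp add: pair_map_def split_def)
qed (auto simp: omega_deg_def)

lemma xanti_right:
  assumes "w \<in> Xwords"
  shows "lin (\<lambda>x. bas (fst x) * xanti (bas (snd x))) (xomega_coprod X (bas w)) \<approx> (scale (xomega_counit (bas w)) 1 :: ('x, 'k::comm_ring_1) xomega)"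
proof -
  have "lin (\<lambda>x. alg_ext (\<lambda>l. bas (Word [l])) (bas (fst x)) * xanti (bas (snd x))) (xomega_coprod X (bas w)) \<approx>
      (scale (xomega_counit (bas w)) 1 :: ('x, 'k) xomega)"
    unfolding xomega_coprod_def xomega_counit_def xanti_def
  proof (rule antipode_right_ext[OF Jideal xomega_coprod_letter_supported _ _ assms])
    fix l :: "('x, 'k) xletter"
    assume l: "l \<in> xomega_letters X"
    show "(case l of Cell s \<Rightarrow> omega_counit (bas (Word [s]) :: ('x, 'k) omega) | Inv f \<Rightarrow> 1) \<noteq> 0 \<Longrightarrow> xomega_deg l = 0"
      using l by (cases rule: xomega_letter_cases) (simp_all add: omega_counit_def)
    show "lin (\<lambda>x. alg_ext (\<lambda>l. bas (Word [l])) (bas (fst x)) * anti_ext xomega_deg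
          (\<lambda>l. case l of Cell s \<Rightarrow> antipode_cell X s | Inv f \<Rightarrow> xomega_incl f) (bas (snd x)))
        (case l of Cell s \<Rightarrow> lin (\<lambda>(u, v). tens (xomega_incl (bas u)) (xomega_incl (bas v))) (omega_coprod X (bas (Word [s])))
         | Inv f \<Rightarrow> bas (Word [Inv f], Word [Inv f])) \<approx>
        (scale (case l of Cell s \<Rightarrow> omega_counit (bas (Word [s]) :: ('x, 'k) omega) | Inv f \<Rightarrow> 1) 1 :: ('x, 'k) xomega)"
      unfolding xanti_def[symmetric] alg_ext_id using l
    proof (cases rule: xomega_letter_cases)
      case (1 s)
      have "lin (\<lambda>x. bas (fst x) * xanti (bas (snd x))) (lin (\<lambda>(u, v). tens (xomega_incl (bas u)) (xomega_incl (bas v))) (omega_coprod X (bas (Word [s])))) =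
         (conv Oincl Oanti (Word [s]) :: ('x, 'k) xomega)"
        by (simp add: lin_lin conv_def split_def xomega_incl_bas) (simp add: xomega_incl_bas[symmetric] xanti_incl)
      then show "lin (\<lambda>x. bas (fst x) * xanti (bas (snd x)))
        (case l of Cell s \<Rightarrow> lin (\<lambda>(u, v). tens (xomega_incl (bas u)) (xomega_incl (bas v))) (omega_coprod X (bas (Word [s])))
         | Inv f \<Rightarrow> bas (Word [Inv f], Word [Inv f])) \<approx>
        (scale (case l of Cell s \<Rightarrow> omega_counit (bas (Word [s]) :: ('x, 'k) omega) | Inv f \<Rightarrow> 1) 1 :: ('x, 'k) xomega)"
        using antipode_right[of "Word [s]", where 'k = 'k] 1(2) by (simp add: 1(1) conv_unit_def)
    next
      case (2 f)
      then show "lin (\<lambda>x. bas (fst x) * xanti (bas (snd x)))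
        (case l of Cell s \<Rightarrow> lin (\<lambda>(u, v). tens (xomega_incl (bas u)) (xomega_incl (bas v))) (omega_coprod X (bas (Word [s])))
         | Inv f \<Rightarrow> bas (Word [Inv f], Word [Inv f])) \<approx>
        (scale (case l of Cell s \<Rightarrow> omega_counit (bas (Word [s]) :: ('x, 'k) omega) | Inv f \<Rightarrow> 1) 1 :: ('x, 'k) xomega)"
        using inverse_left[OF 2(2)] by (simp add: xanti_def)
    qed
  qed
  then show ?thesis by (simp only: alg_ext_id)
qed

lemma xanti_left:
  assumes "w \<in> Xwords"
  shows "lin (\<lambda>x. xanti (bas (fst x)) * bas (snd x)) (xomega_coprod X (bas w)) \<approx> (scale (xomega_counit (bas w)) 1 :: ('x, 'k::comm_ring_1) xomega)"
proof -
  have "lin (\<lambda>x. xanti (bas (fst x)) * alg_ext (\<lambda>l. bas (Word [l])) (bas (snd x))) (xomega_coprod X (bas w)) \<approx>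
      (scale (xomega_counit (bas w)) 1 :: ('x, 'k) xomega)"
    unfolding xomega_coprod_def xomega_counit_def xanti_def
  proof (rule antipode_left_ext[OF Jideal xomega_coprod_letter_supported _ _ assms])
    fix l :: "('x, 'k) xletter"
    assume l: "l \<in> xomega_letters X"
    show "(case l of Cell s \<Rightarrow> omega_counit (bas (Word [s]) :: ('x, 'k) omega) | Inv f \<Rightarrow> 1) \<noteq> 0 \<Longrightarrow> xomega_deg l = 0"
      using l by (cases rule: xomega_letter_cases) (simp_all add: omega_counit_def)
    show "lin (\<lambda>x. anti_ext xomega_deg
          (\<lambda>l. case l of Cell s \<Rightarrow> antipode_cell X s | Inv f \<Rightarrow> xomega_incl f) (bas (fst x)) * alg_ext (\<lambda>l. bas (Word [l])) (bas (snd x)))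
        (case l of Cell s \<Rightarrow> lin (\<lambda>(u, v). tens (xomega_incl (bas u)) (xomega_incl (bas v))) (omega_coprod X (bas (Word [s])))
         | Inv f \<Rightarrow> bas (Word [Inv f], Word [Inv f])) \<approx>
        (scale (case l of Cell s \<Rightarrow> omega_counit (bas (Word [s]) :: ('x, 'k) omega) | Inv f \<Rightarrow> 1) 1 :: ('x, 'k) xomega)"
      unfolding xanti_def[symmetric] alg_ext_id using l
    proof (cases rule: xomega_letter_cases)
      case (1 s)
      have "lin (\<lambda>x. xanti (bas (fst x)) * bas (snd x)) (lin (\<lambda>(u, v). tens (xomega_incl (bas u)) (xomega_incl (bas v))) (omega_coprod X (bas (Word [s])))) =
         (conv Oanti Oincl (Word [s]) :: ('x, 'k) xomega)"
        by (simp add: lin_lin conv_def split_def xomega_incl_bas) (simp add: xomega_incl_bas[symmetric] xanti_incl)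
      then show "lin (\<lambda>x. xanti (bas (fst x)) * bas (snd x))
        (case l of Cell s \<Rightarrow> lin (\<lambda>(u, v). tens (xomega_incl (bas u)) (xomega_incl (bas v))) (omega_coprod X (bas (Word [s])))
         | Inv f \<Rightarrow> bas (Word [Inv f], Word [Inv f])) \<approx>
        (scale (case l of Cell s \<Rightarrow> omega_counit (bas (Word [s]) :: ('x, 'k) omega) | Inv f \<Rightarrow> 1) 1 :: ('x, 'k) xomega)"
        using antipode_left[of "Word [s]", where 'k = 'k] 1(2) by (simp add: 1(1) conv_unit_def)
    next
      case (2 f)
      then show "lin (\<lambda>x. xanti (bas (fst x)) * bas (snd x))
        (case l of Cell s \<Rightarrow> lin (\<lambda>(u, v). tens (xomega_incl (bas u)) (xomega_incl (bas v))) (omega_coprod X (bas (Word [s])))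
         | Inv f \<Rightarrow> bas (Word [Inv f], Word [Inv f])) \<approx>
        (scale (case l of Cell s \<Rightarrow> omega_counit (bas (Word [s]) :: ('x, 'k) omega) | Inv f \<Rightarrow> 1) 1 :: ('x, 'k) xomega)"
        using inverse_right[OF 2(2)] by (simp add: xanti_def)
    qed
  qed
  then show ?thesis by (simp only: alg_ext_id)
qed

lemma xanti_supported:
  "w \<in> Xwords \<Longrightarrow> xanti (bas w) \<in> supported {v \<in> Xwords. wdeg xomega_deg v = wdeg xomega_deg w}"
  unfolding xanti_def
  by (rule supported_anti_ext)
    (auto elim!: xomega_letter_cases simp: antipode_cell_supported xomega_incl_set_like_supported)

lemma xomega_ideal_supported: "x \<in> xomega_ideal X \<Longrightarrow> x \<in> supported Xwords"
  unfolding xomega_ideal_def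
proof (induction rule: free_module.span_induct_alt)
  case (step c x y)
  then obtain u v r f where x: "x = bas u * r * bas v" and uv: "u \<in> Xwords" "v \<in> Xwords" and f: "set_like X f"
    and r: "r = xomega_incl f * bas (Word [Inv f]) - 1 \<or> r = bas (Word [Inv f]) * xomega_incl f - 1" by blast
  have "xomega_incl f \<in> supported Xwords"
    using xomega_incl_set_like_supported[OF f] by (auto elim: supported_mono)
  moreover have "bas (Word [Inv f]) \<in> supported Xwords" using f by (auto simp: xomega_letters_def)
  ultimately have "r \<in> supported Xwords"
    using r by (auto intro!: supported_diff supported_mult[of _ Xwords _ Xwords] simp: supported_iff[of 1])
  then have "x \<in> supported Xwords"
    using uv unfolding x by (intro supported_mult[of _ Xwords _ Xwords] supported_bas) auto
  with step show ?case by (intro supported_add supported_scale)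
qed simp

text \<open>Evaluating the convolution identities on f, whose coproduct is f \<otimes> f, shows that
  the antipode inverts f. For a general set-like element this is a consequence of the construction
  on cells and not part of it.\<close>

lemma set_like_anti:
  fixes f :: "('x, 'k::comm_ring_1) omega"
  assumes "set_like X f"
  shows "xomega_incl f * anti_cell f \<approx> 1" and "anti_cell f * xomega_incl f \<approx> 1"
proof -
  have f: "f \<in> supported \<Omega>words" using set_like_supported[OF assms] by (auto elim: supported_mono)
  have t: "omega_coprod X f = tens f f" and e: "omega_counit f = 1" using assms by (auto simp: set_like_def)
  have unit: "lin conv_unit f = (scale (omega_counit f) 1 :: ('x, 'k) xomega)"
  proof -
    have "(scalar (omega_counit f) :: ('x, 'k) xomega) = lin (\<lambda>w. scale (omega_counit (bas w)) 1) f"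
      by (simp add: omega_counit_def scalar_ext_eq_lin)
    then show ?thesis by (simp only: conv_unit_def[abs_def] scalar_def)
  qed
  have "lin (conv Oincl Oanti) f = xomega_incl f * anti_cell f" "lin (conv Oanti Oincl) f = anti_cell f * xomega_incl f"
  proof -
    have *: "lin (conv P Q) f = lin P f * (lin Q f :: ('x, 'k) xomega)" for P Q
    proof -
      have "lin (conv P Q) f = lin (\<lambda>x. P (fst x) * Q (snd x)) (omega_coprod X f)"
        by (subst klin_eq_lin[OF klin_omega_coprod, of f]) (simp add: lin_lin conv_def[abs_def])
      then show ?thesis by (simp add: t lin_tens lin_mult_lin)
    qed
    show "lin (conv Oincl Oanti) f = xomega_incl f * anti_cell f" "lin (conv Oanti Oincl) f = anti_cell f * xomega_incl f"
      unfolding * by (simp_all add: klin_eq_lin[OF klin_xomega_incl, symmetric] klin_eq_lin[OF klin_anti_ext, symmetric])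
  qed
  moreover have "lin (conv Oincl Oanti) f \<approx> lin conv_unit f" "lin (conv Oanti Oincl) f \<approx> lin conv_unit f"
    using supportedD[OF f] by (auto intro!: eqv_lin antipode_right antipode_left)
  ultimately show "xomega_incl f * anti_cell f \<approx> 1" "anti_cell f * xomega_incl f \<approx> 1"
    by (simp_all add: unit e)
qed

text \<open>Reversing a relation u r v exchanges u and v up to a sign, and r itself contributes no
  sign since it has degree 0. The reversed r says that \<open>anti_cell f\<close> is inverse to f,
  which is \<open>set_like_anti\<close>.\<close>

lemma xanti_eqv: "p \<approx> q \<Longrightarrow> xanti p \<approx> xanti q"
proof (rule klin_eqv[OF klin_xanti])
  fix x assume "x \<in> (xomega_rel X :: ('x, 'a) xomega set)"
  then obtain u r v f where x: "x = bas u * r * bas v" and f: "set_like X f"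
    and r: "r = xomega_incl f * bas (Word [Inv f]) - 1 \<or> r = bas (Word [Inv f]) * xomega_incl f - 1"
    unfolding xomega_rel_def by blast
  have m0: "xanti (p * q) = xanti q * xanti p"
    if "p \<in> supported {w. wdeg xomega_deg w = 0} \<or> q \<in> supported {w. wdeg xomega_deg w = 0}" for p q :: "('x, 'a) xomega"
  proof -
    have "xanti (p * q) = lin (\<lambda>u. lin (\<lambda>v. xanti (bas v) * xanti (bas u)) q) p"
      unfolding mult_eq_lin[of p q] klin_compose_lin[OF klin_xanti]
      by (intro lin_cong refl) (use that in \<open>auto simp: xanti_def anti_ext_bas_add dest: supportedD\<close>)
    also have "\<dots> = xanti q * xanti p"
      by (subst lin_swap) (simp add: klin_eq_lin[OF klin_xanti, of q] klin_eq_lin[OF klin_xanti, of p] lin_mult_lin)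
    finally show ?thesis .
  qed
  have fd: "xomega_incl f \<in> supported {w. wdeg xomega_deg w = 0}"
    using xomega_incl_set_like_supported[OF f] by (auto elim: supported_mono)
  have rd: "r \<in> supported {w. wdeg xomega_deg w = 0}"
    using r fd by (auto intro!: supported_diff supported_mult[of _ "{w. wdeg xomega_deg w = 0}" _ "{w. wdeg xomega_deg w = 0}"] simp: supported_iff[of 1])
  have "r \<in> supported {w. wdeg xomega_deg w = 0}" by (rule rd)
  have tw: "xanti x = scale ((-1) ^ (wdeg xomega_deg u * wdeg xomega_deg v)) (xanti (bas v) * xanti r * xanti (bas u))"
  proof -
    have "xanti x = lin (\<lambda>a. xanti (bas (u + a + v))) r"
      by (simp add: x mult_eq_lin[of "bas u"] lin_mult_left bas_mult klin_compose_lin[OF klin_xanti])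
    also have "\<dots> = lin (\<lambda>a. scale ((-1) ^ (wdeg xomega_deg u * wdeg xomega_deg v)) (xanti (bas v) * xanti (bas a) * xanti (bas u))) r"
      by (intro lin_cong refl) (use rd in \<open>auto simp: xanti_def anti_ext_bas_add scale_mult_right mult.assoc dest: supportedD\<close>)
    also have "\<dots> = scale ((-1) ^ (wdeg xomega_deg u * wdeg xomega_deg v)) (xanti (bas v) * xanti r * xanti (bas u))"
      by (simp add: klin_eq_lin[OF klin_xanti, of r] lin_mult_left lin_mult_right scale_lin)
    finally show ?thesis .
  qed
  have "xanti r \<in> free_module.span (xomega_rel X)"
  proof -
    have i: "xanti (bas (Word [Inv f])) = xomega_incl f" "xanti 1 = 1" by (simp_all add: xanti_def)
    have "xanti r = xomega_incl f * anti_cell f - 1 \<or> xanti r = anti_cell f * xomega_incl f - 1"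
      using r fd by (auto simp: klin_diff[OF klin_xanti] m0 i xanti_incl)
    then show ?thesis using set_like_anti[OF f] by (auto simp: eqv_def)
  qed
  then show "xanti x \<in> free_module.span (xomega_rel X)"
    unfolding tw by (intro free_module.span_scale ideal_gens_mult[OF Jideal])
qed

text \<open>Existence, which gives the choice in \<open>antipode\<close> its defining
  property.\<close>

lemma is_antipode_xanti: "is_antipode X (xanti :: ('x, 'k::comm_ring_1) xomega \<Rightarrow> _)"
  unfolding is_antipode_def
proof (intro conjI ballI)
  show "Modules.module_hom scale scale (xanti :: ('x, 'k) xomega \<Rightarrow> _)"
    by (rule klin_module_hom[OF klin_xanti])
  show "xanti (bas w) \<in> supported {v \<in> Xwords. wdeg xomega_deg v = wdeg xomega_deg w}" if "w \<in> Xwords" for w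
    by (rule xanti_supported[OF that])
  have xs: "xanti x \<in> supported Xwords" if "x \<in> supported Xwords" for x :: "('x, 'k) xomega"
    unfolding klin_eq_lin[OF klin_xanti, of x]
    by (rule supported_lin) (auto intro!: supported_mono[OF xanti_supported] dest: supportedD[OF that])
  show "xanti ` xomega_ideal X \<subseteq> (xomega_ideal X :: ('x, 'k) xomega set)"
  proof
    fix y assume "y \<in> xanti ` (xomega_ideal X :: ('x, 'k) xomega set)"
    then obtain x where x: "x \<in> xomega_ideal X" "y = xanti x" by blast
    have "x \<approx> 0" using x xomega_ideal_subset by (auto simp: eqv_0)
    then have "xanti x \<approx> xanti 0" by (rule xanti_eqv)
    then have "y \<in> free_module.span (xomega_rel X)" by (simp add: x klin_0[OF klin_xanti] eqv_0)
    then show "y \<in> xomega_ideal X"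
      using x xs xomega_ideal_supported by (auto intro: span_xomega_rel_ideal)
  qed
  fix a :: "('x, 'k) xomega" assume a: "a \<in> supported Xwords"
  have c: "(scale (xomega_counit a) 1 :: ('x, 'k) xomega) = lin (\<lambda>w. scale (xomega_counit (bas w)) 1) a"
    unfolding xomega_counit_def using scalar_ext_eq_lin[of _ a] by (simp add: scalar_def)
  have pw: "fst x \<in> Xwords \<and> snd x \<in> Xwords" if "x \<in> Poly_Mapping.keys (xomega_coprod X (bas w))" "w \<in> Poly_Mapping.keys a" for x w
    using supportedD[OF xomega_coprod_supported[OF supportedD[OF a that(2)]] that(1)] by (auto simp: word_pairs_def)
  have c1: "(scale (xomega_counit a) 1 :: ('x, 'k) xomega) \<in> supported Xwords"
    by (intro supported_scale) (simp add: supported_iff)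
  \<comment> \<open>Turns a congruence modulo \<open>xomega_rel X\<close> into membership in
    \<open>xomega_ideal X\<close>, at the price of controlling supports.\<close>
  have key: "lin (\<lambda>x. F (fst x) (snd x)) (xomega_coprod X a) - scale (xomega_counit a) 1 \<in> xomega_ideal X"
    if F: "\<And>w. w \<in> Xwords \<Longrightarrow> lin (\<lambda>x. F (fst x) (snd x)) (xomega_coprod X (bas w)) \<approx> scale (xomega_counit (bas w)) 1"
      and Fs: "\<And>u v. u \<in> Xwords \<Longrightarrow> v \<in> Xwords \<Longrightarrow> F u v \<in> supported Xwords" for F :: "_ \<Rightarrow> _ \<Rightarrow> ('x, 'k) xomega"
  proof (rule span_xomega_rel_ideal)
    have e: "lin (\<lambda>x. F (fst x) (snd x)) (xomega_coprod X a) = lin (\<lambda>w. lin (\<lambda>x. F (fst x) (snd x)) (xomega_coprod X (bas w))) a"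
      by (subst klin_eq_lin[OF klin_xomega_coprod]) (simp add: lin_lin)
    have "lin (\<lambda>x. F (fst x) (snd x)) (xomega_coprod X a) \<approx> scale (xomega_counit a) 1"
      unfolding e c by (intro eqv_lin F) (auto dest: supportedD[OF a])
    then show "lin (\<lambda>x. F (fst x) (snd x)) (xomega_coprod X a) - scale (xomega_counit a) 1 \<in> free_module.span (xomega_rel X)"
      by (simp add: eqv_def)
    show "lin (\<lambda>x. F (fst x) (snd x)) (xomega_coprod X a) - scale (xomega_counit a) 1 \<in> supported Xwords"
      unfolding e by (intro supported_diff supported_lin Fs c1) (auto dest: pw)
  qed
  have sm: "p * q \<in> supported Xwords" if "p \<in> supported Xwords" "q \<in> supported Xwords" for p q :: "('x, 'k) xomega"
    by (rule supported_mult[OF that]) simp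
  show "lin (\<lambda>(u, v). xanti (bas u) * bas v) (xomega_coprod X a) - scale (xomega_counit a) 1 \<in> xomega_ideal X"
    unfolding split_def
    by (rule key[of "\<lambda>u v. xanti (bas u) * bas v"]) (auto intro!: xanti_left sm xs supported_bas simp del: supported_bas)
  show "lin (\<lambda>(u, v). bas u * xanti (bas v)) (xomega_coprod X a) - scale (xomega_counit a) 1 \<in> xomega_ideal X"
    unfolding split_def
    by (rule key[of "\<lambda>u v. bas u * xanti (bas v)"]) (auto intro!: xanti_right sm xs supported_bas simp del: supported_bas)
qed

lemma is_antipode_antipode: "is_antipode X (antipode X)"
  unfolding antipode_def by (rule someI[of "is_antipode X", OF is_antipode_xanti])

text \<open>Both sides are left convolution inverses of the inclusion modulo the ideal, and the
  inclusion has a right inverse. Hence every choice of an antipode has these values on the cobar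
  construction.\<close>

lemma antipode_incl:
  assumes "w \<in> \<Omega>words"
  shows "antipode X (Oincl w) \<approx> (Oanti w :: ('x, 'k::comm_ring_1) xomega)"
proof (rule conv_cancel[OF Jideal antipode_right _ assms])
  fix w :: "'x simplex word" assume w: "w \<in> \<Omega>words"
  have "xomega_counit (Oincl w :: ('x, 'k) xomega) = (omega_counit (bas w) :: 'k)"
    by (simp add: xomega_incl_bas xomega_counit_def omega_counit_def o_def)
  moreover have "Oincl w \<in> supported (Xwords :: ('x, 'k) xletter word set)"
    by (simp add: xomega_incl_bas cell_word_in[OF w])
  ultimately have "lin (\<lambda>(u, v). antipode X (bas u) * bas v) (xomega_coprod X (Oincl w)) \<approx> (conv_unit w :: ('x, 'k) xomega)"
  proof -
    assume c: "xomega_counit (Oincl w :: ('x, 'k) xomega) = (omega_counit (bas w) :: 'k)"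
      and "Oincl w \<in> supported (Xwords :: ('x, 'k) xletter word set)"
    then have "lin (\<lambda>(u, v). antipode X (bas u) * bas v) (xomega_coprod X (Oincl w)) -
        scale (xomega_counit (Oincl w :: ('x, 'k) xomega)) 1 \<in> (xomega_ideal X :: ('x, 'k) xomega set)"
      using is_antipode_antipode unfolding is_antipode_def by blast
    then show ?thesis using xomega_ideal_subset unfolding eqv_def conv_unit_def c by blast
  qed
  moreover have "lin (\<lambda>(u, v). antipode X (bas u) * bas v) (xomega_coprod X (Oincl w)) =
      (conv (\<lambda>u. antipode X (Oincl u)) Oincl w :: ('x, 'k) xomega)"
    unfolding xomega_coprod_incl[OF w] pair_map_def lin_lin conv_def split_def by (simp add: xomega_incl_bas)
  ultimately have "conv (\<lambda>u. antipode X (Oincl u)) Oincl w \<approx> (conv_unit w :: ('x, 'k) xomega)" by simp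
  also have "\<dots> \<approx> conv Oanti Oincl w" by (rule eqv_sym[OF antipode_left[OF w]])
  finally show "conv (\<lambda>u. antipode X (Oincl u)) Oincl w \<approx> (conv Oanti Oincl w :: ('x, 'k) xomega)" .
qed

end

section \<open>Noncommutative differentials and the coHochschild complex\<close>

text \<open>\<open>cyc u m\<close> is \<open>du \<otimes> m\<close>, expanded by the Leibniz rule in terms of
  \<open>d{c} \<otimes> m = c \<otimes> m\<close>.\<close>

primrec cyc_list :: "'x simplex list \<Rightarrow> ('x, 'k::comm_ring_1) xomega \<Rightarrow> ('x simplex \<times> ('x, 'k) xletter word \<Rightarrow>\<^sub>0 'k)" where
  "cyc_list [] m = 0"
| "cyc_list (g # gs) m = tens (bas g) (xomega_incl (bas (Word gs)) * m) +
     scale ((-1) ^ (omega_deg g * wdeg omega_deg (Word gs)))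
       (cyc_list gs (twist xomega_deg (omega_deg g) m * xomega_incl (bas (Word [g]))))"

definition cyc :: "('x, 'k::comm_ring_1) omega \<Rightarrow> ('x, 'k) xomega \<Rightarrow> ('x simplex \<times> ('x, 'k) xletter word \<Rightarrow>\<^sub>0 'k)" where
  "cyc p m = lin (\<lambda>w. cyc_list (letters w) m) p"

lemma klin_cyc_left: "klin (\<lambda>p. cyc p m)"
  by (simp add: cyc_def)

lemma klin_cyc_list: "klin f \<Longrightarrow> klin (\<lambda>m. cyc_list gs (f m))"
proof (induction gs arbitrary: f)
  case Nil
  then show ?case by (simp add: klin_intros)
next
  case (Cons g gs)
  show ?case unfolding cyc_list.simps
    by (intro klins Cons.IH klin_comp[OF klin_twist] Cons.prems)
qed

lemma klin_cyc_right: "klin f \<Longrightarrow> klin (\<lambda>m. cyc p (f m))"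
  unfolding cyc_def by (intro klin_intros klin_cyc_list)

lemma klin_cyc: "klin (cyc p)"
  using klin_cyc_right[OF klin_intros(1)] .

lemmas cyc_simps [simp] = klin_0[OF klin_cyc_left] klin_add[OF klin_cyc_left] klin_diff[OF klin_cyc_left]
  klin_uminus[OF klin_cyc_left] klin_scale[OF klin_cyc_left] klin_0[OF klin_cyc] klin_add[OF klin_cyc]
  klin_diff[OF klin_cyc] klin_uminus[OF klin_cyc] klin_scale[OF klin_cyc]

lemma cyc_1 [simp]: "cyc 1 m = 0"
  by (simp add: cyc_def)

lemma cyc_letter [simp]: "cyc (bas (Word [g])) m = tens (bas g) m"
  by (simp add: cyc_def Word_Nil)

lemma twist_incl_bas: "twist xomega_deg k (xomega_incl (bas w)) = scale ((-1) ^ (k * wdeg omega_deg w)) (xomega_incl (bas w))"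
  by (simp add: xomega_incl_bas)

text \<open>The Leibniz rule d(uv) \<otimes> m = du \<otimes> v m \<plusminus> dv \<otimes> m u: the
  factor u in front of dv is moved cyclically to the right of m.\<close>

lemma cyc_bas_add: "cyc (bas (u + v)) m = cyc (bas u) (xomega_incl (bas v) * m) +
    scale ((-1) ^ (wdeg omega_deg u * wdeg omega_deg v)) (cyc (bas v) (twist xomega_deg (wdeg omega_deg u) m * xomega_incl (bas u)))"
proof -
  have u: "u \<in> words UNIV" by simp
  have inc: "xomega_incl (bas (a + b)) = xomega_incl (bas a) * xomega_incl (bas b)" for a b
    by (simp add: xomega_incl_mult[symmetric] bas_mult)
  have C: "cyc (bas (Word [g] + w)) m = tens (bas g) (xomega_incl (bas w) * m) +
     scale ((-1) ^ (omega_deg g * wdeg omega_deg w)) (cyc (bas w) (twist xomega_deg (omega_deg g) m * xomega_incl (bas (Word [g]))))"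
    for g w m by (simp add: cyc_def plus_word_def)
  show ?thesis using u
  proof (induction arbitrary: m rule: word_induct)
    case zero
    then show ?case using twist_mult[of xomega_deg 0 m 1] by (simp add: twist_def)
  next
    case (Cons g u)
    let ?g = "omega_deg g" and ?u = "wdeg omega_deg u" and ?v = "wdeg omega_deg v"
    let ?i = "\<lambda>w. xomega_incl (bas w)" and ?t = "twist xomega_deg"
    have "cyc (bas (Word [g] + u + v)) m = tens (bas g) (?i u * ?i v * m) +
       scale ((-1) ^ (?g * (?u + ?v))) (cyc (bas (u + v)) (?t ?g m * ?i (Word [g])))"
      by (simp add: add.assoc C inc)
    also have "cyc (bas (u + v)) (?t ?g m * ?i (Word [g])) = cyc (bas u) (?i v * (?t ?g m * ?i (Word [g]))) +
       scale ((-1) ^ (?u * ?v)) (cyc (bas v) (?t ?u (?t ?g m * ?i (Word [g])) * ?i u))"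
      by (rule Cons)
    also have "?t ?u (?t ?g m * ?i (Word [g])) * ?i u = scale ((-1) ^ (?u * ?g)) (?t (?g + ?u) m * ?i (Word [g] + u))"
      by (simp add: twist_mult twist_twist twist_incl_bas scale_mult_left scale_mult_right inc mult.assoc add.commute)
    also have "tens (bas g) (?i u * ?i v * m) + scale ((-1) ^ (?g * (?u + ?v)))
       (cyc (bas u) (?i v * (?t ?g m * ?i (Word [g]))) + scale ((-1) ^ (?u * ?v)) (cyc (bas v)
         (scale ((-1) ^ (?u * ?g)) (?t (?g + ?u) m * ?i (Word [g] + u))))) =
       tens (bas g) (?i u * ?i v * m) + scale ((-1) ^ (?g * ?u)) (scale ((-1) ^ (?g * ?v)) (cyc (bas u) (?i v * (?t ?g m * ?i (Word [g]))))) +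
       scale ((-1) ^ ((?g + ?u) * ?v)) (cyc (bas v) (?t (?g + ?u) m * ?i (Word [g] + u)))"
    proof -
      have "(- 1 :: 'b) ^ (?g * (?u + ?v)) * ((- 1) ^ (?u * ?v) * (- 1) ^ (?u * ?g)) = (- 1) ^ ((?g + ?u) * ?v)"
        unfolding power_add[symmetric] by (rule sgn_eqI) auto
      then show ?thesis by (simp add: scale_add distrib_left power_add mult.assoc add.assoc)
    qed
    also have "tens (bas g) (?i u * ?i v * m) + scale ((-1) ^ (?g * ?u)) (scale ((-1) ^ (?g * ?v)) (cyc (bas u) (?i v * (?t ?g m * ?i (Word [g]))))) =
       cyc (bas (Word [g] + u)) (?i v * m)"
      by (simp add: C twist_mult twist_incl_bas scale_mult_left mult.assoc)
    finally show ?case by simp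
  qed
qed

lemma cyc_mult_right:
  assumes "\<And>w. w \<in> Poly_Mapping.keys p \<Longrightarrow> even (wdeg omega_deg w) = even n"
  shows "cyc (p * bas v) m = cyc p (xomega_incl (bas v) * m) +
    scale ((-1) ^ (n * wdeg omega_deg v)) (cyc (bas v) (twist xomega_deg n m * xomega_incl p))"
proof (rule klin_eqI[where f = "\<lambda>p. cyc (p * bas v) m"])
  fix w assume "w \<in> Poly_Mapping.keys p"
  note e = assms[OF this]
  have "twist xomega_deg (wdeg omega_deg w) m = twist xomega_deg n m"
    unfolding twist_def by (intro lin_cong refl arg_cong2[where f = scale] sgn_eqI) (simp add: e)
  moreover have "(- 1 :: 'b) ^ (wdeg omega_deg w * wdeg omega_deg v) = (- 1) ^ (n * wdeg omega_deg v)"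
    by (rule sgn_eqI) (simp add: e)
  ultimately show "cyc (bas w * bas v) m = cyc (bas w) (xomega_incl (bas v) * m) +
    scale ((-1) ^ (n * wdeg omega_deg v)) (cyc (bas v) (twist xomega_deg n m * xomega_incl (bas w)))"
    by (simp add: bas_mult cyc_bas_add)
qed (intro klins klin_comp[OF klin_cyc_left] klin_cyc_left klin_cyc_right klin_xomega_incl)+

lemma cyc_mult_left:
  assumes "\<And>w. w \<in> Poly_Mapping.keys q \<Longrightarrow> even (wdeg omega_deg w) = even n"
  shows "cyc (bas u * q) m = cyc (bas u) (xomega_incl q * m) +
    scale ((-1) ^ (wdeg omega_deg u * n)) (cyc q (twist xomega_deg (wdeg omega_deg u) m * xomega_incl (bas u)))"
proof (rule klin_eqI[where f = "\<lambda>q. cyc (bas u * q) m"])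
  fix w assume "w \<in> Poly_Mapping.keys q"
  note e = assms[OF this]
  have "(- 1 :: 'b) ^ (wdeg omega_deg u * wdeg omega_deg w) = (- 1) ^ (wdeg omega_deg u * n)"
    by (rule sgn_eqI) (simp add: e)
  then show "cyc (bas u * bas w) m = cyc (bas u) (xomega_incl (bas w) * m) +
    scale ((-1) ^ (wdeg omega_deg u * n)) (cyc (bas w) (twist xomega_deg (wdeg omega_deg u) m * xomega_incl (bas u)))"
    by (simp add: bas_mult cyc_bas_add)
qed (intro klins klin_comp[OF klin_cyc_left] klin_cyc_left klin_cyc_right klin_xomega_incl)+

lemma klin_cohochschild_diff: "klin (cohochschild_diff X)"
  by (simp add: cohochschild_diff_def)

lemmas cohochschild_diff_simps [simp] = klin_0[OF klin_cohochschild_diff] klin_add[OF klin_cohochschild_diff]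
  klin_diff[OF klin_cohochschild_diff] klin_uminus[OF klin_cohochschild_diff] klin_scale[OF klin_cohochschild_diff]

lemma cohochschild_diff_tens:
  "cohochschild_diff X (tens (bas c) m) = tens (bd X (bas c)) m + scale ((-1) ^ fst c) (tens (bas c) (xomega_diff X m))
     + lin (\<lambda>x. scale ((-1) ^ fst (fst x)) (tens (bas (fst x)) (xomega_incl (cobar_gen (bas (snd x))) * m))) (aw X (bas c))
     - lin (\<lambda>x. scale ((-1) ^ ((fst (fst x) + 1) * fst (snd x)))
         (tens (bas (snd x)) (twist xomega_deg (fst (fst x) + 1) m * xomega_incl (cobar_gen (bas (fst x)))))) (aw X (bas c))"
proof (rule klin_eqI[where f = "\<lambda>m. cohochschild_diff X (tens (bas c) m)"])
  fix w
  show "cohochschild_diff X (tens (bas c) (bas w)) = tens (bd X (bas c)) (bas w) + scale ((-1) ^ fst c) (tens (bas c) (xomega_diff X (bas w)))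
     + lin (\<lambda>x. scale ((-1) ^ fst (fst x)) (tens (bas (fst x)) (xomega_incl (cobar_gen (bas (snd x))) * bas w))) (aw X (bas c))
     - lin (\<lambda>x. scale ((-1) ^ ((fst (fst x) + 1) * fst (snd x)))
         (tens (bas (snd x)) (twist xomega_deg (fst (fst x) + 1) (bas w) * xomega_incl (cobar_gen (bas (fst x)))))) (aw X (bas c))"
    by (simp add: cohochschild_diff_def split_def scale_mult_left power_add distrib_left del: cobar_gen_simps)
qed (intro klins klin_comp[OF klin_cohochschild_diff] klin_comp[OF klin_xomega_diff] klin_comp[OF klin_twist])+

context reduced_sset
begin

definition pt :: "'x simplex" where
  "pt = (0, the_elem (simplices X 0))"

lemma fst_pt [simp]: "fst pt = 0"
  by (simp add: pt_def)

lemma is_simplex_pt: "is_simplex X pt" and pt_unique: "is_simplex X c \<Longrightarrow> fst c = 0 \<Longrightarrow> c = pt"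
proof -
  obtain v where v: "simplices X 0 = {v}" using reduced by (auto simp: reduced_def)
  then show "is_simplex X pt" by (simp add: pt_def is_simplex_def)
  show "c = pt" if "is_simplex X c" "fst c = 0"
    using that v by (cases c) (simp add: pt_def is_simplex_def)
qed

lemma pt_nondegenerate: "pt \<in> nondegenerate X"
  using is_simplex_pt by (simp add: nondegenerate_iff)

lemma chain_0: "is_simplex X c \<Longrightarrow> fst c = 0 \<Longrightarrow> chain X c = bas pt"
  using pt_unique[of c] pt_nondegenerate by (simp add: chain_def)

text \<open>Both complexes split along this distinction into the part over the vertex and the part
  over the letters; the differentials then have the shape of a cone.\<close>

lemma nondegenerate_cases:
  assumes "c \<in> nondegenerate X"
  obtains "c = pt" | "c \<in> omega_letters X"
proof (cases "fst c = 0")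
  case True
  then have "c = pt" by (intro pt_unique nondegenerate_is_simplex assms)
  then show ?thesis by (rule that(1))
next
  case False
  then have "c \<in> omega_letters X" using assms by (simp add: omega_letters_def)
  then show ?thesis by (rule that(2))
qed

lemma front_back_simplex:
  assumes "is_simplex X c" "i \<le> fst c"
  shows "is_simplex X (face X c [0..<Suc i])" "is_simplex X (face X c [i..<Suc (fst c)])"
  using assms by (auto intro!: face_is_simplex vertex_list_upt simp del: upt_Suc)

lemma aw_pt: "aw X (bas pt) = bas (pt, pt)"
  using front_back_simplex[OF is_simplex_pt, of 0] by (simp add: aw_def chain_0)

lemma bd_pt: "bd X (bas pt) = 0"
  by (simp add: bd_def)

text \<open>As there is one vertex, the Alexander-Whitney terms with a factor of dimension 0 are pt
  \<otimes> c and c \<otimes> pt. The conditional picks them out, so that they can be separated from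
  the reduced coproduct.\<close>

lemma aw_special:
  fixes f :: "'x simplex \<Rightarrow> 'x simplex \<Rightarrow> ('b \<Rightarrow>\<^sub>0 'k::comm_ring_1)"
  assumes c: "c \<in> omega_letters X"
  shows "lin (\<lambda>x. if fst (fst x) = 0 then f (fst x) (snd x) else 0) (aw X (bas c)) = f pt c"
    and "lin (\<lambda>x. if fst (snd x) = 0 then f (fst x) (snd x) else 0) (aw X (bas c)) = f c pt"
proof -
  have s: "c \<in> nondegenerate X" "is_simplex X c" "fst c \<ge> 1"
    using c by (auto simp: omega_letters_def nondegenerate_is_simplex)
  have cc: "chain X (face X c [0..<Suc (fst c)]) = (bas c :: _ \<Rightarrow>\<^sub>0 'k)"
    using face_id[OF s(2)] s(1) by (simp add: chain_def del: upt_Suc)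
  have "lin (\<lambda>x. if fst (fst x) = 0 then f (fst x) (snd x) else 0) (aw X (bas c)) =
      (\<Sum>i\<le>fst c. if i = 0 then f pt c else 0)"
    unfolding lin_aw
  proof (rule sum.cong[OF refl])
    fix i assume i: "i \<in> {..fst c}"
    show "lin (\<lambda>a. lin (\<lambda>b. if fst (fst (a, b)) = 0 then f (fst (a, b)) (snd (a, b)) else 0) (chain X (face X c [i..<Suc (fst c)])))
       (chain X (face X c [0..<Suc i])) = (if i = 0 then f pt c else 0)"
    proof (cases "i = 0")
      case True
      have "chain X (face X c [0..<Suc 0]) = (bas pt :: _ \<Rightarrow>\<^sub>0 'k)"
        using front_back_simplex(1)[OF s(2), of 0] by (intro chain_0) auto
      then show ?thesis using True cc by (simp del: upt_Suc)
    next
      case False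
      then show ?thesis by (simp add: chain_lin del: upt_Suc)
    qed
  qed
  then show "lin (\<lambda>x. if fst (fst x) = 0 then f (fst x) (snd x) else 0) (aw X (bas c)) = f pt c" by simp
  have "lin (\<lambda>x. if fst (snd x) = 0 then f (fst x) (snd x) else 0) (aw X (bas c)) =
      (\<Sum>i\<le>fst c. if i = fst c then f c pt else 0)"
    unfolding lin_aw
  proof (rule sum.cong[OF refl])
    fix i assume i: "i \<in> {..fst c}"
    show "lin (\<lambda>a. lin (\<lambda>b. if fst (snd (a, b)) = 0 then f (fst (a, b)) (snd (a, b)) else 0) (chain X (face X c [i..<Suc (fst c)])))
       (chain X (face X c [0..<Suc i])) = (if i = fst c then f c pt else 0)"
    proof (cases "i = fst c")
      case True
      have "chain X (face X c [fst c..<Suc (fst c)]) = (bas pt :: _ \<Rightarrow>\<^sub>0 'k)"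
        using front_back_simplex(2)[OF s(2), of "fst c"] by (intro chain_0) auto
      then show ?thesis using True cc by (simp del: upt_Suc)
    next
      case False
      then show ?thesis using i by (simp add: chain_lin del: upt_Suc)
    qed
  qed
  then show "lin (\<lambda>x. if fst (snd x) = 0 then f (fst x) (snd x) else 0) (aw X (bas c)) = f c pt" by simp
qed

lemma bd_supported:
  assumes "c \<in> nondegenerate X"
  shows "bd X (bas c) \<in> supported {d \<in> nondegenerate X. Suc (fst d) = fst c}"
proof (cases "fst c = 0")
  case False
  then show ?thesis
    by (auto simp: bd_def chain_def length_remove1 intro!: supported_sum supported_scale simp del: upt_Suc)
qed (simp add: bd_def)

text \<open>Both ends of an edge are the one vertex and cancel. Hence the chain boundary never leads
  from positive dimension to dimension 0, where \<open>cobar_gen\<close> would lose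
  information.\<close>

lemma bd_1:
  assumes "is_simplex X c" "fst c = 1"
  shows "bd X (bas c) = (0 :: _ \<Rightarrow>\<^sub>0 'k::comm_ring_1)"
proof -
  have "chain X (face X c [0]) = (bas pt :: _ \<Rightarrow>\<^sub>0 'k)" "chain X (face X c [1]) = (bas pt :: _ \<Rightarrow>\<^sub>0 'k)"
    using assms by (auto intro!: chain_0 face_is_simplex simp: vertex_list_def)
  then show ?thesis by (simp add: bd_def assms numeral_2_eq_2)
qed

lemma aw_supported:
  assumes "is_simplex X c"
  shows "aw X (bas c) \<in> supported {x. fst x \<in> nondegenerate X \<and> snd x \<in> nondegenerate X \<and> fst (fst x) + fst (snd x) = fst c}"
  by (auto simp: aw_def chain_def intro!: supported_sum simp del: upt_Suc)

lemma cyc_cobar_gen: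
  assumes "p \<in> supported {d. fst d \<ge> 1}"
  shows "cyc (cobar_gen p) m = tens p m"
proof (rule klin_eqI[where f = "\<lambda>p. cyc (cobar_gen p) m"])
  fix d assume "d \<in> Poly_Mapping.keys p"
  then have "fst d \<ge> 1" using supportedD[OF assms] by auto
  then show "cyc (cobar_gen (bas d)) m = tens (bas d) m" by simp
qed (intro klin_comp[OF klin_cyc_left] klin_cobar_gen klins)+

lemma cohochschild_diff_pt: "cohochschild_diff X (tens (bas pt) m) = tens (bas pt) (xomega_diff X m)"
  by (simp add: cohochschild_diff_tens bd_pt aw_pt)

text \<open>In the two Alexander-Whitney sums the terms with both factors of positive dimension are
  the two Leibniz terms of \<open>cyc\<close> on the quadratic part of the cobar differential. The
  terms with {c} over the vertex form the commutator.\<close>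

lemma cohochschild_diff_letter:
  fixes m :: "('x, 'k::comm_ring_1) xomega"
  assumes c: "c \<in> omega_letters X"
  shows "cohochschild_diff X (tens (bas c) m) = - cyc (omega_diff X (bas (Word [c]))) m
    - scale ((-1) ^ omega_deg c) (tens (bas c) (xomega_diff X m))
    + tens (bas pt) (xomega_incl (bas (Word [c])) * m - twist xomega_deg (omega_deg c) m * xomega_incl (bas (Word [c])))"
proof -
  have s: "c \<in> nondegenerate X" "is_simplex X c" "fst c \<ge> 1"
    using c by (auto simp: omega_letters_def nondegenerate_is_simplex)
  have b: "cyc (cobar_gen (bd X (bas c))) m = tens (bd X (bas c)) m"
  proof (cases "fst c = 1")
    case False
    then show ?thesis using s
      by (intro cyc_cobar_gen supported_mono[OF bd_supported[OF s(1)]]) auto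
  qed (simp add: bd_1 s)
  let ?L = "\<lambda>x. scale ((-1) ^ fst (fst x)) (tens (bas (fst x)) (xomega_incl (cobar_gen (bas (snd x))) * m))"
  let ?R = "\<lambda>x. scale ((-1) ^ ((fst (fst x) + 1) * fst (snd x)))
         (tens (bas (snd x)) (twist xomega_deg (fst (fst x) + 1) m * xomega_incl (cobar_gen (bas (fst x)))))"
  let ?G = "\<lambda>x. scale ((-1) ^ fst (fst x)) (cobar_gen (bas (fst x)) * cobar_gen (bas (snd x)))"
  let ?a = "\<lambda>c d. tens (bas c) (xomega_incl (cobar_gen (bas d)) * m)"
  let ?b = "\<lambda>c d. tens (bas d) (twist xomega_deg (fst c + 1) m * xomega_incl (cobar_gen (bas c)))"
  have P: "?L x - ?R x = cyc (?G x) m + (if fst (fst x) = 0 then ?a (fst x) (snd x) else 0)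
      - (if fst (snd x) = 0 then ?b (fst x) (snd x) else 0)" for x :: "'x simplex \<times> 'x simplex"
  proof (cases "fst (fst x) = 0 \<or> fst (snd x) = 0")
    case True
    then show ?thesis by auto
  next
    case False
    let ?n = "fst (fst x)" and ?k = "fst (snd x)"
    \<comment> \<open>A letter has degree one less than its simplex; n - 1 from the Leibniz rule and
      n + 1 from the coHochschild differential have the same parity.\<close>
    have t: "twist xomega_deg (?n - 1) m = twist xomega_deg (?n + 1) m"
      unfolding twist_def by (intro lin_cong refl arg_cong2[where f = scale] sgn_eqI) (use False in auto)
    have sg: "(- 1 :: 'k) ^ ?n * (- 1) ^ ((?n - 1) * (?k - 1)) = - ((- 1) ^ ((?n + 1) * ?k))"
    proof -
      have "(- 1 :: 'k) ^ (?n + (?n - 1) * (?k - 1)) = (- 1) ^ (1 + (?n + 1) * ?k)"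
        by (rule sgn_eqI) (use False in auto)
      then show ?thesis by (simp add: power_add)
    qed
    have "cyc (?G x) m = scale ((- 1) ^ ?n) (cyc (bas (Word [fst x] + Word [snd x])) m)"
      using False by (simp add: bas_mult)
    also have "\<dots> = scale ((- 1) ^ ?n) (?a (fst x) (snd x)) + scale ((- 1) ^ ?n * (- 1) ^ ((?n - 1) * (?k - 1))) (?b (fst x) (snd x))"
      using False t by (simp add: cyc_bas_add scale_add omega_deg_def)
    finally show ?thesis unfolding sg using False by simp
  qed
  have "lin ?L (aw X (bas c)) - lin ?R (aw X (bas c)) = cyc (lin ?G (aw X (bas c))) m + ?a pt c - ?b c pt"
    unfolding lin_diff_fun[symmetric] P lin_diff_fun lin_add_fun aw_special(1)[OF c, of ?a]
      aw_special(2)[OF c, of ?b] klin_compose_lin[OF klin_cyc_left] ..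
  moreover have "twist xomega_deg (fst c + 1) m = twist xomega_deg (omega_deg c) m"
    unfolding twist_def by (intro lin_cong refl arg_cong2[where f = scale] sgn_eqI) (use s in \<open>auto simp: omega_deg_def\<close>)
  moreover have "(- 1 :: 'k) ^ fst c = - ((- 1) ^ omega_deg c)"
    using s by (cases "fst c") (auto simp: omega_deg_def)
  ultimately show ?thesis
    using s b by (simp add: cohochschild_diff_tens omega_diff_letter del: cobar_gen_simps) (simp add: algebra_simps)
qed

text \<open>Extends the formula for letters by the Leibniz rule. The commutators telescope: up to
  signs, (g (v m) - (v m) g) + (v (m g) - (m g) v) = g v m - m g v for a letter g and a word
  v.\<close>

lemma cohochschild_diff_cyc:
  assumes "w \<in> \<Omega>words" "m \<in> supported (Xwords :: ('x, 'k::comm_ring_1) xletter word set)"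
  shows "cohochschild_diff X (cyc (bas w) m) = - cyc (omega_diff X (bas w)) m
    - scale ((-1) ^ wdeg omega_deg w) (cyc (bas w) (xomega_diff X m))
    + tens (bas pt) (xomega_incl (bas w) * m - twist xomega_deg (wdeg omega_deg w) m * xomega_incl (bas w))"
  using assms
proof (induction arbitrary: m rule: word_induct)
  case zero
  have "twist xomega_deg 0 m = m" by (simp add: twist_def)
  then show ?case by simp
next
  case (Cons g w)
  let ?i = "\<lambda>w. xomega_incl (bas w) :: ('x, 'k) xomega" and ?t = "twist xomega_deg" and ?D = "xomega_diff X :: ('x, 'k) xomega \<Rightarrow> _"
  let ?g = "omega_deg g" and ?w = "wdeg omega_deg w" and ?s = "\<lambda>n. scale ((-1) ^ n)"
  let ?dg = "omega_diff X (bas (Word [g])) :: ('x, 'k) omega" and ?dw = "omega_diff X (bas w) :: ('x, 'k) omega"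
  let ?m = "?t ?g m * ?i (Word [g])"
  have gw: "Word [g] \<in> \<Omega>words" using Cons by simp
  have tm: "?t k m \<in> supported Xwords" for k
    unfolding twist_def using Cons(4) by (auto intro!: supported_lin supported_scale dest: supportedD)
  have ig: "?i (Word [g]) \<in> supported Xwords"
    unfolding xomega_incl_bas by (rule supported_bas, rule cell_word_in[OF gw])
  have m': "?m \<in> supported Xwords" by (rule supported_mult[OF tm ig]) simp
  have inc: "?i (Word [g] + w) = ?i (Word [g]) * ?i w"
    by (simp add: xomega_incl_mult[symmetric] bas_mult)
  have edg: "even (wdeg omega_deg v) = even (?g + 1)" if "v \<in> Poly_Mapping.keys ?dg" for v
  proof -
    have "?g = wdeg omega_deg v + 1" using supportedD[OF omega_diff_letter_supported[OF Cons(1)] that] by simp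
    then show ?thesis by simp
  qed
  have edw: "even (wdeg omega_deg v) = even (?w + 1)" if "v \<in> Poly_Mapping.keys ?dw" for v
  proof -
    have "?w = wdeg omega_deg v + 1" using supportedD[OF omega_diff_supported[OF Cons(2)] that] by simp
    then show ?thesis by simp
  qed
  have L: "cohochschild_diff X (cyc (bas (Word [g])) (?i w * m)) = - cyc ?dg (?i w * m)
     - ?s ?g (cyc (bas (Word [g])) (xomega_incl ?dw * m)) - ?s (?g + ?w) (cyc (bas (Word [g])) (?i w * ?D m))
     + tens (bas pt) (?i (Word [g]) * ?i w * m) - ?s (?g * ?w) (tens (bas pt) (?i w * ?m))"
    using cohochschild_diff_letter[OF Cons(1), of "?i w * m"]
    by (simp add: xomega_diff_mult xomega_diff_incl_bas[OF Cons(2)] twist_mult twist_incl_bas scale_mult_left scale_add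
        power_add mult.assoc)
  have tt: "?t ?w ?m * ?i w = ?s (?g * ?w) (?t (?g + ?w) m * (?i (Word [g]) * ?i w))"
    by (simp add: twist_mult twist_twist twist_incl_bas scale_mult_left scale_mult_right mult.assoc mult.commute add.commute)
  have Dm: "?D ?m = ?s ?g (?t ?g (?D m) * ?i (Word [g])) + ?t (?g + 1) m * xomega_incl ?dg"
  proof -
    have "?D (?t ?g m) = ?s ?g (?t ?g (?D m))"
      using twist_xomega_diff[OF Cons(4), of ?g] by (simp add: power_add[symmetric] mult_2[symmetric])
    then show ?thesis
      by (simp add: xomega_diff_mult xomega_diff_incl_bas[OF gw] twist_twist scale_mult_left add.commute del: xomega_diff_simps(8))
  qed
  have R: "cohochschild_diff X (cyc (bas w) ?m) = - cyc ?dw ?m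
     - ?s (?w + ?g) (cyc (bas w) (?t ?g (?D m) * ?i (Word [g]))) - ?s ?w (cyc (bas w) (?t (?g + 1) m * xomega_incl ?dg))
     + tens (bas pt) (?i w * ?m) - ?s (?g * ?w) (tens (bas pt) (?t (?g + ?w) m * (?i (Word [g]) * ?i w)))"
    using Cons(3)[OF m'] unfolding Dm tt by (simp add: scale_add power_add)
  have "omega_diff X (bas (Word [g] + w)) = ?dg * bas w + ?s ?g (bas (Word [g]) * ?dw)"
    by (simp add: omega_diff_mult bas_mult[symmetric] scale_mult_left)
  then have T: "cyc (omega_diff X (bas (Word [g] + w))) m = cyc ?dg (?i w * m)
     + ?s ((?g + 1) * ?w) (cyc (bas w) (?t (?g + 1) m * xomega_incl ?dg))
     + ?s ?g (cyc (bas (Word [g])) (xomega_incl ?dw * m)) + ?s (?g + ?g * (?w + 1)) (cyc ?dw ?m)"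
    using cyc_mult_right[of ?dg "?g + 1" w m, OF edg] cyc_mult_left[of ?dw "?w + 1" "Word [g]" m, OF edw]
    by (simp add: scale_add power_add mult.assoc del: cyc_letter)
  have U: "cyc (bas (Word [g] + w)) (?D m) = cyc (bas (Word [g])) (?i w * ?D m) + ?s (?g * ?w) (cyc (bas w) (?t ?g (?D m) * ?i (Word [g])))"
    by (simp add: cyc_bas_add)
  have V: "cyc (bas (Word [g] + w)) m = cyc (bas (Word [g])) (?i w * m) + ?s (?g * ?w) (cyc (bas w) ?m)"
    by (simp add: cyc_bas_add)
  have s1: "(- 1 :: 'k) ^ (?g * ?w) * (- 1) ^ ?w = (- 1) ^ ((?g + 1) * ?w)"
    unfolding power_add[symmetric] by (rule sgn_eqI) auto
  have s2: "(- 1 :: 'k) ^ (?g * ?w) = (- 1) ^ (?g + ?g * (?w + 1))"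
    by (rule sgn_eqI) auto
  have s3: "(- 1 :: 'k) ^ (?g * ?w) * (- 1) ^ (?w + ?g) = (- 1) ^ (?g + ?w) * (- 1) ^ (?g * ?w)"
    by (simp add: power_add)
  have s4: "(- 1 :: 'k) ^ (?g * ?w) * (- 1) ^ (?g * ?w) = 1"
    by (simp add: power_add[symmetric] mult_2[symmetric])
  \<comment> \<open>The remaining rearrangement, with the sign relations \<open>s1\<close> to
    \<open>s4\<close> as hypotheses; Z is the middle commutator term that cancels.\<close>
  have rearrange: "(- A - B - C + E - scale a Z) + scale a (- P - scale b Q - scale c R + Z - scale a Y) =
      - (A + scale d R + B + scale p P) - (C + scale e (scale a Q)) + E - Y"
    if "a * c = d" "a = p" "a * b = e * a" "a * a = 1"
    for a b c d e p :: 'k and A B C E P Q R Y Z :: "'x simplex \<times> ('x, 'k) xletter word \<Rightarrow>\<^sub>0 'k"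
  proof -
    have "scale a (- P - scale b Q - scale c R + Z - scale a Y) =
        - scale a P - scale (a * b) Q - scale (a * c) R + scale a Z - scale (a * a) Y"
      by (simp add: scale_add scale_diff)
    also have "\<dots> = - scale p P - scale (e * a) Q - scale d R + scale a Z - Y"
      by (simp only: that(1) that(3) that(4) scale_simps) (simp only: that(2))
    finally show ?thesis by (simp add: algebra_simps)
  qed
  have "cohochschild_diff X (cyc (bas (Word [g] + w)) m) =
     cohochschild_diff X (cyc (bas (Word [g])) (?i w * m)) + ?s (?g * ?w) (cohochschild_diff X (cyc (bas w) ?m))"
    unfolding V by (simp del: cyc_letter)
  also have "\<dots> = - cyc (omega_diff X (bas (Word [g] + w))) m - ?s (?g + ?w) (cyc (bas (Word [g] + w)) (?D m)) +
     tens (bas pt) (?i (Word [g]) * ?i w * m) - tens (bas pt) (?t (?g + ?w) m * (?i (Word [g]) * ?i w))"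
    unfolding L R T U scale_add by (rule rearrange[OF s1 s2 s3 s4])
  finally show ?case by (simp add: inc)
qed

lemma cohochschild_diff_cyc_lin:
  assumes p: "p \<in> supported {w \<in> \<Omega>words. even (wdeg omega_deg w) = even n}"
    and m: "m \<in> supported (Xwords :: ('x, 'k::comm_ring_1) xletter word set)"
  shows "cohochschild_diff X (cyc p m) = - cyc (omega_diff X p) m - scale ((-1) ^ n) (cyc p (xomega_diff X m))
    + tens (bas pt) (xomega_incl p * m - twist xomega_deg n m * xomega_incl p)"
proof (rule klin_eqI[where f = "\<lambda>p. cohochschild_diff X (cyc p m)"])
  fix w assume "w \<in> Poly_Mapping.keys p"
  then have w: "w \<in> \<Omega>words" "even (wdeg omega_deg w) = even n" using supportedD[OF p] by auto
  have "twist xomega_deg (wdeg omega_deg w) m = twist xomega_deg n m"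
    unfolding twist_def by (intro lin_cong refl arg_cong2[where f = scale] sgn_eqI) (simp add: w)
  moreover have "(- 1 :: 'k) ^ wdeg omega_deg w = (- 1) ^ n" by (rule sgn_eqI[OF w(2)])
  ultimately show "cohochschild_diff X (cyc (bas w) m) = - cyc (omega_diff X (bas w)) m - scale ((-1) ^ n) (cyc (bas w) (xomega_diff X m))
    + tens (bas pt) (xomega_incl (bas w) * m - twist xomega_deg n m * xomega_incl (bas w))"
    using cohochschild_diff_cyc[OF w(1) m] by simp
qed (intro klins klin_comp[OF klin_cohochschild_diff] klin_comp[OF klin_cyc_left] klin_cyc_left klin_omega_diff klin_xomega_incl)+

lemma xomega_diff_supported':
  "m \<in> supported Xwords \<Longrightarrow> xomega_diff X m \<in> supported Xwords"
  unfolding klin_eq_lin[OF klin_xomega_diff, of X m]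
  by (rule supported_lin) (auto intro!: supported_mono[OF xomega_diff_supported] dest: supportedD)

text \<open>By the cone formula the square consists of the squares of the differentials on both
  factors and of the failure of the commutator to be a chain map; all of these vanish.\<close>

lemma cohochschild_diff_diff:
  assumes c: "c \<in> nondegenerate X" and w: "w \<in> (Xwords :: ('x, 'k::comm_ring_1) xletter word set)"
  shows "cohochschild_diff X (cohochschild_diff X (bas (c, w))) = 0"
  using c
proof (cases rule: nondegenerate_cases)
  case 1
  have "bas (c, w) = tens (bas pt) (bas w :: ('x, 'k) xomega)" by (simp add: 1)
  then show ?thesis by (simp only: cohochschild_diff_pt xomega_diff_diff[OF w]) simp
next
  case 2
  let ?n = "omega_deg c" and ?d = "omega_diff X (bas (Word [c])) :: ('x, 'k) omega" and ?m = "bas w :: ('x, 'k) xomega"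
  let ?i = "xomega_incl (bas (Word [c])) :: ('x, 'k) xomega"
  have m: "?m \<in> supported Xwords" using w by simp
  have dm: "xomega_diff X ?m \<in> supported Xwords" by (rule xomega_diff_supported'[OF m])
  have cw: "Word [c] \<in> \<Omega>words" using 2 by simp
  have d: "?d \<in> supported {w \<in> \<Omega>words. even (wdeg omega_deg w) = even (?n + 1)}"
  proof (rule supported_mono[OF omega_diff_letter_supported[OF 2]], rule subsetI)
    fix v assume "v \<in> {v \<in> \<Omega>words. wdeg omega_deg v + 1 = ?n}"
    then have "v \<in> \<Omega>words" "?n = wdeg omega_deg v + 1" by auto
    then show "v \<in> {w \<in> \<Omega>words. even (wdeg omega_deg w) = even (?n + 1)}" by simp
  qed
  have b: "bas (c, w) = cyc (bas (Word [c])) ?m" by simp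
  have t: "xomega_diff X (twist xomega_deg ?n ?m) = scale ((-1) ^ ?n) (twist xomega_deg ?n (xomega_diff X ?m))"
    using twist_xomega_diff[OF m, of ?n] by (simp add: power_add[symmetric] mult_2[symmetric] del: twist_bas)
  have dd: "omega_diff X ?d = 0" by (rule omega_diff_diff_letter[OF 2])
  have D3: "xomega_diff X (?i * ?m - twist xomega_deg ?n ?m * ?i) = xomega_incl ?d * ?m + scale ((-1) ^ ?n) (?i * xomega_diff X ?m)
      - scale ((-1) ^ ?n) (twist xomega_deg ?n (xomega_diff X ?m) * ?i) - twist xomega_deg (?n + 1) ?m * xomega_incl ?d"
  proof -
    have "twist xomega_deg 1 ?i = scale ((-1) ^ ?n) ?i" by (simp add: twist_incl_bas del: twist_bas)
    moreover have "twist xomega_deg 1 (twist xomega_deg ?n ?m) = twist xomega_deg (?n + 1) ?m" by (simp only: twist_twist add.commute)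
    ultimately show ?thesis
      by (simp only: xomega_diff_simps(3) xomega_diff_mult xomega_diff_incl_bas[OF cw] t scale_mult_left) simp
  qed
  have deg: "wdeg omega_deg (Word [c]) = ?n" by simp
  show ?thesis
    unfolding b cohochschild_diff_cyc[OF cw m] cohochschild_diff_simps cohochschild_diff_cyc_lin[OF d m]
      cohochschild_diff_cyc[OF cw dm] cohochschild_diff_pt dd xomega_diff_diff[OF w] deg D3
    by (simp only: tens_simps cyc_simps scale_simps scale_add scale_diff power_add power_one_right) simp
qed

end

section \<open>The comparison map\<close>

text \<open>As in \<open>xomega_rel\<close>, supports are left free: every c is allowed.
  \<open>tensor_rel_iff\<close> returns to the relations of the complexes.\<close>

definition tens_rel :: "'x sset \<Rightarrow> ('x simplex \<times> ('x, 'k::comm_ring_1) xletter word \<Rightarrow>\<^sub>0 'k) set" where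
  "tens_rel X = {tens (bas c) x | c x. x \<in> xomega_rel X}"

context reduced_sset
begin

abbreviation Teq :: "('x simplex \<times> ('x, 'k::comm_ring_1) xletter word \<Rightarrow>\<^sub>0 'k) \<Rightarrow>
    ('x simplex \<times> ('x, 'k) xletter word \<Rightarrow>\<^sub>0 'k) \<Rightarrow> bool" (infix "\<simeq>" 50) where
  "a \<simeq> b \<equiv> eqv (tens_rel X) a b"

lemma tens_eqv: "x \<approx> y \<Longrightarrow> tens p x \<simeq> tens p y"
proof (rule klin_eqv[where f = "tens p"])
  show "klin (tens p)" using klin_tens_right[OF klin_intros(1)] .
  fix x :: "('x, 'a) xomega" assume "x \<in> xomega_rel X"
  then have b: "tens (bas c) x \<in> tens_rel X" for c unfolding tens_rel_def by blast
  have e: "tens p x = lin (\<lambda>c. tens (bas c) x) p"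
    using lin_tens_left[of bas p x] by simp
  show "tens p x \<in> free_module.span (tens_rel X)"
    unfolding e by (rule span_lin) (rule free_module.span_base[OF b])
qed

lemma cyc_eqv: "x \<approx> y \<Longrightarrow> cyc p x \<simeq> cyc p y"
proof -
  have "cyc_list gs x \<simeq> cyc_list gs y" if "x \<approx> y" for gs and x y :: "('x, 'a) xomega"
    using that
  proof (induction gs arbitrary: x y)
    case (Cons g gs)
    show ?case
      unfolding cyc_list.simps
      by (intro eqv_add eqv_scale tens_eqv Cons.IH eqv_mult[OF Jideal] twist_eqv eqv_refl Cons.prems)
  qed simp
  then show "x \<approx> y \<Longrightarrow> cyc p x \<simeq> cyc p y"
    unfolding cyc_def by (intro eqv_lin)
qed

text \<open>The comparison map on all elements p of the cobar construction instead of generators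
  only; products are needed for the quadratic part of the differential.\<close>

definition adj_cyc :: "('x, 'k::comm_ring_1) omega \<Rightarrow> ('x, 'k) xomega \<Rightarrow> ('x simplex \<times> ('x, 'k) xletter word \<Rightarrow>\<^sub>0 'k)" where
  "adj_cyc p m = lin (\<lambda>x. scale ((-1) ^ (wdeg omega_deg (fst x) * wdeg omega_deg (snd x)))
     (cyc (bas (snd x)) (twist xomega_deg (wdeg omega_deg (fst x)) m * Oanti (fst x)))) (omega_coprod X p)"

text \<open>The adjoint action with the constructed \<open>anti_cell\<close> in place of the chosen
  antipode; \<open>adjoint_action_adj\<close> identifies the two modulo the ideal.\<close>

definition adj :: "('x, 'k::comm_ring_1) omega \<Rightarrow> ('x, 'k) xomega \<Rightarrow> ('x, 'k) xomega" where
  "adj p m = lin (\<lambda>x. scale ((-1) ^ (wdeg omega_deg (fst x) * wdeg omega_deg (snd x)))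
     (Oincl (snd x) * (twist xomega_deg (wdeg omega_deg (fst x)) m * Oanti (fst x)))) (omega_coprod X p)"

lemma klin_adj_cyc: "klin (\<lambda>p. adj_cyc p m)" "klin (adj_cyc p)"
  unfolding adj_cyc_def[abs_def]
  by (intro klin_comp[OF klin_lin klin_omega_coprod] klins klin_cyc_right klin_comp[OF klin_twist])+

lemma klin_adj: "klin (\<lambda>p. adj p m)" "klin (adj p)"
  unfolding adj_def[abs_def]
  by (intro klin_comp[OF klin_lin klin_omega_coprod] klins klin_comp[OF klin_twist])+

lemmas adj_cyc_simps [simp] = klin_0[OF klin_adj_cyc(1)] klin_add[OF klin_adj_cyc(1)] klin_diff[OF klin_adj_cyc(1)]
  klin_uminus[OF klin_adj_cyc(1)] klin_scale[OF klin_adj_cyc(1)] klin_0[OF klin_adj_cyc(2)] klin_add[OF klin_adj_cyc(2)]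
  klin_diff[OF klin_adj_cyc(2)] klin_uminus[OF klin_adj_cyc(2)] klin_scale[OF klin_adj_cyc(2)]

lemma adj_cyc_1 [simp]: "adj_cyc 1 m = 0"
proof -
  have "cyc (bas 0) x = 0" for x :: "('x, 'a) xomega" by simp
  then show ?thesis by (simp add: adj_cyc_def)
qed

lemma adj_cyc_eqv: "x \<approx> y \<Longrightarrow> adj_cyc p x \<simeq> adj_cyc p y"
  unfolding adj_cyc_def by (intro eqv_lin eqv_scale cyc_eqv eqv_mult[OF Jideal] twist_eqv eqv_refl)

lemma Oanti_supported:
  "u \<in> \<Omega>words \<Longrightarrow> (Oanti u :: ('x, 'k::comm_ring_1) xomega) \<in> supported {v \<in> Xwords. wdeg xomega_deg v = wdeg omega_deg u}"
  by (rule supported_anti_ext[OF antipode_cell_supported])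

lemma twist_Oanti:
  assumes "u \<in> \<Omega>words"
  shows "twist xomega_deg k (Oanti u :: ('x, 'k::comm_ring_1) xomega) = scale ((-1) ^ (k * wdeg omega_deg u)) (Oanti u)"
  proof (rule twist_homog)
  fix w assume "w \<in> Poly_Mapping.keys (Oanti u :: ('x, 'k) xomega)"
  from supportedD[OF Oanti_supported[OF assms] this] show "even (wdeg xomega_deg w) = even (wdeg omega_deg u)" by simp
qed

text \<open>The part of the Koszul sign that depends on the coefficient is absorbed into
  \<open>twist\<close>, which gives the action the same form as \<open>adj\<close>.\<close>

lemma adjoint_action_eq: "adjoint_action X p m = lin (\<lambda>x. scale ((-1) ^ (wdeg omega_deg (fst x) * wdeg omega_deg (snd x)))
     (Oincl (snd x) * (twist xomega_deg (wdeg omega_deg (fst x)) m * antipode X (Oincl (fst x))))) (omega_coprod X p)"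
  unfolding adjoint_action_def split_def
proof (rule lin_cong[OF refl])
  fix x :: "'x simplex word \<times> 'x simplex word"
  let ?a = "wdeg omega_deg (fst x)" and ?b = "wdeg omega_deg (snd x)"
  show "lin (\<lambda>w. scale ((-1) ^ (?a * (?b + wdeg xomega_deg w))) (Oincl (snd x) * bas w * antipode X (Oincl (fst x)))) m =
     scale ((-1) ^ (?a * ?b)) (Oincl (snd x) * (twist xomega_deg ?a m * antipode X (Oincl (fst x))))"
    by (simp add: twist_def lin_mult_left lin_mult_right scale_lin scale_mult_left scale_mult_right mult.assoc
        power_add distrib_left)
qed

lemma omega_coprod_words_lin:
  assumes "p \<in> supported \<Omega>words" "x \<in> Poly_Mapping.keys (omega_coprod X p)"
  shows "fst x \<in> \<Omega>words" "snd x \<in> \<Omega>words"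
proof -
  have "omega_coprod X p \<in> supported (\<Omega>words \<times> \<Omega>words)"
    unfolding klin_eq_lin[OF klin_omega_coprod, of p]
  proof (rule supported_lin)
    fix w assume "w \<in> Poly_Mapping.keys p"
    then have "w \<in> \<Omega>words" using supportedD[OF assms(1)] by auto
    then show "omega_coprod X (bas w) \<in> supported (\<Omega>words \<times> \<Omega>words)"
      by (rule supported_mono[OF omega_coprod_supported]) (auto simp: word_pairs_def)
  qed
  then show "fst x \<in> \<Omega>words" "snd x \<in> \<Omega>words" using supportedD[OF _ assms(2)] by fastforce+
qed

lemma adjoint_action_adj:
  assumes "p \<in> supported \<Omega>words"
  shows "adjoint_action X p m \<approx> adj p m"
  unfolding adjoint_action_eq adj_def
  by (intro eqv_lin eqv_scale eqv_mult[OF Jideal] eqv_refl antipode_incl omega_coprod_words_lin[OF assms])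

text \<open>The common pattern of \<open>adj_cyc\<close> and \<open>adj\<close>, where P is the
  antipode, and of the inverse map, where P is the inclusion.\<close>

definition coact :: "('x simplex word \<Rightarrow> ('x, 'k::comm_ring_1) xomega \<Rightarrow> ('b \<Rightarrow>\<^sub>0 'k)) \<Rightarrow> ('x simplex word \<Rightarrow> ('x, 'k) xomega) \<Rightarrow>
    'x simplex word \<Rightarrow> ('x, 'k) xomega \<Rightarrow> ('b \<Rightarrow>\<^sub>0 'k)" where
  "coact K P w m = lin (\<lambda>x. scale ((-1) ^ (wdeg omega_deg (fst x) * wdeg omega_deg (snd x)))
     (K (snd x) (twist xomega_deg (wdeg omega_deg (fst x)) m * P (fst x)))) (omega_coprod X (bas w))"

lemma adj_cyc_coact: "adj_cyc (bas w) m = coact (\<lambda>u. cyc (bas u)) Oanti w m"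
  by (simp add: adj_cyc_def coact_def)

lemma adj_coact: "adj (bas w) m = coact (\<lambda>u m. Oincl u * m) Oanti w m"
  by (simp add: adj_def coact_def)

lemma coact_adj:
  fixes m :: "('x, 'k::comm_ring_1) xomega"
  assumes K: "\<And>w. klin (K w)" and b: "b \<in> \<Omega>words"
  shows "coact K Oanti a (adj (bas b) m) = lin (\<lambda>x. lin (\<lambda>y.
     scale ((-1) ^ (wdeg omega_deg (fst x) * wdeg omega_deg (snd x) + wdeg omega_deg (fst y) * wdeg omega_deg (snd y) +
       wdeg omega_deg (fst x) * (wdeg omega_deg (snd y) + wdeg omega_deg (fst y))))
     (K (snd x) (Oincl (snd y) * (twist xomega_deg (wdeg omega_deg (fst x) + wdeg omega_deg (fst y)) m *
       (Oanti (fst y) * Oanti (fst x)))))) (omega_coprod X (bas b))) (omega_coprod X (bas a))"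
  unfolding coact_def
proof (rule lin_cong[OF refl])
  fix x assume x: "x \<in> Poly_Mapping.keys (omega_coprod X (bas a) :: _ \<Rightarrow>\<^sub>0 'k)"
  let ?t = "twist xomega_deg" and ?d = "wdeg omega_deg"
  let ?\<Delta>b = "omega_coprod X (bas b) :: _ \<Rightarrow>\<^sub>0 'k"
  let ?s = "\<lambda>n. scale ((- 1 :: 'k) ^ n)"
  let ?x1 = "?d (fst x)"
    have "K (snd x) (?t ?x1 (adj (bas b) m) * Oanti (fst x)) =
       lin (\<lambda>y. K (snd x) (?t ?x1 (?s (?d (fst y) * ?d (snd y)) (Oincl (snd y) * (?t (?d (fst y)) m * Oanti (fst y)))) * Oanti (fst x))) ?\<Delta>b"
      unfolding adj_def
      by (rule klin_compose_lin[where f = "\<lambda>z. K (snd x) (?t ?x1 z * Oanti (fst x))"])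
        (intro klin_comp[OF K] klin_mult_left klin_twist)
    also have "\<dots> = lin (\<lambda>y. ?s (?d (fst y) * ?d (snd y) + ?x1 * (?d (snd y) + ?d (fst y))) (K (snd x)
         (Oincl (snd y) * (?t (?x1 + ?d (fst y)) m * (Oanti (fst y) * Oanti (fst x)))))) ?\<Delta>b"
    proof (rule lin_cong[OF refl])
      fix y assume "y \<in> Poly_Mapping.keys ?\<Delta>b"
      note yw = omega_coprod_words[OF b this]
      show "K (snd x) (?t ?x1 (?s (?d (fst y) * ?d (snd y)) (Oincl (snd y) * (?t (?d (fst y)) m * Oanti (fst y)))) * Oanti (fst x)) =
        ?s (?d (fst y) * ?d (snd y) + ?x1 * (?d (snd y) + ?d (fst y))) (K (snd x)
         (Oincl (snd y) * (?t (?x1 + ?d (fst y)) m * (Oanti (fst y) * Oanti (fst x)))))"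
        by (simp add: twist_mult twist_twist twist_Oanti[OF yw(1)] twist_incl_bas klin_scale[OF K] scale_mult_left scale_mult_right power_add
            distrib_left mult.assoc) (simp add: mult.left_commute mult.commute)
    qed
    finally show "?s (?d (fst x) * ?d (snd x)) (K (snd x) (?t ?x1 (adj (bas b) m) * Oanti (fst x))) =
      lin (\<lambda>y. ?s (?d (fst x) * ?d (snd x) + ?d (fst y) * ?d (snd y) + ?x1 * (?d (snd y) + ?d (fst y)))
         (K (snd x) (Oincl (snd y) * (?t (?x1 + ?d (fst y)) m * (Oanti (fst y) * Oanti (fst x)))))) ?\<Delta>b"
      by (simp add: scale_lin power_add mult.assoc)
qed

text \<open>When d(a'' b'') is expanded by the Leibniz rule, the terms with da'' give the right
  side. In those with db'' the product S(a') a'' appears, which is the counit of a and hence 0. So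
  \<open>adj_cyc\<close> satisfies the rule of a Fox derivative for the adjoint action.\<close>

lemma adj_cyc_mult:
  fixes m :: "('x, 'k::comm_ring_1) xomega"
  assumes a: "a \<in> \<Omega>words" "omega_counit (bas a :: ('x, 'k) omega) = 0" and b: "b \<in> \<Omega>words"
  shows "adj_cyc (bas (a + b)) m \<simeq> adj_cyc (bas a) (adj (bas b) m)"
proof -
  let ?t = "twist xomega_deg" and ?d = "wdeg omega_deg"
  let ?\<Delta>a = "omega_coprod X (bas a) :: _ \<Rightarrow>\<^sub>0 'k" and ?\<Delta>b = "omega_coprod X (bas b) :: _ \<Rightarrow>\<^sub>0 'k"
  let ?s = "\<lambda>n. scale ((- 1 :: 'k) ^ n)"
  define T1 where "T1 x y = ?s (?d (fst x) * ?d (snd x) + ?d (fst y) * ?d (snd y) + ?d (fst x) * (?d (snd y) + ?d (fst y)))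
     (cyc (bas (snd x)) (Oincl (snd y) * (?t (?d (fst x) + ?d (fst y)) m * (Oanti (fst y) * Oanti (fst x)))))" for x y
  define T2 where "T2 x y = ?s (?d (fst y) * ?d (snd y) + ?d a * (?d (snd y) + ?d (fst y)))
     (cyc (bas (snd y)) (?t (?d a + ?d (fst y)) m * Oanti (fst y) * (Oanti (fst x) * Oincl (snd x))))" for x y
  have "adj_cyc (bas (a + b)) m = lin (\<lambda>x. lin (\<lambda>y. T1 x y + T2 x y) ?\<Delta>b) ?\<Delta>a"
    unfolding adj_cyc_def omega_coprod_bas_add lin_kmult
  proof (intro lin_cong refl)
    fix x y assume x: "x \<in> Poly_Mapping.keys ?\<Delta>a" and y: "y \<in> Poly_Mapping.keys ?\<Delta>b"
    note xw = omega_coprod_words[OF a(1) x] and yw = omega_coprod_words[OF b y]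
    let ?x1 = "?d (fst x)" and ?x2 = "?d (snd x)" and ?y1 = "?d (fst y)" and ?y2 = "?d (snd y)"
    let ?M = "?t (?x1 + ?y1) m * Oanti (fst x + fst y)"
    have M: "?M = ?s (?x1 * ?y1) (?t (?x1 + ?y1) m * (Oanti (fst y) * Oanti (fst x)))"
      by (simp add: anti_ext_bas_add scale_mult_right)
    have tM: "?t ?x2 ?M = ?s (?x1 * ?y1 + ?x2 * (?y1 + ?x1)) (?t (?d a + ?y1) m * (Oanti (fst y) * Oanti (fst x)))"
      unfolding M by (simp add: twist_mult twist_twist twist_Oanti[OF xw(1)] twist_Oanti[OF yw(1)] scale_mult_left scale_mult_right
          xw(3) power_add distrib_left add_ac mult_ac)
    have "cyc (bas (snd x + snd y)) ?M = ?s (?x1 * ?y1) (cyc (bas (snd x)) (Oincl (snd y) * (?t (?x1 + ?y1) m * (Oanti (fst y) * Oanti (fst x))))) +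
       ?s (?x2 * ?y2 + (?x1 * ?y1 + ?x2 * (?y1 + ?x1))) (cyc (bas (snd y)) (?t (?d a + ?y1) m * Oanti (fst y) * (Oanti (fst x) * Oincl (snd x))))"
      unfolding cyc_bas_add tM unfolding M by (simp add: scale_mult_left scale_mult_right power_add mult.assoc)
    then have "?s (?x2 * ?y1) (?s ((?x1 + ?y1) * (?x2 + ?y2)) (cyc (bas (snd x + snd y)) ?M)) =
      ?s (?x2 * ?y1 + (?x1 + ?y1) * (?x2 + ?y2) + ?x1 * ?y1) (cyc (bas (snd x)) (Oincl (snd y) * (?t (?x1 + ?y1) m * (Oanti (fst y) * Oanti (fst x))))) +
      ?s (?x2 * ?y1 + (?x1 + ?y1) * (?x2 + ?y2) + (?x2 * ?y2 + (?x1 * ?y1 + ?x2 * (?y1 + ?x1)))) (cyc (bas (snd y)) (?t (?d a + ?y1) m * Oanti (fst y) * (Oanti (fst x) * Oincl (snd x))))"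
      by (simp add: scale_add power_add mult.assoc)
    also have "(- 1 :: 'k) ^ (?x2 * ?y1 + (?x1 + ?y1) * (?x2 + ?y2) + ?x1 * ?y1) = (- 1) ^ (?x1 * ?x2 + ?y1 * ?y2 + ?x1 * (?y2 + ?y1))"
      by (rule sgn_eqI) auto
    also have "(- 1 :: 'k) ^ (?x2 * ?y1 + (?x1 + ?y1) * (?x2 + ?y2) + (?x2 * ?y2 + (?x1 * ?y1 + ?x2 * (?y1 + ?x1)))) =
       (- 1) ^ (?y1 * ?y2 + ?d a * (?y2 + ?y1))"
      by (rule sgn_eqI) (auto simp: xw(3))
    finally show "?s (?d (snd x) * ?d (fst y)) (?s (?d (fst (fst x + fst y, snd x + snd y)) * ?d (snd (fst x + fst y, snd x + snd y)))
       (cyc (bas (snd (fst x + fst y, snd x + snd y))) (?t (?d (fst (fst x + fst y, snd x + snd y))) m * Oanti (fst (fst x + fst y, snd x + snd y))))) =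
      T1 x y + T2 x y"
      by (simp add: T1_def T2_def)
  qed
  also have "\<dots> = lin (\<lambda>x. lin (T1 x) ?\<Delta>b) ?\<Delta>a + lin (\<lambda>y. lin (\<lambda>x. T2 x y) ?\<Delta>a) ?\<Delta>b"
    by (subst (2) lin_swap) (simp add: lin_add_fun)
  also have "lin (\<lambda>x. lin (T1 x) ?\<Delta>b) ?\<Delta>a = adj_cyc (bas a) (adj (bas b) m)"
    by (simp add: adj_cyc_coact coact_adj[OF klin_cyc b] T1_def[abs_def])
  finally have *: "adj_cyc (bas (a + b)) m = adj_cyc (bas a) (adj (bas b) m) + lin (\<lambda>y. lin (\<lambda>x. T2 x y) ?\<Delta>a) ?\<Delta>b" .
  have "lin (\<lambda>y. lin (\<lambda>x. T2 x y) ?\<Delta>a) ?\<Delta>b \<simeq> lin (\<lambda>y. 0) ?\<Delta>b"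
  proof (rule eqv_lin)
    fix y :: "'x simplex word \<times> 'x simplex word"
    let ?P = "?t (?d a + ?d (fst y)) m * Oanti (fst y)"
    have "lin (\<lambda>x. T2 x y) ?\<Delta>a = ?s (?d (fst y) * ?d (snd y) + ?d a * (?d (snd y) + ?d (fst y)))
       (cyc (bas (snd y)) (?P * conv Oanti Oincl a))"
      unfolding T2_def lin_scale_fun conv_def
      by (subst klin_compose_lin[where f = "\<lambda>z. cyc (bas (snd y)) (?P * z)", symmetric])
        (intro klin_cyc_right klin_mult_right klin_intros, rule refl)
    also have "\<dots> \<simeq> ?s (?d (fst y) * ?d (snd y) + ?d a * (?d (snd y) + ?d (fst y))) (cyc (bas (snd y)) (?P * conv_unit a))"
      by (intro eqv_scale cyc_eqv eqv_mult[OF Jideal] eqv_refl antipode_left a(1))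
    finally show "lin (\<lambda>x. T2 x y) ?\<Delta>a \<simeq> 0" by (simp add: conv_unit_def a(2))
  qed
  from eqv_add[OF eqv_refl this] show ?thesis unfolding * by (simp only: lin_0_fun add_0_right)
qed

text \<open>Evaluates the sum of \<open>adj_cyc\<close> on a pure tensor. Parities suffice for the
  sign, so factors that have been differentiated are covered too.\<close>

lemma lin_cyc_tens:
  fixes m :: "('x, 'k::comm_ring_1) xomega"
  assumes P: "\<And>u. u \<in> Poly_Mapping.keys P \<Longrightarrow> even (wdeg omega_deg u) = even i"
    and Q: "\<And>u. u \<in> Poly_Mapping.keys Q \<Longrightarrow> even (wdeg omega_deg u) = even j"
  shows "lin (\<lambda>x. scale ((-1) ^ (wdeg omega_deg (fst x) * wdeg omega_deg (snd x)))
     (cyc (bas (snd x)) (twist xomega_deg (wdeg omega_deg (fst x)) m * Oanti (fst x)))) (tens P Q) =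
    scale ((-1) ^ (i * j)) (cyc Q (twist xomega_deg i m * anti_cell P))" (is "lin ?f _ = _")
proof (rule klin_eqI2[where F = "\<lambda>P Q. lin ?f (tens P Q)" and G = "\<lambda>P Q. scale ((-1) ^ (i * j)) (cyc Q (twist xomega_deg i m * anti_cell P))"])
  fix u v assume u: "u \<in> Poly_Mapping.keys P" and v: "v \<in> Poly_Mapping.keys Q"
  have "twist xomega_deg (wdeg omega_deg u) m = twist xomega_deg i m"
    unfolding twist_def by (intro lin_cong refl arg_cong2[where f = scale] sgn_eqI) (simp add: P[OF u])
  moreover have "(- 1 :: 'k) ^ (wdeg omega_deg u * wdeg omega_deg v) = (- 1) ^ (i * j)"
    by (rule sgn_eqI) (simp add: P[OF u] Q[OF v])
  ultimately show "lin ?f (tens (bas u) (bas v)) = scale ((-1) ^ (i * j)) (cyc (bas v) (twist xomega_deg i m * Oanti u))"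
    by simp
qed (intro klins klin_cyc_left klin_cyc_right klin_anti_ext)+

text \<open>The formula for \<open>cyc\<close> is applied under the coproduct of u. The second half
  of the commutator contains S(u') u'', which is the counit of u and hence 0, so over the vertex
  only the adjoint action is left.\<close>

lemma cohochschild_diff_adj_cyc:
  fixes m :: "('x, 'k::comm_ring_1) xomega"
  assumes u: "u \<in> \<Omega>words" "omega_counit (bas u :: ('x, 'k) omega) = 0" and m: "m \<in> supported Xwords"
  shows "cohochschild_diff X (adj_cyc (bas u) m) \<simeq> - adj_cyc (omega_diff X (bas u)) m
     - scale ((-1) ^ wdeg omega_deg u) (adj_cyc (bas u) (xomega_diff X m)) + tens (bas pt) (adj (bas u) m)"
proof -
  let ?t = "twist xomega_deg" and ?d = "wdeg omega_deg" and ?D = "xomega_diff X :: ('x, 'k) xomega \<Rightarrow> _"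
  let ?dO = "\<lambda>a. omega_diff X (bas a) :: ('x, 'k) omega"
  let ?\<Delta> = "omega_coprod X (bas u) :: _ \<Rightarrow>\<^sub>0 'k"
  let ?s = "\<lambda>n. scale ((- 1 :: 'k) ^ n)"
  let ?f = "\<lambda>x. ?s (?d (fst x) * ?d (snd x)) (cyc (bas (snd x)) (?t (?d (fst x)) m * Oanti (fst x)))"
  \<comment> \<open>The differential falls on u'' in \<open>A\<close>, on m in \<open>B\<close> and
    on the antipode of u' in \<open>C\<close>; \<open>E\<close> and \<open>G\<close> are the two
    halves of the commutator. \<open>A\<close> and \<open>C\<close> recombine because the coproduct
    is a chain map.\<close>
  define A where "A x = ?s (?d (fst x) * ?d (snd x)) (cyc (?dO (snd x)) (?t (?d (fst x)) m * Oanti (fst x)))" for x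
  define B where "B x = ?s (?d (fst x) * ?d (snd x)) (cyc (bas (snd x)) (?t (?d (fst x)) (?D m) * Oanti (fst x)))" for x
  define C where "C x = ?s (?d (fst x) * ?d (snd x) + ?d (snd x)) (cyc (bas (snd x)) (?t (?d (fst x) + 1) m * anti_cell (?dO (fst x))))" for x
  define E where "E x = ?s (?d (fst x) * ?d (snd x)) (Oincl (snd x) * (?t (?d (fst x)) m * Oanti (fst x)))" for x
  define G where "G x = ?t (?d u) m * (Oanti (fst x) * Oincl (snd x))" for x
  have tm: "?t k m \<in> supported Xwords" for k
    unfolding twist_def using m by (auto intro!: supported_lin supported_scale dest: supportedD)
  have "cohochschild_diff X (adj_cyc (bas u) m) = lin (\<lambda>x. cohochschild_diff X (?f x)) ?\<Delta>"
    unfolding adj_cyc_def by (rule klin_compose_lin[OF klin_cohochschild_diff])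
  also have "\<dots> \<simeq> lin (\<lambda>x. - A x - ?s (?d u) (B x) - C x + tens (bas pt) (E x) - tens (bas pt) (G x)) ?\<Delta>"
  proof (rule eqv_lin)
    fix x assume x: "x \<in> Poly_Mapping.keys ?\<Delta>"
    note xw = omega_coprod_words[OF u(1) x]
    let ?a = "?d (fst x)" and ?b = "?d (snd x)"
    let ?M = "?t ?a m * Oanti (fst x)"
    have os: "(Oanti (fst x) :: ('x, 'k) xomega) \<in> supported Xwords"
      by (rule supported_mono[OF Oanti_supported[OF xw(1)]]) auto
    have M: "?M \<in> supported Xwords" by (rule supported_mult[OF tm os]) simp
    have "?D (?t ?a m) = ?s ?a (?t ?a (?D m))"
      using twist_xomega_diff[OF m, of ?a] by (simp add: power_add[symmetric] mult_2[symmetric])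
    then have DM: "?D ?M = ?s ?a (?t ?a (?D m) * Oanti (fst x)) + ?t (?a + 1) m * ?D (Oanti (fst x))"
      by (simp add: xomega_diff_mult twist_twist scale_mult_left add.commute)
    have tM: "?t ?b ?M * Oincl (snd x) = ?s (?a * ?b) (G x)"
      by (simp add: G_def twist_mult twist_twist twist_Oanti[OF xw(1)] scale_mult_left scale_mult_right xw(3) mult.assoc
          mult.commute add.commute)
    have C': "?s (?a * ?b + ?b) (cyc (bas (snd x)) (?t (?a + 1) m * ?D (Oanti (fst x)))) \<simeq> C x"
      unfolding C_def by (intro eqv_scale cyc_eqv eqv_mult[OF Jideal] eqv_refl omega_antipode_diff xw)
    have s1: "(- 1 :: 'k) ^ (?a * ?b) * ((- 1) ^ ?b * (- 1) ^ ?a) = (- 1) ^ ?d u * (- 1) ^ (?a * ?b)"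
      by (simp add: xw(3) power_add mult.commute)
    have s2: "(- 1 :: 'k) ^ (?a * ?b) * (- 1) ^ (?a * ?b) = 1"
      by (simp add: power_add[symmetric] mult_2[symmetric])
    have "cohochschild_diff X (?f x) = - A x - ?s (?d u) (B x)
       - ?s (?a * ?b + ?b) (cyc (bas (snd x)) (?t (?a + 1) m * ?D (Oanti (fst x)))) + tens (bas pt) (E x) - tens (bas pt) (G x)"
      unfolding cohochschild_diff_simps cohochschild_diff_cyc[OF xw(2) M] DM tM
      by (simp add: A_def B_def E_def scale_add scale_diff power_add s1[unfolded power_add] s2 mult.assoc)
    also have "\<dots> \<simeq> - A x - ?s (?d u) (B x) - C x + tens (bas pt) (E x) - tens (bas pt) (G x)"
      by (intro eqv_add eqv_diff eqv_refl C')
    finally show "cohochschild_diff X (?f x) \<simeq> - A x - ?s (?d u) (B x) - C x + tens (bas pt) (E x) - tens (bas pt) (G x)" .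
  qed
  also have "\<dots> = - lin (\<lambda>x. A x + C x) ?\<Delta> - ?s (?d u) (lin B ?\<Delta>) + tens (bas pt) (lin E ?\<Delta>) - tens (bas pt) (lin G ?\<Delta>)"
    by (simp add: lin_add_fun lin_diff_fun lin_uminus_fun lin_scale_fun lin_tens_right)
  also have "lin B ?\<Delta> = adj_cyc (bas u) (?D m)" by (simp add: adj_cyc_def B_def[abs_def])
  also have "lin E ?\<Delta> = adj (bas u) m" by (simp add: adj_def E_def[abs_def])
  also have "lin (\<lambda>x. A x + C x) ?\<Delta> = adj_cyc (?dO u) m"
    unfolding adj_cyc_def omega_coder[OF u(1)] tens_der_def lin_lin
  proof (rule lin_cong[OF refl])
    fix x assume "x \<in> Poly_Mapping.keys ?\<Delta>"
    note xw = omega_coprod_words[OF u(1) this]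
    have ed: "even (?d v) = even (?d w + 1)" if "w \<in> \<Omega>words" "v \<in> Poly_Mapping.keys (?dO w)" for v w
    proof -
      have "?d w = ?d v + 1" using supportedD[OF omega_diff_supported[OF that(1)] that(2)] by simp
      then show ?thesis by simp
    qed
    have 1: "lin ?f (tens (?dO (fst x)) (bas (snd x))) = ?s ((?d (fst x) + 1) * ?d (snd x))
        (cyc (bas (snd x)) (?t (?d (fst x) + 1) m * anti_cell (?dO (fst x))))"
      by (rule lin_cyc_tens) (auto simp: ed[OF xw(1)])
    have 2: "lin ?f (tens (bas (fst x)) (?dO (snd x))) = ?s (?d (fst x) * (?d (snd x) + 1))
        (cyc (?dO (snd x)) (?t (?d (fst x)) m * Oanti (fst x)))"
      by (rule lin_cyc_tens) (auto simp: ed[OF xw(2)])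
    have "(- 1 :: 'k) ^ ?d (fst x) * (- 1) ^ (?d (fst x) * (?d (snd x) + 1)) = (- 1) ^ (?d (fst x) * ?d (snd x))"
      unfolding power_add[symmetric] by (rule sgn_eqI) auto
    then show "A x + C x = lin ?f (tens (?dO (fst x)) (bas (snd x)) + ?s (?d (fst x)) (tens (bas (fst x)) (?dO (snd x))))"
      unfolding lin_simps 1 2 by (simp add: A_def C_def algebra_simps)
  qed
  also have "lin G ?\<Delta> = ?t (?d u) m * conv Oanti Oincl u"
    unfolding conv_def lin_mult_right by (simp add: G_def[abs_def])
  finally have *: "cohochschild_diff X (adj_cyc (bas u) m) \<simeq> - adj_cyc (?dO u) m - ?s (?d u) (adj_cyc (bas u) (?D m)) +
      tens (bas pt) (adj (bas u) m) - tens (bas pt) (?t (?d u) m * conv Oanti Oincl u)" .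
  have "?t (?d u) m * conv Oanti Oincl u \<approx> ?t (?d u) m * conv_unit u"
    by (intro eqv_mult[OF Jideal] eqv_refl antipode_left u)
  then have "?t (?d u) m * conv Oanti Oincl u \<approx> 0" by (simp add: conv_unit_def u(2))
  from eqv_trans[OF * eqv_diff[OF eqv_refl tens_eqv[OF this]]] show ?thesis by simp
qed

definition to_coH :: "('x simplex \<times> ('x, 'k::comm_ring_1) xletter word \<Rightarrow>\<^sub>0 'k) \<Rightarrow> ('x simplex \<times> ('x, 'k) xletter word \<Rightarrow>\<^sub>0 'k)" where
  "to_coH = lin (\<lambda>x. if fst (fst x) = 0 then bas x else adj_cyc (bas (Word [fst x])) (bas (snd x)))"

lemma klin_to_coH: "klin to_coH"
  by (simp add: to_coH_def)

lemmas to_coH_simps [simp] = klin_0[OF klin_to_coH] klin_add[OF klin_to_coH] klin_diff[OF klin_to_coH]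
  klin_uminus[OF klin_to_coH] klin_scale[OF klin_to_coH]

lemma to_coH_tens: "to_coH (tens (bas c) m) = (if fst c = 0 then tens (bas c) m else adj_cyc (bas (Word [c])) m)"
proof (rule klin_eqI[where f = "\<lambda>m. to_coH (tens (bas c) m)"])
  show "klin (\<lambda>m. if fst c = 0 then tens (bas c) m else adj_cyc (bas (Word [c])) m)"
    by (cases "fst c = 0") (simp_all add: klin_adj_cyc klins)
qed (intro klin_comp[OF klin_to_coH] klins, simp add: to_coH_def)

lemma to_coH_tens_cobar:
  assumes "p \<in> supported {d. fst d \<ge> 1}"
  shows "to_coH (tens p m) = adj_cyc (cobar_gen p) m"
proof (rule klin_eqI[where f = "\<lambda>p. to_coH (tens p m)"])
  fix d assume "d \<in> Poly_Mapping.keys p"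
  then have "fst d \<ge> 1" using supportedD[OF assms] by auto
  then show "to_coH (tens (bas d) m) = adj_cyc (cobar_gen (bas d)) m" by (simp add: to_coH_tens)
qed (intro klin_comp[OF klin_to_coH] klin_comp[OF klin_adj_cyc(1)] klin_cobar_gen klins)+

lemma to_coH_eqv: "y \<simeq> z \<Longrightarrow> to_coH y \<simeq> to_coH z"
proof (rule klin_eqv[OF klin_to_coH])
  fix y :: "'x simplex \<times> ('x, 'a) xletter word \<Rightarrow>\<^sub>0 'a" assume "y \<in> tens_rel X"
  then obtain c x where y: "y = tens (bas c) x" and x: "x \<in> xomega_rel X" unfolding tens_rel_def by blast
  have "x \<approx> 0" using x by (simp add: eqv_0 free_module.span_base)
  from tens_eqv[OF this, of "bas c"] adj_cyc_eqv[OF this, of "bas (Word [c])"]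
  have "to_coH y \<simeq> 0" by (simp add: y to_coH_tens)
  then show "to_coH y \<in> free_module.span (tens_rel X)" by (simp add: eqv_0)
qed

abbreviation adjoint_diff :: "('x simplex \<times> ('x, 'k::comm_ring_1) xletter word \<Rightarrow>\<^sub>0 'k) \<Rightarrow> ('x simplex \<times> ('x, 'k) xletter word \<Rightarrow>\<^sub>0 'k)" where
  "adjoint_diff \<equiv> twisted_diff fst (bd X) (aw X) (xomega_diff X) (adjoint_action X) cobar_gen"

lemma klin_adjoint_action: "klin (adjoint_action X p)" "klin (\<lambda>p. adjoint_action X p m)"
  unfolding adjoint_action_def[abs_def] split_def
  by (intro klins klin_omega_coprod klin_comp[OF klin_lin klin_omega_coprod])+

lemma adjoint_action_0: "adjoint_action X 0 m = 0"
  by (rule klin_0[OF klin_adjoint_action(2)])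

lemma adjoint_diff_tens: "adjoint_diff (tens (bas c) m) = tens (bd X (bas c)) m + scale ((-1) ^ fst c) (tens (bas c) (xomega_diff X m))
   + lin (\<lambda>x. scale ((-1) ^ fst (fst x)) (tens (bas (fst x)) (adjoint_action X (cobar_gen (bas (snd x))) m))) (aw X (bas c))"
proof (rule klin_eqI[where f = "\<lambda>m. adjoint_diff (tens (bas c) m)"])
qed (unfold twisted_diff_def, (intro klins klin_comp[OF klin_lin] klin_comp[OF klin_xomega_diff] klin_comp[OF klin_adjoint_action(1)])+, simp add: split_def)

text \<open>The inner Alexander-Whitney terms are combined by \<open>adj_cyc_mult\<close> into
  \<open>adj_cyc\<close> of the quadratic part of the cobar differential. The term with the vertex
  on the left becomes the adjoint action over the vertex, and the one with the vertex on the right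
  is 0, since {c} = 0 in dimension 0. The result is the formula of
  \<open>cohochschild_diff_adj_cyc\<close>.\<close>

lemma to_coH_diff:
  fixes m :: "('x, 'k::comm_ring_1) xomega"
  assumes c: "c \<in> nondegenerate X" and m: "m \<in> supported Xwords"
  shows "to_coH (adjoint_diff (tens (bas c) m)) \<simeq> cohochschild_diff X (to_coH (tens (bas c) m))"
  using c
proof (cases rule: nondegenerate_cases)
  case 1
  then show ?thesis
    by (simp add: adjoint_diff_tens bd_pt aw_pt adjoint_action_0 to_coH_tens cohochschild_diff_pt)
next
  case 2
  have s: "c \<in> nondegenerate X" "is_simplex X c" "fst c \<ge> 1"
    using 2 by (auto simp: omega_letters_def nondegenerate_is_simplex)
  have cw: "Word [c] \<in> \<Omega>words" using 2 by simp
  have b: "to_coH (tens (bd X (bas c)) m) = adj_cyc (cobar_gen (bd X (bas c))) m"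
  proof (cases "fst c = 1")
    case False
    then show ?thesis using s
      by (intro to_coH_tens_cobar supported_mono[OF bd_supported[OF s(1)]]) auto
  qed (simp add: bd_1 s)
  have ltr: "d \<in> omega_letters X" if "d \<in> nondegenerate X" "fst d \<noteq> 0" for d
    using that by (simp add: omega_letters_def)
  let ?G = "\<lambda>x. scale ((-1) ^ fst (fst x)) (cobar_gen (bas (fst x)) * cobar_gen (bas (snd x)))"
  let ?P = "\<lambda>c d. tens (bas c) (adj (cobar_gen (bas d)) m)"
  let ?T = "\<lambda>x. scale ((-1) ^ fst (fst x)) (tens (bas (fst x)) (adjoint_action X (cobar_gen (bas (snd x))) m))"
  have cz: "omega_counit (bas (Word [d]) :: ('x, 'k) omega) = 0" for d by (simp add: omega_counit_def)
  have "to_coH (lin ?T (aw X (bas c))) = lin (\<lambda>x. to_coH (?T x)) (aw X (bas c))"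
    by (rule klin_compose_lin[OF klin_to_coH])
  also have "\<dots> \<simeq> lin (\<lambda>x. adj_cyc (?G x) m + (if fst (fst x) = 0 then ?P (fst x) (snd x) else 0)) (aw X (bas c))"
  proof (rule eqv_lin)
    fix x assume "x \<in> Poly_Mapping.keys (aw X (bas c) :: _ \<Rightarrow>\<^sub>0 'k)"
    note x = supportedD[OF aw_supported[OF s(2)] this]
    show "to_coH (?T x) \<simeq> adj_cyc (?G x) m + (if fst (fst x) = 0 then ?P (fst x) (snd x) else 0)"
    proof (cases "fst (snd x) = 0")
      case True
      then show ?thesis by (simp add: adjoint_action_0 klin_0[OF klin_adj(1)])
    next
      case False
      then have w: "Word [snd x] \<in> \<Omega>words" using x ltr by simp
      have act: "adjoint_action X (cobar_gen (bas (snd x))) m \<approx> adj (cobar_gen (bas (snd x))) m"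
        by (rule adjoint_action_adj) (use False w in simp)
      show ?thesis
      proof (cases "fst (fst x) = 0")
        case True
        then show ?thesis using tens_eqv[OF act, of "bas (fst x)"] by (simp add: to_coH_tens del: cobar_gen_simps(6)) simp
      next
        case F2: False
        then have w': "Word [fst x] \<in> \<Omega>words" using x ltr by simp
        have "to_coH (?T x) \<simeq> scale ((-1) ^ fst (fst x)) (adj_cyc (bas (Word [fst x])) (adj (bas (Word [snd x])) m))"
          using eqv_scale[OF adj_cyc_eqv[OF act, of "bas (Word [fst x])"], of "(-1) ^ fst (fst x)"] False F2 by (simp add: to_coH_tens)
        also have "\<dots> \<simeq> scale ((-1) ^ fst (fst x)) (adj_cyc (bas (Word [fst x] + Word [snd x])) m)"
          by (rule eqv_scale[OF eqv_sym[OF adj_cyc_mult[OF w' cz w]]])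
        finally show ?thesis using False F2 by (simp add: bas_mult)
      qed
    qed
  qed
  also have "\<dots> = adj_cyc (lin ?G (aw X (bas c))) m + ?P pt c"
    unfolding lin_add_fun aw_special(1)[OF 2, of ?P] klin_compose_lin[OF klin_adj_cyc(1)] ..
  finally have T: "to_coH (lin ?T (aw X (bas c))) \<simeq> adj_cyc (lin ?G (aw X (bas c))) m + ?P pt c" .
  have sg: "(- 1 :: 'k) ^ fst c = - ((- 1) ^ omega_deg c)"
    using s by (cases "fst c") (auto simp: omega_deg_def)
  have "to_coH (adjoint_diff (tens (bas c) m)) = adj_cyc (cobar_gen (bd X (bas c))) m +
      scale ((-1) ^ fst c) (adj_cyc (bas (Word [c])) (xomega_diff X m)) + to_coH (lin ?T (aw X (bas c)))"
    unfolding adjoint_diff_tens to_coH_simps b using s by (simp add: to_coH_tens)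
  also have "\<dots> \<simeq> adj_cyc (cobar_gen (bd X (bas c))) m +
      scale ((-1) ^ fst c) (adj_cyc (bas (Word [c])) (xomega_diff X m)) + (adj_cyc (lin ?G (aw X (bas c))) m + ?P pt c)"
    by (intro eqv_add eqv_refl T)
  also have "\<dots> = - adj_cyc (omega_diff X (bas (Word [c]))) m - scale ((-1) ^ wdeg omega_deg (Word [c])) (adj_cyc (bas (Word [c])) (xomega_diff X m))
      + tens (bas pt) (adj (bas (Word [c])) m)"
    unfolding omega_diff_letter sg using s by (simp del: cobar_gen_simps) (simp add: algebra_simps)
  also have "\<dots> \<simeq> cohochschild_diff X (adj_cyc (bas (Word [c])) m)"
    by (rule eqv_sym[OF cohochschild_diff_adj_cyc[OF cw cz m]])
  finally show ?thesis using s by (simp add: to_coH_tens)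
qed

end

section \<open>The inverse of the comparison map\<close>

context reduced_sset
begin

lemma omega_counit_bas: "omega_counit (bas w) = (if w = 0 then 1 else 0)"
  by (cases w; cases "letters w") (auto simp: omega_counit_def zero_word_def)

text \<open>By coassociativity the two coactions act together through P * Q, which is the counit.
  With the inclusion and the antipode as P and Q, in either order, this makes the two comparison
  maps inverse to each other.\<close>

lemma coact_coact:
  fixes m :: "('x, 'k::comm_ring_1) xomega"
  assumes K: "\<And>w. klin (K w)" "\<And>w x y. x \<approx> y \<Longrightarrow> eqv R (K w x) (K w y)"
    and P: "\<And>u. u \<in> \<Omega>words \<Longrightarrow> P u \<in> supported {v. wdeg xomega_deg v = wdeg omega_deg u}"
    and inv: "\<And>u. u \<in> \<Omega>words \<Longrightarrow> conv P Q u \<approx> conv_unit u" and w: "w \<in> \<Omega>words"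
  shows "eqv R (coact (coact K Q) P w m) (K w m)"
proof -
  let ?t = "twist xomega_deg" and ?d = "wdeg omega_deg"
  let ?s = "\<lambda>n. scale ((- 1 :: 'k) ^ n)"
  let ?\<Delta> = "\<lambda>w. omega_coprod X (bas w) :: _ \<Rightarrow>\<^sub>0 'k"
  define T where "T u v z = ?s ((?d u + ?d v) * ?d z) (K z (?t (?d u + ?d v) m * (P u * Q v)))" for u v z
  have "coact (coact K Q) P w m = lin (\<lambda>x. lin (\<lambda>y. T (fst x) (fst y) (snd y)) (?\<Delta> (snd x))) (?\<Delta> w)"
    unfolding coact_def[of _ P] unfolding coact_def scale_lin
  proof (intro lin_cong refl)
    fix x y assume x: "x \<in> Poly_Mapping.keys (?\<Delta> w)" and y: "y \<in> Poly_Mapping.keys (?\<Delta> (snd x))"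
    note xw = omega_coprod_words[OF w x]
    note yw = omega_coprod_words[OF xw(2) y]
    have "?t (?d (fst y)) (P (fst x)) = ?s (?d (fst y) * ?d (fst x)) (P (fst x))"
    proof (rule twist_homog)
      fix v assume "v \<in> Poly_Mapping.keys (P (fst x))"
      from supportedD[OF P[OF xw(1)] this] show "even (wdeg xomega_deg v) = even (?d (fst x))" by simp
    qed
    moreover have "(- 1 :: 'k) ^ (?d (fst x) * ?d (snd x)) * ((- 1) ^ (?d (fst y) * ?d (snd y)) * (- 1) ^ (?d (fst y) * ?d (fst x))) =
        (- 1) ^ ((?d (fst x) + ?d (fst y)) * ?d (snd y))"
      unfolding power_add[symmetric] by (rule sgn_eqI) (auto simp: yw(3))
    ultimately show "?s (?d (fst x) * ?d (snd x)) (?s (?d (fst y) * ?d (snd y))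
        (K (snd y) (?t (?d (fst y)) (?t (?d (fst x)) m * P (fst x)) * Q (fst y)))) = T (fst x) (fst y) (snd y)"
      by (simp add: T_def twist_mult twist_twist scale_mult_left scale_mult_right klin_scale[OF K(1)] mult.assoc add.commute)
  qed
  also have "\<dots> = lin (\<lambda>x. lin (\<lambda>y. T (fst y) (snd y) (snd x)) (?\<Delta> (fst x))) (?\<Delta> w)"
    by (rule omega_coassoc_lin[OF w, symmetric])
  also have "\<dots> = lin (\<lambda>x. ?s (?d (fst x) * ?d (snd x)) (K (snd x) (?t (?d (fst x)) m * conv P Q (fst x)))) (?\<Delta> w)"
  proof (rule lin_cong[OF refl])
    fix x assume x: "x \<in> Poly_Mapping.keys (?\<Delta> w)"
    note xw = omega_coprod_words[OF w x]
    have "lin (\<lambda>y. T (fst y) (snd y) (snd x)) (?\<Delta> (fst x)) =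
       lin (\<lambda>y. ?s (?d (fst x) * ?d (snd x)) (K (snd x) (?t (?d (fst x)) m * (P (fst y) * Q (snd y))))) (?\<Delta> (fst x))"
      by (intro lin_cong refl) (simp add: T_def omega_coprod_words(3)[OF xw(1)])
    also have "\<dots> = ?s (?d (fst x) * ?d (snd x)) (K (snd x) (?t (?d (fst x)) m * conv P Q (fst x)))"
      unfolding lin_scale_fun conv_def
      by (subst klin_compose_lin[where f = "\<lambda>z. K (snd x) (?t (?d (fst x)) m * z)", symmetric])
        (intro klin_comp[OF K(1)] klin_mult_right klin_intros, rule refl)
    finally show "lin (\<lambda>y. T (fst y) (snd y) (snd x)) (?\<Delta> (fst x)) =
        ?s (?d (fst x) * ?d (snd x)) (K (snd x) (?t (?d (fst x)) m * conv P Q (fst x)))" .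
  qed
  also have "eqv R \<dots> (lin (\<lambda>x. ?s (?d (fst x) * ?d (snd x)) (K (snd x) (?t (?d (fst x)) m * conv_unit (fst x)))) (?\<Delta> w))"
    by (intro eqv_lin eqv_scale K(2) eqv_mult[OF Jideal] eqv_refl inv omega_coprod_words(1)[OF w])
  also have "\<dots> = lin (\<lambda>v. K v m) (lin (\<lambda>x. scale (omega_counit (bas (fst x))) (bas (snd x))) (?\<Delta> w))"
    unfolding lin_lin
  proof (rule lin_cong[OF refl])
    fix x :: "'x simplex word \<times> 'x simplex word"
    have "?t 0 m = m" by (simp add: twist_def)
    then show "?s (?d (fst x) * ?d (snd x)) (K (snd x) (?t (?d (fst x)) m * conv_unit (fst x))) =
       lin (\<lambda>v. K v m) (scale (omega_counit (bas (fst x))) (bas (snd x)))"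
      by (simp add: conv_unit_def omega_counit_bas klin_0[OF K(1)])
  qed
  also have "\<dots> = K w m" by (simp add: omega_counit(1)[OF w])
  finally show ?thesis .
qed

lemma coact_eqv:
  assumes "\<And>w x y. x \<approx> y \<Longrightarrow> eqv R (K w x) (K w y)" "x \<approx> y"
  shows "eqv R (coact K P w x) (coact K P w y)"
  unfolding coact_def by (intro eqv_lin eqv_scale assms(1) eqv_mult[OF Jideal] twist_eqv eqv_refl assms(2))

lemma klin_coact:
  assumes "\<And>w. klin (K w)"
  shows "klin (coact K P w)"
  unfolding coact_def[abs_def] by (intro klin_intros klin_comp[OF assms] klin_mult_left klin_twist)

lemma coact_cong_eqv:
  assumes "\<And>v m. v \<in> \<Omega>words \<Longrightarrow> eqv R (K v m) (K' v m)" "w \<in> \<Omega>words"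
  shows "eqv R (coact K P w m) (coact K' P w m)"
  unfolding coact_def by (intro eqv_lin eqv_scale assms(1) omega_coprod_words(2)[OF assms(2)])

lemma Oincl_degree: "u \<in> \<Omega>words \<Longrightarrow> Oincl u \<in> supported {v. wdeg xomega_deg v = wdeg omega_deg u}"
  by (simp add: xomega_incl_bas)

lemma Oanti_degree: "u \<in> \<Omega>words \<Longrightarrow> Oanti u \<in> supported {v. wdeg xomega_deg v = wdeg omega_deg u}"
  by (rule supported_mono[OF Oanti_supported]) auto

text \<open>An action in the strict sense and not only modulo the relations, since
  \<open>anti_cell\<close> reverses products exactly.\<close>

lemma adj_mult:
  fixes m :: "('x, 'k::comm_ring_1) xomega"
  assumes a: "a \<in> \<Omega>words" and b: "b \<in> \<Omega>words"
  shows "adj (bas (a + b)) m = adj (bas a) (adj (bas b) m)"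
  unfolding adj_coact[of a] coact_adj[OF klin_mult_right[OF klin_intros(1)] b]
  unfolding adj_def omega_coprod_bas_add lin_kmult
proof (intro lin_cong refl)
  let ?t = "twist xomega_deg" and ?d = "wdeg omega_deg"
  let ?s = "\<lambda>n. scale ((- 1 :: 'k) ^ n)"
  fix x y :: "'x simplex word \<times> 'x simplex word"
  let ?x1 = "?d (fst x)" and ?x2 = "?d (snd x)" and ?y1 = "?d (fst y)" and ?y2 = "?d (snd y)"
  have "(- 1 :: 'k) ^ (?x2 * ?y1) * ((- 1) ^ ((?x1 + ?y1) * (?x2 + ?y2)) * (- 1) ^ (?x1 * ?y1)) =
      (- 1) ^ (?x1 * ?x2 + ?y1 * ?y2 + ?x1 * (?y2 + ?y1))"
    unfolding power_add[symmetric] by (rule sgn_eqI) auto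
  moreover have "Oincl (snd x + snd y) = (Oincl (snd x) * Oincl (snd y) :: ('x, 'k) xomega)"
    by (simp add: bas_mult[symmetric] xomega_incl_mult)
  ultimately show "?s (?d (snd x) * ?d (fst y)) (?s (?d (fst (fst x + fst y, snd x + snd y)) * ?d (snd (fst x + fst y, snd x + snd y)))
       (Oincl (snd (fst x + fst y, snd x + snd y)) * (?t (?d (fst (fst x + fst y, snd x + snd y))) m * Oanti (fst (fst x + fst y, snd x + snd y))))) =
     ?s (?x1 * ?x2 + ?y1 * ?y2 + ?x1 * (?y2 + ?y1)) (Oincl (snd x) * (Oincl (snd y) * (?t (?x1 + ?y1) m * (Oanti (fst y) * Oanti (fst x)))))"
    by (simp add: anti_ext_bas_add scale_mult_right mult.assoc)
qed

text \<open>\<open>lcyc\<close> is the Fox derivative with respect to the adjoint action.\<close>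

definition lcyc :: "'x simplex word \<Rightarrow> ('x, 'k::comm_ring_1) xomega \<Rightarrow> ('x simplex \<times> ('x, 'k) xletter word \<Rightarrow>\<^sub>0 'k)" where
  "lcyc w m = (case letters w of [] \<Rightarrow> 0 | g # gs \<Rightarrow> tens (bas g) (adj (bas (Word gs)) m))"

abbreviation lad :: "'x simplex word \<Rightarrow> ('x, 'k::comm_ring_1) xomega \<Rightarrow> ('x simplex \<times> ('x, 'k) xletter word \<Rightarrow>\<^sub>0 'k)" where
  "lad \<equiv> coact lcyc Oincl"

lemma lcyc_0 [simp]: "lcyc 0 m = 0"
  by (simp add: lcyc_def)

lemma klin_lcyc: "klin (lcyc w)"
  unfolding lcyc_def[abs_def]
  by (cases "letters w") (auto intro!: klin_intros klin_tens_right klin_adj)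

lemma adj_eqv: "x \<approx> y \<Longrightarrow> adj p x \<approx> adj p y"
  unfolding adj_def by (intro eqv_lin eqv_scale eqv_mult[OF Jideal] twist_eqv eqv_refl)

lemma lcyc_eqv: "x \<approx> y \<Longrightarrow> lcyc w x \<simeq> lcyc w y"
  unfolding lcyc_def by (cases "letters w") (simp_all add: tens_eqv adj_eqv)

lemma adj_1: "adj 1 m = m"
proof -
  have "omega_coprod X (1 :: ('x, 'a) omega) = bas (0, 0)" "twist xomega_deg 0 m = m"
    by (simp_all add: twist_def)
  then show ?thesis by (simp add: adj_def)
qed

lemma lcyc_letter: "lcyc (Word [g]) m = tens (bas g) m"
  by (simp add: lcyc_def Word_Nil adj_1)

lemma lcyc_add:
  assumes "u \<in> \<Omega>words" "v \<in> \<Omega>words"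
  shows "lcyc (u + v) m = lcyc u (adj (bas v) m) + scale (omega_counit (bas u)) (lcyc v m)"
proof (cases "letters u")
  case Nil
  then have "u = 0" by (cases u) (simp add: zero_word_def)
  then show ?thesis by (simp add: omega_counit_def)
next
  case (Cons g gs)
  have "u \<noteq> 0" using Cons by auto
  moreover have "Word gs \<in> \<Omega>words" using assms(1) Cons by (auto simp: words_def)
  from adj_mult[OF this assms(2), of m] have "adj (bas (Word (gs @ letters v))) m = adj (bas (Word gs)) (adj (bas v) m)"
    by (simp add: plus_word_def)
  ultimately show ?thesis by (simp add: lcyc_def Cons omega_counit_bas)
qed

text \<open>\<open>adj\<close> arises from left multiplication by coacting with the antipode, so
  coacting with the inclusion recovers left multiplication.\<close>

lemma adj_coact_incl:
  assumes "v \<in> \<Omega>words"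
  shows "coact (\<lambda>w. adj (bas w)) Oincl v m \<approx> Oincl v * m"
proof -
  have "coact (coact (\<lambda>u m. Oincl u * m) Oanti) Oincl v m \<approx> Oincl v * m"
    by (rule coact_coact[OF _ _ Oincl_degree antipode_right assms])
      (auto intro!: klin_mult_right klin_intros eqv_mult[OF Jideal])
  then show ?thesis by (simp only: adj_coact[abs_def])
qed

text \<open>The Leibniz rule of \<open>cyc_bas_add\<close>, now for \<open>lad\<close>; it makes the
  inverse map, which is given on letters, computable on all \<open>cyc\<close>.\<close>

lemma lad_add:
  fixes m :: "('x, 'k::comm_ring_1) xomega"
  assumes u: "u \<in> \<Omega>words" and v: "v \<in> \<Omega>words"
  shows "lad (u + v) m \<simeq> lad u (Oincl v * m) +
    scale ((-1) ^ (wdeg omega_deg u * wdeg omega_deg v)) (lad v (twist xomega_deg (wdeg omega_deg u) m * Oincl u))"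
proof -
  let ?t = "twist xomega_deg" and ?d = "wdeg omega_deg"
  let ?s = "\<lambda>n. scale ((- 1 :: 'k) ^ n)"
  let ?\<Delta> = "\<lambda>w. omega_coprod X (bas w) :: _ \<Rightarrow>\<^sub>0 'k"
  let ?N = "\<lambda>x. ?t (?d (fst x)) m * Oincl (fst x)"
  \<comment> \<open>\<open>T1\<close> comes from the first summand of the Fox rule and is simplified
    by \<open>adj_coact_incl\<close>; \<open>T2\<close> comes from the second, whose counit factor
    collapses the coproduct of u.\<close>
  define T1 where "T1 x y = ?s (?d (fst x) * ?d (snd x) + ?d (fst x) * ?d v) (lcyc (snd x)
      (?s (?d (fst y) * ?d (snd y)) (adj (bas (snd y)) (?t (?d (fst y)) (?N x) * Oincl (fst y)))))" for x y
  define T2 where "T2 x y = scale (omega_counit (bas (snd x))) (?s (?d (fst x) * ?d v) (?s (?d (fst y) * ?d (snd y))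
      (lcyc (snd y) (?t (?d (fst y)) (?N x) * Oincl (fst y)))))" for x y :: "'x simplex word \<times> 'x simplex word"
  have "lad (u + v) m = lin (\<lambda>x. lin (\<lambda>y. T1 x y + T2 x y) (?\<Delta> v)) (?\<Delta> u)"
    unfolding coact_def omega_coprod_bas_add lin_kmult
  proof (intro lin_cong refl)
    fix x y assume x: "x \<in> Poly_Mapping.keys (?\<Delta> u)" and y: "y \<in> Poly_Mapping.keys (?\<Delta> v)"
    note xw = omega_coprod_words[OF u x] and yw = omega_coprod_words[OF v y]
    let ?x1 = "?d (fst x)" and ?x2 = "?d (snd x)" and ?y1 = "?d (fst y)" and ?y2 = "?d (snd y)"
    let ?M = "?t (?x1 + ?y1) m * (Oincl (fst x) * Oincl (fst y))"
    have M: "?t ?y1 (?N x) * Oincl (fst y) = ?s (?y1 * ?x1) ?M"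
      by (simp add: twist_mult twist_twist twist_incl_bas scale_mult_left scale_mult_right mult.assoc add.commute)
    have s1: "(- 1 :: 'k) ^ (?x1 * ?x2 + ?x1 * ?d v) * ((- 1) ^ (?y1 * ?y2) * (- 1) ^ (?y1 * ?x1)) =
        (- 1) ^ (?x2 * ?y1) * (- 1) ^ ((?x1 + ?y1) * (?x2 + ?y2))"
      unfolding power_add[symmetric] by (rule sgn_eqI) (auto simp: yw(3))
    have s2: "(- 1 :: 'k) ^ (?x1 * ?d v) * ((- 1) ^ (?y1 * ?y2) * (- 1) ^ (?y1 * ?x1)) =
        (- 1) ^ (?x2 * ?y1) * (- 1) ^ ((?x1 + ?y1) * (?x2 + ?y2))" if "snd x = 0"
      unfolding power_add[symmetric] by (rule sgn_eqI) (auto simp: yw(3) that)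
    have "T1 x y = ?s (?x2 * ?y1) (?s ((?x1 + ?y1) * (?x2 + ?y2)) (lcyc (snd x) (adj (bas (snd y)) ?M)))"
      unfolding T1_def M by (simp add: klin_scale[OF klin_adj(2)] klin_scale[OF klin_lcyc] s1)
    moreover have "T2 x y = scale (omega_counit (bas (snd x))) (?s (?x2 * ?y1) (?s ((?x1 + ?y1) * (?x2 + ?y2)) (lcyc (snd y) ?M)))"
      unfolding T2_def M using s2 by (simp add: klin_scale[OF klin_lcyc] omega_counit_bas)
    ultimately show "?s (?d (snd x) * ?d (fst y)) (?s (?d (fst (fst x + fst y, snd x + snd y)) * ?d (snd (fst x + fst y, snd x + snd y)))
       (lcyc (snd (fst x + fst y, snd x + snd y)) (?t (?d (fst (fst x + fst y, snd x + snd y))) m * Oincl (fst (fst x + fst y, snd x + snd y))))) =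
      T1 x y + T2 x y"
      by (simp add: lcyc_add[OF xw(2) yw(2)] bas_mult[symmetric] xomega_incl_mult scale_add mult_ac)
  qed
  also have "\<dots> = lin (\<lambda>x. lin (T1 x) (?\<Delta> v)) (?\<Delta> u) + lin (\<lambda>x. lin (T2 x) (?\<Delta> v)) (?\<Delta> u)"
    by (simp add: lin_add_fun)
  also have "\<dots> \<simeq> lad u (Oincl v * m) + ?s (?d u * ?d v) (lad v (?t (?d u) m * Oincl u))"
  proof (rule eqv_add)
    show "lin (\<lambda>x. lin (T1 x) (?\<Delta> v)) (?\<Delta> u) \<simeq> lad u (Oincl v * m)"
      unfolding coact_def
    proof (rule eqv_lin)
      fix x assume x: "x \<in> Poly_Mapping.keys (?\<Delta> u)"
      have "lin (T1 x) (?\<Delta> v) = ?s (?d (fst x) * ?d (snd x) + ?d (fst x) * ?d v) (lcyc (snd x) (coact (\<lambda>w. adj (bas w)) Oincl v (?N x)))"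
        unfolding T1_def coact_def lin_scale_fun by (simp add: klin_compose_lin[OF klin_lcyc])
      also have "\<dots> \<simeq> ?s (?d (fst x) * ?d (snd x) + ?d (fst x) * ?d v) (lcyc (snd x) (Oincl v * ?N x))"
        by (intro eqv_scale lcyc_eqv adj_coact_incl v)
      also have "\<dots> = ?s (?d (fst x) * ?d (snd x)) (lcyc (snd x) (?t (?d (fst x)) (Oincl v * m) * Oincl (fst x)))"
        by (simp add: twist_mult twist_incl_bas scale_mult_left klin_scale[OF klin_lcyc] power_add mult.assoc)
      finally show "lin (T1 x) (?\<Delta> v) \<simeq> ?s (?d (fst x) * ?d (snd x)) (lcyc (snd x) (?t (?d (fst x)) (Oincl v * m) * Oincl (fst x)))" .
    qed
    define H where "H z = ?s (?d z * ?d v) (lad v (?t (?d z) m * Oincl z))" for z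
    have "lin (\<lambda>x. lin (T2 x) (?\<Delta> v)) (?\<Delta> u) = lin (\<lambda>x. scale (omega_counit (bas (snd x))) (H (fst x))) (?\<Delta> u)"
      unfolding T2_def H_def coact_def lin_scale_fun ..
    also have "\<dots> = lin H (lin (\<lambda>x. scale (omega_counit (bas (snd x))) (bas (fst x))) (?\<Delta> u))"
      by (simp add: lin_lin)
    also have "\<dots> = H u" by (simp add: omega_counit(2)[OF u])
    finally show "lin (\<lambda>x. lin (T2 x) (?\<Delta> v)) (?\<Delta> u) \<simeq> ?s (?d u * ?d v) (lad v (?t (?d u) m * Oincl u))"
      by (simp add: H_def)
  qed
  finally show ?thesis .
qed

lemma lad_0: "lad 0 m = 0"
  by (simp add: coact_def)

definition of_coH :: "('x simplex \<times> ('x, 'k::comm_ring_1) xletter word \<Rightarrow>\<^sub>0 'k) \<Rightarrow> ('x simplex \<times> ('x, 'k) xletter word \<Rightarrow>\<^sub>0 'k)" where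
  "of_coH = lin (\<lambda>x. if fst (fst x) = 0 then bas x else lad (Word [fst x]) (bas (snd x)))"

lemma klin_of_coH: "klin of_coH"
  by (simp add: of_coH_def)

lemmas of_coH_simps [simp] = klin_0[OF klin_of_coH] klin_add[OF klin_of_coH] klin_diff[OF klin_of_coH]
  klin_uminus[OF klin_of_coH] klin_scale[OF klin_of_coH]

lemma klin_lad: "klin (lad w)"
  by (rule klin_coact[OF klin_lcyc])

lemma lad_eqv: "x \<approx> y \<Longrightarrow> lad w x \<simeq> lad w y"
  by (rule coact_eqv[OF lcyc_eqv])

lemma of_coH_tens: "of_coH (tens (bas c) m) = (if fst c = 0 then tens (bas c) m else lad (Word [c]) m)"
proof (rule klin_eqI[where f = "\<lambda>m. of_coH (tens (bas c) m)"])
  show "klin (\<lambda>m. if fst c = 0 then tens (bas c) m else lad (Word [c]) m)"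
    by (cases "fst c = 0") (simp_all add: klin_lad klins)
qed (intro klin_comp[OF klin_of_coH] klins, simp add: of_coH_def)

lemma of_coH_eqv: "y \<simeq> z \<Longrightarrow> of_coH y \<simeq> of_coH z"
proof (rule klin_eqv[OF klin_of_coH])
  fix y :: "'x simplex \<times> ('x, 'a) xletter word \<Rightarrow>\<^sub>0 'a" assume "y \<in> tens_rel X"
  then obtain c x where y: "y = tens (bas c) x" and x: "x \<in> xomega_rel X" unfolding tens_rel_def by blast
  have "x \<approx> 0" using x by (simp add: eqv_0 free_module.span_base)
  from tens_eqv[OF this, of "bas c"] lad_eqv[OF this, of "Word [c]"]
  have "of_coH y \<simeq> 0" by (simp add: y of_coH_tens klin_0[OF klin_lad])
  then show "of_coH y \<in> free_module.span (tens_rel X)" by (simp add: eqv_0)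
qed

lemma to_coH_lcyc:
  assumes "w \<in> \<Omega>words"
  shows "to_coH (lcyc w m) \<simeq> adj_cyc (bas w) m"
proof (cases "letters w")
  case Nil
  then have "w = 0" by (cases w) (simp add: zero_word_def)
  then show ?thesis by simp
next
  case (Cons g gs)
  define u where "u = Word gs"
  have w: "w = Word [g] + u" using Cons by (cases w) (simp add: u_def plus_word_def)
  then have gu: "g \<in> omega_letters X" "u \<in> \<Omega>words" using assms by auto
  have "to_coH (lcyc w m) = adj_cyc (bas (Word [g])) (adj (bas u) m)"
    using gu by (simp add: w lcyc_def plus_word_def to_coH_tens omega_letters_def)
  also have "\<dots> \<simeq> adj_cyc (bas w) m"
    unfolding w by (rule eqv_sym[OF adj_cyc_mult]) (use gu in \<open>simp_all add: omega_counit_bas zero_word_def\<close>)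
  finally show ?thesis .
qed

text \<open>\<open>to_coH\<close> turns \<open>lcyc\<close> into \<open>adj_cyc\<close>, so the
  coaction with the inclusion meets the one with the antipode, and \<open>coact_coact\<close>
  removes both.\<close>

lemma to_coH_lad:
  assumes w: "w \<in> \<Omega>words"
  shows "to_coH (lad w m) \<simeq> cyc (bas w) m"
proof -
  have "to_coH (lad w m) = coact (\<lambda>u m. to_coH (lcyc u m)) Oincl w m"
    by (simp add: coact_def klin_compose_lin[OF klin_to_coH])
  also have "\<dots> \<simeq> coact (\<lambda>u. adj_cyc (bas u)) Oincl w m"
    by (rule coact_cong_eqv[OF to_coH_lcyc w])
  also have "\<dots> = coact (coact (\<lambda>u. cyc (bas u)) Oanti) Oincl w m"
    by (simp only: adj_cyc_coact[abs_def])
  also have "\<dots> \<simeq> cyc (bas w) m"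
    by (rule coact_coact[OF klin_cyc cyc_eqv Oincl_degree antipode_right w])
  finally show ?thesis .
qed

text \<open>\<open>of_coH\<close> is defined by \<open>lad\<close> on letters, and
  \<open>cyc\<close> and \<open>lad\<close> satisfy the same Leibniz rule.\<close>

lemma of_coH_cyc:
  assumes "w \<in> \<Omega>words"
  shows "of_coH (cyc (bas w) m) \<simeq> lad w m"
  using assms
proof (induction arbitrary: m rule: word_induct)
  case zero
  then show ?case by (simp add: lad_0)
next
  case (Cons g w)
  have g: "fst g \<noteq> 0" "Word [g] \<in> \<Omega>words" using Cons(1) by (auto simp: omega_letters_def)
  have "of_coH (cyc (bas (Word [g] + w)) m) = lad (Word [g]) (Oincl w * m) +
    scale ((-1) ^ (wdeg omega_deg (Word [g]) * wdeg omega_deg w)) (of_coH (cyc (bas w) (twist xomega_deg (wdeg omega_deg (Word [g])) m * Oincl (Word [g]))))"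
    unfolding cyc_bas_add of_coH_simps using g by (simp add: of_coH_tens)
  also have "\<dots> \<simeq> lad (Word [g]) (Oincl w * m) +
    scale ((-1) ^ (wdeg omega_deg (Word [g]) * wdeg omega_deg w)) (lad w (twist xomega_deg (wdeg omega_deg (Word [g])) m * Oincl (Word [g])))"
    by (intro eqv_add eqv_scale eqv_refl Cons.IH)
  also have "\<dots> \<simeq> lad (Word [g] + w) m"
    by (rule eqv_sym[OF lad_add[OF g(2) Cons(2)]])
  finally show ?case .
qed

text \<open>\<open>of_coH\<close> turns \<open>cyc\<close> into \<open>lad\<close>, so here the
  coaction with the antipode is the outer one; it cancels as in \<open>to_coH_lad\<close>.\<close>

lemma of_coH_adj_cyc:
  assumes w: "w \<in> \<Omega>words"
  shows "of_coH (adj_cyc (bas w) m) \<simeq> lcyc w m"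
proof -
  have "of_coH (adj_cyc (bas w) m) = coact (\<lambda>u m. of_coH (cyc (bas u) m)) Oanti w m"
    by (simp add: adj_cyc_coact coact_def klin_compose_lin[OF klin_of_coH])
  also have "\<dots> \<simeq> coact lad Oanti w m"
    by (rule coact_cong_eqv[OF of_coH_cyc w])
  also have "\<dots> \<simeq> lcyc w m"
    by (rule coact_coact[OF klin_lcyc lcyc_eqv Oanti_degree antipode_left w])
  finally show ?thesis .
qed

abbreviation Tbasis :: "('x simplex \<times> ('x, 'k::comm_ring_1) xletter word) set" where
  "Tbasis \<equiv> nondegenerate X \<times> Xwords"

lemma klin_eqv_basis:
  assumes "klin f" "klin g" "\<And>c w. c \<in> nondegenerate X \<Longrightarrow> w \<in> Xwords \<Longrightarrow> eqv R (f (tens (bas c) (bas w))) (g (tens (bas c) (bas w)))"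
    and "y \<in> supported Tbasis"
  shows "eqv R (f y) (g y)"
  unfolding klin_eq_lin[OF assms(1), of y] klin_eq_lin[OF assms(2), of y]
proof (rule eqv_lin)
  fix x assume "x \<in> Poly_Mapping.keys y"
  from supportedD[OF assms(4) this] show "eqv R (f (bas x)) (g (bas x))"
    using assms(3)[of "fst x" "snd x"] by auto
qed

lemma of_coH_to_coH:
  assumes "y \<in> supported Tbasis"
  shows "of_coH (to_coH y) \<simeq> y"
proof (rule klin_eqv_basis[OF klin_comp[OF klin_of_coH klin_to_coH] klin_intros(1) _ assms])
  fix c and w :: "('x, 'a) xletter word" assume "c \<in> nondegenerate X"
  then show "of_coH (to_coH (tens (bas c) (bas w))) \<simeq> tens (bas c) (bas w)"
  proof (cases rule: nondegenerate_cases)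
    case 2
    then show ?thesis
      using of_coH_adj_cyc[of "Word [c]" "bas w"] by (simp add: to_coH_tens omega_letters_def lcyc_letter del: tens_bas)
  qed (simp add: to_coH_tens of_coH_tens del: tens_bas)
qed

lemma to_coH_of_coH:
  assumes "y \<in> supported Tbasis"
  shows "to_coH (of_coH y) \<simeq> y"
proof (rule klin_eqv_basis[OF klin_comp[OF klin_to_coH klin_of_coH] klin_intros(1) _ assms])
  fix c and w :: "('x, 'a) xletter word" assume "c \<in> nondegenerate X"
  then show "to_coH (of_coH (tens (bas c) (bas w))) \<simeq> tens (bas c) (bas w)"
  proof (cases rule: nondegenerate_cases)
    case 2
    then show ?thesis
      using to_coH_lad[of "Word [c]" "bas w"] by (simp add: of_coH_tens omega_letters_def del: tens_bas)
  qed (simp add: to_coH_tens of_coH_tens del: tens_bas)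
qed

end

section \<open>Degrees and relations\<close>

context reduced_sset
begin

abbreviation Xdeg :: "nat \<Rightarrow> ('x, 'k::comm_ring_1) xletter word set" where
  "Xdeg n \<equiv> {v \<in> Xwords. wdeg xomega_deg v = n}"

abbreviation Tdeg :: "nat \<Rightarrow> ('x simplex \<times> ('x, 'k::comm_ring_1) xletter word) set" where
  "Tdeg n \<equiv> {x \<in> Tbasis. fst (fst x) + wdeg xomega_deg (snd x) = n}"

lemma tens_supported_Tdeg:
  assumes "p \<in> supported {c \<in> nondegenerate X. fst c = i}" "q \<in> supported (Xdeg j)"
  shows "tens p q \<in> supported (Tdeg (i + j))"
  by (rule supported_mono[OF supported_tens[OF assms]]) auto

lemma mult_supported_Xdeg: "p \<in> supported (Xdeg i) \<Longrightarrow> q \<in> supported (Xdeg j) \<Longrightarrow> p * q \<in> supported (Xdeg (i + j))"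
  by (rule supported_mult[of p "Xdeg i" q "Xdeg j"]) auto

lemma twist_supported: "p \<in> supported B \<Longrightarrow> twist xomega_deg k p \<in> supported B"
  unfolding twist_def by (intro supported_lin supported_scale supported_bas) (rule supportedD)

lemma Oincl_supported: "u \<in> \<Omega>words \<Longrightarrow> Oincl u \<in> supported (Xdeg (wdeg omega_deg u))"
  by (simp add: xomega_incl_bas cell_word_in)

text \<open>The family S is a parameter because \<open>adj\<close> takes values in
  \<open>Xdeg n\<close>, and the maps into the tensor product in \<open>Tdeg (n + 1)\<close>: a
  letter has degree one less than its simplex.\<close>

lemma coact_supported:
  fixes m :: "('x, 'k::comm_ring_1) xomega"
  assumes K: "\<And>v j m. v \<in> \<Omega>words \<Longrightarrow> m \<in> supported (Xdeg j) \<Longrightarrow> K v m \<in> supported (S (wdeg omega_deg v + j))"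
    and P: "\<And>u. u \<in> \<Omega>words \<Longrightarrow> P u \<in> supported (Xdeg (wdeg omega_deg u))"
    and w: "w \<in> \<Omega>words" and m: "m \<in> supported (Xdeg j)"
  shows "coact K P w m \<in> supported (S (wdeg omega_deg w + j))"
  unfolding coact_def
proof (intro supported_lin supported_scale)
  fix x assume "x \<in> Poly_Mapping.keys (omega_coprod X (bas w) :: _ \<Rightarrow>\<^sub>0 'k)"
  note x = omega_coprod_words[OF w this]
  have "twist xomega_deg (wdeg omega_deg (fst x)) m * P (fst x) \<in> supported (Xdeg (j + wdeg omega_deg (fst x)))"
    by (rule mult_supported_Xdeg[OF twist_supported[OF m] P[OF x(1)]])
  from K[OF x(2) this] show "K (snd x) (twist xomega_deg (wdeg omega_deg (fst x)) m * P (fst x)) \<in> supported (S (wdeg omega_deg w + j))"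
    by (simp add: x(3) add_ac)
qed

lemma Oincl_mult_supported: "v \<in> \<Omega>words \<Longrightarrow> m \<in> supported (Xdeg j) \<Longrightarrow> Oincl v * m \<in> supported (Xdeg (wdeg omega_deg v + j))"
  by (rule mult_supported_Xdeg[OF Oincl_supported])

lemma adj_supported: "v \<in> \<Omega>words \<Longrightarrow> m \<in> supported (Xdeg j) \<Longrightarrow> adj (bas v) m \<in> supported (Xdeg (wdeg omega_deg v + j))"
  unfolding adj_coact by (rule coact_supported[where S = Xdeg, OF Oincl_mult_supported Oanti_supported])

lemma antipode_incl_supported:
  assumes "u \<in> \<Omega>words"
  shows "antipode X (Oincl u) \<in> supported (Xdeg (wdeg omega_deg u))"
  using is_antipode_antipode cell_word_in[OF assms] unfolding is_antipode_def xomega_incl_bas by fastforce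

lemma adjoint_action_supported:
  assumes "v \<in> \<Omega>words" "m \<in> supported (Xdeg j)"
  shows "adjoint_action X (bas v) m \<in> supported (Xdeg (wdeg omega_deg v + j))"
proof -
  have "adjoint_action X (bas v) m = coact (\<lambda>u m. Oincl u * m) (\<lambda>u. antipode X (Oincl u)) v m"
    by (simp add: adjoint_action_eq coact_def)
  then show ?thesis
    using coact_supported[where S = Xdeg, OF Oincl_mult_supported antipode_incl_supported assms] by simp
qed

lemma letter_tens_supported:
  assumes "g \<in> omega_letters X" "m \<in> supported (Xdeg j)" "n = omega_deg g + j + 1"
  shows "tens (bas g) m \<in> supported (Tdeg n)"
proof -
  have "tens (bas g) m \<in> supported (Tdeg (fst g + j))"
    by (rule tens_supported_Tdeg) (use assms in \<open>auto simp: omega_letters_def\<close>)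
  moreover have "fst g + j = n" using assms by (auto simp: omega_letters_def omega_deg_def)
  ultimately show ?thesis by simp
qed

lemma cyc_supported:
  "w \<in> \<Omega>words \<Longrightarrow> m \<in> supported (Xdeg j) \<Longrightarrow> cyc (bas w) m \<in> supported (Tdeg (wdeg omega_deg w + j + 1))"
proof (induction arbitrary: m j rule: word_induct)
  case (Cons g w)
  have g: "Word [g] \<in> \<Omega>words" using Cons by simp
  have 1: "cyc (bas (Word [g])) (Oincl w * m) \<in> supported (Tdeg (wdeg omega_deg (Word [g] + w) + j + 1))"
    unfolding cyc_letter
    by (rule letter_tens_supported[OF Cons(1) Oincl_mult_supported[OF Cons(2,4)]]) simp
  have "twist xomega_deg (wdeg omega_deg (Word [g])) m * Oincl (Word [g]) \<in> supported (Xdeg (j + wdeg omega_deg (Word [g])))"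
    by (rule mult_supported_Xdeg[OF twist_supported[OF Cons(4)] Oincl_supported[OF g]])
  from Cons(3)[OF this] have 2: "cyc (bas w) (twist xomega_deg (wdeg omega_deg (Word [g])) m * Oincl (Word [g]))
      \<in> supported (Tdeg (wdeg omega_deg (Word [g] + w) + j + 1))"
    by (simp add: add_ac)
  show ?case unfolding cyc_bas_add by (intro supported_add supported_scale 1 2)
qed simp

lemma lcyc_supported:
  assumes "w \<in> \<Omega>words" "m \<in> supported (Xdeg j)"
  shows "lcyc w m \<in> supported (Tdeg (wdeg omega_deg w + j + 1))"
proof (cases "letters w")
  case (Cons g gs)
  then have w: "w = Word (g # gs)" by (cases w) simp
  then have g: "g \<in> omega_letters X" "Word gs \<in> \<Omega>words" using assms(1) by auto
  have "tens (bas g) (adj (bas (Word gs)) m) \<in> supported (Tdeg (wdeg omega_deg w + j + 1))"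
    by (rule letter_tens_supported[OF g(1) adj_supported[OF g(2) assms(2)]]) (simp add: w)
  then show ?thesis by (simp add: lcyc_def w)
qed (simp add: lcyc_def)

lemma pt_tens_supported: "m \<in> supported (Xdeg j) \<Longrightarrow> tens (bas pt) m \<in> supported (Tdeg j)"
  using tens_supported_Tdeg[of "bas pt" 0 m j] pt_nondegenerate by simp

lemma comparison_supported:
  fixes w :: "('x, 'k::comm_ring_1) xletter word"
  assumes "c \<in> nondegenerate X" "w \<in> Xwords"
  shows "to_coH (bas (c, w)) \<in> supported (Tdeg (fst c + wdeg xomega_deg w))"
    and "of_coH (bas (c, w)) \<in> supported (Tdeg (fst c + wdeg xomega_deg w))"
proof -
  have w: "(bas w :: ('x, 'k) xomega) \<in> supported (Xdeg (wdeg xomega_deg w))" using assms(2) by simp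
  have b: "bas (c, w) = tens (bas c) (bas w :: ('x, 'k) xomega)" by simp
  have "to_coH (bas (c, w)) \<in> supported (Tdeg (fst c + wdeg xomega_deg w)) \<and> of_coH (bas (c, w)) \<in> supported (Tdeg (fst c + wdeg xomega_deg w))"
    using assms(1)
  proof (cases rule: nondegenerate_cases)
    case 1
    then show ?thesis unfolding b to_coH_tens of_coH_tens using pt_tens_supported[OF w] by simp
  next
    case 2
    then have c: "Word [c] \<in> \<Omega>words" "fst c \<noteq> 0" by (auto simp: omega_letters_def)
    have d: "wdeg omega_deg (Word [c]) + wdeg xomega_deg w + 1 = fst c + wdeg xomega_deg w" using c by (simp add: omega_deg_def)
    have "adj_cyc (bas (Word [c])) (bas w) \<in> supported (Tdeg (wdeg omega_deg (Word [c]) + wdeg xomega_deg w + 1))"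
      unfolding adj_cyc_coact by (rule coact_supported[where S = "\<lambda>n. Tdeg (n + 1)", OF cyc_supported Oanti_supported c(1) w])
    moreover have "lad (Word [c]) (bas w) \<in> supported (Tdeg (wdeg omega_deg (Word [c]) + wdeg xomega_deg w + 1))"
      by (rule coact_supported[where S = "\<lambda>n. Tdeg (n + 1)", OF lcyc_supported Oincl_supported c(1) w])
    ultimately show ?thesis unfolding b to_coH_tens of_coH_tens d using c by (simp del: tens_bas)
  qed
  then show "to_coH (bas (c, w)) \<in> supported (Tdeg (fst c + wdeg xomega_deg w))"
    "of_coH (bas (c, w)) \<in> supported (Tdeg (fst c + wdeg xomega_deg w))" by auto
qed

abbreviation Tlow :: "nat \<Rightarrow> ('x simplex \<times> ('x, 'k::comm_ring_1) xletter word) set" where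
  "Tlow n \<equiv> {x \<in> Tbasis. fst (fst x) + wdeg xomega_deg (snd x) + 1 = n}"

lemma aw_term_supported:
  fixes T :: "'x simplex \<times> 'x simplex \<Rightarrow> ('x simplex \<times> ('x, 'k::comm_ring_1) xletter word \<Rightarrow>\<^sub>0 'k)"
  assumes "is_simplex X c"
    and "\<And>a b. a \<in> nondegenerate X \<Longrightarrow> b \<in> nondegenerate X \<Longrightarrow> fst a + fst b = fst c \<Longrightarrow> T (a, b) \<in> supported B"
  shows "lin T (aw X (bas c)) \<in> supported B"
proof (rule supported_lin)
  fix x assume "x \<in> Poly_Mapping.keys (aw X (bas c) :: _ \<Rightarrow>\<^sub>0 'k)"
  from supportedD[OF aw_supported[OF assms(1)] this] show "T x \<in> supported B"
    using assms(2)[of "fst x" "snd x"] by simp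
qed

lemma diff_supported:
  fixes w :: "('x, 'k::comm_ring_1) xletter word"
  assumes c: "c \<in> nondegenerate X" and w: "w \<in> Xwords"
  shows "cohochschild_diff X (bas (c, w)) \<in> supported (Tlow (fst c + wdeg xomega_deg w))"
    and "adjoint_diff (bas (c, w)) \<in> supported (Tlow (fst c + wdeg xomega_deg w))"
proof -
  let ?m = "bas w :: ('x, 'k) xomega" and ?N = "fst c + wdeg xomega_deg w"
  have m: "?m \<in> supported (Xdeg (wdeg xomega_deg w))" using w by simp
  have b: "bas (c, w) = tens (bas c) ?m" by simp
  note s = nondegenerate_is_simplex[OF c]
  have 1: "tens (bd X (bas c)) ?m \<in> supported (Tlow ?N)"
    by (rule supported_mono[OF supported_tens[OF bd_supported[OF c] m]]) auto
  have 2: "tens (bas c) (xomega_diff X ?m) \<in> supported (Tlow ?N)"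
    by (rule supported_mono[OF supported_tens[OF supported_bas[of c "{c}"] xomega_diff_supported[OF w]]]) (use c in auto)
  have T: "tens (bas d) q \<in> supported (Tlow ?N)" if "d \<in> nondegenerate X" "q \<in> supported (Xdeg j)" "fst d + j + 1 = ?N"
    for d j and q :: "('x, 'k) xomega"
    by (rule supported_mono[OF supported_tens[OF supported_bas[of d "{d}"] that(2)]]) (use that in auto)
  have l: "Word [d] \<in> \<Omega>words" "cobar_gen (bas d) = (bas (Word [d]) :: ('x, 'k) omega)" if "d \<in> nondegenerate X" "fst d \<noteq> 0" for d
    using that by (simp_all add: omega_letters_def)
  have e: "wdeg omega_deg (Word [d]) = fst d - 1" for d :: "'x simplex" by (simp add: omega_deg_def)
  have 3: "tens (bas a) (xomega_incl (cobar_gen (bas d)) * ?m) \<in> supported (Tlow ?N)"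
    if ad: "a \<in> nondegenerate X" "d \<in> nondegenerate X" "fst a + fst d = fst c" for a d
  proof (cases "fst d = 0")
    case False
    show ?thesis unfolding l(2)[OF ad(2) False]
      by (rule T[OF ad(1) Oincl_mult_supported[OF l(1)[OF ad(2) False] m]]) (use False ad(3) e in simp)
  qed simp
  have 4: "tens (bas d) (twist xomega_deg (fst a + 1) ?m * xomega_incl (cobar_gen (bas a))) \<in> supported (Tlow ?N)"
    if ad: "a \<in> nondegenerate X" "d \<in> nondegenerate X" "fst a + fst d = fst c" for a d
  proof (cases "fst a = 0")
    case False
    show ?thesis unfolding l(2)[OF ad(1) False]
      by (rule T[OF ad(2) mult_supported_Xdeg[OF twist_supported[OF m] Oincl_supported[OF l(1)[OF ad(1) False]]]])
        (use False ad(3) e in simp)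
  qed simp
  have 5: "tens (bas a) (adjoint_action X (cobar_gen (bas d)) ?m) \<in> supported (Tlow ?N)"
    if ad: "a \<in> nondegenerate X" "d \<in> nondegenerate X" "fst a + fst d = fst c" for a d
  proof (cases "fst d = 0")
    case False
    show ?thesis unfolding l(2)[OF ad(2) False]
      by (rule T[OF ad(1) adjoint_action_supported[OF l(1)[OF ad(2) False] m]]) (use False ad(3) e in simp)
  qed (simp add: adjoint_action_0)
  show "cohochschild_diff X (bas (c, w)) \<in> supported (Tlow ?N)"
    unfolding b cohochschild_diff_tens
    by (intro supported_add supported_diff supported_scale 1 2 aw_term_supported[OF s]; unfold fst_conv snd_conv; intro supported_scale 3 4)
  show "adjoint_diff (bas (c, w)) \<in> supported (Tlow ?N)"
    unfolding b adjoint_diff_tens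
    by (intro supported_add supported_diff supported_scale 1 2 aw_term_supported[OF s]; unfold fst_conv snd_conv; intro supported_scale 5)
qed

lemma tensor_reps_basis: "y \<in> tensor_reps X n \<Longrightarrow> y \<in> supported Tbasis"
  unfolding tensor_reps_def by (erule supported_mono) auto

lemma tensor_reps_map:
  assumes "klin f" and y: "y \<in> tensor_reps X n"
    and f: "\<And>c w. c \<in> nondegenerate X \<Longrightarrow> w \<in> Xwords \<Longrightarrow> f (bas (c, w)) \<in>
      supported {x \<in> Tbasis. int (fst (fst x) + wdeg xomega_deg (snd x)) + k = int (fst c + wdeg xomega_deg w)}"
  shows "f y \<in> tensor_reps X (n - k)"
  unfolding klin_eq_lin[OF assms(1), of y] unfolding tensor_reps_def
proof (rule supported_lin)
  fix x assume "x \<in> Poly_Mapping.keys y"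
  with y have "x \<in> {(c, w). c \<in> nondegenerate X \<and> w \<in> Xwords \<and> int (fst c + wdeg xomega_deg w) = n}"
    unfolding tensor_reps_def by (rule supportedD)
  then obtain c w where x: "x = (c, w)" "c \<in> nondegenerate X" "w \<in> Xwords" "int (fst c + wdeg xomega_deg w) = n" by blast
  show "f (bas x) \<in> supported {(c, w). c \<in> nondegenerate X \<and> w \<in> Xwords \<and> int (fst c + wdeg xomega_deg w) = n - k}"
    unfolding x(1) by (rule supported_mono[OF f[OF x(2,3)]]) (use x(4) in auto)
qed

lemma tensor_rel_subset: "tensor_rel X \<subseteq> free_module.span (tens_rel X)"
proof -
  have "{tens (bas c) r |c r. c \<in> nondegenerate X \<and> r \<in> xomega_ideal X} \<subseteq> free_module.span (tens_rel X)"
  proof clarify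
    fix c r assume "r \<in> xomega_ideal X"
    then have "r \<approx> 0" using xomega_ideal_subset by (auto simp: eqv_0)
    from tens_eqv[OF this, of "bas c"] show "tens (bas c) r \<in> free_module.span (tens_rel X)" by (simp add: eqv_0)
  qed
  then have "free_module.span {tens (bas c) r |c r. c \<in> nondegenerate X \<and> r \<in> xomega_ideal X} \<subseteq> free_module.span (free_module.span (tens_rel X))"
    by (rule free_module.span_mono)
  then show ?thesis by (simp add: tensor_rel_def free_module.span_span)
qed

lemma tensor_rel_supported: "y \<in> tensor_rel X \<Longrightarrow> y \<in> supported Tbasis"
  unfolding tensor_rel_def
proof (induction rule: free_module.span_induct_alt)
  case (step k x y)
  then obtain c r where x: "x = tens (bas c) r" and cr: "c \<in> nondegenerate X" "r \<in> xomega_ideal X" by blast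
  have "x \<in> supported Tbasis"
    unfolding x by (rule supported_tens[OF supported_bas xomega_ideal_supported[OF cr(2)]]) (rule cr)
  with step show ?case by (intro supported_add supported_scale)
qed simp

text \<open>On representatives with cells and letters of X the larger relations give nothing new:
  the retraction \<open>\<rho>\<close> fixes these representatives and maps the generators of the
  larger relations into \<open>tensor_rel X\<close>.\<close>

lemma tensor_rel_iff:
  assumes "y \<in> supported Tbasis"
  shows "y \<in> tensor_rel X \<longleftrightarrow> y \<simeq> (0 :: 'x simplex \<times> ('x, 'k::comm_ring_1) xletter word \<Rightarrow>\<^sub>0 'k)"
proof
  assume "y \<in> tensor_rel X"
  then show "y \<simeq> 0" using tensor_rel_subset by (auto simp: eqv_0)
next
  define \<rho> :: "('x simplex \<times> ('x, 'k) xletter word \<Rightarrow>\<^sub>0 'k) \<Rightarrow> _" where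
    "\<rho> = lin (\<lambda>x. if fst x \<in> nondegenerate X then tens (bas (fst x)) (letter_retract (xomega_letters X) (bas (snd x))) else 0)"
  assume "y \<simeq> 0"
  then have y: "y \<in> free_module.span (tens_rel X)" by (simp add: eqv_0)
  have "\<rho> y \<in> free_module.span (tensor_rel X)"
  proof (rule klin_span[OF _ _ y])
    fix x :: "'x simplex \<times> ('x, 'k) xletter word \<Rightarrow>\<^sub>0 'k" assume "x \<in> tens_rel X"
    then obtain c r where x: "x = tens (bas c) r" and r: "r \<in> xomega_rel X" unfolding tens_rel_def by blast
    have "\<rho> x = (if c \<in> nondegenerate X then tens (bas c) (letter_retract (xomega_letters X) r) else 0)"
      unfolding \<rho>_def x lin_tens
      by (simp add: lin_tens_right[symmetric] klin_eq_lin[OF klin_letter_retract, symmetric])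
    moreover have "tens (bas c) (letter_retract (xomega_letters X) r) \<in> tensor_rel X" if "c \<in> nondegenerate X"
      unfolding tensor_rel_def by (rule free_module.span_base) (use that letter_retract_rel[OF r] in blast)
    ultimately have "\<rho> x \<in> tensor_rel X"
      by (cases "c \<in> nondegenerate X") (simp_all add: tensor_rel_def free_module.span_zero)
    then show "\<rho> x \<in> free_module.span (tensor_rel X)" by (rule free_module.span_base)
  qed (simp add: \<rho>_def)
  moreover have "\<rho> y = y"
  proof (rule klin_eqI[where f = \<rho>])
    fix x assume "x \<in> Poly_Mapping.keys y"
    from supportedD[OF assms this] show "\<rho> (bas x) = bas x" by (auto simp: \<rho>_def letter_retract_bas)
  qed (simp_all add: \<rho>_def klin_intros)
  ultimately show "y \<in> tensor_rel X" by (simp add: tensor_rel_def free_module.span_span)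
qed

section \<open>Relations and squares of the differentials\<close>

lemma cohochschild_diff_tens_eqv:
  assumes "x \<approx> y"
  shows "cohochschild_diff X (tens (bas c) x) \<simeq> cohochschild_diff X (tens (bas c) y)"
  unfolding cohochschild_diff_tens
  by (intro eqv_add eqv_diff eqv_scale eqv_lin tens_eqv xomega_diff_eqv eqv_mult[OF Jideal] twist_eqv eqv_refl assms)

lemma cohochschild_diff_eqv: "y \<simeq> z \<Longrightarrow> cohochschild_diff X y \<simeq> cohochschild_diff X z"
proof (rule klin_eqv[OF klin_cohochschild_diff])
  fix y :: "'x simplex \<times> ('x, 'a) xletter word \<Rightarrow>\<^sub>0 'a" assume "y \<in> tens_rel X"
  then obtain c x where y: "y = tens (bas c) x" and x: "x \<in> xomega_rel X" unfolding tens_rel_def by blast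
  have "x \<approx> 0" using x by (simp add: eqv_0 free_module.span_base)
  from cohochschild_diff_tens_eqv[OF this, of c] show "cohochschild_diff X y \<in> free_module.span (tens_rel X)"
    by (simp add: y eqv_0)
qed

lemma klin_adjoint_diff: "klin adjoint_diff"
  by (simp add: twisted_diff_def)

lemma supported_map:
  assumes "klin f" "y \<in> supported Tbasis" "\<And>c w. c \<in> nondegenerate X \<Longrightarrow> w \<in> Xwords \<Longrightarrow> f (bas (c, w)) \<in> supported B"
  shows "f y \<in> supported B"
  unfolding klin_eq_lin[OF assms(1), of y]
proof (rule supported_lin)
  fix x assume "x \<in> Poly_Mapping.keys y"
  from supportedD[OF assms(2) this] show "f (bas x) \<in> supported B" using assms(3)[of "fst x" "snd x"] by auto
qed

lemma adjoint_diff_supported: "y \<in> supported Tbasis \<Longrightarrow> adjoint_diff y \<in> supported Tbasis"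
  by (erule supported_map[OF klin_adjoint_diff]) (rule supported_mono[OF diff_supported(2)], auto)

lemma to_coH_supported: "y \<in> supported Tbasis \<Longrightarrow> to_coH y \<in> supported Tbasis"
  by (erule supported_map[OF klin_to_coH]) (rule supported_mono[OF comparison_supported(1)], auto)

lemma to_coH_chain:
  assumes "y \<in> supported Tbasis"
  shows "to_coH (adjoint_diff y) \<simeq> cohochschild_diff X (to_coH y)"
proof (rule klin_eqv_basis[OF klin_comp[OF klin_to_coH klin_adjoint_diff] klin_comp[OF klin_cohochschild_diff klin_to_coH] _ assms])
  fix c and w :: "('x, 'a) xletter word" assume "c \<in> nondegenerate X" "w \<in> Xwords"
  then show "to_coH (adjoint_diff (tens (bas c) (bas w))) \<simeq> cohochschild_diff X (to_coH (tens (bas c) (bas w)))"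
    by (intro to_coH_diff supported_bas)
qed

lemma cohochschild_diff_diff_eqv:
  assumes "y \<in> supported Tbasis"
  shows "cohochschild_diff X (cohochschild_diff X y) \<simeq> 0"
  by (rule klin_eqv_basis[OF klin_comp[OF klin_cohochschild_diff klin_cohochschild_diff] klin_intros(2) _ assms])
    (simp add: cohochschild_diff_diff)

text \<open>A left inverse is given by \<open>of_coH_to_coH\<close>. Properties of the adjoint
  differential are read off after applying \<open>to_coH\<close>.\<close>

lemma to_coH_injective:
  assumes "y \<in> supported Tbasis" "to_coH y \<simeq> 0"
  shows "y \<simeq> 0"
proof -
  have "y \<simeq> of_coH (to_coH y)" by (rule eqv_sym[OF of_coH_to_coH[OF assms(1)]])
  also have "\<dots> \<simeq> of_coH 0" by (rule of_coH_eqv[OF assms(2)])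
  finally show ?thesis by simp
qed

lemma adjoint_diff_eqv_0:
  assumes "y \<in> supported Tbasis" "y \<simeq> 0"
  shows "adjoint_diff y \<simeq> 0"
proof (rule to_coH_injective[OF adjoint_diff_supported[OF assms(1)]])
  have "to_coH (adjoint_diff y) \<simeq> cohochschild_diff X (to_coH y)" by (rule to_coH_chain[OF assms(1)])
  also have "\<dots> \<simeq> cohochschild_diff X (to_coH 0)" by (intro cohochschild_diff_eqv to_coH_eqv assms(2))
  finally show "to_coH (adjoint_diff y) \<simeq> 0" by simp
qed

lemma adjoint_diff_diff:
  assumes "y \<in> supported Tbasis"
  shows "adjoint_diff (adjoint_diff y) \<simeq> 0"
proof (rule to_coH_injective)
  note d = adjoint_diff_supported[OF assms]
  show "adjoint_diff (adjoint_diff y) \<in> supported Tbasis" by (rule adjoint_diff_supported[OF d])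
  have "to_coH (adjoint_diff (adjoint_diff y)) \<simeq> cohochschild_diff X (to_coH (adjoint_diff y))" by (rule to_coH_chain[OF d])
  also have "\<dots> \<simeq> cohochschild_diff X (cohochschild_diff X (to_coH y))"
    by (intro cohochschild_diff_eqv to_coH_chain assms)
  also have "\<dots> \<simeq> 0" by (rule cohochschild_diff_diff_eqv[OF to_coH_supported[OF assms]])
  finally show "to_coH (adjoint_diff (adjoint_diff y)) \<simeq> 0" .
qed

lemma tensor_reps_maps:
  assumes "y \<in> tensor_reps X n"
  shows "to_coH y \<in> tensor_reps X n" "of_coH y \<in> tensor_reps X n"
    "cohochschild_diff X y \<in> tensor_reps X (n - 1)" "adjoint_diff y \<in> tensor_reps X (n - 1)"
proof -
  have "to_coH y \<in> tensor_reps X (n - 0)"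
    by (rule tensor_reps_map[OF klin_to_coH assms], rule supported_mono[OF comparison_supported(1)]) auto
  moreover have "of_coH y \<in> tensor_reps X (n - 0)"
    by (rule tensor_reps_map[OF klin_of_coH assms], rule supported_mono[OF comparison_supported(2)]) auto
  ultimately show "to_coH y \<in> tensor_reps X n" "of_coH y \<in> tensor_reps X n" by simp_all
  show "cohochschild_diff X y \<in> tensor_reps X (n - 1)"
    by (rule tensor_reps_map[OF klin_cohochschild_diff assms], rule supported_mono[OF diff_supported(1)]) auto
  show "adjoint_diff y \<in> tensor_reps X (n - 1)"
    by (rule tensor_reps_map[OF klin_adjoint_diff assms], rule supported_mono[OF diff_supported(2)]) auto
qed

end

section \<open>Naturality\<close>

locale reduced_sset_map = A: reduced_sset X + B: reduced_sset Y
  for X :: "'x sset" and Y :: "'y sset" +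
  fixes f :: "nat \<Rightarrow> 'x \<Rightarrow> 'y"
  assumes map: "simplicial_map X Y f"
begin

definition sm :: "'x simplex \<Rightarrow> 'y simplex" where
  "sm s = (fst s, f (fst s) (snd s))"

lemma fst_sm [simp]: "fst (sm s) = fst s"
  by (simp add: sm_def)

lemma sm_simplex: "is_simplex X s \<Longrightarrow> is_simplex Y (sm s)"
  using map by (auto simp: is_simplex_def sm_def simplicial_map_def)

lemma sm_face:
  assumes "is_simplex X s" "vertex_list s xs" "xs \<noteq> []"
  shows "sm (face X s xs) = face Y (sm s) xs"
proof -
  have "xs \<in> mono_lists (length xs - 1) (fst s)"
    using assms by (cases xs) (auto simp: mono_lists_def vertex_list_def)
  then show ?thesis
    using map assms(1) by (simp add: sm_def face_def is_simplex_def simplicial_map_def)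
qed

text \<open>The converse fails: a nondegenerate simplex may have a degenerate image, and its
  generator is then sent to 0.\<close>

lemma sm_degenerate:
  assumes "is_simplex X s" "s \<notin> nondegenerate X"
  shows "sm s \<notin> nondegenerate Y"
proof -
  obtain m xs \<tau> where m: "m < fst s" "xs \<in> mono_lists (fst s) m" "\<tau> \<in> simplices X m" "snd s = act X m xs \<tau>"
    using assms unfolding A.nondegenerate_iff by blast
  then have "snd (sm s) = act Y m xs (f m \<tau>)" "f m \<tau> \<in> simplices Y m"
    using map by (auto simp: sm_def simplicial_map_def)
  then show ?thesis unfolding B.nondegenerate_iff using m by auto
qed

lemma chain_push_bas: "chain_push Y f (bas s) = chain Y (sm s)"
  by (cases s) (simp add: chain_push_def sm_def)

abbreviation opush :: "('x, 'k::comm_ring_1) omega \<Rightarrow> ('y, 'k) omega" where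
  "opush \<equiv> omega_push Y f"

abbreviation xpush :: "('x, 'k::comm_ring_1) xomega \<Rightarrow> ('y, 'k) xomega" where
  "xpush \<equiv> xomega_push Y f"

lemma klin_opush: "klin opush"
  by (simp add: omega_push_def klin_alg_ext)

lemma klin_xpush: "klin xpush"
  by (simp add: xomega_push_def klin_alg_ext)

lemmas opush_simps [simp] = klin_0[OF klin_opush] klin_add[OF klin_opush] klin_diff[OF klin_opush]
  klin_uminus[OF klin_opush] klin_scale[OF klin_opush]

lemmas xpush_simps [simp] = klin_0[OF klin_xpush] klin_add[OF klin_xpush] klin_diff[OF klin_xpush]
  klin_uminus[OF klin_xpush] klin_scale[OF klin_xpush]

lemma push_1 [simp]: "opush 1 = 1" "xpush 1 = 1"
  by (simp_all add: omega_push_def xomega_push_def)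

lemma opush_mult: "opush (p * q) = opush p * opush q"
  by (simp add: omega_push_def alg_ext_mult)

lemma xpush_mult: "xpush (p * q) = xpush p * xpush q"
  by (simp add: xomega_push_def alg_ext_mult)

lemma opush_bas_add: "opush (bas (u + v)) = opush (bas u) * opush (bas v)"
  by (simp add: omega_push_def alg_ext_bas_add)

lemma opush_letter: "opush (bas (Word [s])) = simplex_gen Y (sm s)"
  by (simp add: omega_push_def chain_push_bas alg_ext_letter)

lemma opush_simplex_gen:
  assumes "is_simplex X s"
  shows "opush (simplex_gen X s) = simplex_gen Y (sm s)"
proof (cases "s \<in> omega_letters X")
  case True
  then show ?thesis by (simp add: simplex_gen_eq opush_letter)
next
  case False
  then have "sm s \<notin> omega_letters Y" using sm_degenerate[OF assms] by (auto simp: omega_letters_def)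
  then show ?thesis using False by (simp add: simplex_gen_eq)
qed

lemma opush_I_simplex: "is_simplex X s \<Longrightarrow> opush (I_simplex X s) = I_simplex Y (sm s)"
  by (simp add: I_simplex_def opush_simplex_gen)

lemma opush_kword:
  assumes s: "is_simplex X s" "fst s \<ge> 1" and w: "length w = fst s - 1"
  shows "opush (kword (I_face X s) [0..<Suc (fst s)] (Word w)) =
    (kword (I_face Y (sm s)) [0..<Suc (fst s)] (Word w) :: ('y, 'k::comm_ring_1) omega)"
proof -
  have u: "[0..<Suc (fst s)] = 0 # [1..<Suc (fst s)]" by (simp add: upt_conv_Cons del: upt_Suc)
  show ?thesis
    unfolding kword_def u list.sel word.sel kw_comp[of opush, OF opush_mult]
  proof (rule kw_cong[where A = "{..fst s}"])
    fix ys assume "2 \<le> length ys" "sorted ys" "set ys \<subseteq> {..fst s}"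
    then have v: "vertex_list s ys" "ys \<noteq> []" by (auto simp: vertex_list_def)
    then show "opush (I_face X s ys) = (I_face Y (sm s) ys :: ('y, 'k) omega)"
      using opush_I_simplex[OF A.face_is_simplex[OF s(1) v]] sm_face[OF s(1) v] by simp
  qed (use s w in \<open>auto simp del: upt_Suc\<close>)
qed

lemma opush_letter_supported:
  "s \<in> omega_letters X \<Longrightarrow> cobar_gen (chain_push Y f (bas s)) \<in> supported {v \<in> words (omega_letters Y). wdeg omega_deg v = omega_deg s}"
  using B.simplex_gen_supported[of "sm s"] by (simp add: chain_push_bas omega_letters_def omega_deg_def)

lemma opush_supported:
  "w \<in> words (omega_letters X) \<Longrightarrow> (opush (bas w) :: ('y, 'k::comm_ring_1) omega) \<in>
    supported {v \<in> words (omega_letters Y). wdeg omega_deg v = wdeg omega_deg w}"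
  unfolding omega_push_def by (rule supported_alg_ext[OF opush_letter_supported])

lemma omega_coprod_opush_letter:
  assumes "s \<in> omega_letters X"
  shows "omega_coprod Y (opush (bas (Word [s]) :: ('x, 'k::comm_ring_1) omega)) = pair_map opush (omega_coprod X (bas (Word [s])))"
proof -
  note s = A.letter_I(2,3)[OF assms]
  have "pair_map opush (omega_coprod X (I_simplex X s :: ('x, 'k) omega)) = omega_coprod Y (opush (I_simplex X s))"
    unfolding opush_I_simplex[OF s(1)] A.omega_coprod_I_simplex[OF s]
      B.omega_coprod_I_simplex[OF sm_simplex[OF s(1)], unfolded fst_sm, OF s(2)] kpair_def klin_compose_lin[OF klin_pair_map]
  proof (rule lin_cong[OF refl])
    fix x assume "x \<in> Poly_Mapping.keys (cube_word_coprod (bas (Word (replicate (fst s - 1) I01))) :: _ \<Rightarrow>\<^sub>0 'k)"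
    from tri_length[OF cube_coprod_tri[OF this]]
    have l: "length (letters (fst x)) = fst s - 1" "length (letters (snd x)) = fst s - 1" by auto
    show "pair_map opush (tens (kword (I_face X s) [0..<Suc (fst s)] (fst x)) (kword (I_face X s) [0..<Suc (fst s)] (snd x))) =
       tens (kword (I_face Y (sm s)) [0..<Suc (fst s)] (fst x)) (kword (I_face Y (sm s)) [0..<Suc (fst s)] (snd x) :: ('y, 'k) omega)"
      using opush_kword[OF s l(1), where 'k = 'k] opush_kword[OF s l(2), where 'k = 'k]
      by (simp add: pair_map_tens[OF klin_opush] del: upt_Suc)
  qed
  moreover have "pair_map opush (bas (0, 0) :: _ \<Rightarrow>\<^sub>0 'k) = bas (0, 0)"
    using pair_map_tens[OF klin_opush, of "1 :: ('x, 'k) omega" 1] by (simp add: A.tens_1_1)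
  ultimately show ?thesis unfolding A.letter_I(1)[OF assms] by simp
qed

lemma omega_coprod_opush_bas:
  assumes "w \<in> words (omega_letters X)"
  shows "omega_coprod Y (opush (bas w)) = pair_map opush (omega_coprod X (bas w))"
  unfolding omega_coprod_def omega_push_def
  by (rule coprod_morphism[OF opush_letter_supported A.omega_coprod_letter_supported' _ assms])
    (assumption | rule omega_coprod_opush_letter[unfolded A.omega_coprod_letter omega_push_def alg_ext_letter, unfolded omega_coprod_def])+

lemma omega_coprod_opush:
  assumes "p \<in> supported (words (omega_letters X))"
  shows "omega_coprod Y (opush p) = pair_map opush (omega_coprod X p)"
proof (rule klin_eqI[where f = "\<lambda>p. omega_coprod Y (opush p)"])
  fix w assume "w \<in> Poly_Mapping.keys p"
  from omega_coprod_opush_bas[OF supportedD[OF assms this]]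
  show "omega_coprod Y (opush (bas w)) = pair_map opush (omega_coprod X (bas w))" .
qed (intro klin_comp[OF B.klin_omega_coprod] klin_opush klin_comp[OF klin_pair_map] A.klin_omega_coprod)+

lemma omega_counit_opush: "omega_counit (opush p) = (omega_counit p :: 'k::comm_ring_1)"
proof -
  \<comment> \<open>Scalars are embedded in a free algebra, since \<open>klin_eqI\<close> compares
    maps into free modules.\<close>
  define E where "E q = (scalar (omega_counit q) :: unit word \<Rightarrow>\<^sub>0 'k)" for q :: "('x, 'k) omega"
  define E' where "E' q = (scalar (omega_counit q) :: unit word \<Rightarrow>\<^sub>0 'k)" for q :: "('y, 'k) omega"
  have k: "klin E" "klin E'" by (simp_all add: E_def[abs_def] E'_def[abs_def] omega_counit_def scalar_ext_eq_lin)
  have "E' (opush p) = E p"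
  proof (rule klin_eqI[where f = "\<lambda>p. E' (opush p)"])
    fix w :: "'x simplex word"
    have "w \<in> words UNIV" by simp
    then have "omega_counit (opush (bas w)) = (omega_counit (bas w) :: 'k)"
    proof (induction rule: word_induct)
      case (Cons g w)
      have "omega_counit (simplex_gen Y (sm g)) = (0 :: 'k)"
        by (simp add: simplex_gen_eq omega_counit_def)
      then show ?case
        using Cons(3) by (simp add: opush_bas_add opush_letter omega_counit_def scalar_ext_mult)
    qed (simp add: omega_counit_def)
    then show "E' (opush (bas w)) = E (bas w)" by (simp add: E_def E'_def)
  qed (intro klin_comp[OF k(2)] klin_opush k)+
  then show ?thesis by (simp add: E_def E'_def scalar_inj)
qed

lemma opush_supported_lin:
  assumes "p \<in> supported {w \<in> words (omega_letters X). wdeg omega_deg w = n}"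
  shows "opush p \<in> supported {v \<in> words (omega_letters Y). wdeg omega_deg v = n}"
  unfolding klin_eq_lin[OF klin_opush, of p]
proof (rule supported_lin)
  fix w assume "w \<in> Poly_Mapping.keys p"
  from supportedD[OF assms this] opush_supported[of w]
  show "opush (bas w) \<in> supported {v \<in> words (omega_letters Y). wdeg omega_deg v = n}" by simp
qed

text \<open>Formal inverses are thus sent to formal inverses of set-like elements, which makes the
  extended cobar construction functorial.\<close>

lemma set_like_opush:
  assumes "set_like X g"
  shows "set_like Y (opush g)"
proof -
  have g: "g \<in> supported {w \<in> words (omega_letters X). wdeg omega_deg w = 0}" "omega_coprod X g = tens g g" "omega_counit g = 1"
    using assms by (auto simp: set_like_def)
  have "omega_coprod Y (opush g) = tens (opush g) (opush g)"
    using omega_coprod_opush[OF supported_mono[OF g(1)]] g(2) by (auto simp: pair_map_tens[OF klin_opush])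
  then show ?thesis using opush_supported_lin[OF g(1)] g(3) by (simp add: set_like_def omega_counit_opush)
qed

lemma xpush_Inv: "xpush (bas (Word [Inv g])) = bas (Word [Inv (opush g)])"
  by (simp add: xomega_push_def alg_ext_letter)

lemma xpush_incl: "xpush (xomega_incl p) = (xomega_incl (opush p) :: ('y, 'k::comm_ring_1) xomega)"
proof (rule klin_eqI[where f = "\<lambda>p. xpush (xomega_incl p)"])
  fix w :: "'x simplex word"
  have "w \<in> words UNIV" by simp
  then show "xpush (xomega_incl (bas w)) = (xomega_incl (opush (bas w)) :: ('y, 'k) xomega)"
  proof (induction rule: word_induct)
    case (Cons g w)
    have "xpush (xomega_incl (bas (Word [g]))) = (xomega_incl (opush (bas (Word [g]))) :: ('y, 'k) xomega)"
      by (simp add: xomega_incl_bas xomega_push_def alg_ext_letter)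
    then show ?case
      using Cons(3) by (simp add: bas_mult[symmetric] xomega_incl_mult xpush_mult opush_mult)
  qed simp
qed (intro klin_comp[OF klin_xpush] klin_comp[OF klin_xomega_incl] klin_xomega_incl klin_opush)+

lemma xpush_supported:
  fixes w :: "('x, 'k::comm_ring_1) xletter word"
  assumes "w \<in> words (xomega_letters X)"
  shows "xpush (bas w) \<in> supported {v \<in> words (xomega_letters Y). wdeg xomega_deg v = wdeg xomega_deg w}"
  unfolding xomega_push_def
proof (rule supported_alg_ext[OF _ assms])
  fix l :: "('x, 'k) xletter" assume "l \<in> xomega_letters X"
  then show "(case l of Cell s \<Rightarrow> xomega_incl (opush (bas (Word [s]))) | Inv g \<Rightarrow> bas (Word [Inv (opush g)])) \<in>
    supported {v \<in> words (xomega_letters Y). wdeg xomega_deg v = xomega_deg l}"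
  proof (cases rule: A.xomega_letter_cases)
    case (1 s)
    then show ?thesis
      using xomega_incl_supported[OF opush_supported[of "Word [s]", where 'k = 'k]] by simp
  next
    case (2 g)
    then show ?thesis using set_like_opush[of g] by (auto simp: xomega_letters_def)
  qed
qed

lemma xpush_eqv:
  assumes "eqv (xomega_rel X) x y"
  shows "eqv (xomega_rel Y) (xpush x) (xpush y)"
proof (rule klin_eqv[OF klin_xpush _ assms])
  fix x :: "('x, 'a) xomega" assume "x \<in> xomega_rel X"
  then obtain u r v g where x: "x = bas u * r * bas v" and g: "set_like X g"
    and r: "r = xomega_incl g * bas (Word [Inv g]) - 1 \<or> r = bas (Word [Inv g]) * xomega_incl g - 1"
    unfolding xomega_rel_def by blast
  have "xpush r \<in> free_module.span (xomega_rel Y)"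
    using r inverse_right[OF set_like_opush[OF g]] inverse_left[OF set_like_opush[OF g]]
    by (auto simp: eqv_def xpush_mult xpush_incl xpush_Inv)
  then show "xpush x \<in> free_module.span (xomega_rel Y)"
    unfolding x xpush_mult by (rule ideal_gens_mult[OF ideal_gens_xomega_rel])
qed

lemma xpush_twist:
  assumes "m \<in> supported (words (xomega_letters X))"
  shows "xpush (twist xomega_deg k m) = twist xomega_deg k (xpush m)"
proof (rule klin_eqI[where f = "\<lambda>m. xpush (twist xomega_deg k m)"])
  fix w assume "w \<in> Poly_Mapping.keys m"
  note w = supportedD[OF assms this]
  have "twist xomega_deg k (xpush (bas w)) = scale ((-1) ^ (k * wdeg xomega_deg w)) (xpush (bas w))"
    by (rule twist_homog) (use supportedD[OF xpush_supported[OF w]] in simp)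
  then show "xpush (twist xomega_deg k (bas w)) = twist xomega_deg k (xpush (bas w))" by simp
qed (intro klin_comp[OF klin_xpush] klin_comp[OF klin_twist] klin_twist klin_xpush)+

text \<open>\<open>opush\<close> is a coalgebra map, so pulling functions back along it commutes
  with convolution.\<close>

lemma pair_map_conv:
  fixes P Q :: "'y simplex word \<Rightarrow> ('g word \<Rightarrow>\<^sub>0 'k::comm_ring_1)"
  assumes u: "u \<in> words (omega_letters X)"
  shows "A.conv (\<lambda>w. lin P (opush (bas w))) (\<lambda>w. lin Q (opush (bas w))) u = lin (B.conv P Q) (opush (bas u))"
proof -
  define T where "T = lin (\<lambda>x. P (fst x) * Q (snd x))"
  have T: "T (tens p q) = lin P p * lin Q q" for p q
    unfolding T_def lin_tens by (simp add: lin_mult_lin)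
  have kl: "klin T" by (simp add: T_def)
  have "lin (B.conv P Q) (opush (bas u)) = T (omega_coprod Y (opush (bas u)))"
    unfolding klin_eq_lin[OF klin_comp[OF kl B.klin_omega_coprod], of "opush (bas u)"]
    by (simp add: T_def B.conv_def[abs_def])
  also have "\<dots> = A.conv (\<lambda>w. lin P (opush (bas w))) (\<lambda>w. lin Q (opush (bas w))) u"
    unfolding omega_coprod_opush_bas[OF u] pair_map_def klin_compose_lin[OF kl] T A.conv_def ..
  finally show ?thesis by simp
qed

lemma lin_conv_unit_opush: "lin B.conv_unit (opush (bas u)) = (A.conv_unit u :: 'g word \<Rightarrow>\<^sub>0 'k::comm_ring_1)"
proof -
  have "lin B.conv_unit q = (scale (omega_counit q) 1 :: 'g word \<Rightarrow>\<^sub>0 'k)" for q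
  proof -
    have "(scalar (scalar_ext (\<lambda>s. 0) q) :: 'g word \<Rightarrow>\<^sub>0 'k) = lin (\<lambda>w. scale (prod_list (map (\<lambda>s. 0) (letters w))) 1) q"
      by (rule scalar_ext_eq_lin)
    then show ?thesis by (simp add: scalar_def omega_counit_def B.conv_unit_def[abs_def])
  qed
  then show ?thesis by (simp add: omega_counit_opush A.conv_unit_def)
qed

lemma opush_eqv_lin:
  assumes "u \<in> words (omega_letters X)" "\<And>v. v \<in> words (omega_letters Y) \<Longrightarrow> eqv R (P v) (Q v)"
  shows "eqv R (lin P (opush (bas u))) (lin Q (opush (bas u)))"
proof (rule eqv_lin)
  fix v assume "v \<in> Poly_Mapping.keys (opush (bas u) :: ('y, 'b) omega)"
  from supportedD[OF opush_supported[OF assms(1)] this] show "eqv R (P v) (Q v)" by (intro assms(2)) simp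
qed

text \<open>Both sides are left convolution inverses of the pushed inclusion, which has a right
  inverse. The recursive formula of the antipode does not enter.\<close>

lemma xpush_anti:
  fixes w :: "'x simplex word"
  assumes "w \<in> words (omega_letters X)"
  shows "eqv (xomega_rel Y) (xpush (A.Oanti w)) (B.anti_cell (opush (bas w)) :: ('y, 'k::comm_ring_1) xomega)"
proof (rule A.conv_cancel[OF ideal_gens_xomega_rel _ _ assms, where i = "\<lambda>u. xomega_incl (opush (bas u))"
      and S = "\<lambda>u. B.anti_cell (opush (bas u))" and f = "\<lambda>u. xpush (A.Oanti u)"])
  have I: "lin B.Oincl q = (xomega_incl q :: ('y, 'k) xomega)" and S: "lin B.Oanti q = (B.anti_cell q :: ('y, 'k) xomega)" for q
    by (rule klin_eq_lin[OF klin_xomega_incl, symmetric], rule klin_eq_lin[OF klin_anti_ext, symmetric])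
  fix u assume u: "u \<in> words (omega_letters X)"
  note C = pair_map_conv[OF u, of "B.Oincl :: _ \<Rightarrow> ('y, 'k) xomega" B.Oanti, unfolded I S] pair_map_conv[OF u, of "B.Oanti :: _ \<Rightarrow> ('y, 'k) xomega" B.Oincl, unfolded I S]
  show "eqv (xomega_rel Y) (A.conv (\<lambda>u. xomega_incl (opush (bas u))) (\<lambda>u. B.anti_cell (opush (bas u))) u) (A.conv_unit u :: ('y, 'k) xomega)"
    unfolding C lin_conv_unit_opush[symmetric]
    by (rule opush_eqv_lin[OF u B.antipode_right])
  have 1: "eqv (xomega_rel Y) (A.conv (\<lambda>u. B.anti_cell (opush (bas u))) (\<lambda>u. xomega_incl (opush (bas u))) u) (A.conv_unit u :: ('y, 'k) xomega)"
    unfolding C lin_conv_unit_opush[symmetric]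
    by (rule opush_eqv_lin[OF u B.antipode_left])
  have 2: "A.conv (\<lambda>u. xpush (A.Oanti u)) (\<lambda>u. xomega_incl (opush (bas u))) u = (xpush (A.conv A.Oanti A.Oincl u) :: ('y, 'k) xomega)"
    by (simp add: A.conv_def klin_compose_lin[OF klin_xpush] xpush_mult xpush_incl)
  have 3: "xpush (A.conv_unit u) = (A.conv_unit u :: ('y, 'k) xomega)"
    by (simp add: A.conv_unit_def)
  have 4: "eqv (xomega_rel Y) (xpush (A.conv A.Oanti A.Oincl u)) (A.conv_unit u :: ('y, 'k) xomega)"
    unfolding 3[symmetric] by (rule xpush_eqv[OF A.antipode_left[OF u]])
  show "eqv (xomega_rel Y) (A.conv (\<lambda>u. xpush (A.Oanti u)) (\<lambda>u. xomega_incl (opush (bas u))) u)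
      (A.conv (\<lambda>u. B.anti_cell (opush (bas u))) (\<lambda>u. xomega_incl (opush (bas u))) u :: ('y, 'k) xomega)"
    unfolding 2 by (rule eqv_trans[OF 4 eqv_sym[OF 1]])
qed

definition tpush :: "('x simplex \<times> ('x, 'k::comm_ring_1) xletter word \<Rightarrow>\<^sub>0 'k) \<Rightarrow> ('y simplex \<times> ('y, 'k) xletter word \<Rightarrow>\<^sub>0 'k)" where
  "tpush = lin (\<lambda>(c, w). tens (chain_push Y f (bas c)) (xpush (bas w)))"

lemma klin_tpush: "klin tpush"
  by (simp add: tpush_def)

lemmas tpush_simps [simp] = klin_0[OF klin_tpush] klin_add[OF klin_tpush] klin_diff[OF klin_tpush]
  klin_uminus[OF klin_tpush] klin_scale[OF klin_tpush]

lemma tpush_tens: "tpush (tens (bas c) m) = tens (chain Y (sm c)) (xpush m)"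
proof (rule klin_eqI[where f = "\<lambda>m. tpush (tens (bas c) m)"])
qed ((intro klin_comp[OF klin_tpush] klins klin_xpush)+, simp add: tpush_def chain_push_bas)

lemma tpush_eqv:
  assumes "eqv (tens_rel X) y z"
  shows "eqv (tens_rel Y) (tpush y) (tpush z)"
proof (rule klin_eqv[OF klin_tpush _ assms])
  fix y :: "'x simplex \<times> ('x, 'a) xletter word \<Rightarrow>\<^sub>0 'a" assume "y \<in> tens_rel X"
  then obtain c x where y: "y = tens (bas c) x" and x: "x \<in> xomega_rel X" unfolding tens_rel_def by blast
  have "eqv (xomega_rel X) x 0" using x by (simp add: eqv_0 free_module.span_base)
  from B.tens_eqv[OF xpush_eqv[OF this], of "chain Y (sm c)"]
  show "tpush y \<in> free_module.span (tens_rel Y)" by (simp add: y tpush_tens eqv_0)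
qed

lemma tpush_cyc:
  fixes m :: "('x, 'k::comm_ring_1) xomega"
  assumes "w \<in> words (omega_letters X)" "m \<in> supported (words (xomega_letters X))"
  shows "tpush (cyc (bas w) m) = cyc (opush (bas w)) (xpush m)"
  using assms
proof (induction arbitrary: m rule: word_induct)
  case (Cons g w)
  let ?g = "omega_deg g" and ?M = "xpush m"
  let ?m = "twist xomega_deg ?g m * xomega_incl (bas (Word [g]))"
  have gw: "Word [g] \<in> A.\<Omega>words" using Cons by simp
  have i: "xomega_incl (bas (Word [g])) \<in> supported A.Xwords"
    by (rule supported_mono[OF A.Oincl_supported[OF gw]]) auto
  have "?m \<in> supported A.Xwords" by (rule supported_mult[OF A.twist_supported[OF Cons(4)] i]) simp
  note IH = Cons(3)[OF this]
  have L: "tpush (cyc (bas (Word [g] + w)) m) = tens (chain Y (sm g)) (xomega_incl (opush (bas w)) * ?M) +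
     scale ((-1) ^ (?g * wdeg omega_deg w)) (cyc (opush (bas w)) (twist xomega_deg ?g ?M * xomega_incl (simplex_gen Y (sm g))))"
    using IH by (simp add: cyc_bas_add tpush_tens xpush_mult xpush_incl xpush_twist[OF Cons(4)] opush_letter)
  show ?case
  proof (cases "sm g \<in> nondegenerate Y")
    \<comment> \<open>A degenerate image kills both the basis element and the generator, so both
      sides are 0.\<close>
    case False
    then have "chain Y (sm g) = (0 :: _ \<Rightarrow>\<^sub>0 'k)" by (simp add: chain_def)
    then show ?thesis unfolding L by (simp add: opush_bas_add opush_letter)
  next
    case True
    have c: "chain Y (sm g) = (bas (sm g) :: _ \<Rightarrow>\<^sub>0 'k)" using True by (simp add: chain_def)
    have G: "simplex_gen Y (sm g) = (bas (Word [sm g]) :: ('y, 'k) omega)"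
      using True Cons(1) by (simp add: simplex_gen_eq omega_letters_def)
    have d: "omega_deg (sm g) = ?g" by (simp add: omega_deg_def)
    have "cyc (opush (bas (Word [g] + w))) ?M = tens (bas (sm g)) (xomega_incl (opush (bas w)) * ?M) +
       scale ((-1) ^ (?g * wdeg omega_deg w)) (cyc (opush (bas w)) (twist xomega_deg ?g ?M * xomega_incl (bas (Word [sm g]))))"
      using cyc_mult_left[of "opush (bas w) :: ('y, 'k) omega" "wdeg omega_deg w" "Word [sm g]" ?M]
        supportedD[OF opush_supported[OF Cons(2), where 'k = 'k]] unfolding opush_bas_add opush_letter G by (simp add: d)
    then show ?thesis unfolding L c[symmetric] G[symmetric] by simp
  qed
qed simp

lemma tpush_adj_cyc:
  fixes m :: "('x, 'k::comm_ring_1) xomega"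
  assumes w: "w \<in> words (omega_letters X)" and m: "m \<in> supported (words (xomega_letters X))"
  shows "eqv (tens_rel Y) (tpush (A.adj_cyc (bas w) m)) (B.adj_cyc (opush (bas w)) (xpush m))"
proof -
  let ?t = "twist xomega_deg" and ?d = "wdeg omega_deg" and ?M = "xpush m"
  let ?s = "\<lambda>n. scale ((- 1 :: 'k) ^ n)"
  let ?\<Delta> = "omega_coprod X (bas w) :: _ \<Rightarrow>\<^sub>0 'k"
  let ?g = "\<lambda>x. ?s (?d (fst x) * ?d (snd x)) (cyc (bas (snd x)) (?t (?d (fst x)) ?M * B.Oanti (fst x)))"
  have "tpush (A.adj_cyc (bas w) m) = lin (\<lambda>x. tpush (?s (?d (fst x) * ?d (snd x)) (cyc (bas (snd x)) (?t (?d (fst x)) m * A.Oanti (fst x))))) ?\<Delta>"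
    unfolding A.adj_cyc_def by (rule klin_compose_lin[OF klin_tpush])
  also have "eqv (tens_rel Y) \<dots> (lin (\<lambda>x. lin ?g (tens (opush (bas (fst x))) (opush (bas (snd x))))) ?\<Delta>)"
  proof (rule eqv_lin)
    fix x assume "x \<in> Poly_Mapping.keys ?\<Delta>"
    note xw = A.omega_coprod_words[OF w this]
    have a: "(A.Oanti (fst x) :: ('x, 'k) xomega) \<in> supported A.Xwords"
      by (rule supported_mono[OF A.Oanti_supported[OF xw(1)]]) auto
    have "?t (?d (fst x)) m * A.Oanti (fst x) \<in> supported A.Xwords"
      by (rule supported_mult[OF A.twist_supported[OF m] a]) simp
    then have "tpush (?s (?d (fst x) * ?d (snd x)) (cyc (bas (snd x)) (?t (?d (fst x)) m * A.Oanti (fst x)))) =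
        ?s (?d (fst x) * ?d (snd x)) (cyc (opush (bas (snd x))) (?t (?d (fst x)) ?M * xpush (A.Oanti (fst x))))"
      by (simp add: tpush_cyc[OF xw(2)] xpush_mult xpush_twist[OF m])
    also have "eqv (tens_rel Y) \<dots> (?s (?d (fst x) * ?d (snd x)) (cyc (opush (bas (snd x))) (?t (?d (fst x)) ?M * B.anti_cell (opush (bas (fst x))))))"
      by (intro eqv_scale B.cyc_eqv eqv_mult[OF ideal_gens_xomega_rel] eqv_refl xpush_anti xw)
    also have "\<dots> = lin ?g (tens (opush (bas (fst x))) (opush (bas (snd x))))"
    proof (rule B.lin_cyc_tens[symmetric])
      show "even (?d v) = even (?d (fst x))" if "v \<in> Poly_Mapping.keys (opush (bas (fst x)) :: ('y, 'k) omega)" for v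
        using supportedD[OF opush_supported[OF xw(1)] that] by simp
      show "even (?d v) = even (?d (snd x))" if "v \<in> Poly_Mapping.keys (opush (bas (snd x)) :: ('y, 'k) omega)" for v
        using supportedD[OF opush_supported[OF xw(2)] that] by simp
    qed
    finally show "eqv (tens_rel Y) (tpush (?s (?d (fst x) * ?d (snd x)) (cyc (bas (snd x)) (?t (?d (fst x)) m * A.Oanti (fst x)))))
      (lin ?g (tens (opush (bas (fst x))) (opush (bas (snd x)))))" .
  qed
  also have "\<dots> = B.adj_cyc (opush (bas w)) ?M"
    unfolding B.adj_cyc_def omega_coprod_opush_bas[OF w] pair_map_def lin_lin ..
  finally show ?thesis .
qed

lemma tpush_to_coH:
  assumes "y \<in> supported A.Tbasis"
  shows "eqv (tens_rel Y) (tpush (A.to_coH y)) (B.to_coH (tpush y))"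
proof (rule A.klin_eqv_basis[OF klin_comp[OF klin_tpush A.klin_to_coH] klin_comp[OF B.klin_to_coH klin_tpush] _ assms])
  fix c and w :: "('x, 'a) xletter word" assume c: "c \<in> nondegenerate X" and w: "w \<in> A.Xwords"
  from c show "eqv (tens_rel Y) (tpush (A.to_coH (tens (bas c) (bas w)))) (B.to_coH (tpush (tens (bas c) (bas w))))"
  proof (cases rule: A.nondegenerate_cases)
    case 1
    have "chain Y (sm c) = (bas B.pt :: _ \<Rightarrow>\<^sub>0 'a)"
      using sm_simplex[OF A.is_simplex_pt] by (intro B.chain_0) (simp_all add: 1)
    then show ?thesis by (simp add: A.to_coH_tens tpush_tens B.to_coH_tens 1 del: tens_bas)
  next
    case 2
    then have cw: "Word [c] \<in> A.\<Omega>words" "fst c \<ge> 1" by (simp_all add: omega_letters_def)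
    have "chain Y (sm c) \<in> (supported {d. fst d \<ge> 1} :: (_ \<Rightarrow>\<^sub>0 'a) set)" using cw by (simp add: chain_def)
    from B.to_coH_tens_cobar[OF this, of "xpush (bas w)"] tpush_adj_cyc[OF cw(1), of "bas w"]
    show ?thesis using w cw(2) by (simp add: A.to_coH_tens tpush_tens opush_letter del: tens_bas)
  qed
qed

lemma tpush_tensor_reps:
  assumes "y \<in> tensor_reps X n"
  shows "tpush y \<in> tensor_reps Y n"
  unfolding klin_eq_lin[OF klin_tpush, of y] unfolding tensor_reps_def
proof (rule supported_lin)
  fix x assume "x \<in> Poly_Mapping.keys y"
  with assms have "x \<in> {(c, w). c \<in> nondegenerate X \<and> w \<in> words (xomega_letters X) \<and> int (fst c + wdeg xomega_deg w) = n}"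
    unfolding tensor_reps_def by (rule supportedD)
  then obtain c w where x: "x = (c, w)" "w \<in> words (xomega_letters X)" "int (fst c + wdeg xomega_deg w) = n" by blast
  have "tens (chain Y (sm c)) (xpush (bas w)) \<in> supported (B.Tdeg (fst c + wdeg xomega_deg w))"
    by (rule B.tens_supported_Tdeg[OF _ xpush_supported[OF x(2)]]) (simp add: chain_def)
  then show "tpush (bas x) \<in> supported {(c, w). c \<in> nondegenerate Y \<and> w \<in> words (xomega_letters Y) \<and> int (fst c + wdeg xomega_deg w) = n}"
    unfolding x(1) tens_bas[symmetric] tpush_tens by (rule supported_mono) (use x(3) in auto)
qed

end

section \<open>Quotient complexes\<close>

lemma coset_of_eq_iff:
  assumes "free_module.subspace R"
  shows "coset_of R x = coset_of R y \<longleftrightarrow> x - y \<in> R"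
proof
  assume "coset_of R x = coset_of R y"
  moreover have "x \<in> coset_of R x" using free_module.subspace_0[OF assms] by (simp add: coset_of_def)
  ultimately show "x - y \<in> R" by (simp add: coset_of_def)
next
  assume xy: "x - y \<in> R"
  have "z - x \<in> R \<longleftrightarrow> z - y \<in> R" for z
    using free_module.subspace_add[OF assms _ xy, of "z - x"] free_module.subspace_diff[OF assms _ xy, of "z - y"] by auto
  then show "coset_of R x = coset_of R y" by (simp add: coset_of_def)
qed

text \<open>All cosets in the union coincide, so it is that single coset. The operations of
  \<open>quot_module\<close> and \<open>quot_map\<close> are such unions.\<close>

lemma coset_of_UN:
  assumes R: "free_module.subspace R" and R': "free_module.subspace R'" and "\<And>y. y - x \<in> R \<Longrightarrow> g y - g x \<in> R'"
  shows "(\<Union>y\<in>coset_of R x. coset_of R' (g y)) = coset_of R' (g x)"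
proof -
  have "coset_of R' (g y) = coset_of R' (g x)" if "y \<in> coset_of R x" for y
  proof -
    have "g y - g x \<in> R'" using that by (intro assms(3)) (simp add: coset_of_def)
    then show ?thesis by (simp only: coset_of_eq_iff[OF R'])
  qed
  moreover have "x \<in> coset_of R x" using free_module.subspace_0[OF R] by (simp add: coset_of_def)
  ultimately show ?thesis by blast
qed

lemma quot_module_simps:
  assumes R: "free_module.subspace R"
  shows "carrier (quot_module F R) = coset_of R ` F"
    and "\<zero>\<^bsub>quot_module F R\<^esub> = coset_of R 0"
    and "coset_of R x \<oplus>\<^bsub>quot_module F R\<^esub> coset_of R y = coset_of R (x + y)"
    and "c \<odot>\<^bsub>quot_module F R\<^esub> coset_of R x = coset_of R (scale c x)"
proof -
  have 1: "(\<Union>y'\<in>coset_of R y. coset_of R (x' + y')) = coset_of R (x' + y)" for x'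
    by (rule coset_of_UN[OF R R]) simp
  have "(\<Union>x'\<in>coset_of R x. coset_of R (x' + y)) = coset_of R (x + y)"
    by (rule coset_of_UN[OF R R, where g = "\<lambda>x. x + y"]) simp
  then show "coset_of R x \<oplus>\<^bsub>quot_module F R\<^esub> coset_of R y = coset_of R (x + y)"
    by (simp add: quot_module_def 1)
  show "c \<odot>\<^bsub>quot_module F R\<^esub> coset_of R x = coset_of R (scale c x)"
    unfolding quot_module_def module.simps
    by (rule coset_of_UN[OF R R]) (simp add: scale_diff[symmetric] free_module.subspace_scale[OF R])
qed (simp_all add: quot_module_def)

lemma cring_scalar_ring: "cring (scalar_ring :: 'k::comm_ring_1 ring)"
proof (rule cringI)
  show "abelian_group (scalar_ring :: 'k ring)"
  proof (rule abelian_groupI)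
    fix x :: 'k
    show "\<exists>y\<in>carrier scalar_ring. y \<oplus>\<^bsub>scalar_ring\<^esub> x = \<zero>\<^bsub>scalar_ring\<^esub>"
      by (rule bexI[of _ "- x"]) (simp_all add: scalar_ring_def)
  qed (simp_all add: scalar_ring_def add_ac)
  show "comm_monoid (scalar_ring :: 'k ring)"
    by (rule comm_monoidI) (simp_all add: scalar_ring_def mult_ac)
qed (simp add: scalar_ring_def distrib_right)

lemma module_quot_module:
  fixes R F :: "('b \<Rightarrow>\<^sub>0 'k::comm_ring_1) set"
  assumes R: "free_module.subspace R" and F: "free_module.subspace F"
  shows "Module.module (scalar_ring :: 'k ring) (quot_module F R)"
proof -
  note s = quot_module_simps[OF R]
  note FI = free_module.subspace_add[OF F] free_module.subspace_scale[OF F] free_module.subspace_0[OF F] free_module.subspace_neg[OF F]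
  have inv: "\<exists>y\<in>carrier (quot_module F R). y \<oplus>\<^bsub>quot_module F R\<^esub> x = \<zero>\<^bsub>quot_module F R\<^esub>"
    if x: "x \<in> carrier (quot_module F R)" for x
  proof -
    obtain a where a: "a \<in> F" "x = coset_of R a" using x by (auto simp: s)
    then show ?thesis by (intro bexI[of _ "coset_of R (- a)"]) (auto simp: s FI)
  qed
  have "abelian_group (quot_module F R)"
    by (rule abelian_groupI; (rule inv)?) (auto simp: s FI add_ac)
  then show ?thesis
    by (rule moduleI[OF cring_scalar_ring]) (auto simp: s FI scalar_ring_def scale_add scale_add_left)
qed

lemma quot_map_coset_of:
  assumes "free_module.subspace R" "free_module.subspace R'" "klin g" "g ` R \<subseteq> R'"
  shows "quot_map R' g (coset_of R x) = coset_of R' (g x)"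
  unfolding quot_map_def
  by (rule coset_of_UN[OF assms(1,2)]) (use assms(4) klin_diff[OF assms(3)] in \<open>metis image_subset_iff\<close>)

lemma linear_map_quot_map:
  assumes R: "free_module.subspace R" "free_module.subspace R'" and g: "klin g" "g ` R \<subseteq> R'" "g ` F \<subseteq> F'"
  shows "linear_map (quot_module F R) (quot_module F' R') (quot_map R' g)"
  using g(3)
  by (auto simp: linear_map_def quot_module_simps[OF R(1)] quot_module_simps[OF R(2)] quot_map_coset_of[OF R g(1,2)]
      klin_add[OF g(1)] klin_scale[OF g(1)])

text \<open>The zero map in coset form. It is the homotopy for both composites, which are the
  identity on classes.\<close>

lemma linear_map_zero:
  assumes R: "free_module.subspace R" and R': "free_module.subspace R'" and F': "free_module.subspace F'"
  shows "linear_map (quot_module F R) (quot_module F' R') (\<lambda>x. coset_of R' 0)"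
  using free_module.subspace_0[OF F']
  by (auto simp: linear_map_def quot_module_simps[OF R'])

lemma subspace_supported: "free_module.subspace (supported B)"
  by (auto intro!: free_module.subspaceI supported_add supported_scale)

lemma subspace_tensor_reps: "free_module.subspace (tensor_reps X n)"
  unfolding tensor_reps_def by (rule subspace_supported)

lemma subspace_tensor_rel: "free_module.subspace (tensor_rel X)"
  unfolding tensor_rel_def by (rule free_module.subspace_span)

lemma boundary_tensor_complex [simp]: "boundary (tensor_complex X d) n = quot_map (tensor_rel X) d"
  and component_tensor_complex [simp]: "component (tensor_complex X d) n = quot_module (tensor_reps X n) (tensor_rel X)"
  by (simp_all add: tensor_complex_def)

lemma carrier_tensor_complex: "carrier (component (tensor_complex X d) n) = coset_of (tensor_rel X) ` tensor_reps X n"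
  by (simp add: quot_module_simps[OF subspace_tensor_rel])

lemma is_dg_module_tensor_complex:
  assumes d: "klin d" "d ` tensor_rel X \<subseteq> tensor_rel X" "\<And>n. d ` tensor_reps X n \<subseteq> tensor_reps X (n - 1)"
    "\<And>n y. y \<in> tensor_reps X n \<Longrightarrow> d (d y) \<in> tensor_rel X"
  shows "is_dg_module (tensor_complex X d)"
  unfolding is_dg_module_def component_tensor_complex boundary_tensor_complex
  using d(4)
  by (auto simp: module_quot_module subspace_tensor_reps subspace_tensor_rel linear_map_quot_map d(1-3)
      quot_module_simps[OF subspace_tensor_rel] quot_map_coset_of[OF subspace_tensor_rel subspace_tensor_rel d(1,2)]
      coset_of_eq_iff[OF subspace_tensor_rel])

lemma chain_map_tensor_complex:
  assumes d: "klin d" "d ` tensor_rel X \<subseteq> tensor_rel X" and e: "klin e" "e ` tensor_rel X \<subseteq> tensor_rel X"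
    and g: "klin g" "g ` tensor_rel X \<subseteq> tensor_rel X" "\<And>n. g ` tensor_reps X n \<subseteq> tensor_reps X n"
    and "\<And>n y. y \<in> tensor_reps X n \<Longrightarrow> e (g y) - g (d y) \<in> tensor_rel X"
  shows "chain_map (tensor_complex X d) (tensor_complex X e) (\<lambda>n. quot_map (tensor_rel X) g)"
proof -
  note q = quot_map_coset_of[OF subspace_tensor_rel subspace_tensor_rel]
  show ?thesis
    unfolding chain_map_def component_tensor_complex boundary_tensor_complex using assms(8)
    by (auto simp: linear_map_quot_map subspace_tensor_rel g quot_module_simps[OF subspace_tensor_rel]
        q[OF d] q[OF e] q[OF g(1,2)] coset_of_eq_iff[OF subspace_tensor_rel])
qed

lemma chain_homotopic_tensor_complex:
  assumes d: "klin d" "d ` tensor_rel X \<subseteq> tensor_rel X"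
    and g: "klin g" "g ` tensor_rel X \<subseteq> tensor_rel X" and g': "klin g'" "g' ` tensor_rel X \<subseteq> tensor_rel X"
    and gg: "\<And>n y. y \<in> tensor_reps X n \<Longrightarrow> g' (g y) - y \<in> tensor_rel X"
  shows "chain_homotopic (tensor_complex X d) (tensor_complex X d)
    (\<lambda>n x. quot_map (tensor_rel X) g' (quot_map (tensor_rel X) g x)) (\<lambda>n x. x)"
proof -
  note q = quot_map_coset_of[OF subspace_tensor_rel subspace_tensor_rel]
  have "quot_map (tensor_rel X) g' (quot_map (tensor_rel X) g x) = x \<oplus>\<^bsub>component (tensor_complex X d) n\<^esub>
      (boundary (tensor_complex X d) (n + 1) (coset_of (tensor_rel X) 0) \<oplus>\<^bsub>component (tensor_complex X d) n\<^esub> coset_of (tensor_rel X) 0)"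
    if "x \<in> carrier (component (tensor_complex X d) n)" for n x
  proof -
    from that obtain y where y: "y \<in> tensor_reps X n" "x = coset_of (tensor_rel X) y"
      by (auto simp: carrier_tensor_complex simp del: component_tensor_complex)
    then show ?thesis
      using gg[OF y(1)] by (simp add: q[OF d] q[OF g] q[OF g'] klin_0[OF d(1)] quot_module_simps[OF subspace_tensor_rel]
          coset_of_eq_iff[OF subspace_tensor_rel])
  qed
  moreover have "linear_map (component (tensor_complex X d) n) (component (tensor_complex X d) (n + 1)) (\<lambda>x. coset_of (tensor_rel X) 0)" for n
    unfolding component_tensor_complex by (rule linear_map_zero[OF subspace_tensor_rel subspace_tensor_rel subspace_tensor_reps])
  ultimately show ?thesis
    unfolding chain_homotopic_def by (intro exI[of _ "\<lambda>n x. coset_of (tensor_rel X) 0"] conjI allI ballI)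
qed

context reduced_sset
begin

text \<open>Both sides have the same image under \<open>to_coH\<close>, which is injective modulo
  the relations.\<close>

lemma of_coH_chain:
  assumes y: "y \<in> supported Tbasis"
  shows "of_coH (cohochschild_diff X y) \<simeq> adjoint_diff (of_coH y)"
proof -
  have of: "of_coH z \<in> supported Tbasis" if "z \<in> supported Tbasis" for z
    using that by (elim supported_map[OF klin_of_coH]) (rule supported_mono[OF comparison_supported(2)], auto)
  have co: "cohochschild_diff X y \<in> supported Tbasis"
    using y by (elim supported_map[OF klin_cohochschild_diff]) (rule supported_mono[OF diff_supported(1)], auto)
  let ?z = "of_coH (cohochschild_diff X y) - adjoint_diff (of_coH y)"
  have "to_coH (adjoint_diff (of_coH y)) \<simeq> cohochschild_diff X (to_coH (of_coH y))" by (rule to_coH_chain[OF of[OF y]])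
  also have "\<dots> \<simeq> cohochschild_diff X y" by (rule cohochschild_diff_eqv[OF to_coH_of_coH[OF y]])
  finally have "to_coH ?z \<simeq> cohochschild_diff X y - cohochschild_diff X y"
    unfolding to_coH_simps by (intro eqv_diff to_coH_of_coH co)
  then have "to_coH ?z \<simeq> 0" by simp
  then have "?z \<simeq> 0"
    by (rule to_coH_injective[OF supported_diff[OF of[OF co] adjoint_diff_supported[OF of[OF y]]]])
  then show ?thesis by (simp add: eqv_def)
qed

text \<open>The shift k is 0 for the comparison maps and 1 for the differentials. The control of
  degrees keeps the values within \<open>Tbasis\<close>, where \<open>tensor_rel_iff\<close>
  applies.\<close>

lemma tensor_rel_map:
  assumes "\<And>y. y \<in> supported Tbasis \<Longrightarrow> y \<simeq> 0 \<Longrightarrow> g y \<simeq> 0" "\<And>n y. y \<in> tensor_reps X n \<Longrightarrow> g y \<in> tensor_reps X (n - k)" "klin g"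
  shows "g ` tensor_rel X \<subseteq> tensor_rel X"
proof clarify
  fix y :: "'x simplex \<times> ('x, 'a) xletter word \<Rightarrow>\<^sub>0 'a" assume y: "y \<in> tensor_rel X"
  note s = tensor_rel_supported[OF y]
  have "g (bas (c, w)) \<in> supported Tbasis" if "c \<in> nondegenerate X" "w \<in> Xwords" for c w
    using tensor_reps_basis[OF assms(2)[of "bas (c, w)" "int (fst c + wdeg xomega_deg w)"]] that by (simp add: tensor_reps_def)
  then have "g y \<in> supported Tbasis" by (rule supported_map[OF assms(3) s])
  then show "g y \<in> tensor_rel X" using assms(1)[OF s] y by (simp add: tensor_rel_iff s)
qed

lemma maps_tensor_rel:
  "to_coH ` tensor_rel X \<subseteq> tensor_rel X" "of_coH ` tensor_rel X \<subseteq> tensor_rel X"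
  "cohochschild_diff X ` tensor_rel X \<subseteq> tensor_rel X" "adjoint_diff ` tensor_rel X \<subseteq> tensor_rel X"
proof -
  show "to_coH ` tensor_rel X \<subseteq> tensor_rel X"
    by (rule tensor_rel_map[where k = 0]) (use to_coH_eqv[of _ 0] in \<open>simp_all add: tensor_reps_maps klin_to_coH\<close>)
  show "of_coH ` tensor_rel X \<subseteq> tensor_rel X"
    by (rule tensor_rel_map[where k = 0]) (use of_coH_eqv[of _ 0] in \<open>simp_all add: tensor_reps_maps klin_of_coH\<close>)
  show "cohochschild_diff X ` tensor_rel X \<subseteq> tensor_rel X"
    by (rule tensor_rel_map[where k = 1]) (use cohochschild_diff_eqv[of _ 0] in \<open>simp_all add: tensor_reps_maps klin_cohochschild_diff\<close>)
  show "adjoint_diff ` tensor_rel X \<subseteq> tensor_rel X"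
    by (rule tensor_rel_map[where k = 1, OF adjoint_diff_eqv_0 tensor_reps_maps(4) klin_adjoint_diff])
qed

lemma tensor_rel_eqv:
  assumes "y \<in> tensor_reps X n" "z \<in> tensor_reps X n" "y \<simeq> z"
  shows "y - z \<in> tensor_rel X"
proof -
  have "y - z \<in> supported Tbasis" by (intro supported_diff tensor_reps_basis[OF assms(1)] tensor_reps_basis[OF assms(2)])
  then show ?thesis using assms(3) by (simp add: tensor_rel_iff eqv_def)
qed

lemma chain_homotopy_equivalence_coH:
  "chain_homotopy_equivalence (adjoint_twisted_complex X :: ('k::comm_ring_1, ('x, 'k) tensor_class) dg_module)
    (extended_coHochschild X) (\<lambda>n. quot_map (tensor_rel X) to_coH) (\<lambda>n. quot_map (tensor_rel X) of_coH)"
proof -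
  note m = tensor_reps_maps and r = maps_tensor_rel and b = tensor_reps_basis
  have z: "0 \<in> tensor_reps X n" for n by (simp add: tensor_reps_def)
  have dd: "n - 1 - 1 = n - 2" for n :: int by simp
  have "is_dg_module (tensor_complex X adjoint_diff)"
    by (rule is_dg_module_tensor_complex[OF klin_adjoint_diff r(4)])
      (use m(4) in blast, use tensor_rel_eqv[OF m(4)[OF m(4)] z adjoint_diff_diff[OF b]] in simp)
  moreover have "is_dg_module (tensor_complex X (cohochschild_diff X))"
    by (rule is_dg_module_tensor_complex[OF klin_cohochschild_diff r(3)])
      (use m(3) in blast, use tensor_rel_eqv[OF m(3)[OF m(3)] z cohochschild_diff_diff_eqv[OF b]] in simp)
  moreover have "chain_map (tensor_complex X adjoint_diff) (tensor_complex X (cohochschild_diff X)) (\<lambda>n. quot_map (tensor_rel X) to_coH)"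
    by (rule chain_map_tensor_complex[OF klin_adjoint_diff r(4) klin_cohochschild_diff r(3) klin_to_coH r(1)])
      (use m(1) in blast, rule tensor_rel_eqv[OF m(3)[OF m(1)] m(1)[OF m(4)] eqv_sym[OF to_coH_chain[OF b]]])
  moreover have "chain_map (tensor_complex X (cohochschild_diff X)) (tensor_complex X adjoint_diff) (\<lambda>n. quot_map (tensor_rel X) of_coH)"
    by (rule chain_map_tensor_complex[OF klin_cohochschild_diff r(3) klin_adjoint_diff r(4) klin_of_coH r(2)])
      (use m(2) in blast, rule tensor_rel_eqv[OF m(4)[OF m(2)] m(2)[OF m(3)] eqv_sym[OF of_coH_chain[OF b]]])
  moreover have "chain_homotopic (tensor_complex X adjoint_diff) (tensor_complex X adjoint_diff)
      (\<lambda>n x. quot_map (tensor_rel X) of_coH (quot_map (tensor_rel X) to_coH x)) (\<lambda>n x. x)"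
    by (rule chain_homotopic_tensor_complex[OF klin_adjoint_diff r(4) klin_to_coH r(1) klin_of_coH r(2)])
      (rule tensor_rel_eqv[OF m(2)[OF m(1)] _ of_coH_to_coH[OF b]])
  moreover have "chain_homotopic (tensor_complex X (cohochschild_diff X)) (tensor_complex X (cohochschild_diff X))
      (\<lambda>n x. quot_map (tensor_rel X) to_coH (quot_map (tensor_rel X) of_coH x)) (\<lambda>n x. x)"
    by (rule chain_homotopic_tensor_complex[OF klin_cohochschild_diff r(3) klin_of_coH r(2) klin_to_coH r(1)])
      (rule tensor_rel_eqv[OF m(1)[OF m(2)] _ to_coH_of_coH[OF b]])
  ultimately show ?thesis
    unfolding chain_homotopy_equivalence_def adjoint_twisted_complex_def extended_coHochschild_def by blast
qed

end

context reduced_sset_map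
begin

text \<open>The inverse of a natural isomorphism is natural: naturality of \<open>to_coH\<close> is
  used at the preimage, and \<open>of_coH\<close> is applied to both sides.\<close>

lemma tpush_of_coH:
  assumes y: "y \<in> tensor_reps X n"
  shows "eqv (tens_rel Y) (B.of_coH (tpush y)) (tpush (A.of_coH y))"
proof -
  note x = A.tensor_reps_maps(2)[OF y]
  have "eqv (tens_rel Y) (tpush y) (tpush (A.to_coH (A.of_coH y)))"
    by (rule tpush_eqv[OF eqv_sym[OF A.to_coH_of_coH[OF A.tensor_reps_basis[OF y]]]])
  also have "eqv (tens_rel Y) \<dots> (B.to_coH (tpush (A.of_coH y)))"
    by (rule tpush_to_coH[OF A.tensor_reps_basis[OF x]])
  finally have "eqv (tens_rel Y) (B.of_coH (tpush y)) (B.of_coH (B.to_coH (tpush (A.of_coH y))))"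
    by (rule B.of_coH_eqv)
  also have "eqv (tens_rel Y) \<dots> (tpush (A.of_coH y))"
    by (rule B.of_coH_to_coH[OF B.tensor_reps_basis[OF tpush_tensor_reps[OF x]]])
  finally show ?thesis .
qed

lemma tpush_rel: "tpush ` tensor_rel X \<subseteq> tensor_rel Y"
proof clarify
  fix y :: "'x simplex \<times> ('x, 'a) xletter word \<Rightarrow>\<^sub>0 'a" assume y: "y \<in> tensor_rel X"
  note s = A.tensor_rel_supported[OF y]
  have "tpush (bas (c, w)) \<in> supported B.Tbasis" if "c \<in> nondegenerate X" "w \<in> A.Xwords" for c and w :: "('x, 'a) xletter word"
    using B.tensor_reps_basis[OF tpush_tensor_reps[of "bas (c, w)" "int (fst c + wdeg xomega_deg w)"]] that by (simp add: tensor_reps_def)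
  then have t: "tpush y \<in> supported B.Tbasis" by (rule A.supported_map[OF klin_tpush s])
  have "eqv (tens_rel Y) (tpush y) (tpush 0)" using y by (intro tpush_eqv) (simp add: A.tensor_rel_iff[OF s])
  then show "tpush y \<in> tensor_rel Y" by (simp add: B.tensor_rel_iff[OF t])
qed

lemma tensor_push_coset_of: "tensor_push Y f (coset_of (tensor_rel X) y) = coset_of (tensor_rel Y) (tpush y)"
  unfolding tensor_push_def tpush_def[symmetric]
  by (rule quot_map_coset_of[OF subspace_tensor_rel subspace_tensor_rel klin_tpush tpush_rel])

lemma natural_coH:
  fixes y :: "'x simplex \<times> ('x, 'k::comm_ring_1) xletter word \<Rightarrow>\<^sub>0 'k"
  assumes y: "y \<in> tensor_reps X n"
  shows "quot_map (tensor_rel Y) B.to_coH (tensor_push Y f (coset_of (tensor_rel X) y)) =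
      tensor_push Y f (quot_map (tensor_rel X) A.to_coH (coset_of (tensor_rel X) y))"
    and "quot_map (tensor_rel Y) B.of_coH (tensor_push Y f (coset_of (tensor_rel X) y)) =
      tensor_push Y f (quot_map (tensor_rel X) A.of_coH (coset_of (tensor_rel X) y))"
proof -
  note q = quot_map_coset_of[OF subspace_tensor_rel subspace_tensor_rel] and t = tpush_tensor_reps
    and am = A.tensor_reps_maps and bm = B.tensor_reps_maps
  have "B.to_coH (tpush y) - tpush (A.to_coH y) \<in> tensor_rel Y"
    by (rule B.tensor_rel_eqv[OF bm(1)[OF t[OF y]] t[OF am(1)[OF y]] eqv_sym[OF tpush_to_coH[OF A.tensor_reps_basis[OF y]]]])
  then show "quot_map (tensor_rel Y) B.to_coH (tensor_push Y f (coset_of (tensor_rel X) y)) =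
      tensor_push Y f (quot_map (tensor_rel X) A.to_coH (coset_of (tensor_rel X) y))"
    by (simp add: tensor_push_coset_of q[OF A.klin_to_coH A.maps_tensor_rel(1)] q[OF B.klin_to_coH B.maps_tensor_rel(1)]
        coset_of_eq_iff[OF subspace_tensor_rel])
  have "B.of_coH (tpush y) - tpush (A.of_coH y) \<in> tensor_rel Y"
    by (rule B.tensor_rel_eqv[OF bm(2)[OF t[OF y]] t[OF am(2)[OF y]] tpush_of_coH[OF y]])
  then show "quot_map (tensor_rel Y) B.of_coH (tensor_push Y f (coset_of (tensor_rel X) y)) =
      tensor_push Y f (quot_map (tensor_rel X) A.of_coH (coset_of (tensor_rel X) y))"
    by (simp add: tensor_push_coset_of q[OF A.klin_of_coH A.maps_tensor_rel(2)] q[OF B.klin_of_coH B.maps_tensor_rel(2)]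
        coset_of_eq_iff[OF subspace_tensor_rel])
qed

end

theorem theorem26:
  shows "\<exists>(\<phi> :: 'x sset \<Rightarrow> int \<Rightarrow> ('x, 'k::comm_ring_1) tensor_class \<Rightarrow> ('x, 'k) tensor_class)
          (\<psi> :: 'x sset \<Rightarrow> int \<Rightarrow> ('x, 'k) tensor_class \<Rightarrow> ('x, 'k) tensor_class).
     (\<forall>X. reduced X \<longrightarrow>
        chain_homotopy_equivalence (adjoint_twisted_complex X) (extended_coHochschild X) (\<phi> X) (\<psi> X)) \<and>
     (\<forall>X Y f. reduced X \<and> reduced Y \<and> simplicial_map X Y f \<longrightarrow>
        (\<forall>n. \<forall>z\<in>carrier (component (adjoint_twisted_complex X) n).
           \<phi> Y n (tensor_push Y f z) = tensor_push Y f (\<phi> X n z)) \<and>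
        (\<forall>n. \<forall>z\<in>carrier (component (extended_coHochschild X) n).
           \<psi> Y n (tensor_push Y f z) = tensor_push Y f (\<psi> X n z)))"
proof (rule exI[of _ "\<lambda>X n. quot_map (tensor_rel X) (reduced_sset.to_coH X)"],
    rule exI[of _ "\<lambda>X n. quot_map (tensor_rel X) (reduced_sset.of_coH X)"], intro conjI allI impI ballI)
  fix X :: "'x sset" assume "reduced X"
  then interpret reduced_sset X by unfold_locales
  show "chain_homotopy_equivalence (adjoint_twisted_complex X :: ('k, ('x, 'k) tensor_class) dg_module) (extended_coHochschild X)
      (\<lambda>n. quot_map (tensor_rel X) to_coH) (\<lambda>n. quot_map (tensor_rel X) of_coH)"
    by (rule chain_homotopy_equivalence_coH)
next
  fix X Y :: "'x sset" and f n and z :: "('x, 'k) tensor_class"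
  assume XY: "reduced X \<and> reduced Y \<and> simplicial_map X Y f" and z: "z \<in> carrier (component (adjoint_twisted_complex X) n)"
  from XY interpret reduced_sset_map X Y f by unfold_locales auto
  from z obtain y where "y \<in> tensor_reps X n" "z = coset_of (tensor_rel X) y"
    by (auto simp: adjoint_twisted_complex_def carrier_tensor_complex simp del: component_tensor_complex)
  then show "quot_map (tensor_rel Y) B.to_coH (tensor_push Y f z) = tensor_push Y f (quot_map (tensor_rel X) A.to_coH z)"
    using natural_coH(1) by simp
next
  fix X Y :: "'x sset" and f n and z :: "('x, 'k) tensor_class"
  assume XY: "reduced X \<and> reduced Y \<and> simplicial_map X Y f" and z: "z \<in> carrier (component (extended_coHochschild X) n)"
  from XY interpret reduced_sset_map X Y f by unfold_locales auto
  from z obtain y where "y \<in> tensor_reps X n" "z = coset_of (tensor_rel X) y"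
    by (auto simp: extended_coHochschild_def carrier_tensor_complex simp del: component_tensor_complex)
  then show "quot_map (tensor_rel Y) B.of_coH (tensor_push Y f z) = tensor_push Y f (quot_map (tensor_rel X) A.of_coH z)"
    using natural_coH(2) by simp
qed

end
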